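(* Let $\Bbbk$ be a field, $Q=\Bbbk[[x,y,z]]$ with maximal ideal $\mathfrak n$, and let $m\ge 3$. Let $\mathfrak g_m$ be the ideal of $Q$ generated by the sub-maximal Pfaffians of the skew-symmetric matrix $V_m$, and let $d_i=\det(U_i)$ (with $d_0=1$), where $U_i$ and $V_m$ are the matrices defined in the context. The ideal $\mathfrak g_m$ is minimally generated by the $2m+1$ elements $$x^{m-i}d_i\ \text{ and }\ y^{m-i}d_i\ \text{ for } 0\le i\le m-1,\quad\text{and}\quad d_m .$$ Let $g$ be one of these generators, let $\mathfrak b$ be the ideal generated by the remaining $2m$ of these generators, and set $\mathfrak a=\mathfrak n g+\mathfrak b$. Then the ring $R=Q/\mathfrak a$ has the following properties. (a) $R$ is an artinian local ring of type $2$ with socle generated by the classes of the elements $g$ and $x^{m-1}y^{m-1}$. (b) If $g$ is $x^{m-i}d_i$ or $y^{m-i}d_i$ for some $i\in\{1,\dots,m-1\}$, then $\mathfrak a$ is minimally generated by $2m$ elements and $R$ is of class $\mathbf G(2m-3)$. (c) If $g$ is $x^m$, $y^m$, or $d_m$, then $\mathfrak a$ is minimally generated by $2m+1$ elements and $R$ is of class $\mathbf G(2m-2)$.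
   Context: Matrices. For $m\ge 1$, $U_m$ is the $m\times m$ matrix over $Q$ whose $i$-th row has entries $u_{i,m-i}=x$, $u_{i,m-i+1}=z$, $u_{i,m-i+2}=y$ (whenever the column index lies in $\{1,\dots,m\}$) and $0$ elsewhere. E.g. $U_1=[z]$, $U_2=\begin{bmatrix} x & z \\ z & y \end{bmatrix}$, $U_3=\begin{bmatrix} 0 & x & z \\ x & z & y \\ z & y & 0 \end{bmatrix}$. Set $d_{-1}=0$, $d_0=1$, $d_m=\det(U_m)$. $V_m$ is the $(2m+1)\times(2m+1)$ skew-symmetric matrix $$V_m=\begin{bmatrix} O & O_x & U_m \\ -(O_x)^T & 0 & {}^yO \\ -U_m & -({}^yO)^T & O \end{bmatrix},$$ where $O$ is the $m\times m$ zero matrix, $O_x$ is the $m\times1$ column with $x$ as its last entry and $0$ elsewhere, and ${}^yO$ is the $1\times m$ row with $y$ as its first entry and $0$ elsewhere. E.g. $V_1=\begin{bmatrix} 0 & x & z \\ -x & 0 & y \\ -z & -y & 0 \end{bmatrix}$. For $1\le i\le 2m+1$, $\mathrm{pf}_i(V_m)$ is the Pfaffian of the matrix $(V_m)_{ii}$ obtained from $V_m$ by deleting row $i$ and column $i$; it is determined up to sign by $\mathrm{pf}_i(V_m)^2=\det((V_m)_{ii})$. The ideal is $\mathfrak g_m=(\mathrm{pf}_1(V_m),\dots,\mathrm{pf}_{2m+1}(V_m))$. Type and class. Let $\mathfrak a\subseteq\mathfrak n^2$ be an ideal such that $R=Q/\mathfrak a$ has projective dimension $3$ over $Q$. Let $K^R$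 be the Koszul complex over $R$ on a minimal set of generators of the maximal ideal of $R$, and $A=\mathrm H(K^R)$ its homology algebra, a graded-commutative $\Bbbk$-algebra with $A_i=0$ for $i\ge4$. Set $\mathrm{type}(R)=\mathrm{rank}_\Bbbk(A_3)$; if $\mathfrak a$ is $\mathfrak n$-primary, this is the socle rank $\mathrm{rank}_\Bbbk(0:_R\mathfrak n/\mathfrak a)$. For $r\ge2$, $R$ is of class $\mathbf G(r)$ if, with $n$ the minimal number of generators of $\mathfrak a$ and $t=\mathrm{type}(R)$, there are $\Bbbk$-bases $\mathbf e_1,\dots,\mathbf e_n$ of $A_1$, $\mathbf f_1,\dots,\mathbf f_{n+t-1}$ of $A_2$, $\mathbf g_1,\dots,\mathbf g_t$ of $A_3$ such that the only non-zero products of basis elements of positive degree are $\mathbf e_i\mathbf f_i=\mathbf g_1=-\mathbf f_i\mathbf e_i$ for $1\le i\le r$.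
   Formalization: In the definition of class G(r), the products are taken as e_i f_i = g_1 = f_i e_i instead of e_i f_i = g_1 = -f_i e_i, since graded commutativity of A makes the printed sign impossible unless the characteristic of k is 2. *)

theory Defs
  imports
    "HOL-Algebra.QuotRing"
    "HOL-Algebra.Ideal_Product"
    "HOL-Algebra.Embedded_Algebras"
    "HOL-Computational_Algebra.Formal_Power_Series"
    "Jordan_Normal_Form.Determinant"
    "Jordan_Normal_Form.VS_Connect"
begin

hide_const (open) Multiset.mult

section \<open>Ideals and rings\<close>

definition minimal_generating_set :: "('a, 'b) ring_scheme \<Rightarrow> 'a set \<Rightarrow> 'a set \<Rightarrow> bool" where
  "minimal_generating_set R I S \<longleftrightarrow>
     S \<subseteq> carrier R \<and> genideal R S = I \<and> (\<forall>T. T \<subset> S \<longrightarrow> genideal R T \<noteq> I)"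

definition minimally_generated_by :: "('a, 'b) ring_scheme \<Rightarrow> 'a set \<Rightarrow> nat \<Rightarrow> bool" where
  "minimally_generated_by R I n \<longleftrightarrow>
     (\<exists>S. finite S \<and> card S = n \<and> minimal_generating_set R I S)"

definition min_num_generators :: "('a, 'b) ring_scheme \<Rightarrow> 'a set \<Rightarrow> nat" where
  "min_num_generators R I =
     (LEAST n. \<exists>S. S \<subseteq> carrier R \<and> finite S \<and> card S = n \<and> genideal R S = I)"

definition artinian_cring :: "('a, 'b) ring_scheme \<Rightarrow> bool" where
  "artinian_cring R \<longleftrightarrow> cring R \<and>
     (\<forall>I :: nat \<Rightarrow> 'a set. (\<forall>n. ideal (I n) R \<and> I (Suc n) \<subseteq> I n) \<longrightarrow> (\<exists>N. \<forall>n\<ge>N. I n = I N))"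

definition local_cring :: "('a, 'b) ring_scheme \<Rightarrow> bool" where
  "local_cring R \<longleftrightarrow> cring R \<and> (\<exists>!M. maximalideal M R)"

definition annihilator :: "('a, 'b) ring_scheme \<Rightarrow> 'a set \<Rightarrow> 'a set" where
  "annihilator R J = {r \<in> carrier R. \<forall>s\<in>J. r \<otimes>\<^bsub>R\<^esub> s = \<zero>\<^bsub>R\<^esub>}"

section \<open>The Koszul complex and its homology algebra\<close>

text \<open>
  Let \<open>xs = [x\<^sub>0, \<dots>, x\<^sub>n\<^sub>-\<^sub>1]\<close> be a sequence in a commutative ring \<open>R\<close>. The underlying algebra of the
  Koszul complex is the exterior algebra of the free module with basis
  $e_0, \dots, e_{n-1}$. A function \<open>u\<close> represents the element $\sum_S u(S)\, e_S$, where $S$ ranges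
  over the subsets of $\{0, \dots, n-1\}$ and $e_S = e_{s_1} \wedge \dots \wedge e_{s_p}$ for
  $S = \{s_1 < \dots < s_p\}$. For disjoint $S$, $T$ one has
  $e_S \wedge e_T = (-1)^k e_{S \cup T}$ with $k$ the number of pairs $(s,t)$ in $S \times T$
  with $t < s$, and
  $\partial(e_{s_1} \wedge \dots \wedge e_{s_p}) =
    \sum_k (-1)^{k-1} x_{s_k}\, e_{S \setminus \{s_k\}}$.
\<close>

definition ring_sign :: "('a, 'b) ring_scheme \<Rightarrow> nat \<Rightarrow> 'a" where
  "ring_sign R k = (\<ominus>\<^bsub>R\<^esub> \<one>\<^bsub>R\<^esub>) [^]\<^bsub>R\<^esub> k"

definition inversions :: "nat set \<Rightarrow> nat set \<Rightarrow> nat" where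
  "inversions S T = card {(s, t). s \<in> S \<and> t \<in> T \<and> t < s}"

definition koszul_algebra :: "('a, 'b) ring_scheme \<Rightarrow> 'a list \<Rightarrow> (nat set \<Rightarrow> 'a) ring" where
  "koszul_algebra R xs =
    \<lparr>carrier = {u. (\<forall>S. u S \<in> carrier R) \<and> (\<forall>S. \<not> S \<subseteq> {..<length xs} \<longrightarrow> u S = \<zero>\<^bsub>R\<^esub>)},
     mult = (\<lambda>u v S. if S \<subseteq> {..<length xs}
        then (\<Oplus>\<^bsub>R\<^esub>T\<in>Pow S. ring_sign R (inversions T (S - T)) \<otimes>\<^bsub>R\<^esub> (u T \<otimes>\<^bsub>R\<^esub> v (S - T)))
        else \<zero>\<^bsub>R\<^esub>),
     one = (\<lambda>S. if S = {} then \<one>\<^bsub>R\<^esub> else \<zero>\<^bsub>R\<^esub>),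
     zero = (\<lambda>S. \<zero>\<^bsub>R\<^esub>),
     add = (\<lambda>u v S. u S \<oplus>\<^bsub>R\<^esub> v S)\<rparr>"

definition koszul_degree :: "('a, 'b) ring_scheme \<Rightarrow> 'a list \<Rightarrow> nat \<Rightarrow> (nat set \<Rightarrow> 'a) set" where
  "koszul_degree R xs p =
     {u \<in> carrier (koszul_algebra R xs). \<forall>S. card S \<noteq> p \<longrightarrow> u S = \<zero>\<^bsub>R\<^esub>}"

definition koszul_diff :: "('a, 'b) ring_scheme \<Rightarrow> 'a list \<Rightarrow> (nat set \<Rightarrow> 'a) \<Rightarrow> nat set \<Rightarrow> 'a" where
  "koszul_diff R xs u = (\<lambda>S. if S \<subseteq> {..<length xs}
     then (\<Oplus>\<^bsub>R\<^esub>j\<in>{..<length xs} - S. ring_sign R (card {i \<in> S. i < j}) \<otimes>\<^bsub>R\<^esub> (xs ! j \<otimes>\<^bsub>R\<^esub> u (insert j S)))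
     else \<zero>\<^bsub>R\<^esub>)"

definition koszul_cycles :: "('a, 'b) ring_scheme \<Rightarrow> 'a list \<Rightarrow> (nat set \<Rightarrow> 'a) set" where
  "koszul_cycles R xs =
     {u \<in> carrier (koszul_algebra R xs). koszul_diff R xs u = \<zero>\<^bsub>koszul_algebra R xs\<^esub>}"

definition koszul_boundaries :: "('a, 'b) ring_scheme \<Rightarrow> 'a list \<Rightarrow> (nat set \<Rightarrow> 'a) set" where
  "koszul_boundaries R xs = koszul_diff R xs ` carrier (koszul_algebra R xs)"

text \<open>The cycles form a subalgebra in which the boundaries are a two-sided ideal.\<close>

definition koszul_cycle_algebra :: "('a, 'b) ring_scheme \<Rightarrow> 'a list \<Rightarrow> (nat set \<Rightarrow> 'a) ring" where
  "koszul_cycle_algebra R xs = koszul_algebra R xs \<lparr>carrier := koszul_cycles R xs\<rparr>"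

definition koszul_homology :: "('a, 'b) ring_scheme \<Rightarrow> 'a list \<Rightarrow> (nat set \<Rightarrow> 'a) set ring" where
  "koszul_homology R xs = koszul_cycle_algebra R xs Quot koszul_boundaries R xs"

definition koszul_class :: "('a, 'b) ring_scheme \<Rightarrow> 'a list \<Rightarrow> (nat set \<Rightarrow> 'a) \<Rightarrow> (nat set \<Rightarrow> 'a) set" where
  "koszul_class R xs u = koszul_boundaries R xs +>\<^bsub>koszul_cycle_algebra R xs\<^esub> u"

definition koszul_homology_degree ::
    "('a, 'b) ring_scheme \<Rightarrow> 'a list \<Rightarrow> nat \<Rightarrow> (nat set \<Rightarrow> 'a) set set" where
  "koszul_homology_degree R xs p =
     koszul_class R xs ` (koszul_cycles R xs \<inter> koszul_degree R xs p)"

section \<open>Projective dimension\<close>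

text \<open>
  A free resolution \<open>0 \<rightarrow> F\<^sub>l \<rightarrow> \<dots> \<rightarrow> F\<^sub>1 \<rightarrow> F\<^sub>0 \<rightarrow> Q/\<aa> \<rightarrow> 0\<close> with $F_i$ free of finite
  rank \<open>b i\<close>, differential $F_{i+1} \to F_i$ given by the matrix \<open>M i\<close>, and augmentation
  $F_0 \to Q/\mathfrak a$ sending \<open>v\<close> to the class of \<open>q \<bullet> v\<close>. The projective dimension is the length
  of a shortest such resolution: here \<open>Q\<close> is noetherian and local, so finitely generated projective
  modules are free and it suffices to consider finitely generated resolutions.
\<close>

definition has_free_resolution :: "'a :: comm_ring_1 set \<Rightarrow> nat \<Rightarrow> bool" where
  "has_free_resolution \<aa> l \<longleftrightarrow> (\<exists>b M q.
     (\<forall>i. M i \<in> carrier_mat (b i) (b (Suc i))) \<and> (\<forall>i>l. b i = 0) \<and> q \<in> carrier_vec (b 0) \<and>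
     (\<forall>f. \<exists>v\<in>carrier_vec (b 0). f - q \<bullet> v \<in> \<aa>) \<and>
     (\<forall>v\<in>carrier_vec (b 0). q \<bullet> v \<in> \<aa> \<longleftrightarrow> (\<exists>w\<in>carrier_vec (b 1). v = M 0 *\<^sub>v w)) \<and>
     (\<forall>i. \<forall>v\<in>carrier_vec (b (Suc i)).
        M i *\<^sub>v v = 0\<^sub>v (b i) \<longleftrightarrow> (\<exists>w\<in>carrier_vec (b (Suc (Suc i))). v = M (Suc i) *\<^sub>v w)))"

definition proj_dim_quotient :: "'a :: comm_ring_1 set \<Rightarrow> nat \<Rightarrow> bool" where
  "proj_dim_quotient \<aa> l \<longleftrightarrow>
     has_free_resolution \<aa> l \<and> (\<forall>k<l. \<not> has_free_resolution \<aa> k)"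

section \<open>The power series ring, type, and class\<close>

text \<open>
  $\Bbbk[[x,y,z]]$ is realized as $\Bbbk[[x]][[y]][[z]]$; as a ring in the sense of HOL-Algebra it is
  \<^term>\<open>class_ring\<close> at this type.
\<close>

type_synonym 'k pser3 = "'k fps fps fps"

definition varx :: "'k :: field pser3" where "varx = fps_const (fps_const fps_X)"
definition vary :: "'k :: field pser3" where "vary = fps_const fps_X"
definition varz :: "'k :: field pser3" where "varz = fps_X"

definition const3 :: "'k :: field \<Rightarrow> 'k pser3" where
  "const3 c = fps_const (fps_const (fps_const c))"

definition max_ideal :: "'k :: field pser3 set" where
  "max_ideal = genideal class_ring {varx, vary, varz}"

abbreviation quot :: "'k :: field pser3 set \<Rightarrow> 'k pser3 set ring" where
  "quot \<aa> \<equiv> class_ring Quot \<aa>"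

definition cls :: "'k :: field pser3 set \<Rightarrow> 'k pser3 \<Rightarrow> 'k pser3 set" where
  "cls \<aa> f = \<aa> +>\<^bsub>class_ring\<^esub> f"

text \<open>
  For $\mathfrak a \subseteq \mathfrak n^2$ the classes of $x$, $y$, $z$ are a minimal set of
  generators of the maximal ideal of $R = Q/\mathfrak a$. Below, \<open>hom_alg \<aa>\<close> is the algebra
  $A = \mathrm H(K^R)$, \<open>hom_deg \<aa> p\<close> is $A_p$, and \<open>hom_scalars \<aa>\<close> is the copy of $\Bbbk$ inside $A$
  (the image of the constants), so that $\Bbbk$-linear notions in $A$ are those of \<^locale>\<open>ring\<close>
  relative to this subfield.
\<close>

definition max_ideal_gens :: "'k :: field pser3 set \<Rightarrow> 'k pser3 set list" where
  "max_ideal_gens \<aa> = [cls \<aa> varx, cls \<aa> vary, cls \<aa> varz]"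

definition hom_alg :: "'k :: field pser3 set \<Rightarrow> (nat set \<Rightarrow> 'k pser3 set) set ring" where
  "hom_alg \<aa> = koszul_homology (quot \<aa>) (max_ideal_gens \<aa>)"

definition hom_deg :: "'k :: field pser3 set \<Rightarrow> nat \<Rightarrow> (nat set \<Rightarrow> 'k pser3 set) set set" where
  "hom_deg \<aa> p = koszul_homology_degree (quot \<aa>) (max_ideal_gens \<aa>) p"

definition hom_scalars :: "'k :: field pser3 set \<Rightarrow> (nat set \<Rightarrow> 'k pser3 set) set set" where
  "hom_scalars \<aa> = range (\<lambda>c. koszul_class (quot \<aa>) (max_ideal_gens \<aa>)
     (\<lambda>S. if S = {} then cls \<aa> (const3 c) else \<zero>\<^bsub>quot \<aa>\<^esub>))"

definition hom_basis :: "'k :: field pser3 set \<Rightarrow> nat \<Rightarrow> (nat set \<Rightarrow> 'k pser3 set) set list \<Rightarrow> bool" where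
  "hom_basis \<aa> p us \<longleftrightarrow> ring.independent (hom_alg \<aa>) (hom_scalars \<aa>) us \<and>
     ring.Span (hom_alg \<aa>) (hom_scalars \<aa>) us = hom_deg \<aa> p"

definition has_type :: "'k :: field pser3 set \<Rightarrow> nat \<Rightarrow> bool" where
  "has_type \<aa> t \<longleftrightarrow> ring.dimension (hom_alg \<aa>) t (hom_scalars \<aa>) (hom_deg \<aa> 3)"

text \<open>
  The non-zero products in the multiplication table of class $\mathbf G(r)$ are
  $e_i f_i = g_1 = f_i e_i$ for $1 \le i \le r$. In the literature the second equality also appears
  as $g_1 = -f_i e_i$; this sign is incompatible with graded commutativity, which gives
  $f_i e_i = (-1)^{2 \cdot 1} e_i f_i$. Lists are indexed from 0.
\<close>

definition class_G :: "'k :: field pser3 set \<Rightarrow> nat \<Rightarrow> bool" where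
  "class_G \<aa> r \<longleftrightarrow>
     ideal \<aa> class_ring \<and> \<aa> \<subseteq> ideal_prod class_ring max_ideal max_ideal \<and> proj_dim_quotient \<aa> 3 \<and>
     2 \<le> r \<and>
     (\<exists>n t es fs gs. n = min_num_generators class_ring \<aa> \<and> has_type \<aa> t \<and>
        r \<le> n \<and> r \<le> n + t - 1 \<and> 1 \<le> t \<and>
        length es = n \<and> hom_basis \<aa> 1 es \<and>
        length fs = n + t - 1 \<and> hom_basis \<aa> 2 fs \<and>
        length gs = t \<and> hom_basis \<aa> 3 gs \<and>
        (\<forall>i<n. \<forall>j<n + t - 1.
           es ! i \<otimes>\<^bsub>hom_alg \<aa>\<^esub> fs ! j = (if i = j \<and> i < r then gs ! 0 else \<zero>\<^bsub>hom_alg \<aa>\<^esub>) \<and>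
           fs ! j \<otimes>\<^bsub>hom_alg \<aa>\<^esub> es ! i = (if i = j \<and> i < r then gs ! 0 else \<zero>\<^bsub>hom_alg \<aa>\<^esub>)) \<and>
        (\<forall>u\<in>set es. \<forall>v\<in>set es. u \<otimes>\<^bsub>hom_alg \<aa>\<^esub> v = \<zero>\<^bsub>hom_alg \<aa>\<^esub>) \<and>
        (\<forall>u\<in>set fs. \<forall>v\<in>set fs. u \<otimes>\<^bsub>hom_alg \<aa>\<^esub> v = \<zero>\<^bsub>hom_alg \<aa>\<^esub>) \<and>
        (\<forall>u\<in>set gs. \<forall>v\<in>set (es @ fs @ gs).
           u \<otimes>\<^bsub>hom_alg \<aa>\<^esub> v = \<zero>\<^bsub>hom_alg \<aa>\<^esub> \<and> v \<otimes>\<^bsub>hom_alg \<aa>\<^esub> u = \<zero>\<^bsub>hom_alg \<aa>\<^esub>))"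

section \<open>Pfaffians\<close>

text \<open>
  Expansion of the Pfaffian of a skew-symmetric matrix along its first row; the square of the
  Pfaffian is the determinant.
\<close>

function pfaffian :: "'a :: comm_ring_1 mat \<Rightarrow> 'a" where
  "pfaffian A = (if dim_row A = 0 then 1 else
     (\<Sum>j\<in>{1..<dim_row A}.
        (-1) ^ (j - 1) * A $$ (0, j) * pfaffian (mat_delete (mat_delete A j j) 0 0)))"
  by auto
termination
  by (relation "measure dim_row") (auto simp: mat_delete_def)

declare pfaffian.simps [simp del]

section \<open>The matrices and ideals\<close>

text \<open>Rows and columns are indexed from 0, so the anti-diagonal consists of the positions with
  \<open>i + j + 1 = m\<close>.\<close>

definition Umat :: "nat \<Rightarrow> 'k :: field pser3 mat" where
  "Umat m = mat m m (\<lambda>(i, j).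
     if i + j + 2 = m then varx else if i + j + 1 = m then varz
     else if i + j = m then vary else 0)"

text \<open>The determinant of the empty matrix is 1, so \<open>dU 0 = 1\<close>.\<close>

definition dU :: "nat \<Rightarrow> 'k :: field pser3" where
  "dU i = det (Umat i)"

definition Vmat :: "nat \<Rightarrow> 'k :: field pser3 mat" where
  "Vmat m = mat (2 * m + 1) (2 * m + 1) (\<lambda>(i, j).
     if i < m then
       (if j < m then 0
        else if j = m then (if i = m - 1 then varx else 0)
        else Umat m $$ (i, j - (m + 1)))
     else if i = m then
       (if j < m then (if j = m - 1 then - varx else 0)
        else if j = m then 0
        else (if j = m + 1 then vary else 0))
     else
       (if j < m then - (Umat m $$ (i - (m + 1), j))
        else if j = m then (if i = m + 1 then - vary else 0)
        else 0))"

definition pf :: "nat \<Rightarrow> nat \<Rightarrow> 'k :: field pser3" where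
  "pf m i = pfaffian (mat_delete (Vmat m) i i)"

definition pf_ideal :: "nat \<Rightarrow> 'k :: field pser3 set" where
  "pf_ideal m = genideal class_ring (pf m ` {..<2 * m + 1})"

definition pf_gens :: "nat \<Rightarrow> 'k :: field pser3 set" where
  "pf_gens m = {varx ^ (m - i) * dU i | i. i < m} \<union> {vary ^ (m - i) * dU i | i. i < m} \<union> {dU m}"

text \<open>The ideal $\mathfrak n g + \mathfrak b$ with $\mathfrak b$ generated by \<open>pf_gens m - {g}\<close>.\<close>

definition trimmed_ideal :: "nat \<Rightarrow> 'k :: field pser3 \<Rightarrow> 'k pser3 set" where
  "trimmed_ideal m g =
     {h * g | h. h \<in> max_ideal} <+>\<^bsub>class_ring\<^esub> genideal class_ring (pf_gens m - {g})"

end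

theory Submission
  imports Defs "HOL-Library.Function_Algebras"
begin

text \<open>
  The determinants satisfy, up to sign, the recursion $D_{j+1} = z D_j - x y D_{j-1}$, and the products
  $x^a y^b D_j$ form a topological basis of $Q$. In this basis every ideal of the statement is the set of
  series with support in a prescribed set of exponents: $\mathfrak g_m$ belongs to the condition
  $\max(a, b) + j \ge m$, its generators are the minimal such $x^a y^b D_j$, and passing to $\mathfrak a$
  removes one of these exponents. Ideals and syzygies are thereby computed by inspection of exponents.

  The bases of the Koszul homology are explicit: degree 1 comes from lifting the generators along the Koszul
  differential, degree 2 from the alternating middle matrix of the resolution of $\mathfrak g_m$ together with
  the multiples of $g$, and degree 3 is the socle. The product of the 1-cycle with index $k$ and the 2-cycle
  with index $l$ is, modulo boundaries, the socle element $x^{m-1} y^{m-1}$ if $k = l$ and zero otherwise; the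
  class is the number of indices for which both cycles survive the passage to $\mathfrak a$.
\<close>

text \<open>The price of the basis is that z x^a y^b D_j has two terms, x^a y^b D_{j+1} and x^{a+1}
  y^{b+1} D_{j-1}, so every closure condition on exponents carries an extra clause. In return D_p
  D_q is the sum of (x y)^i D_{p+q-2i} for i up to min p q and contains D_0 only for p = q; this is
  the orthogonality behind the products. Homogeneity reduces each product to a single coefficient:
  the cycles lifted from generators and syzygies have entries of degree m - 1, and in degree 2 m - 2
  only x^{m-1} y^{m-1} survives modulo the trimmed ideal. The projective dimension is found without
  a minimal resolution of the trimmed ideal. Length at least 3 follows from a non-zero socle
  element. A resolution of length 3 is the Koszul complex of x - X, y - Y, z - Z, where X, Y, Z
  describe multiplication on the finite-dimensional space Q/a; its ranks are far from minimal, but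
  its exactness needs only division with remainder.\<close>

notation fps_nth (infixl \<open>!!\<close> 75)

section \<open>Coordinates with respect to the determinants\<close>

text \<open>\<open>ch (Suc j)\<close> is D_j, a homogenized Chebyshev polynomial of the second kind:
  (x y)^(j/2) times the Chebyshev polynomial of degree j at z / (2 sqrt(x y)). The index is shifted
  so that D_{-1} = 0 is available as \<open>ch 0\<close>.\<close>

fun ch :: "nat \<Rightarrow> 'k :: field pser3" where
  "ch 0 = 0"
| "ch (Suc 0) = 1"
| "ch (Suc (Suc n)) = varz * ch (Suc n) - varx * vary * ch n"

text \<open>
  Every \<open>f\<close> is uniquely $\sum_{a,b,j}$ \<open>const3 (coef f a b j) * varx ^ a * vary ^ b * ch (Suc j)\<close>. The recursion
  comes from \<open>varz * ch (Suc j) = ch (Suc (Suc j)) + varx * vary * ch j\<close>.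
\<close>

function coef :: "'k :: field pser3 \<Rightarrow> nat \<Rightarrow> nat \<Rightarrow> nat \<Rightarrow> 'k" where
  "coef f a b j = (if j = 0 then f !! 0 !! b !! a else coef (fps_shift (Suc 0) f) a b (j - Suc 0)) +
     (if a = 0 \<or> b = 0 then 0 else coef (fps_shift (Suc 0) f) (a - Suc 0) (b - Suc 0) (Suc j))"
  by auto
text \<open>The second call lowers \<open>a\<close> by one and raises \<open>j\<close> by one, hence
  the weight 2 on \<open>a\<close>.\<close>

termination by (relation "measure (\<lambda>(f, a, b, j). 2 * a + j)") auto

declare coef.simps [simp del]

section \<open>Linearity of the coordinates and the action of x, y and z on them\<close>

lemma coef_add [simp]: "coef (f + g) a b j = coef f a b j + coef g a b j"
proof (induction f a b j arbitrary: g rule: coef.induct)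
  case (1 f a b j)
  have s: "fps_shift (Suc 0) (f + g) = fps_shift (Suc 0) f + fps_shift (Suc 0) g"
    by (simp add: fps_eq_iff)
  show ?case
    by (use 1 in \<open>subst (1 2 3) coef.simps, auto simp: s\<close>)
qed

lemma varx_nth: "(varx * f) !! i !! b !! a = (if a = 0 then 0 else f !! i !! b !! (a - 1))"
  by (simp add: varx_def)

lemma vary_nth: "(vary * f) !! i !! b = (if b = 0 then 0 else f !! i !! (b - 1))"
  by (simp add: vary_def)

lemma varz_nth: "(varz * f) !! i = (if i = 0 then 0 else f !! (i - 1))"
  by (simp add: varz_def)

lemma const3_nth: "(const3 c * f) !! i !! b !! a = c * f !! i !! b !! a"
  by (simp add: const3_def)

lemma fps_shift_varx: "fps_shift n (varx * f) = varx * fps_shift n f"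
  and fps_shift_vary: "fps_shift n (vary * f) = vary * fps_shift n f"
  and fps_shift_varz: "fps_shift (Suc 0) (varz * f) = f"
  and fps_shift_const3: "fps_shift n (const3 c * f) = const3 c * fps_shift n f"
  by (simp_all add: fps_eq_iff varx_def vary_def varz_def const3_def)

lemma coef_const3 [simp]: "coef (const3 c * f) a b j = c * coef f a b j"
proof (induction f a b j rule: coef.induct)
  case (1 f a b j)
  show ?case
    by (use 1 in \<open>subst (1 2) coef.simps,
        auto simp: fps_shift_const3 const3_nth distrib_left simp del: fps_mult_nth_0\<close>)
qed

lemma const3_uminus_one: "const3 (-1) * f = - f"
proof -
  have "const3 (-1 :: 'a) = - 1"
    by (simp add: const3_def flip: fps_const_neg)
  then show ?thesis by simp
qed

lemma coef_uminus [simp]: "coef (- f) a b j = - coef f a b j"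
  using coef_const3[of "-1" f a b j] unfolding const3_uminus_one by simp

lemma coef_diff [simp]: "coef (f - g) a b j = coef f a b j - coef g a b j"
  using coef_add[of f "- g" a b j] by simp

lemma coef_zero [simp]: "coef 0 a b j = 0"
  using coef_diff[of 0 0 a b j] by simp

lemma coef_sum [simp]: "coef (\<Sum>i\<in>I. f i) a b j = (\<Sum>i\<in>I. coef (f i) a b j)"
  by (induction I rule: infinite_finite_induct) auto

lemma coef_varx [simp]: "coef (varx * f) a b j = (if a = 0 then 0 else coef f (a - 1) b j)"
proof (induction f a b j rule: coef.induct)
  case (1 f a b j)
  show ?case
    by (use 1 in \<open>subst (1 2) coef.simps,
        auto simp: fps_shift_varx varx_nth simp del: fps_mult_nth_0\<close>)
qed

lemma coef_vary [simp]: "coef (vary * f) a b j = (if b = 0 then 0 else coef f a (b - 1) j)"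
proof (induction f a b j rule: coef.induct)
  case (1 f a b j)
  show ?case
    by (use 1 in \<open>subst (1 2) coef.simps,
        auto simp: fps_shift_vary vary_nth simp del: fps_mult_nth_0\<close>)
qed

lemma coef_varz [simp]: "coef (varz * f) a b j =
    (if j = 0 then 0 else coef f a b (j - 1)) +
    (if a = 0 \<or> b = 0 then 0 else coef f (a - 1) (b - 1) (j + 1))"
  by (subst coef.simps) (simp add: fps_shift_varz varz_nth del: fps_mult_nth_0)

lemma coef_varx_power [simp]:
  "coef (varx ^ n * f) a b j = (if a < n then 0 else coef f (a - n) b j)"
  by (induction n arbitrary: a) (auto simp: mult.assoc)

lemma coef_vary_power [simp]:
  "coef (vary ^ n * f) a b j = (if b < n then 0 else coef f a (b - n) j)"
  by (induction n arbitrary: b) (auto simp: mult.assoc)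

text \<open>The recursion at \<open>Suc j\<close> expresses a coordinate of the z-shift of a series
  through a coordinate of the series and one of the shift with smaller \<open>a\<close>. So
  vanishing coordinates are inherited by the shift, and by iteration all z-coefficients
  vanish.\<close>

lemma coef_eq_zeroD:
  assumes "\<And>a b j. coef f a b j = 0"
  shows "f = 0"
proof -
  have s: "coef (fps_shift (Suc 0) g) a b j = 0" if "\<And>a b j. coef g a b j = 0"
    for g :: "'a pser3" and a b j
  proof (induction a arbitrary: b j)
    case 0
    show ?case using that[of 0 b "Suc j"] by (subst (asm) coef.simps) simp
  next
    case (Suc a)
    have "coef (fps_shift (Suc 0) g) (Suc a) b j +
        (if b = 0 then 0 else coef (fps_shift (Suc 0) g) a (b - 1) (Suc (Suc j))) = 0"
      using that[of "Suc a" b "Suc j"] by (subst (asm) coef.simps) (simp split: if_splits)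
    then show ?case by (simp add: Suc split: if_splits)
  qed
  have "\<forall>a b. f !! i !! b !! a = 0" for i using assms
  proof (induction i arbitrary: f)
    case 0
    show ?case
    proof (intro allI)
      fix a b
      show "f !! 0 !! b !! a = 0"
        using 0[of a b 0] s[OF 0] by (subst (asm) coef.simps) (simp split: if_splits)
    qed
  next
    case (Suc i)
    show ?case using Suc.IH[OF s[OF Suc.prems]] by simp
  qed note * = this
  show ?thesis
    by (rule fps_ext)+ (use * in simp)
qed

lemma coef_eqI: "(\<And>a b j. coef f a b j = coef g a b j) \<Longrightarrow> f = g"
  using coef_eq_zeroD[of "f - g"] by simp

text \<open>If \<open>c\<close> gives the coordinates of a series, \<open>descend c\<close> gives
  those of its z-shift: the recursion of \<open>coef\<close> at \<open>Suc j\<close>, solved for the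
  shift.\<close>

fun descend :: "(nat \<Rightarrow> nat \<Rightarrow> nat \<Rightarrow> 'k :: field) \<Rightarrow> nat \<Rightarrow> nat \<Rightarrow> nat \<Rightarrow> 'k" where
  "descend c a b j = c a b (Suc j) -
     (if a = 0 \<or> b = 0 then 0 else descend c (a - 1) (b - 1) (Suc (Suc j)))"

declare descend.simps [simp del]

text \<open>The inverse of \<open>coef\<close>. The i-th z-coefficient is the constant z-coefficient
  of the i-fold shift, obtained from the recursion of \<open>coef\<close> at j = 0.\<close>

definition el :: "(nat \<Rightarrow> nat \<Rightarrow> nat \<Rightarrow> 'k :: field) \<Rightarrow> 'k pser3" where
  "el c = Abs_fps (\<lambda>i. Abs_fps (\<lambda>b. Abs_fps (\<lambda>a. (descend ^^ i) c a b 0 -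
     (if a = 0 \<or> b = 0 then 0 else (descend ^^ Suc i) c (a - 1) (b - 1) 1))))"

lemma coef_el [simp]: "coef (el c) a b j = c a b j"
proof -
  have s: "fps_shift (Suc 0) (el c) = el (descend c)" for c :: "nat \<Rightarrow> nat \<Rightarrow> nat \<Rightarrow> 'a"
    by (simp add: el_def fps_eq_iff funpow_swap1)
  have "coef f a b j = c a b j" if "f = el c" for f
    using that
  proof (induction f a b j arbitrary: c rule: coef.induct)
    case (1 f a b j)
    have e: "(el c) !! 0 !! b !! a = c a b 0 -
        (if a = 0 \<or> b = 0 then 0 else descend c (a - 1) (b - 1) 1)"
      by (simp add: el_def)
    have s': "fps_shift (Suc 0) f = el (descend c)" using 1(3) s by simp
    show ?case
      using 1(1)[OF _ s'] 1(2)[OF _ s'] e 1(3)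
      by (subst coef.simps) (auto simp: s' descend.simps[of c a b])
  qed
  then show ?thesis by blast
qed

lemma el_coef: "el (coef f) = f"
  by (rule coef_eqI) simp

lemma coef_one: "coef 1 a b j = (if a = 0 \<and> b = 0 \<and> j = 0 then 1 else (0 :: 'k :: field))"
proof -
  have s: "fps_shift (Suc 0) (1 :: 'k pser3) = 0" by (simp add: fps_eq_iff)
  show ?thesis by (subst coef.simps) (auto simp: s)
qed

lemma coef_ch [simp]:
  "coef (ch n) a b j = (if n = Suc j \<and> a = 0 \<and> b = 0 then 1 else (0 :: 'k :: field))"
proof (induction n arbitrary: a b j rule: ch.induct)
  case 2
  then show ?case by (simp add: coef_one)
next
  case (3 n)
  show ?case
    by (auto simp: mult.assoc 3 split: if_splits)
qed simp

text \<open>The addition formula D_{m+j} = D_m D_j - x y D_{m-1} D_{j-1}, extended linearly over all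
  coordinates of \<open>h\<close>; the form with \<open>el\<close> covers infinitely many j at once.
  Both sides satisfy the recursion of \<open>ch\<close> in \<open>m\<close>.\<close>

lemma el_shift_eq:
  "el (\<lambda>a b j. if j < m then 0 else coef h a b (j - m)) =
     ch (Suc m) * h - varx * vary * ch m * el (\<lambda>a b j. coef h a b (Suc j))"
  (is "?S m = _ - _ * _ * _ * ?h")
proof (induction m rule: ch.induct)
  case 1
  then show ?case by (simp add: el_coef)
next
  case 2
  show ?case
    by (rule coef_eqI) (auto simp: mult.assoc)
next
  case (3 m)
  have "?S (Suc (Suc m)) = varz * ?S (Suc m) - varx * (vary * ?S m)"
    by (rule coef_eqI) (auto simp: Suc_diff_le not_less less_Suc_eq_le diff_diff_left)
  also have "\<dots> = ch (Suc (Suc (Suc m))) * h - varx * vary * ch (Suc (Suc m)) * ?h"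
    unfolding 3 by (simp add: algebra_simps)
  finally show ?case .
qed

lemma ch_mult: "ch (Suc p) * ch (Suc q) = ch (Suc (p + q)) + varx * vary * ch p * ch q"
proof -
  have 1: "el (\<lambda>a b j. coef (ch (Suc q)) a b (Suc j)) = ch q"
    by (rule coef_eqI) auto
  have 2: "el (\<lambda>a b j. if j < p then 0 else coef (ch (Suc q)) a b (j - p)) = ch (Suc (p + q))"
    by (rule coef_eqI) auto
  show ?thesis using el_shift_eq[of p "ch (Suc q)"] unfolding 1 2 by (metis diff_add_cancel)
qed

text \<open>Iterating \<open>ch_mult\<close> lowers p and q together and gains a factor x y each
  time; D_0 is reached only if both indices arrive at 0 simultaneously.\<close>

lemma coef_ch_mult_ch:
  "coef (ch (Suc p) * ch (Suc q)) a b 0 = (if a = p \<and> b = p \<and> p = q then 1 else 0)"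
proof (induction p arbitrary: q a b)
  case (Suc p)
  show ?case
  proof (cases q)
    case 0
    then show ?thesis by (simp del: ch.simps(3))
  next
    case (Suc r)
    show ?thesis
      unfolding Suc ch_mult[of "Suc p"] mult.assoc
      by (cases a; cases b) (auto simp: Suc.IH simp del: ch.simps)
  qed
qed auto

section \<open>Ideals spanned by coordinates\<close>

definition supp_in :: "(nat \<Rightarrow> nat \<Rightarrow> nat \<Rightarrow> bool) \<Rightarrow> 'k :: field pser3 set" where
  "supp_in W = {f. \<forall>a b j. coef f a b j \<noteq> 0 \<longrightarrow> W a b j}"

text \<open>The last clause is the second term of z D_{j+1} = D_{j+2} + x y D_j.\<close>

definition stable :: "(nat \<Rightarrow> nat \<Rightarrow> nat \<Rightarrow> bool) \<Rightarrow> bool" where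
  "stable W \<longleftrightarrow> (\<forall>a b j. W a b j \<longrightarrow> W (Suc a) b j \<and> W a (Suc b) j \<and> W a b (Suc j)) \<and>
     (\<forall>a b j. W a b (Suc j) \<longrightarrow> W (Suc a) (Suc b) j)"

lemma decompose:
  obtains h1 h2 h3 where "f = const3 (coef f 0 0 0) + varx * h1 + vary * h2 + varz * h3"
proof
  let ?h3 = "fps_shift (Suc 0) f"
  let ?h2 = "fps_const (fps_shift (Suc 0) (f !! 0))"
  let ?h1 = "fps_const (fps_const (fps_shift (Suc 0) (f !! 0 !! 0)))"
  have c: "coef f 0 0 0 = f !! 0 !! 0 !! 0" by (subst coef.simps) simp
  show "f = const3 (coef f 0 0 0) + varx * ?h1 + vary * ?h2 + varz * ?h3"
    unfolding c by (simp add: fps_eq_iff varx_def vary_def varz_def const3_def)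
qed

text \<open>\<open>h\<close> may be an infinite series, so there is no induction on
  \<open>h\<close>. A fixed coordinate of \<open>h * f\<close> is traced back instead: splitting off
  the constant term of \<open>h\<close> leaves multiples of x, y, z, whose coordinates come from
  exponents of smaller weight 2 a + b + j.\<close>

lemma supp_in_mult:
  assumes "stable W" "f \<in> supp_in W"
  shows "h * f \<in> supp_in W"
proof -
  have "coef (h * f) a b j \<noteq> 0 \<longrightarrow> W a b j" for a b j
  proof (induction "2 * a + b + j" arbitrary: h a b j rule: less_induct)
    case less
    obtain h1 h2 h3 where h: "h = const3 (coef h 0 0 0) + varx * h1 + vary * h2 + varz * h3"
      by (rule decompose)
    have e: "h * f = const3 (coef h 0 0 0) * f + varx * (h1 * f) + vary * (h2 * f) +
        varz * (h3 * f)"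
      by (subst h) (simp add: algebra_simps)
    have 1: "coef (varx * (h1 * f)) a b j \<noteq> 0 \<longrightarrow> W a b j"
      using less[of "a - 1" b j h1] assms(1) unfolding stable_def
      by (cases a) auto
    have 2: "coef (vary * (h2 * f)) a b j \<noteq> 0 \<longrightarrow> W a b j"
      using less[of a "b - 1" j h2] assms(1) unfolding stable_def
      by (cases b) auto
    have 3: "coef (varz * (h3 * f)) a b j \<noteq> 0 \<longrightarrow> W a b j"
      using less[of a b "j - 1" h3] less[of "a - 1" "b - 1" "j + 1" h3] assms(1)
      unfolding stable_def by (cases a; cases b; cases j) auto
    have 4: "coef (const3 (coef h 0 0 0) * f) a b j \<noteq> 0 \<longrightarrow> W a b j"
      using assms(2) unfolding supp_in_def by auto
    show ?case unfolding e coef_add using 1 2 3 4 by (metis add.right_neutral)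
  qed
  then show ?thesis unfolding supp_in_def by blast
qed

lemma supp_in_add: "f \<in> supp_in W \<Longrightarrow> g \<in> supp_in W \<Longrightarrow> f + g \<in> supp_in W"
  unfolding supp_in_def by (auto, metis add.right_neutral)

lemma supp_in_zero [simp]: "0 \<in> supp_in W"
  by (simp add: supp_in_def)

lemma supp_in_uminus: "f \<in> supp_in W \<Longrightarrow> - f \<in> supp_in W"
  by (simp add: supp_in_def)

lemma class_ring_idealI:
  fixes I :: "'a :: comm_ring_1 set"
  assumes "0 \<in> I" "\<And>f g. f \<in> I \<Longrightarrow> g \<in> I \<Longrightarrow> f + g \<in> I" "\<And>h f. f \<in> I \<Longrightarrow> h * f \<in> I"
  shows "ideal I class_ring"
proof (rule idealI)
  show "ring (class_ring :: 'a ring)" by (rule class_ring.ring_axioms)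
  have "- f \<in> I" if "f \<in> I" for f using assms(3)[OF that, of "-1"] by simp
  moreover have "a_inv class_ring f = - f" for f :: 'a
    by (simp only: class_ring_simps)
  then have "inv\<^bsub>add_monoid class_ring\<^esub> f = - f" for f :: 'a
    unfolding a_inv_def by simp
  ultimately show "subgroup I (add_monoid class_ring)"
    using assms(1,2) by unfold_locales auto
qed (auto simp: assms(3), metis assms(3) mult.commute)

lemma supp_in_ideal: "stable W \<Longrightarrow> ideal (supp_in W) class_ring"
  by (rule class_ring_idealI) (auto intro: supp_in_add supp_in_mult)

section \<open>The Pfaffian ideal and its trimmings in coordinates\<close>

lemma ideal_closed:
  fixes I :: "'a :: comm_ring_1 set"
  assumes "ideal I class_ring"
  shows ideal_zero: "0 \<in> I"
    and ideal_add: "f \<in> I \<Longrightarrow> g \<in> I \<Longrightarrow> f + g \<in> I"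
    and ideal_mult: "f \<in> I \<Longrightarrow> h * f \<in> I"
    and ideal_mult_right: "f \<in> I \<Longrightarrow> f * h \<in> I"
    and ideal_uminus: "f \<in> I \<Longrightarrow> - f \<in> I"
    and ideal_diff: "f \<in> I \<Longrightarrow> g \<in> I \<Longrightarrow> f - g \<in> I"
    and ideal_sum: "(\<And>k. k \<in> K \<Longrightarrow> s k \<in> I) \<Longrightarrow> sum s K \<in> I"
proof -
  interpret ideal I class_ring by fact
  show z: "0 \<in> I" using zero_closed by simp
  show a: "f \<in> I \<Longrightarrow> g \<in> I \<Longrightarrow> f + g \<in> I" for f g using a_closed[of f g] by simp
  show m: "f \<in> I \<Longrightarrow> h * f \<in> I" for f h using I_l_closed[of f h] by simp
  show "f \<in> I \<Longrightarrow> f * h \<in> I" using m[of f h] by (simp add: mult.commute)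
  show u: "f \<in> I \<Longrightarrow> - f \<in> I" for f using m[of f "-1"] by simp
  show "f \<in> I \<Longrightarrow> g \<in> I \<Longrightarrow> f - g \<in> I" using a[of f "- g"] u[of g] by simp
  show "(\<And>k. k \<in> K \<Longrightarrow> s k \<in> I) \<Longrightarrow> sum s K \<in> I"
    by (induction K rule: infinite_finite_induct) (auto simp: z a)
qed

lemma genideal_class_ring:
  fixes S :: "'a :: comm_ring_1 set"
  shows genideal_is_ideal: "ideal (genideal class_ring S) class_ring"
    and genideal_mem: "f \<in> S \<Longrightarrow> f \<in> genideal class_ring S"
    and genideal_least: "ideal I class_ring \<Longrightarrow> S \<subseteq> I \<Longrightarrow> genideal class_ring S \<subseteq> I"
proof -
  show "ideal (genideal class_ring S) class_ring"
    by (rule ring.genideal_ideal[OF class_ring.ring_axioms]) simp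
  show "f \<in> S \<Longrightarrow> f \<in> genideal class_ring S"
    using ring.genideal_self[OF class_ring.ring_axioms, of S] by auto
  show "ideal I class_ring \<Longrightarrow> S \<subseteq> I \<Longrightarrow> genideal class_ring S \<subseteq> I"
    by (rule ring.genideal_minimal[OF class_ring.ring_axioms])
qed

lemma genideal_image:
  fixes g :: "'i \<Rightarrow> 'a :: comm_ring_1"
  assumes "finite K"
  shows "genideal class_ring (g ` K) = {\<Sum>k\<in>K. h k * g k | h. True}"
proof
  have 1: "ideal {\<Sum>k\<in>K. h k * g k | h. True} class_ring"
  proof (rule class_ring_idealI)
    show "0 \<in> {\<Sum>k\<in>K. h k * g k | h. True}"
      by (auto intro!: exI[of _ "\<lambda>_. 0"])
  next
    fix u v assume "u \<in> {\<Sum>k\<in>K. h k * g k | h. True}" "v \<in> {\<Sum>k\<in>K. h k * g k | h. True}"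
    then obtain h h' where "u = (\<Sum>k\<in>K. h k * g k)" "v = (\<Sum>k\<in>K. h' k * g k)" by auto
    then have "u + v = (\<Sum>k\<in>K. (h k + h' k) * g k)"
      by (simp add: distrib_right sum.distrib)
    then show "u + v \<in> {\<Sum>k\<in>K. h k * g k | h. True}" by auto
  next
    fix c u assume "u \<in> {\<Sum>k\<in>K. h k * g k | h. True}"
    then obtain h where "u = (\<Sum>k\<in>K. h k * g k)" by auto
    then have "c * u = (\<Sum>k\<in>K. (c * h k) * g k)"
      by (simp add: sum_distrib_left mult.assoc)
    then show "c * u \<in> {\<Sum>k\<in>K. h k * g k | h. True}" by (auto intro: exI[of _ "\<lambda>k. c * h k"])
  qed
  have 2: "g k \<in> {\<Sum>k\<in>K. h k * g k | h. True}" if "k \<in> K" for k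
  proof -
    have "(\<Sum>k'\<in>K. (if k' = k then 1 else 0) * g k') = (\<Sum>k'\<in>K. if k' = k then g k' else 0)"
      by (rule sum.cong) auto
    also have "\<dots> = g k"
      using assms that by simp
    finally show ?thesis by (auto intro!: exI[of _ "\<lambda>k'. if k' = k then 1 else 0"])
  qed
  show "genideal class_ring (g ` K) \<subseteq> {\<Sum>k\<in>K. h k * g k | h. True}"
    using 2 by (intro genideal_least[OF 1]) auto
  note i = genideal_is_ideal[of "g ` K"]
  show "{\<Sum>k\<in>K. h k * g k | h. True} \<subseteq> genideal class_ring (g ` K)"
  proof clarify
    fix h
    show "(\<Sum>k\<in>K. h k * g k) \<in> genideal class_ring (g ` K)"
      by (rule ideal_sum[OF i], rule ideal_mult[OF i], rule genideal_mem, rule imageI)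
  qed
qed

lemma mem_max_ideal_iff: "h \<in> max_ideal \<longleftrightarrow> coef h 0 0 0 = 0"
proof
  have st: "stable (\<lambda>a b j. 0 < a + b + j)" by (auto simp: stable_def)
  have "{varx, vary, varz} \<subseteq> supp_in (\<lambda>a b j. 0 < a + b + j)"
  proof -
    have "coef (varx * 1) 0 0 0 = 0" "coef (vary * 1) 0 0 0 = 0" "coef (varz * 1) 0 0 0 = 0"
      by (simp_all only: coef_varx coef_vary coef_varz) auto
    then show ?thesis unfolding supp_in_def by (auto intro!: gr0I)
  qed
  then have "max_ideal \<subseteq> supp_in (\<lambda>a b j. 0 < a + b + j)"
    unfolding max_ideal_def by (rule genideal_least[OF supp_in_ideal[OF st]])
  then show "h \<in> max_ideal \<Longrightarrow> coef h 0 0 0 = 0"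
    unfolding supp_in_def by fastforce
next
  assume h: "coef h 0 0 0 = 0"
  note i = genideal_is_ideal[of "{varx, vary, varz}"]
  obtain h1 h2 h3 where *: "h = const3 (coef h 0 0 0) + varx * h1 + vary * h2 + varz * h3"
    by (rule decompose)
  show "h \<in> max_ideal"
    unfolding max_ideal_def by (subst *, simp add: h const3_def)
      (intro ideal_add[OF i] ideal_mult_right[OF i] genideal_mem; simp)
qed

lemma max_ideal_decompose:
  assumes "h \<in> max_ideal"
  obtains h1 h2 h3 where "h = varx * h1 + vary * h2 + varz * h3"
proof -
  obtain h1 h2 h3 where *: "h = const3 (coef h 0 0 0) + varx * h1 + vary * h2 + varz * h3"
    by (rule decompose)
  have "coef h 0 0 0 = 0" using assms by (simp add: mem_max_ideal_iff)
  then have "h = varx * h1 + vary * h2 + varz * h3"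
    by (subst *) (simp add: const3_def)
  then show thesis by (rule that)
qed

lemma max_ideal_decompose_unit:
  obtains h' where "h' \<in> max_ideal" "h = const3 (coef h 0 0 0) + h'"
proof
  have "coef (const3 c * 1) 0 0 0 = c" for c :: 'a
    by (simp only: coef_const3 coef_one) auto
  then show "h - const3 (coef h 0 0 0) \<in> max_ideal"
    by (simp add: mem_max_ideal_iff)
qed simp

text \<open>No exponent of \<open>W\<close> is moved to (a, b, j) by x, y or z. The coordinate there
  vanishes on n times \<open>supp_in W\<close>, so it is a functional on the quotient of
  \<open>supp_in W\<close> by this product, the space that counts minimal generators by Nakayama's
  lemma.\<close>

definition corner :: "(nat \<Rightarrow> nat \<Rightarrow> nat \<Rightarrow> bool) \<Rightarrow> nat \<Rightarrow> nat \<Rightarrow> nat \<Rightarrow> bool" where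
  "corner W a b j \<longleftrightarrow> (\<forall>a'. a = Suc a' \<longrightarrow> \<not> W a' b j) \<and> (\<forall>b'. b = Suc b' \<longrightarrow> \<not> W a b' j) \<and>
     (\<forall>j'. j = Suc j' \<longrightarrow> \<not> W a b j') \<and> (\<forall>a' b'. a = Suc a' \<and> b = Suc b' \<longrightarrow> \<not> W a' b' (Suc j))"

lemma coef_corner_max_ideal:
  assumes "stable W" "corner W a b j" "f \<in> supp_in W" "h \<in> max_ideal"
  shows "coef (h * f) a b j = 0"
proof -
  obtain h1 h2 h3 where h: "h = varx * h1 + vary * h2 + varz * h3"
    using assms(4) by (rule max_ideal_decompose)
  have e: "h * f = varx * (h1 * f) + vary * (h2 * f) + varz * (h3 * f)"
    by (simp add: h algebra_simps)
  have s: "\<not> W a b j \<Longrightarrow> coef (h' * f) a b j = 0" for h' a b j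
    using supp_in_mult[OF assms(1,3), of h'] unfolding supp_in_def by blast
  have "coef (varx * (h1 * f)) a b j = 0"
    using assms(2) by (cases a) (auto simp: corner_def s)
  moreover have "coef (vary * (h2 * f)) a b j = 0"
    using assms(2) by (cases b) (auto simp: corner_def s)
  moreover have "coef (varz * (h3 * f)) a b j = 0"
    using assms(2) by (cases a; cases b; cases j) (auto simp: corner_def s)
  ultimately show ?thesis unfolding e by simp
qed

lemma coef_corner:
  assumes "stable W" "corner W a b j" "f \<in> supp_in W"
  shows "coef (h * f) a b j = coef h 0 0 0 * coef f a b j"
proof -
  obtain h' where h: "h' \<in> max_ideal" "h = const3 (coef h 0 0 0) + h'"
    by (rule max_ideal_decompose_unit)
  have "h * f = const3 (coef h 0 0 0) * f + h' * f"
    by (subst h(2)) (simp add: algebra_simps)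
  then show ?thesis
    using coef_corner_max_ideal[OF assms h(1)] by simp
qed

definition above :: "nat \<Rightarrow> nat \<Rightarrow> nat \<Rightarrow> nat \<Rightarrow> bool" where
  "above m a b j \<longleftrightarrow> m \<le> max a b + j"

text \<open>The generators of the Pfaffian ideal, up to sign, indexed by \<open>-m \<le> k \<le> m\<close>.\<close>

definition gen :: "nat \<Rightarrow> int \<Rightarrow> 'k :: field pser3" where
  "gen m k = varx ^ nat (- k) * (vary ^ nat k * ch (Suc (m - nat \<bar>k\<bar>)))"

lemma coef_gen [simp]:
  "coef (gen m k) a b j =
    (if a = nat (- k) \<and> b = nat k \<and> j = m - nat \<bar>k\<bar> then 1 else 0)"
  unfolding gen_def by auto

lemma stable_above: "stable (above m)"
  by (auto simp: stable_def above_def)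

lemma gen_mem_above: "gen m k \<in> supp_in (above m)"
  by (auto simp: supp_in_def above_def)

text \<open>The hypothesis says that \<open>h\<close> involves only x and y, so the correction term
  in \<open>el_shift_eq\<close> is zero.\<close>

lemma coef_ch_mult_flat:
  assumes "\<And>a b j. j \<noteq> 0 \<Longrightarrow> coef h a b j = 0"
  shows "coef (ch (Suc q) * h) a b j = (if j = q then coef h a b 0 else 0)"
proof -
  have "el (\<lambda>a b j. coef h a b (Suc j)) = 0"
    by (rule coef_eqI) (simp add: assms)
  then have "ch (Suc q) * h = el (\<lambda>a b j. if j < q then 0 else coef h a b (j - q))"
    using el_shift_eq[of q h] by simp
  then show ?thesis using assms by auto
qed

text \<open>For each of the finitely many j < m the exponents with a >= m - j are collected in a
  multiple of x^{m-j} D_j; the others have b >= m - j and go to y^{m-j} D_j. All j >= m are treated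
  together.\<close>

lemma genideal_gen: "genideal class_ring (gen m ` {- int m..int m}) = (supp_in (above m) :: 'k :: field pser3 set)"
  (is "?J = _")
proof
  show "?J \<subseteq> supp_in (above m)"
    by (rule genideal_least[OF supp_in_ideal[OF stable_above]]) (auto intro: gen_mem_above)
  note i = genideal_is_ideal[of "gen m ` {- int m..int m} :: 'k pser3 set"]
  have X: "varx ^ (m - j) * (ch (Suc j) * h) \<in> ?J" if "j \<le> m" for j h
  proof -
    have "varx ^ (m - j) * (ch (Suc j) * h) = gen m (- int (m - j)) * h"
      using that by (simp add: gen_def mult.assoc del: of_nat_diff)
    then show ?thesis
      by (simp only:) (rule ideal_mult_right[OF i], rule genideal_mem, rule imageI, simp)
  qed
  have Y: "vary ^ (m - j) * (ch (Suc j) * h) \<in> ?J" if "j \<le> m" for j h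
  proof -
    have "vary ^ (m - j) * (ch (Suc j) * h) = gen m (int (m - j)) * h"
      using that by (simp add: gen_def mult.assoc del: of_nat_diff)
    then show ?thesis
      by (simp only:) (rule ideal_mult_right[OF i], rule genideal_mem, rule imageI, simp)
  qed
  show "supp_in (above m) \<subseteq> ?J"
  proof
    fix f :: "'k pser3" assume f: "f \<in> supp_in (above m)"
    define P where "P j = el (\<lambda>a b i. if i = 0 then coef f (a + (m - j)) b j else 0)" for j
    define P' where
      "P' j = el (\<lambda>a b i. if i = 0 \<and> a < m - j then coef f a (b + (m - j)) j else 0)" for j
    \<comment> \<open>The tail has unbounded j. By the addition formula it is D_m times a series
      minus x y D_{m-1} times a series, and x D_{m-1} is itself a generator.\<close>
    define T where "T = el (\<lambda>a b j. if j < m then 0 else coef f a b j)"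
    have cP: "coef (ch (Suc j) * P j) a b i = (if i = j then coef f (a + (m - j)) b j else 0)"
      for a b i j
      by (subst coef_ch_mult_flat) (auto simp: P_def)
    have cP': "coef (ch (Suc j) * P' j) a b i =
        (if i = j \<and> a < m - j then coef f a (b + (m - j)) j else 0)" for a b i j
      by (subst coef_ch_mult_flat) (auto simp: P'_def)
    have z: "coef f a b i = 0" if "max a b + i < m" for a b i
    proof -
      have "coef f a b i \<noteq> 0 \<Longrightarrow> m \<le> max a b + i"
        using f unfolding supp_in_def above_def by blast
      then show ?thesis using that by linarith
    qed
    have f_eq: "f = (\<Sum>j<m. varx ^ (m - j) * (ch (Suc j) * P j)) +
        (\<Sum>j<m. vary ^ (m - j) * (ch (Suc j) * P' j)) + T" (is "f = ?r")
    proof (rule coef_eqI)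
      fix a b i
      have 1: "coef (\<Sum>j<m. varx ^ (m - j) * (ch (Suc j) * P j)) a b i =
          (\<Sum>j<m. if j = i then (if a < m - j then 0 else coef f a b j) else 0)"
        unfolding coef_sum by (rule sum.cong) (auto simp: cP)
      have 2: "coef (\<Sum>j<m. vary ^ (m - j) * (ch (Suc j) * P' j)) a b i =
          (\<Sum>j<m. if j = i then (if b < m - j \<or> \<not> a < m - j then 0 else coef f a b j) else 0)"
        unfolding coef_sum by (rule sum.cong) (auto simp: cP')
      show "coef f a b i = coef ?r a b i"
      proof (cases "i < m")
        case True
        have "coef T a b i = 0" using True by (simp add: T_def)
        moreover have "a < m - i \<Longrightarrow> b < m - i \<Longrightarrow> coef f a b i = 0"
          by (rule z) simp
        ultimately show ?thesis
          unfolding coef_add 1 2 using True by (simp add: sum.delta)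
      next
        case False
        then show ?thesis
          unfolding coef_add 1 2 by (simp add: T_def sum.delta)
      qed
    qed
    have "T = ch (Suc m) * el (\<lambda>a b j. coef f a b (j + m)) -
        varx * vary * ch m * el (\<lambda>a b j. coef f a b (Suc j + m))"
    proof -
      have "el (\<lambda>a b j. if j < m then 0 else
          coef (el (\<lambda>a b j. coef f a b (j + m))) a b (j - m)) = T"
        unfolding T_def by (rule arg_cong[where f = el], intro ext) simp
      then show ?thesis
        using el_shift_eq[of m "el (\<lambda>a b j. coef f a b (j + m))"] by simp
    qed
    moreover have "ch (Suc m) * h \<in> ?J" for h using X[of m h] by simp
    moreover have "varx * vary * ch m * h \<in> ?J" for h
    proof (cases m)
      case 0
      then have "varx * vary * ch m * h = 0" by simp
      then show ?thesis by (simp only: ideal_zero[OF i])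
    next
      case (Suc n)
      then show ?thesis using X[of n "vary * h"] by (simp add: mult_ac)
    qed
    ultimately have "T \<in> ?J" by (simp only: ideal_diff[OF i])
    then show "f \<in> ?J"
      by (subst f_eq) (intro ideal_add[OF i] ideal_sum[OF i] X Y; simp)
  qed
qed

definition above_except :: "nat \<Rightarrow> int \<Rightarrow> nat \<Rightarrow> nat \<Rightarrow> nat \<Rightarrow> bool" where
  "above_except m k a b j \<longleftrightarrow>
     above m a b j \<and> \<not> (a = nat (- k) \<and> b = nat k \<and> j = m - nat \<bar>k\<bar>)"

lemma corner_above:
  assumes "k \<in> {- int m..int m}"
  shows "corner (above m) (nat (- k)) (nat k) (m - nat \<bar>k\<bar>)"
  using assms by (cases "k \<ge> 0") (auto simp: corner_def above_def)

text \<open>Nothing in \<open>W\<close> is moved to a corner, so removing the corner violates no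
  closure condition.\<close>

lemma stable_minus_corner:
  assumes "stable W" "corner W p q r"
  shows "stable (\<lambda>a b j. W a b j \<and> \<not> (a = p \<and> b = q \<and> j = r))"
  using assms unfolding stable_def corner_def by (intro conjI allI impI) auto

lemma stable_above_except:
  assumes "k \<in> {- int m..int m}"
  shows "stable (above_except m k)"
  using stable_minus_corner[OF stable_above corner_above[OF assms]]
  unfolding above_except_def .

lemma gen_mem_above_except:
  assumes "k \<in> {- int m..int m}" "k' \<in> {- int m..int m}" "k \<noteq> k'"
  shows "gen m k' \<in> supp_in (above_except m k)"
  using assms by (auto simp: supp_in_def above_except_def above_def)

lemma max_ideal_mult_above:
  assumes "k \<in> {- int m..int m}" "f \<in> supp_in (above m)" "h \<in> max_ideal"
  shows "h * f \<in> supp_in (above_except m k)"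
  using supp_in_mult[OF stable_above assms(2), of h]
    coef_corner_max_ideal[OF stable_above corner_above[OF assms(1)] assms(2,3)]
  unfolding supp_in_def above_except_def by auto

lemma above_decompose:
  assumes "k \<in> {- int m..int m}" "f \<in> supp_in (above m)"
  shows "f - const3 (coef f (nat (- k)) (nat k) (m - nat \<bar>k\<bar>)) * gen m k \<in> supp_in (above_except m k)"
  using assms gen_mem_above[of m k]
  unfolding supp_in_def above_except_def by auto

text \<open>At the corner of \<open>gen m k\<close> every other generator has coordinate zero, so
  the coordinate of \<open>f\<close> there is the constant term of \<open>h k\<close>.\<close>

lemma supp_in_above_except:
  fixes m :: nat and k :: int
  defines "I \<equiv> {- int m..int m}"
  assumes "k \<in> I" "f \<in> supp_in (above_except m k)"
  obtains h where "f = (\<Sum>i\<in>I. h i * gen m i)" "h k \<in> max_ideal"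
proof -
  have k: "k \<in> {- int m..int m}" using assms by simp
  have "f \<in> supp_in (above m)"
    using assms(3) by (auto simp: supp_in_def above_except_def)
  then obtain h where h: "f = (\<Sum>i\<in>I. h i * gen m i)"
    unfolding genideal_gen[symmetric] I_def by (auto simp: genideal_image)
  let ?c = "\<lambda>f. coef f (nat (- k)) (nat k) (m - nat \<bar>k\<bar>)"
  have "?c (h i * gen m i) = (if i = k then coef (h k) 0 0 0 else 0)" if "i \<in> I" for i
    using that by (subst coef_corner[OF stable_above corner_above[OF k] gen_mem_above]) (auto simp: I_def)
  then have "?c f = (\<Sum>i\<in>I. if i = k then coef (h k) 0 0 0 else 0)"
    unfolding h coef_sum by (intro sum.cong) auto
  also have "\<dots> = coef (h k) 0 0 0"
    using assms by (simp add: I_def)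
  finally have "coef (h k) 0 0 0 = ?c f" ..
  also have "?c f = 0"
    using assms(3) unfolding supp_in_def above_except_def by fast
  finally have "coef (h k) 0 0 0 = 0" .
  then show thesis using h that by (simp add: mem_max_ideal_iff)
qed

section \<open>Determinants and Pfaffians\<close>

text \<open>The sign of the permutation that reverses n elements. It enters twice: in determinants
  of anti-diagonal shape, and in the Pfaffian of a matrix with off-diagonal blocks C and -C^T and a
  zero diagonal block, which is \<open>sg n\<close> times det C.\<close>

definition sg :: "nat \<Rightarrow> 'a :: comm_ring_1" where
  "sg n = (-1) ^ (n * (n - 1) div 2)"

lemma sg_0 [simp]: "sg 0 = 1"
  by (simp add: sg_def)

lemma sg_Suc: "sg (Suc n) = (-1) ^ n * sg n"
proof -
  have "Suc n * (Suc n - 1) = n * (n - 1) + n * 2" by (cases n) simp_all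
  then have "Suc n * (Suc n - 1) div 2 = n * (n - 1) div 2 + n"
    by (metis div_mult_self1 zero_neq_numeral add.commute mult.commute)
  then show ?thesis by (simp add: sg_def power_add mult.commute)
qed

lemma sg_cases: "sg n = (1 :: 'a :: comm_ring_1) \<or> sg n = (-1 :: 'a)"
  unfolding sg_def by (simp add: minus_one_power_iff)

lemma sg_square [simp]: "sg n * sg n = (1 :: 'a :: comm_ring_1)"
  using sg_cases[of n, where 'a = 'a] by auto

lemma minus_one_power_square: "(-1) ^ n * (-1) ^ n = (1 :: 'a :: comm_ring_1)"
  by (simp add: minus_one_power_iff)

section \<open>Determinants and minors of the matrices U\<close>

lemma Umat_carrier [simp]: "Umat n \<in> carrier_mat n n"
  by (simp add: Umat_def)

lemma Umat_index:
  assumes "i < n" "j < n"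
  shows "Umat n $$ (i, j) = (if i + j + 2 = n then varx else if i + j + 1 = n then varz
     else if i + j = n then vary else 0)"
  using assms by (simp add: Umat_def)

lemma mat_eqI:
  assumes "A \<in> carrier_mat n k" "B \<in> carrier_mat n k"
    "\<And>i j. i < n \<Longrightarrow> j < k \<Longrightarrow> A $$ (i, j) = B $$ (i, j)"
  shows "A = B"
  using assms by (intro eq_matI) auto

lemma mat_delete_entry:
  assumes "A \<in> carrier_mat (Suc N) (Suc M)" "p < N" "q < M"
  shows "mat_delete A i j $$ (p, q) =
    A $$ (if p < i then p else Suc p, if q < j then q else Suc q)"
  using assms by (simp add: mat_delete_def)

lemma mat_delete_carrier_Suc:
  "A \<in> carrier_mat (Suc N) (Suc M) \<Longrightarrow> mat_delete A i j \<in> carrier_mat N M"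
  by (auto simp: mat_delete_def)

text \<open>Laplace expansion along the first row, which has only x and z in its last two places;
  the last column of the minor at x contains only y.\<close>

lemma dU_rec:
  "dU (Suc (Suc n)) = (-1) ^ Suc n * varz * dU (Suc n) + varx * vary * (dU n :: 'k :: field pser3)"
proof -
  let ?U = "Umat (Suc (Suc n)) :: 'k pser3 mat"
  let ?B = "mat_delete ?U 0 n"
  have B: "?B \<in> carrier_mat (Suc n) (Suc n)"
    using mat_delete_carrier[OF Umat_carrier[of "Suc (Suc n)"]] by simp
  have 1: "mat_delete ?U 0 (Suc n) = Umat (Suc n)"
    by (rule eq_matI) (auto simp: mat_delete_def Umat_def)
  have 2: "mat_delete ?B 0 n = Umat n"
    by (rule eq_matI) (auto simp: mat_delete_def Umat_def)
  have 3: "?B $$ (i, n) = (if i = 0 then vary else 0)" if "i < Suc n" for i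
    using that by (auto simp: mat_delete_def Umat_def)
  have "det ?B = (\<Sum>i<Suc n. ?B $$ (i, n) * cofactor ?B i n)"
    by (rule laplace_expansion_column[OF B]) simp
  also have "\<dots> = (\<Sum>i<Suc n. if i = 0 then vary * cofactor ?B i n else 0)"
    by (rule sum.cong) (auto simp: 3)
  also have "\<dots> = vary * ((-1) ^ n * dU n)"
    by (subst sum.delta) (simp_all add: cofactor_def 2 dU_def)
  finally have detB: "det ?B = (-1) ^ n * (vary * dU n)" by (simp add: mult_ac)
  have 4: "?U $$ (0, j) = (if j = n then varx else if j = Suc n then varz else 0)"
    if "j < Suc (Suc n)" for j
    using that by (auto simp: Umat_def)
  have "dU (Suc (Suc n)) = (\<Sum>j<Suc (Suc n). ?U $$ (0, j) * cofactor ?U 0 j)"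
    unfolding dU_def by (rule laplace_expansion_row[OF Umat_carrier]) simp
  also have "\<dots> = (\<Sum>j<n. ?U $$ (0, j) * cofactor ?U 0 j) + ?U $$ (0, n) * cofactor ?U 0 n +
      ?U $$ (0, Suc n) * cofactor ?U 0 (Suc n)"
    by simp
  also have "(\<Sum>j<n. ?U $$ (0, j) * cofactor ?U 0 j) = 0"
    by (rule sum.neutral) (auto simp: 4)
  also have "?U $$ (0, n) * cofactor ?U 0 n = varx * vary * dU n"
  proof -
    have "?U $$ (0, n) * cofactor ?U 0 n = ((-1) ^ n * (-1) ^ n) * (varx * vary * dU n)"
      by (simp add: 4 cofactor_def detB mult_ac)
    then show ?thesis by (simp only: minus_one_power_square mult_1)
  qed
  also have "?U $$ (0, Suc n) * cofactor ?U 0 (Suc n) = (-1) ^ Suc n * varz * dU (Suc n)"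
    by (simp add: 4 cofactor_def 1 dU_def mult_ac)
  finally show ?thesis by simp
qed

lemma dU_eq: "dU n = sg n * (ch (Suc n) :: 'k :: field pser3)"
proof (induction n rule: ch.induct)
  case 1
  show ?case by (simp add: dU_def det_def Umat_def)
next
  case 2
  have "det (Umat (Suc 0) :: 'k pser3 mat) = varz"
    by (subst det_single) (auto simp: Umat_def)
  then show ?case by (simp add: dU_def sg_Suc)
next
  case (3 n)
  have s: "sg (Suc (Suc n)) = - (sg n :: 'k pser3)"
    using minus_one_power_square[of n, where 'a = "'k pser3"]
    by (simp add: sg_Suc mult.assoc[symmetric])
  have t: "(-1) ^ Suc n * sg (Suc n) = - (sg n :: 'k pser3)"
    using minus_one_power_square[of n, where 'a = "'k pser3"]
    by (simp add: sg_Suc mult.assoc[symmetric])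
  have "dU (Suc (Suc n)) = ((-1) ^ Suc n * sg (Suc n)) * (varz * ch (Suc (Suc n))) +
      sg n * (varx * vary * (ch (Suc n) :: 'k pser3))"
    unfolding dU_rec 3 by (simp only: mult_ac)
  also have "\<dots> = sg (Suc (Suc n)) * ch (Suc (Suc (Suc n)))"
    unfolding s t by (simp add: algebra_simps)
  finally show ?case .
qed

text \<open>The Pfaffians matter only through the ideal they generate, so their signs are not
  tracked.\<close>

definition assoc_sign :: "'a :: comm_ring_1 \<Rightarrow> 'a \<Rightarrow> bool" where
  "assoc_sign f g \<longleftrightarrow> f = g \<or> f = - g"

lemma assoc_sign_mult_sg: "assoc_sign f g \<Longrightarrow> assoc_sign (sg n * f) g"
  using sg_cases[of n, where 'a = 'a] unfolding assoc_sign_def by auto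

lemma assoc_sign_mult_power: "assoc_sign f g \<Longrightarrow> assoc_sign ((-1) ^ n * f) g"
  unfolding assoc_sign_def by (auto simp: minus_one_power_iff)

lemma assoc_sign_mult: "assoc_sign f g \<Longrightarrow> assoc_sign (h * f) (h * g)"
  unfolding assoc_sign_def by auto

lemma assoc_sign_refl: "assoc_sign f f"
  unfolding assoc_sign_def by auto

lemma assoc_sign_minus: "assoc_sign (- f) g \<longleftrightarrow> assoc_sign f g" "assoc_sign f (- g) \<longleftrightarrow> assoc_sign f g"
  unfolding assoc_sign_def by (auto simp: minus_equation_iff[of f])

lemma assoc_sign_power_iff:
  "assoc_sign ((-1) ^ n * f) g \<longleftrightarrow> assoc_sign f g" "assoc_sign f ((-1) ^ n * g) \<longleftrightarrow> assoc_sign f g"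
  by (cases "even n"; simp add: assoc_sign_minus)+

lemma assoc_sign_sg_iff: "assoc_sign f (sg n * g) \<longleftrightarrow> assoc_sign f g"
  unfolding sg_def by (rule assoc_sign_power_iff)

lemma assoc_sign_cancel:
  assumes "assoc_sign f g" "h * f' = f" "h * g' = g" "h \<noteq> (0 :: 'a :: idom)"
  shows "assoc_sign f' g'"
  using assms unfolding assoc_sign_def by (metis minus_mult_right mult_left_cancel)

lemma Umat_mult_vec:
  assumes "r < n"
  shows "(Umat n *\<^sub>v vec n c) $ r =
    (if Suc r < n then varx * c (n - Suc (Suc r)) else 0) + varz * c (n - Suc r) +
    (if r = 0 then 0 else vary * c (n - r))"
proof -
  have "(Umat n *\<^sub>v vec n c) $ r = (\<Sum>i<n. Umat n $$ (r, i) * c i)"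
    using assms by (auto simp: Umat_def scalar_prod_def lessThan_atLeast0 intro!: sum.cong)
  also have "\<dots> = (\<Sum>i<n. (if i = n - Suc (Suc r) then (if Suc r < n then varx * c i else 0) else 0) +
      (if i = n - Suc r then varz * c i else 0) +
      (if i = n - r then (if r = 0 then 0 else vary * c i) else 0))"
    by (rule sum.cong) (use assms in \<open>auto simp: Umat_def\<close>)
  also have "\<dots> = (if Suc r < n then varx * c (n - Suc (Suc r)) else 0) + varz * c (n - Suc r) +
    (if r = 0 then 0 else vary * c (n - r))"
    unfolding sum.distrib by (subst (1 2 3) sum.delta) (use assms in auto)
  finally show ?thesis .
qed

lemma ch_nonzero: "ch (Suc n) \<noteq> (0 :: 'k :: field pser3)"
proof
  assume "ch (Suc n) = (0 :: 'k pser3)"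
  then have "coef (ch (Suc n) :: 'k pser3) 0 0 n = 0" by simp
  then show False by (simp del: ch.simps)
qed

text \<open>Minors are found by guessing a column of the adjugate. If U c is plus or minus det U
  times a unit vector, multiplying with the adjugate and cancelling det U, which is non-zero in a
  domain, identifies c with that column up to sign.\<close>

lemma cofactor_from_column:
  fixes c :: "nat \<Rightarrow> 'k :: field pser3"
  assumes "Umat n *\<^sub>v vec n c = e \<cdot>\<^sub>v unit_vec n l" "assoc_sign e (ch (Suc n))" "l < n" "i < n"
  shows "assoc_sign (det (mat_delete (Umat n) l i)) (c i)"
proof -
  let ?U = "Umat n :: 'k pser3 mat"
  note A = adj_mat[of ?U n, OF Umat_carrier]
  have "adj_mat ?U *\<^sub>v (?U *\<^sub>v vec n c) = (adj_mat ?U * ?U) *\<^sub>v vec n c"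
    by (rule assoc_mult_mat_vec[symmetric, OF A(1) Umat_carrier]) simp
  also have "\<dots> = det ?U \<cdot>\<^sub>v vec n c"
    unfolding A(3)
  proof (rule eq_vecI)
    fix i assume "i < dim_vec (det ?U \<cdot>\<^sub>v vec n c)"
    then have i: "i < n" by simp
    have "((det ?U \<cdot>\<^sub>m 1\<^sub>m n) *\<^sub>v vec n c) $ i = (det ?U \<cdot>\<^sub>v unit_vec n i) \<bullet> vec n c"
      using i by (simp add: row_smult)
    also have "\<dots> = det ?U * (unit_vec n i \<bullet> vec n c)"
      by (rule smult_scalar_prod_distrib) auto
    also have "unit_vec n i \<bullet> vec n c = c i"
      using i scalar_prod_left_unit[of "vec n c" n i] by simp
    finally show "((det ?U \<cdot>\<^sub>m 1\<^sub>m n) *\<^sub>v vec n c) $ i = (det ?U \<cdot>\<^sub>v vec n c) $ i"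
      using i by simp
  qed simp
  finally have "(adj_mat ?U *\<^sub>v (e \<cdot>\<^sub>v unit_vec n l)) $ i = (det ?U \<cdot>\<^sub>v vec n c) $ i"
    unfolding assms(1) by simp
  moreover have "(adj_mat ?U *\<^sub>v (e \<cdot>\<^sub>v unit_vec n l)) $ i = e * adj_mat ?U $$ (i, l)"
  proof -
    have r: "row (adj_mat ?U) i \<in> carrier_vec n" using A(1) assms(4) by auto
    have "(adj_mat ?U *\<^sub>v (e \<cdot>\<^sub>v unit_vec n l)) $ i = row (adj_mat ?U) i \<bullet> (e \<cdot>\<^sub>v unit_vec n l)"
      using A(1) assms(4) by simp
    also have "\<dots> = e * (row (adj_mat ?U) i \<bullet> unit_vec n l)"
      by (rule scalar_prod_smult_distrib[OF r]) simp
    finally show ?thesis using A(1) assms(3,4) r by simp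
  qed
  moreover have "adj_mat ?U $$ (i, l) = (-1) ^ (l + i) * det (mat_delete ?U l i)"
    using assms(3,4) by (simp add: adj_mat_def cofactor_def Umat_def)
  moreover have "det ?U = sg n * ch (Suc n)"
    using dU_eq[of n] by (simp add: dU_def)
  ultimately have *: "e * ((-1) ^ (l + i) * det (mat_delete ?U l i)) = sg n * ch (Suc n) * c i"
    using assms(4) by simp
  have "e = ch (Suc n) \<or> e = - ch (Suc n)" using assms(2) by (simp add: assoc_sign_def)
  then have "assoc_sign (ch (Suc n) * ((-1) ^ (l + i) * det (mat_delete ?U l i))) (sg n * ch (Suc n) * c i)"
    using * unfolding assoc_sign_def by (metis minus_minus minus_mult_left)
  then have "assoc_sign ((-1) ^ (l + i) * det (mat_delete ?U l i)) (sg n * c i)"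
    by (rule assoc_sign_cancel[OF _ refl _ ch_nonzero]) (simp only: mult_ac)
  then show ?thesis
    by (simp only: assoc_sign_power_iff assoc_sign_sg_iff)
qed

lemma minor_Umat_last_row:
  assumes "i < n"
  shows "assoc_sign (det (mat_delete (Umat n) (n - 1) i)) (varx ^ i * ch (n - i) :: 'k :: field pser3)"
proof -
  \<comment> \<open>With t = n - 1 - r, entry r of U c is (-1)^t x^t times z D_r - x y D_{r-1} -
    D_{r+1}, which is zero. In the last row the term D_{r+1} is missing and D_n remains.\<close>
  let ?c = "\<lambda>i. (-1) ^ i * (varx ^ i * ch (n - i)) :: 'k pser3"
  have "Umat n *\<^sub>v vec n ?c = ch (Suc n) \<cdot>\<^sub>v unit_vec n (n - 1)"
  proof (rule eq_vecI)
    fix r assume "r < dim_vec (ch (Suc n) \<cdot>\<^sub>v unit_vec n (n - 1) :: 'k pser3 vec)"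
    then have r: "r < n" by simp
    then obtain t where n: "n = Suc (r + t)" using less_iff_Suc_add by blast
    have 1: "(if r = 0 then 0 else vary * ?c (n - r)) = - ((-1) ^ t * (varx ^ t * (varx * vary * ch r)))"
      by (cases r) (auto simp: n)
    have 2: "varz * ?c (n - Suc r) = (-1) ^ t * (varx ^ t * (varz * ch (Suc r)))"
      by (simp add: n del: ch.simps)
    have 3: "(if Suc r < n then varx * ?c (n - Suc (Suc r)) else 0) =
        (if t = 0 then 0 else - ((-1) ^ t * (varx ^ t * ch (Suc (Suc r)))))"
      by (cases t) (auto simp: n simp del: ch.simps)
    show "(Umat n *\<^sub>v vec n ?c) $ r = (ch (Suc n) \<cdot>\<^sub>v unit_vec n (n - 1)) $ r"
      unfolding Umat_mult_vec[OF r] 1 2 3 using r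
      by (cases "t = 0") (auto simp: n algebra_simps)
  qed (simp add: Umat_def)
  from cofactor_from_column[OF this assoc_sign_refl _ assms]
  have "assoc_sign (det (mat_delete (Umat n) (n - 1) i)) (?c i)" using assms by simp
  then show ?thesis
    by (simp only: assoc_sign_power_iff)
qed

lemma minor_Umat_first_column:
  assumes "i < n"
  shows "assoc_sign (det (mat_delete (Umat n) i 0)) (vary ^ (n - Suc i) * ch (Suc i) :: 'k :: field pser3)"
proof -
  \<comment> \<open>The same guess with y in place of x and the order reversed; now only the first
    row fails to cancel.\<close>
  let ?c = "\<lambda>i. (-1) ^ i * (vary ^ (n - Suc i) * ch (Suc i)) :: 'k pser3"
  have "Umat n *\<^sub>v vec n ?c = ((-1) ^ (n - 1) * ch (Suc n)) \<cdot>\<^sub>v unit_vec n 0"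
  proof (rule eq_vecI)
    fix r assume "r < dim_vec (((-1) ^ (n - 1) * ch (Suc n)) \<cdot>\<^sub>v unit_vec n 0 :: 'k pser3 vec)"
    then have r: "r < n" by simp
    then obtain t where n: "n = Suc (r + t)" using less_iff_Suc_add by blast
    have 1: "(if r = 0 then 0 else vary * ?c (n - r)) =
        (if r = 0 then 0 else - ((-1) ^ t * (vary ^ r * ch (Suc (Suc t)))))"
      by (cases r) (auto simp: n simp del: ch.simps)
    have 2: "varz * ?c (n - Suc r) = (-1) ^ t * (vary ^ r * (varz * ch (Suc t)))"
      by (simp add: n del: ch.simps)
    have 3: "(if Suc r < n then varx * ?c (n - Suc (Suc r)) else 0) =
        - ((-1) ^ t * (vary ^ r * (varx * vary * ch t)))"
      by (cases t) (auto simp: n Suc_diff_le simp del: ch.simps(2,3))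
    show "(Umat n *\<^sub>v vec n ?c) $ r = (((-1) ^ (n - 1) * ch (Suc n)) \<cdot>\<^sub>v unit_vec n 0) $ r"
      unfolding Umat_mult_vec[OF r] 1 2 3 using r
      by (cases "r = 0") (auto simp: n algebra_simps)
  qed (simp add: Umat_def)
  from cofactor_from_column[OF this assoc_sign_mult_power[OF assoc_sign_refl] _ assms]
  have "assoc_sign (det (mat_delete (Umat n) 0 i)) (?c i)"
    using assms by simp
  \<comment> \<open>\<open>Umat n\<close> is symmetric, so the minors along the first row are those
    along the first column.\<close>
  moreover have "mat_delete (Umat n) 0 i = transpose_mat (mat_delete (Umat n) i 0 :: 'k pser3 mat)"
    by (rule eq_matI) (use assms in \<open>auto simp: mat_delete_def Umat_def add.commute\<close>)
  moreover have "det (transpose_mat (mat_delete (Umat n) i 0 :: 'k pser3 mat)) = det (mat_delete (Umat n) i 0)"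
    by (rule det_transpose[OF mat_delete_carrier[OF Umat_carrier]])
  ultimately show ?thesis
    by (simp only: assoc_sign_power_iff)
qed

section \<open>Pfaffians of matrices with a large zero block\<close>

definition offdiag :: "nat \<Rightarrow> 'a mat \<Rightarrow> 'a mat" where
  "offdiag n A = mat n n (\<lambda>(i, j). A $$ (i, j + n))"

lemma offdiag_carrier [simp]: "offdiag n A \<in> carrier_mat n n"
  by (simp add: offdiag_def)

lemma offdiag_index: "i < n \<Longrightarrow> j < n \<Longrightarrow> offdiag n A $$ (i, j) = A $$ (i, j + n)"
  by (simp add: offdiag_def)

abbreviation pf_minor :: "'a mat \<Rightarrow> nat \<Rightarrow> 'a mat" where
  "pf_minor A j \<equiv> mat_delete (mat_delete A j j) 0 0"

lemma pf_minor_index: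
  assumes "A \<in> carrier_mat (Suc (Suc N)) (Suc (Suc N))" "p < N" "q < N"
  shows "pf_minor A j $$ (p, q) =
    A $$ (if Suc p < j then Suc p else Suc (Suc p), if Suc q < j then Suc q else Suc (Suc q))"
  using assms
  by (simp add: mat_delete_entry[of _ N N] mat_delete_entry[of _ "Suc N" "Suc N"]
    mat_delete_carrier_Suc)

lemma pf_minor_carrier:
  "A \<in> carrier_mat (Suc (Suc N)) (Suc (Suc N)) \<Longrightarrow> pf_minor A j \<in> carrier_mat N N"
  by (intro mat_delete_carrier_Suc)

text \<open>The induction step shared by both positions of the zero block. Once the columns j <= n
  contribute nothing, the Pfaffian expansion along the first row is the Laplace expansion of the
  upper right block along its first row, up to the factor that turns \<open>sg n\<close> into
  \<open>sg (Suc n)\<close>.\<close>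

lemma pfaffian_step:
  fixes A :: "'a :: comm_ring_1 mat"
  assumes A: "A \<in> carrier_mat (2 * Suc n) (2 * Suc n)"
    and low: "\<And>j. 1 \<le> j \<Longrightarrow> j \<le> n \<Longrightarrow> A $$ (0, j) * pfaffian (pf_minor A j) = 0"
    and high: "\<And>j. n < j \<Longrightarrow> j < 2 * Suc n \<Longrightarrow> pfaffian (pf_minor A j) = sg n * det (offdiag n (pf_minor A j))"
  shows "pfaffian A = sg (Suc n) * det (offdiag (Suc n) A)"
proof -
  let ?C = "offdiag (Suc n) A"
  have A': "A \<in> carrier_mat (Suc (Suc (2 * n))) (Suc (Suc (2 * n)))" using A by simp
  have C: "?C \<in> carrier_mat (Suc n) (Suc n)" by (simp add: offdiag_def)
  have off: "offdiag n (pf_minor A (l + Suc n)) = mat_delete ?C 0 l" if "l < Suc n" for l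
  proof (rule mat_eqI[OF offdiag_carrier mat_delete_carrier_Suc[OF C]])
    fix i j assume ij: "i < n" "j < n"
    show "offdiag n (pf_minor A (l + Suc n)) $$ (i, j) = mat_delete ?C 0 l $$ (i, j)"
      unfolding mat_delete_entry[OF C ij] using ij that
      by (subst offdiag_index, simp, simp, subst pf_minor_index[OF A']) (auto simp: offdiag_index)
  qed
  have "pfaffian A = (\<Sum>j\<in>{1..<2 * Suc n}. (-1) ^ (j - 1) * A $$ (0, j) * pfaffian (pf_minor A j))"
    using A by (subst pfaffian.simps) auto
  also have "\<dots> = (\<Sum>j\<in>{Suc n..<2 * Suc n}. (-1) ^ (j - 1) * A $$ (0, j) * pfaffian (pf_minor A j))"
    by (rule sum.mono_neutral_right) (auto simp: mult.assoc low)
  also have "\<dots> = (\<Sum>l\<in>{0..<Suc n}. (-1) ^ (l + n) * A $$ (0, l + Suc n) * pfaffian (pf_minor A (l + Suc n)))"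
    using sum.shift_bounds_nat_ivl[of "\<lambda>j. (-1) ^ (j - 1) * A $$ (0, j) * pfaffian (pf_minor A j)" 0 "Suc n" "Suc n"]
    by (simp add: mult_2)
  also have "\<dots> = (\<Sum>l\<in>{0..<Suc n}. sg (Suc n) * (?C $$ (0, l) * cofactor ?C 0 l))"
  proof (rule sum.cong)
    fix l assume l: "l \<in> {0..<Suc n}"
    have 1: "pfaffian (pf_minor A (l + Suc n)) = sg n * det (mat_delete ?C 0 l)"
      using high[of "l + Suc n"] off[of l] l by simp
    have 2: "A $$ (0, l + Suc n) = ?C $$ (0, l)" using l by (simp add: offdiag_def)
    show "(-1) ^ (l + n) * A $$ (0, l + Suc n) * pfaffian (pf_minor A (l + Suc n)) =
        sg (Suc n) * (?C $$ (0, l) * cofactor ?C 0 l)"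
      unfolding 1 2 cofactor_def sg_Suc power_add by (simp only: mult_ac power_0 mult_1)
  qed simp
  also have "\<dots> = sg (Suc n) * det ?C"
    unfolding sum_distrib_left[symmetric]
    by (subst laplace_expansion_row[OF C, of 0]) (auto simp: lessThan_atLeast0)
  finally show ?thesis .
qed

lemma pfaffian_zero_top_left:
  fixes A :: "'a :: comm_ring_1 mat"
  assumes "A \<in> carrier_mat (2 * n) (2 * n)" "\<And>i j. i < n \<Longrightarrow> j < n \<Longrightarrow> A $$ (i, j) = 0"
  shows "pfaffian A = sg n * det (offdiag n A)"
  using assms
proof (induction n arbitrary: A)
  case 0
  then show ?case by (subst pfaffian.simps) (auto simp: offdiag_def)
next
  case (Suc n)
  have A': "A \<in> carrier_mat (Suc (Suc (2 * n))) (Suc (Suc (2 * n)))" using Suc.prems(1) by simp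
  show ?case
  proof (rule pfaffian_step[OF Suc.prems(1)])
    fix j assume j: "n < j" "j < 2 * Suc n"
    show "pfaffian (pf_minor A j) = sg n * det (offdiag n (pf_minor A j))"
      by (rule Suc.IH[OF pf_minor_carrier[OF A']])
        (use j in \<open>simp add: pf_minor_index[OF A'] Suc.prems(2)\<close>)
  qed (auto simp: Suc.prems(2))
qed

text \<open>In terms of perfect matchings: q > p pairwise non-adjacent vertices cannot all be
  matched with the other p. Removing a matched pair {0, j} lowers p by two, or p and q by one each,
  so q > p persists.\<close>

lemma pfaffian_big_zero_block:
  fixes A :: "'a :: comm_ring_1 mat"
  assumes "A \<in> carrier_mat (p + q) (p + q)" "p < q"
    "\<And>i j. p \<le> i \<Longrightarrow> i < p + q \<Longrightarrow> p \<le> j \<Longrightarrow> j < p + q \<Longrightarrow> A $$ (i, j) = 0"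
  shows "pfaffian A = 0"
  using assms
proof (induction p arbitrary: q A rule: less_induct)
  case (less p)
  show ?case
  proof (cases p)
    case 0
    then have "(\<Sum>j\<in>{1..<p + q}. (-1) ^ (j - 1) * A $$ (0, j) * pfaffian (pf_minor A j)) = 0"
      using less.prems(3) by (intro sum.neutral) simp
    moreover have "dim_row A = p + q" "p + q \<noteq> 0" using less.prems(1,2) by auto
    ultimately show ?thesis by (subst pfaffian.simps) (simp only: if_False)
  next
    case (Suc p')
    have "pfaffian (pf_minor A j) = 0" if "1 \<le> j" "j < p + q" for j
    proof (cases "j < p")
      case True
      define p'' where "p'' = p - 2"
      have p: "p = Suc (Suc p'')" using that True by (simp add: p''_def)
      have A': "A \<in> carrier_mat (Suc (Suc (p'' + q))) (Suc (Suc (p'' + q)))"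
        using less.prems(1) p by simp
      show ?thesis
        by (rule less.IH[OF _ pf_minor_carrier[OF A']])
          (use True p less.prems(2,3) in \<open>simp_all add: pf_minor_index[OF A']\<close>)
    next
      case False
      obtain q' where q: "q = Suc q'" using less.prems(2) by (cases q) auto
      have A': "A \<in> carrier_mat (Suc (Suc (p' + q'))) (Suc (Suc (p' + q')))"
        using less.prems(1) q Suc by simp
      show ?thesis
        by (rule less.IH[OF _ pf_minor_carrier[OF A']])
          (use False q Suc less.prems(2,3) in \<open>simp_all add: pf_minor_index[OF A']\<close>)
    qed
    then have "(\<Sum>j\<in>{1..<p + q}. (-1) ^ (j - 1) * A $$ (0, j) * pfaffian (pf_minor A j)) = 0"
      by (intro sum.neutral) simp
    moreover have "dim_row A = p + q" "p + q \<noteq> 0" using less.prems(1) Suc by auto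
    ultimately show ?thesis by (subst pfaffian.simps) (simp only: if_False)
  qed
qed

text \<open>Here the first row may have entries in the columns j <= n, but deleting 0 and such a j
  takes two indices from the upper half and leaves a zero block larger than half of the
  matrix.\<close>

lemma pfaffian_zero_bottom_right:
  fixes A :: "'a :: comm_ring_1 mat"
  assumes "A \<in> carrier_mat (2 * n) (2 * n)"
    "\<And>i j. n \<le> i \<Longrightarrow> i < 2 * n \<Longrightarrow> n \<le> j \<Longrightarrow> j < 2 * n \<Longrightarrow> A $$ (i, j) = 0"
  shows "pfaffian A = sg n * det (offdiag n A)"
  using assms
proof (induction n arbitrary: A)
  case 0
  then show ?case by (subst pfaffian.simps) (auto simp: offdiag_def)
next
  case (Suc n)
  have A': "A \<in> carrier_mat (Suc (Suc (2 * n))) (Suc (Suc (2 * n)))" using Suc.prems(1) by simp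
  show ?case
  proof (rule pfaffian_step[OF Suc.prems(1)])
    fix j assume j: "n < j" "j < 2 * Suc n"
    show "pfaffian (pf_minor A j) = sg n * det (offdiag n (pf_minor A j))"
      by (rule Suc.IH[OF pf_minor_carrier[OF A']])
        (use j in \<open>auto simp: pf_minor_index[OF A'] Suc.prems(2)\<close>)
  next
    fix j assume j: "1 \<le> j" "j \<le> n"
    have c: "pf_minor A j \<in> carrier_mat ((n - 1) + Suc n) ((n - 1) + Suc n)"
      using pf_minor_carrier[OF A', of j] j by (simp add: mult_2)
    have "pfaffian (pf_minor A j) = 0"
      by (rule pfaffian_big_zero_block[OF c])
        (use j in \<open>auto simp: pf_minor_index[OF A'] Suc.prems(2)\<close>)
    then show "A $$ (0, j) * pfaffian (pf_minor A j) = 0" by simp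
  qed
qed

section \<open>The sub-maximal Pfaffians of V\<close>

lemma Vmat_carrier [simp]: "Vmat m \<in> carrier_mat (2 * m + 1) (2 * m + 1)"
  by (simp add: Vmat_def)

lemma mat_delete_Vmat_carrier: "mat_delete (Vmat m) i i \<in> carrier_mat (2 * m) (2 * m)"
  using mat_delete_carrier[OF Vmat_carrier] by simp

lemma Vmat_index:
  assumes "i < 2 * m + 1" "j < 2 * m + 1"
  shows "Vmat m $$ (i, j) =
    (if i < m then
       (if j < m then 0
        else if j = m then (if i = m - 1 then varx else 0)
        else Umat m $$ (i, j - (m + 1)))
     else if i = m then
       (if j < m then (if j = m - 1 then - varx else 0)
        else if j = m then 0
        else (if j = m + 1 then vary else 0))
     else
       (if j < m then - (Umat m $$ (i - (m + 1), j))
        else if j = m then (if i = m + 1 then - vary else 0)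
        else 0))"
  using assms by (simp add: Vmat_def)

lemma mat_delete_Vmat_index:
  assumes "p < 2 * m" "q < 2 * m"
  shows "mat_delete (Vmat m) i i $$ (p, q) =
    Vmat m $$ (if p < i then p else Suc p, if q < i then q else Suc q)"
  using assms by (intro mat_delete_entry) (simp_all add: Vmat_def)

lemmas Vmat_delete_simps = mat_delete_Vmat_index Vmat_index

lemma pf_middle: "pf m m = sg m * (dU m :: 'k :: field pser3)"
proof -
  have o: "offdiag m (mat_delete (Vmat m) m m) = (Umat m :: 'k pser3 mat)"
  proof (rule mat_eqI[OF offdiag_carrier Umat_carrier])
    fix i j assume "i < m" "j < m"
    then show "offdiag m (mat_delete (Vmat m) m m) $$ (i, j) = (Umat m :: 'k pser3 mat) $$ (i, j)"
      by (simp add: offdiag_index Vmat_delete_simps)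
  qed
  have "pf m m = sg m * det (offdiag m (mat_delete (Vmat m) m m) :: 'k pser3 mat)"
    unfolding pf_def
    by (rule pfaffian_zero_top_left[OF mat_delete_Vmat_carrier])
      (simp add: Vmat_delete_simps)
  then show ?thesis by (simp only: o dU_def)
qed

text \<open>Deleting an index i < m moves the middle row into the upper half. The lower right block
  is zero, and the upper right block is U without row i, followed by the row (y, 0, ..., 0), along
  which it is expanded.\<close>

lemma pf_upper:
  assumes "i < m"
  shows "assoc_sign (pf m i) (vary ^ (m - i) * ch (Suc i) :: 'k :: field pser3)"
proof -
  let ?A = "mat_delete (Vmat m) i i :: 'k pser3 mat" and ?C = "offdiag m (mat_delete (Vmat m) i i) :: 'k pser3 mat"
  have C: "?C \<in> carrier_mat m m" by simp
  have "pf m i = sg m * det ?C"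
    unfolding pf_def
    by (rule pfaffian_zero_bottom_right[OF mat_delete_Vmat_carrier])
      (use assms in \<open>simp add: Vmat_delete_simps\<close>)
  also have "det ?C = (\<Sum>j<m. ?C $$ (m - 1, j) * cofactor ?C (m - 1) j)"
    by (rule laplace_expansion_row[OF C]) (use assms in simp)
  also have "\<dots> = (\<Sum>j<m. if j = 0 then vary * cofactor ?C (m - 1) j else 0)"
  proof (rule sum.cong)
    fix j assume "j \<in> {..<m}"
    then have "?C $$ (m - 1, j) = (if j = 0 then vary else 0)"
      using assms by (auto simp: offdiag_index Vmat_delete_simps Umat_index)
    then show "?C $$ (m - 1, j) * cofactor ?C (m - 1) j =
        (if j = 0 then vary * cofactor ?C (m - 1) j else 0)" by simp
  qed simp
  also have "\<dots> = (-1) ^ (m - 1) * (vary * det (mat_delete ?C (m - 1) 0))"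
    by (subst sum.delta) (use assms in \<open>simp_all add: cofactor_def\<close>)
  also have "mat_delete ?C (m - 1) 0 = mat_delete (Umat m) i 0"
  proof -
    obtain n where m: "m = Suc n" using assms by (cases m) auto
    have U: "(Umat m :: 'k pser3 mat) \<in> carrier_mat (Suc n) (Suc n)"
      and C': "?C \<in> carrier_mat (Suc n) (Suc n)"
      using Umat_carrier[of m] C by (simp_all add: m)
    show ?thesis
    proof (rule mat_eqI[OF mat_delete_carrier_Suc[OF C'] mat_delete_carrier_Suc[OF U]])
      fix r s assume rs: "r < n" "s < n"
      show "mat_delete ?C (m - 1) 0 $$ (r, s) = mat_delete (Umat m) i 0 $$ (r, s)"
        unfolding mat_delete_entry[OF U rs] mat_delete_entry[OF C' rs] using rs assms m
        by (auto simp: offdiag_index Vmat_delete_simps)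
    qed
  qed
  finally have *: "pf m i = sg m * ((-1) ^ (m - 1) * (vary * det (mat_delete (Umat m) i 0 :: 'k pser3 mat)))" .
  have e: "vary ^ (m - i) * ch (Suc i) = vary * (vary ^ (m - Suc i) * ch (Suc i) :: 'k pser3)"
    using assms by (simp add: Suc_diff_Suc flip: power_Suc mult.assoc)
  show ?thesis
    unfolding * e
    by (intro assoc_sign_mult_sg assoc_sign_mult_power assoc_sign_mult minor_Umat_first_column assms)
qed

text \<open>Deleting an index above m moves the middle column into the right half. The upper left
  block is zero, and the upper right block is U without column c, preceded by a column whose only
  entry is x at the bottom.\<close>

lemma pf_lower:
  assumes "c < m"
  shows "assoc_sign (pf m (Suc (m + c))) (varx ^ Suc c * ch (m - c) :: 'k :: field pser3)"
proof -
  let ?i = "Suc (m + c)"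
  let ?A = "mat_delete (Vmat m) ?i ?i :: 'k pser3 mat" and ?C = "offdiag m (mat_delete (Vmat m) ?i ?i) :: 'k pser3 mat"
  have C: "?C \<in> carrier_mat m m" by simp
  have "pf m ?i = sg m * det ?C"
    unfolding pf_def
    by (rule pfaffian_zero_top_left[OF mat_delete_Vmat_carrier])
      (use assms in \<open>simp add: Vmat_delete_simps\<close>)
  also have "det ?C = (\<Sum>j<m. ?C $$ (j, 0) * cofactor ?C j 0)"
    by (rule laplace_expansion_column[OF C]) (use assms in simp)
  also have "\<dots> = (\<Sum>j<m. if j = m - 1 then varx * cofactor ?C j 0 else 0)"
  proof (rule sum.cong)
    fix j assume "j \<in> {..<m}"
    then have "?C $$ (j, 0) = (if j = m - 1 then varx else 0)"
      using assms by (auto simp: offdiag_index Vmat_delete_simps Umat_index)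
    then show "?C $$ (j, 0) * cofactor ?C j 0 =
        (if j = m - 1 then varx * cofactor ?C j 0 else 0)" by simp
  qed simp
  also have "\<dots> = (-1) ^ (m - 1) * (varx * det (mat_delete ?C (m - 1) 0))"
    by (subst sum.delta) (use assms in \<open>simp_all add: cofactor_def\<close>)
  also have "mat_delete ?C (m - 1) 0 = mat_delete (Umat m) (m - 1) c"
  proof -
    obtain n where m: "m = Suc n" using assms by (cases m) auto
    have U: "(Umat m :: 'k pser3 mat) \<in> carrier_mat (Suc n) (Suc n)"
      and C': "?C \<in> carrier_mat (Suc n) (Suc n)"
      using Umat_carrier[of m] C by (simp_all add: m)
    show ?thesis
    proof (rule mat_eqI[OF mat_delete_carrier_Suc[OF C'] mat_delete_carrier_Suc[OF U]])
      fix r s assume rs: "r < n" "s < n"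
      show "mat_delete ?C (m - 1) 0 $$ (r, s) = mat_delete (Umat m) (m - 1) c $$ (r, s)"
        unfolding mat_delete_entry[OF U rs] mat_delete_entry[OF C' rs] using rs assms m
        by (auto simp: offdiag_index Vmat_delete_simps)
    qed
  qed
  finally have *: "pf m ?i = sg m * ((-1) ^ (m - 1) * (varx * det (mat_delete (Umat m) (m - 1) c :: 'k pser3 mat)))" .
  have e: "varx ^ Suc c * ch (m - c) = varx * (varx ^ c * ch (m - c) :: 'k pser3)"
    by (simp add: mult.assoc)
  show ?thesis
    unfolding * e
    by (intro assoc_sign_mult_sg assoc_sign_mult_power assoc_sign_mult minor_Umat_last_row assms)
qed

section \<open>Minimal generators\<close>

lemma genideal_assoc_sign_le:
  fixes S T :: "'a :: comm_ring_1 set"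
  assumes "\<And>f. f \<in> S \<Longrightarrow> \<exists>g\<in>T. assoc_sign f g"
  shows "genideal class_ring S \<subseteq> genideal class_ring T"
proof (rule genideal_least[OF genideal_is_ideal])
  note i = genideal_is_ideal[of T]
  show "S \<subseteq> genideal class_ring T"
    using assms ideal_uminus[OF i] genideal_mem[of _ T] unfolding assoc_sign_def by blast
qed

lemma assoc_sign_sym: "assoc_sign f g \<longleftrightarrow> assoc_sign g f"
  unfolding assoc_sign_def by auto

lemma genideal_assoc_sign_eq:
  assumes "\<And>f. f \<in> S \<Longrightarrow> \<exists>g\<in>T. assoc_sign f g" "\<And>g. g \<in> T \<Longrightarrow> \<exists>f\<in>S. assoc_sign f g"
  shows "genideal class_ring S = genideal class_ring T"
  using assms by (intro equalityI genideal_assoc_sign_le) (auto simp: assoc_sign_sym)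

lemma pf_assoc_sign_gen:
  assumes "i < 2 * m + 1"
  shows "assoc_sign (pf m i) (gen m (int m - int i) :: 'k :: field pser3)"
proof -
  consider (1) "i < m" | (2) "i = m" | (3) c where "i = Suc (m + c)" "c < m"
  proof -
    assume 1: "i < m \<Longrightarrow> thesis" and 2: "i = m \<Longrightarrow> thesis"
      and 3: "\<And>c. i = Suc (m + c) \<Longrightarrow> c < m \<Longrightarrow> thesis"
    have "i < m \<or> i = m \<or> (i = Suc (m + (i - Suc m)) \<and> i - Suc m < m)" using assms by arith
    then show thesis using 1 2 3 by blast
  qed
  then show ?thesis
  proof cases
    case 1
    then have "gen m (int m - int i) = (vary ^ (m - i) * ch (Suc i) :: 'k pser3)"
      by (simp add: gen_def nat_diff_distrib')
    then show ?thesis using pf_upper[OF 1, where 'k = 'k] by simp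
  next
    case 2
    then show ?thesis
      by (simp add: gen_def pf_middle dU_eq assoc_sign_refl mult.assoc[symmetric] del: ch.simps)
  next
    case 3
    then have "gen m (int m - int i) = (varx ^ Suc c * ch (m - c) :: 'k pser3)"
      by (simp add: gen_def nat_add_distrib Suc_nat_eq_nat_zadd1 Suc_diff_Suc del: ch.simps power_Suc)
    then show ?thesis using pf_lower[OF 3(2), where 'k = 'k] 3(1) by simp
  qed
qed

lemma pf_ideal_eq: "pf_ideal m = (supp_in (above m) :: 'k :: field pser3 set)"
  unfolding pf_ideal_def genideal_gen[symmetric]
proof (rule genideal_assoc_sign_eq)
  fix f :: "'k pser3" assume "f \<in> pf m ` {..<2 * m + 1}"
  then show "\<exists>g\<in>gen m ` {- int m..int m}. assoc_sign f g"
    using pf_assoc_sign_gen by force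
next
  fix g :: "'k pser3" assume "g \<in> gen m ` {- int m..int m}"
  then obtain k where k: "k \<in> {- int m..int m}" "g = gen m k" by auto
  then have "assoc_sign (pf m (nat (int m - k))) g" "nat (int m - k) < 2 * m + 1"
    using pf_assoc_sign_gen[of "nat (int m - k)" m, where 'k = 'k] by auto
  then show "\<exists>f\<in>pf m ` {..<2 * m + 1}. assoc_sign f g" by blast
qed

text \<open>The generators exactly as in the theorem: the factor is the sign relating
  \<open>dU\<close> to \<open>ch\<close>.\<close>

definition pgen :: "nat \<Rightarrow> int \<Rightarrow> 'k :: field pser3" where
  "pgen m k = sg (m - nat \<bar>k\<bar>) * gen m k"

lemma pgen_assoc_sign: "assoc_sign (pgen m k) (gen m k)"
  unfolding pgen_def by (intro assoc_sign_mult_sg assoc_sign_refl)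

lemma pgen_varx: "i \<le> m \<Longrightarrow> pgen m (- int (m - i)) = varx ^ (m - i) * dU i"
  and pgen_vary: "i \<le> m \<Longrightarrow> pgen m (int (m - i)) = vary ^ (m - i) * dU i"
  and pgen_zero: "pgen m 0 = dU m"
  by (simp_all add: pgen_def gen_def dU_eq mult_ac del: of_nat_diff ch.simps)

lemma pf_gens_eq: "pf_gens m = (pgen m ` {- int m..int m} :: 'k :: field pser3 set)"
proof
  show "pf_gens m \<subseteq> (pgen m ` {- int m..int m} :: 'k pser3 set)"
  proof -
    have "varx ^ (m - i) * dU i \<in> (pgen m ` {- int m..int m} :: 'k pser3 set)" if "i < m" for i
      unfolding pgen_varx[OF less_imp_le[OF that], symmetric] by (rule imageI) simp
    moreover have "vary ^ (m - i) * dU i \<in> (pgen m ` {- int m..int m} :: 'k pser3 set)" if "i < m" for i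
      unfolding pgen_vary[OF less_imp_le[OF that], symmetric] by (rule imageI) simp
    moreover have "dU m \<in> (pgen m ` {- int m..int m} :: 'k pser3 set)"
      unfolding pgen_zero[symmetric] by (rule imageI) simp
    ultimately show ?thesis unfolding pf_gens_def by auto
  qed
  show "pgen m ` {- int m..int m} \<subseteq> (pf_gens m :: 'k pser3 set)"
  proof clarify
    fix k assume k: "k \<in> {- int m..int m}"
    consider "k = 0" | i where "i < m" "k = int (m - i)" | i where "i < m" "k = - int (m - i)"
    proof -
      assume a: "k = 0 \<Longrightarrow> thesis" "\<And>i. i < m \<Longrightarrow> k = int (m - i) \<Longrightarrow> thesis"
        "\<And>i. i < m \<Longrightarrow> k = - int (m - i) \<Longrightarrow> thesis"
      show thesis
        using a(1) a(2)[of "m - nat k"] a(3)[of "m - nat (- k)"] k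
        by (cases "k = 0"; cases "k > 0") auto
    qed
    then show "pgen m k \<in> (pf_gens m :: 'k pser3 set)"
      by cases (auto simp: pf_gens_def pgen_zero pgen_varx pgen_vary simp del: of_nat_diff)
  qed
qed

lemma coef_sg [simp]: "coef (sg n * f) a b j = sg n * coef f a b j"
  unfolding sg_def by (simp add: minus_one_power_iff)

lemma nat_eq_both: "nat k = nat l \<Longrightarrow> nat (- k) = nat (- l) \<Longrightarrow> k = l"
  by arith

lemma sg_nonzero [simp]: "sg n \<noteq> (0 :: 'a :: idom)"
  using sg_cases[of n, where 'a = 'a] by auto

lemma inj_on_pgen: "inj_on (pgen m :: int \<Rightarrow> 'k :: field pser3) {- int m..int m}"
proof (rule inj_onI)
  fix k k' assume k: "k \<in> {- int m..int m}" "k' \<in> {- int m..int m}" "pgen m k = (pgen m k' :: 'k pser3)"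
  have "coef (pgen m k) (nat (- k)) (nat k) (m - nat \<bar>k\<bar>) = (sg (m - nat \<bar>k\<bar>) :: 'k)"
    by (simp add: pgen_def)
  then have "coef (pgen m k') (nat (- k)) (nat k) (m - nat \<bar>k\<bar>) \<noteq> (0 :: 'k)"
    unfolding k(3) by simp
  then show "k = k'" by (auto simp: pgen_def split: if_splits dest: nat_eq_both)
qed

lemma card_pf_gens: "card (pf_gens m :: 'k :: field pser3 set) = 2 * m + 1"
  unfolding pf_gens_eq by (simp add: card_image[OF inj_on_pgen])

lemma genideal_pgen: "genideal class_ring (pgen m ` K) = genideal class_ring (gen m ` K :: 'k :: field pser3 set)"
  by (rule genideal_assoc_sign_eq) (use pgen_assoc_sign in blast)+

text \<open>By \<open>supp_in_above_except\<close>, an element supported away from the corner of g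
  is a combination of all generators in which g has a coefficient from n, that is, an element of n g
  + b.\<close>

lemma trimmed_ideal_eq:
  assumes k: "k \<in> {- int m..int m}"
  shows "trimmed_ideal m (pgen m k) = (supp_in (above_except m k) :: 'k :: field pser3 set)"
proof -
  let ?I = "{- int m..int m}" and ?W = "supp_in (above_except m k) :: 'k pser3 set"
  have i: "ideal ?W class_ring" by (rule supp_in_ideal[OF stable_above_except[OF k]])
  have 1: "pf_gens m - {pgen m k} = (pgen m ` (?I - {k}) :: 'k pser3 set)"
    unfolding pf_gens_eq using inj_on_pgen[of m, where 'k = 'k] k by (auto simp: inj_on_def)
  let ?J = "genideal class_ring (gen m ` (?I - {k})) :: 'k pser3 set"
  have 2: "trimmed_ideal m (pgen m k) = {u + v | u v. u \<in> {h * pgen m k | h. h \<in> max_ideal} \<and> v \<in> ?J}"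
    unfolding trimmed_ideal_def 1 genideal_pgen set_add_def set_mult_def by auto
  have J: "ideal ?J class_ring" by (rule genideal_is_ideal)
  show ?thesis
  proof
    have "h * pgen m k \<in> ?W" if "h \<in> max_ideal" for h :: "'k pser3"
    proof -
      have "h * gen m k \<in> ?W" by (rule max_ideal_mult_above[OF k gen_mem_above that])
      then show ?thesis using ideal_mult[OF i, of "h * gen m k" "sg (m - nat \<bar>k\<bar>)"]
        by (simp add: pgen_def mult_ac)
    qed
    moreover have "?J \<subseteq> ?W"
      using k by (intro genideal_least[OF i]) (auto intro!: gen_mem_above_except)
    ultimately show "trimmed_ideal m (pgen m k) \<subseteq> ?W"
      unfolding 2 using ideal_add[OF i] by blast
  next
    show "?W \<subseteq> trimmed_ideal m (pgen m k)"
    proof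
      fix f assume "f \<in> ?W"
      then obtain h where h: "f = (\<Sum>i\<in>?I. h i * gen m i)" "h k \<in> max_ideal"
        using supp_in_above_except[OF k] by blast
      have e: "gen m k = sg (m - nat \<bar>k\<bar>) * (pgen m k :: 'k pser3)"
        by (simp add: pgen_def mult.assoc[symmetric])
      have "f = (h k * sg (m - nat \<bar>k\<bar>)) * pgen m k + (\<Sum>i\<in>?I - {k}. h i * gen m i)"
        unfolding h(1) using k by (subst sum.remove[of _ k]) (simp_all add: mult.assoc e[symmetric])
      moreover have "h k * sg (m - nat \<bar>k\<bar>) \<in> max_ideal"
        using h(2) by (simp add: mem_max_ideal_iff mult.commute[of "h k"])
      moreover have "(\<Sum>i\<in>?I - {k}. h i * gen m i) \<in> ?J"
        by (rule ideal_sum[OF J], rule ideal_mult[OF J], rule genideal_mem) simp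
      ultimately show "f \<in> trimmed_ideal m (pgen m k)"
        unfolding 2 by blast
    qed
  qed
qed

section \<open>Counting minimal generators by corners\<close>

lemma sum_fun_apply: "(\<Sum>x\<in>A. f x) k = (\<Sum>x\<in>A. f x k)"
  for f :: "'a \<Rightarrow> 'b \<Rightarrow> 'c :: comm_monoid_add"
  by (induction A rule: infinite_finite_induct) auto

text \<open>Nakayama's lemma made explicit by coordinates at corners. A proper subset of the
  generators omits some \<open>a k\<close> and lies in the ideal of elements with vanishing k-th
  corner coordinate. For the count, the vectors of corner coordinates of any finite generating set
  span the space of functions on \<open>K\<close>.\<close>

lemma generators_at_corners:
  fixes a :: "'i \<Rightarrow> 'k :: field pser3" and \<phi> :: "'i \<Rightarrow> 'k pser3 \<Rightarrow> 'k"
  assumes st: "stable W" and fin: "finite K"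
    and corner: "\<And>k. k \<in> K \<Longrightarrow> \<exists>p q r. corner W p q r \<and> \<phi> k = (\<lambda>f. coef f p q r)"
    and dual: "\<And>k l. k \<in> K \<Longrightarrow> l \<in> K \<Longrightarrow> \<phi> k (a l) = (if k = l then u k else 0)"
    and u: "\<And>k. k \<in> K \<Longrightarrow> u k \<noteq> 0"
    and gen: "genideal class_ring (a ` K) = supp_in W"
  shows "inj_on a K" "minimal_generating_set class_ring (supp_in W) (a ` K)"
    "min_num_generators class_ring (supp_in W :: 'k pser3 set) = card K"
proof -
  have mul: "\<phi> k (h * f) = coef h 0 0 0 * \<phi> k f" if "k \<in> K" "f \<in> supp_in W" for k h f
    using corner[OF that(1)] coef_corner[OF st _ that(2)] by auto
  have add: "\<phi> k (f + g) = \<phi> k f + \<phi> k g" and zero: "\<phi> k 0 = 0" if "k \<in> K" for k f g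
    using corner[OF that] by auto
  have i: "ideal (supp_in W :: 'k pser3 set) class_ring" by (rule supp_in_ideal[OF st])
  show inj: "inj_on a K"
    by (rule inj_onI) (metis dual u)
  have aW: "a k \<in> supp_in W" if "k \<in> K" for k
    unfolding gen[symmetric] using that by (intro genideal_mem) auto
  have ker: "ideal {f \<in> supp_in W. \<phi> k f = 0} class_ring" if "k \<in> K" for k
    by (rule class_ring_idealI)
      (use that in \<open>auto simp: add zero mul intro: ideal_add[OF i] ideal_mult[OF i] ideal_zero[OF i]\<close>)
  have "genideal class_ring T \<noteq> supp_in W" if T: "T \<subset> a ` K" for T
  proof
    assume T': "genideal class_ring T = supp_in W"
    from T obtain k where k: "k \<in> K" "a k \<notin> T" by blast
    have "\<phi> k (a l) = 0" if "l \<in> K" "a l \<in> T" for l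
      using that k by (subst dual) auto
    then have "T \<subseteq> {f \<in> supp_in W. \<phi> k f = 0}"
      using T aW by blast
    then have "genideal class_ring T \<subseteq> {f \<in> supp_in W. \<phi> k f = 0}"
      by (rule genideal_least[OF ker[OF k(1)]])
    then have "\<phi> k (a k) = 0" using T' aW[OF k(1)] by auto
    then show False using dual[OF k(1) k(1)] u[OF k(1)] by simp
  qed
  then show min: "minimal_generating_set class_ring (supp_in W) (a ` K)"
    unfolding minimal_generating_set_def using gen by simp
  \<comment> \<open>Functions on the index type serve as the coordinate space; only those supported
    on \<open>K\<close> occur, and the \<open>e k\<close> are its unit vectors.\<close>
  interpret V: vector_space "\<lambda>(c :: 'k) (f :: 'i \<Rightarrow> 'k) i. c * f i"
    by unfold_locales (auto simp: fun_eq_iff algebra_simps)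
  define e where "e k = (\<lambda>i. if i = k then 1 else (0 :: 'k))" for k :: 'i
  have inj_e: "inj e" by (rule injI) (metis e_def zero_neq_one)
  have indep: "V.independent (e ` K)"
  proof -
    have "w (e k) = 0" if w: "(\<Sum>v\<in>e ` K. (\<lambda>i. w v * v i)) = 0" and k: "k \<in> K" for w k
    proof -
      have "0 = (\<Sum>v\<in>e ` K. (\<lambda>i. w v * v i)) k" using w by simp
      also have "\<dots> = (\<Sum>l\<in>K. w (e l) * e l k)"
        by (simp add: sum.reindex[OF inj_on_subset[OF inj_e subset_UNIV]] sum_fun_apply)
      also have "\<dots> = (\<Sum>l\<in>K. if l = k then w (e k) else 0)"
        by (rule sum.cong) (auto simp: e_def)
      also have "\<dots> = w (e k)" using fin k by simp
      finally show ?thesis by simp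
    qed
    then show ?thesis using fin by (subst V.dependent_finite) auto
  qed
  have le: "card K \<le> card S" if S: "finite S" "genideal class_ring S = supp_in W" for S :: "'k pser3 set"
  proof -
    define v where "v s = (\<lambda>i. if i \<in> K then \<phi> i s else 0)" for s
    have SW: "S \<subseteq> supp_in W" using genideal_mem S(2) by blast
    \<comment> \<open>In an expression of \<open>a k\<close> over \<open>S\<close> the corner
      functionals see only the constant terms of the coefficients. So \<open>v (a k)\<close> is a
      linear combination of the \<open>v s\<close>, and by duality it is \<open>u k\<close> times
      \<open>e k\<close>.\<close>
    have "e k \<in> V.span (v ` S)" if k: "k \<in> K" for k
    proof -
      obtain h where h: "a k = (\<Sum>s\<in>S. h s * s)"
        using aW[OF k] unfolding S(2)[symmetric] using genideal_image[OF S(1), of "\<lambda>s. s"] by auto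
      have "v (a k) = (\<Sum>s\<in>S. (\<lambda>i. coef (h s) 0 0 0 * v s i))"
      proof
        fix i
        show "v (a k) i = (\<Sum>s\<in>S. (\<lambda>i. coef (h s) 0 0 0 * v s i)) i"
        proof (cases "i \<in> K")
          case True
          have "\<phi> i (\<Sum>s\<in>S. h s * s) = (\<Sum>s\<in>S. \<phi> i (h s * s))"
            using S(1) by (induction S rule: finite_induct) (auto simp: add[OF True] zero[OF True])
          also have "\<dots> = (\<Sum>s\<in>S. coef (h s) 0 0 0 * \<phi> i s)"
            using mul[OF True] SW by (intro sum.cong) auto
          finally show ?thesis
            using True by (simp add: v_def h sum_fun_apply)
        next
          case False
          then show ?thesis by (simp add: v_def sum_fun_apply)
        qed
      qed
      also have "\<dots> \<in> V.span (v ` S)"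
        by (intro V.span_sum V.span_scale V.span_base) auto
      finally have "(\<lambda>i. inverse (u k) * v (a k) i) \<in> V.span (v ` S)"
        by (rule V.span_scale)
      also have "(\<lambda>i. inverse (u k) * v (a k) i) = e k"
        using dual[OF _ k] u[OF k] k by (auto simp: v_def e_def fun_eq_iff)
      finally show ?thesis .
    qed
    then have "card (e ` K) \<le> card (v ` S)"
      using V.independent_span_bound[OF _ indep, of "v ` S"] S(1) by auto
    then show ?thesis
      using card_image_le[OF S(1), of v] card_image[OF inj_on_subset[OF inj_e subset_UNIV], of K] by simp
  qed
  show "min_num_generators class_ring (supp_in W :: 'k pser3 set) = card K"
    unfolding min_num_generators_def
  proof (rule Least_equality)
    show "\<exists>S\<subseteq>carrier class_ring. finite S \<and> card S = card K \<and> genideal class_ring S = (supp_in W :: 'k pser3 set)"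
      using fin gen inj by (intro exI[of _ "a ` K"]) (auto simp: card_image)
  qed (use le in auto)
qed

lemma minimal_generating_set_pf_gens:
  "minimal_generating_set class_ring (pf_ideal m) (pf_gens m :: 'k :: field pser3 set)"
  unfolding pf_ideal_eq pf_gens_eq
proof (rule generators_at_corners[where u = "\<lambda>k. sg (m - nat \<bar>k\<bar>)"
      and \<phi> = "\<lambda>k f. coef f (nat (- k)) (nat k) (m - nat \<bar>k\<bar>)"])
  show "genideal class_ring (pgen m ` {- int m..int m}) = (supp_in (above m) :: 'k pser3 set)"
    unfolding genideal_pgen genideal_gen ..
  fix k l assume "k \<in> {- int m..int m}" "l \<in> {- int m..int m}"
  then show "coef (pgen m l) (nat (- k)) (nat k) (m - nat \<bar>k\<bar>) = (if k = l then sg (m - nat \<bar>k\<bar>) else (0 :: 'k))"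
    by (auto simp: pgen_def dest: nat_eq_both)
next
  fix k assume "k \<in> {- int m..int m}"
  from corner_above[OF this] show "\<exists>p q r. corner (above m) p q r \<and>
      (\<lambda>f. coef f (nat (- k)) (nat k) (m - nat \<bar>k\<bar>)) = (\<lambda>f. coef f p q r :: 'k)"
    by (intro exI[of _ "nat (- k)"] exI[of _ "nat k"] exI[of _ "m - nat \<bar>k\<bar>"] conjI refl)
qed (use stable_above in auto)

text \<open>
  The trimmed ideal is generated by the \<open>gen m k\<close> with \<open>k \<noteq> k0\<close>, and, if \<open>gen m k0\<close> is one of the
  generators \<open>x ^ m\<close>, \<open>y ^ m\<close>, \<open>ch (Suc m)\<close>, by a further generator, which gets the index \<open>m + 1\<close>.
\<close>

definition extra_gen :: "nat \<Rightarrow> int \<Rightarrow> 'k :: field pser3" where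
  "extra_gen m k0 = (if k0 = 0 then varz else if k0 = int m then vary else varx) * gen m k0"

definition trim_gen :: "nat \<Rightarrow> int \<Rightarrow> int \<Rightarrow> 'k :: field pser3" where
  "trim_gen m k0 k = (if k = int m + 1 then extra_gen m k0 else gen m k)"

definition trim_index :: "nat \<Rightarrow> int \<Rightarrow> int set" where
  "trim_index m k0 = ({- int m..int m} - {k0}) \<union> (if k0 \<in> {0, int m, - int m} then {int m + 1} else {})"

text \<open>The functionals dual to \<open>trim_gen\<close>. The extra generator is tested at the
  exponent that becomes a corner when the exponent of g is removed; for k0 = 0 it is (0, 0, m + 1),
  from z D_m = D_{m+1} + x y D_{m-1}.\<close>

definition trim_coef :: "nat \<Rightarrow> int \<Rightarrow> int \<Rightarrow> 'k :: field pser3 \<Rightarrow> 'k" where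
  "trim_coef m k0 k = (if k = int m + 1
    then (if k0 = 0 then (\<lambda>f. coef f 0 0 (m + 1)) else if k0 = int m then (\<lambda>f. coef f 0 (m + 1) 0)
      else (\<lambda>f. coef f (m + 1) 0 0))
    else (\<lambda>f. coef f (nat (- k)) (nat k) (m - nat \<bar>k\<bar>)))"

section \<open>Linear syzygies between neighbouring generators\<close>

lemma gen_nonneg: "gen m (int n) = vary ^ n * (ch (Suc (m - n)) :: 'k :: field pser3)"
  and gen_nonpos: "gen m (- int n) = varx ^ n * (ch (Suc (m - n)) :: 'k :: field pser3)"
  by (simp_all add: gen_def)

text \<open>The recursion of \<open>ch\<close>, multiplied by a power of y, relates three
  neighbouring generators linearly.\<close>

lemma varz_gen_pos:
  assumes "1 \<le> n" "n < m"
  shows "varz * (gen m (int n) :: 'k :: field pser3) = vary * gen m (int n - 1) + varx * gen m (int n + 1)"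
proof -
  obtain n' where n: "n = Suc n'" using assms by (cases n) auto
  obtain t where "m = Suc (n + t)" using assms less_iff_Suc_add by blast
  then have *: "m = Suc (Suc n' + t)" "n = Suc n'" using n by simp_all
  have 1: "int n - 1 = int n'" "int n + 1 = int (Suc (Suc n'))" using * by auto
  show ?thesis
    unfolding 1 gen_nonneg by (simp add: * Suc_diff_le algebra_simps)
qed

lemma varz_gen_neg:
  assumes "1 \<le> n" "n < m"
  shows "varz * (gen m (- int n) :: 'k :: field pser3) = varx * gen m (- int n + 1) + vary * gen m (- int n - 1)"
proof -
  obtain n' where n: "n = Suc n'" using assms by (cases n) auto
  obtain t where "m = Suc (n + t)" using assms less_iff_Suc_add by blast
  then have *: "m = Suc (Suc n' + t)" "n = Suc n'" using n by simp_all
  have 1: "- int n + 1 = - int n'" "- int n - 1 = - int (Suc (Suc n'))" using * by auto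
  show ?thesis
    unfolding 1 gen_nonpos by (simp add: * Suc_diff_le algebra_simps)
qed

lemma varz_gen_top:
  assumes "1 \<le> m"
  shows "varz * (gen m (int m) :: 'k :: field pser3) = vary * gen m (int m - 1)"
    and "varz * (gen m (- int m) :: 'k :: field pser3) = varx * gen m (1 - int m)"
proof -
  obtain n where *: "m = Suc n" using assms by (cases m) auto
  have 1: "int m - 1 = int n" "1 - int m = - int n" using * by auto
  show "varz * (gen m (int m) :: 'k pser3) = vary * gen m (int m - 1)"
    unfolding 1 gen_nonneg by (simp add: * Suc_diff_le)
  show "varz * (gen m (- int m) :: 'k pser3) = varx * gen m (1 - int m)"
    unfolding 1 gen_nonpos by (simp add: * Suc_diff_le)
qed

lemma varx_gen_one: "varx * gen m 1 = vary * (gen m (- 1) :: 'k :: field pser3)"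
  using gen_nonneg[of m 1, where 'k = 'k] gen_nonpos[of m 1, where 'k = 'k] by (simp add: mult_ac)

text \<open>It has to be shown that x g, y g and z g lie in the ideal. Each is read off from a
  linear syzygy with the neighbours of g whenever there is one. Exactly one is missing in each of
  the three exceptional cases: z g for k0 = 0, y g for k0 = m, x g for k0 = -m. This product is the
  extra generator.\<close>

lemma genideal_trim_gen:
  assumes m: "2 \<le> m" and k0: "k0 \<in> {- int m..int m}"
  shows "genideal class_ring (trim_gen m k0 ` trim_index m k0) =
    (supp_in (above_except m k0) :: 'k :: field pser3 set)" (is "?J = ?W")
proof
  have i: "ideal ?W class_ring" by (rule supp_in_ideal[OF stable_above_except[OF k0]])
  have v: "varx \<in> max_ideal" "vary \<in> max_ideal" "(varz :: 'k pser3) \<in> max_ideal"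
    unfolding max_ideal_def by (rule genideal_mem; simp)+
  have "extra_gen m k0 \<in> ?W"
    unfolding extra_gen_def using v by (intro max_ideal_mult_above[OF k0 gen_mem_above]) auto
  then show "?J \<subseteq> ?W"
    using k0 by (intro genideal_least[OF i])
      (auto simp: trim_gen_def trim_index_def split: if_splits intro!: gen_mem_above_except)
  have J: "ideal ?J class_ring" by (rule genideal_is_ideal)
  have G: "h * gen m k \<in> ?J" if "- int m \<le> k" "k \<le> int m" "k \<noteq> k0" for k h
  proof -
    have "trim_gen m k0 k \<in> ?J" by (rule genideal_mem, rule imageI) (use that in \<open>simp add: trim_index_def\<close>)
    then show ?thesis using that by (intro ideal_mult[OF J]) (simp add: trim_gen_def)
  qed
  have E: "extra_gen m k0 \<in> ?J" if "k0 \<in> {0, int m, - int m}"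
  proof -
    have "trim_gen m k0 (int m + 1) \<in> ?J"
      by (rule genideal_mem, rule imageI) (use that in \<open>simp add: trim_index_def\<close>)
    then show ?thesis by (simp add: trim_gen_def)
  qed
  have "varx * gen m k0 \<in> ?J \<and> vary * gen m k0 \<in> ?J \<and> varz * gen m k0 \<in> ?J"
  proof -
    consider (pos) n where "k0 = int n" "1 \<le> n" "n \<le> m" | (neg) n where "k0 = - int n" "1 \<le> n" "n \<le> m"
      | (zero) "k0 = 0"
    proof -
      assume a: "\<And>n. k0 = int n \<Longrightarrow> 1 \<le> n \<Longrightarrow> n \<le> m \<Longrightarrow> thesis"
        "\<And>n. k0 = - int n \<Longrightarrow> 1 \<le> n \<Longrightarrow> n \<le> m \<Longrightarrow> thesis" "k0 = 0 \<Longrightarrow> thesis"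
      show thesis
        using a(1)[of "nat k0"] a(2)[of "nat (- k0)"] a(3) k0 by (cases "k0 = 0"; cases "k0 > 0") auto
    qed
    then show ?thesis
    proof cases
      case (pos n)
      have z: "varz * gen m k0 \<in> ?J"
      proof (cases "n = m")
        case True
        then show ?thesis using varz_gen_top(1)[of m, where 'k = 'k] G[of "int m - 1" vary] m pos by auto
      next
        case False
        then have e: "varz * (gen m k0 :: 'k pser3) = vary * gen m (int n - 1) + varx * gen m (int n + 1)"
          using varz_gen_pos[of n m, where 'k = 'k] pos by simp
        show ?thesis
          unfolding e by (intro ideal_add[OF J] G) (use pos False in auto)
      qed
      have x: "varx * gen m k0 \<in> ?J"
      proof (cases "n = 1")
        case True
        then show ?thesis using varx_gen_one[of m, where 'k = 'k] m pos G[of "- 1" vary] by auto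
      next
        case False
        then have e: "varx * (gen m k0 :: 'k pser3) = varz * gen m (int n - 1) - vary * gen m (int n - 2)"
          using varz_gen_pos[of "n - 1" m, where 'k = 'k] pos by (simp add: of_nat_diff)
        show ?thesis
          unfolding e by (intro ideal_diff[OF J] G) (use pos False in auto)
      qed
      have y: "vary * gen m k0 \<in> ?J"
      proof -
        consider "n = m" | "Suc n = m" | "Suc n < m" using pos by linarith
        then show ?thesis
        proof cases
          case 1
          then show ?thesis using E pos m by (simp add: extra_gen_def)
        next
          case 2
          then have "vary * (gen m k0 :: 'k pser3) = varz * gen m (int m)"
            using varz_gen_top(1)[of m, where 'k = 'k] pos by auto
          then show ?thesis using pos 2 G[of "int m" varz] by auto
        next
          case 3
          then have e: "vary * (gen m k0 :: 'k pser3) = varz * gen m (int n + 1) - varx * gen m (int n + 2)"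
            using varz_gen_pos[of "Suc n" m, where 'k = 'k] pos by (simp add: add_ac)
          show ?thesis
          unfolding e by (intro ideal_diff[OF J] G) (use pos 3 in auto)
        qed
      qed
      show ?thesis using x y z by blast
    next
      case (neg n)
      have z: "varz * gen m k0 \<in> ?J"
      proof (cases "n = m")
        case True
        then show ?thesis using varz_gen_top(2)[of m, where 'k = 'k] G[of "1 - int m" varx] m neg by auto
      next
        case False
        then have e: "varz * (gen m k0 :: 'k pser3) = varx * gen m (- int n + 1) + vary * gen m (- int n - 1)"
          using varz_gen_neg[of n m, where 'k = 'k] neg by simp
        show ?thesis
          unfolding e by (intro ideal_add[OF J] G) (use neg False in auto)
      qed
      have y: "vary * gen m k0 \<in> ?J"
      proof (cases "n = 1")
        case True
        then show ?thesis using varx_gen_one[of m, where 'k = 'k, symmetric] m neg G[of 1 varx] by auto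
      next
        case False
        then have e: "vary * (gen m k0 :: 'k pser3) = varz * gen m (1 - int n) - varx * gen m (2 - int n)"
          using varz_gen_neg[of "n - 1" m, where 'k = 'k] neg by (simp add: of_nat_diff)
        show ?thesis
          unfolding e by (intro ideal_diff[OF J] G) (use neg False in auto)
      qed
      have x: "varx * gen m k0 \<in> ?J"
      proof -
        consider "n = m" | "Suc n = m" | "Suc n < m" using neg by linarith
        then show ?thesis
        proof cases
          case 1
          then show ?thesis using E neg m by (simp add: extra_gen_def split: if_splits)
        next
          case 2
          then have "varx * (gen m k0 :: 'k pser3) = varz * gen m (- int m)"
            using varz_gen_top(2)[of m, where 'k = 'k] neg by auto
          then show ?thesis using neg 2 G[of "- int m" varz] by auto
        next
          case 3
          then have e: "varx * (gen m k0 :: 'k pser3) = varz * gen m (- int n - 1) - vary * gen m (- int n - 2)"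
            
          proof -
            have i: "- int n - 1 = - int (Suc n)" "- int n - 2 = - int (Suc n) - 1" by simp_all
            show ?thesis
              unfolding neg(1) i using varz_gen_neg[of "Suc n" m, where 'k = 'k] 3 by simp
          qed
          show ?thesis
          unfolding e by (intro ideal_diff[OF J] G) (use neg 3 in auto)
        qed
      qed
      show ?thesis using x y z by blast
    next
      case zero
      have e1: "varx * (gen m k0 :: 'k pser3) = varz * gen m (- 1) - vary * gen m (- 2)"
        using varz_gen_neg[of 1 m, where 'k = 'k] m zero by simp
      have e2: "vary * (gen m k0 :: 'k pser3) = varz * gen m 1 - varx * gen m 2"
        using varz_gen_pos[of 1 m, where 'k = 'k] m zero by simp
      have e3: "varz * (gen m k0 :: 'k pser3) = extra_gen m k0"
        using zero by (simp add: extra_gen_def)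
      show ?thesis
        unfolding e1 e2 e3 by (intro conjI ideal_diff[OF J] G E) (use m zero in auto)
    qed
  qed
  note xyz = this
  show "?W \<subseteq> ?J"
  proof
    fix f assume "f \<in> ?W"
    then obtain h where h: "f = (\<Sum>i\<in>{- int m..int m}. h i * gen m i)" "h k0 \<in> max_ideal"
      using supp_in_above_except[OF k0] by blast
    obtain h1 h2 h3 where h': "h k0 = varx * h1 + vary * h2 + varz * h3"
      using max_ideal_decompose[OF h(2)] by blast
    have "h k0 * gen m k0 = h1 * (varx * gen m k0) + h2 * (vary * gen m k0) + h3 * (varz * gen m k0)"
      unfolding h' by (simp add: algebra_simps)
    also have "\<dots> \<in> ?J"
      using xyz by (simp add: ideal_add[OF J] ideal_mult[OF J])
    finally have "h i * gen m i \<in> ?J" if "i \<in> {- int m..int m}" for i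
      using that G[of i "h i"] by (cases "i = k0") auto
    then show "f \<in> ?J" unfolding h(1) by (intro ideal_sum[OF J])
  qed
qed

lemma card_trim_index:
  assumes "1 \<le> m" "k0 \<in> {- int m..int m}"
  shows "card (trim_index m k0) = (if k0 \<in> {0, int m, - int m} then 2 * m + 1 else 2 * m)"
proof -
  have "card ({- int m..int m} - {k0}) = 2 * m" using assms by (subst card_Diff_singleton) auto
  moreover have "card (({- int m..int m} - {k0}) \<union> {int m + 1}) = Suc (card ({- int m..int m} - {k0}))"
    by simp
  ultimately show ?thesis by (simp add: trim_index_def)
qed

lemma finite_trim_index [simp]: "finite (trim_index m k0)"
  by (simp add: trim_index_def)

lemma corner_mono: "corner W a b j \<Longrightarrow> (\<And>a b j. W' a b j \<Longrightarrow> W a b j) \<Longrightarrow> corner W' a b j"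
  unfolding corner_def by blast

lemma trim_coef_corner:
  assumes m: "2 \<le> m" and k0: "k0 \<in> {- int m..int m}" and k: "k \<in> trim_index m k0"
  shows "\<exists>p q r. corner (above_except m k0) p q r \<and> trim_coef m k0 k = (\<lambda>f. coef f p q r)"
proof (cases "k = int m + 1")
  case True
  then consider "k0 = 0" | "k0 = int m" | "k0 = - int m" using k by (auto simp: trim_index_def split: if_splits)
  then show ?thesis
  proof cases
    case 1
    have "corner (above_except m k0) 0 0 (m + 1)"
      unfolding corner_def above_except_def 1 by simp
    moreover have "trim_coef m k0 k = (\<lambda>f. coef f 0 0 (m + 1))"
      using 1 True by (simp add: trim_coef_def)
    ultimately show ?thesis by (intro exI[of _ 0] exI[of _ 0] exI[of _ "m + 1"] conjI)
  next
    case 2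
    have "corner (above_except m k0) 0 (m + 1) 0"
      unfolding corner_def above_except_def 2 by simp
    moreover have "trim_coef m k0 k = (\<lambda>f. coef f 0 (m + 1) 0)"
      using 2 True m by (simp add: trim_coef_def)
    ultimately show ?thesis by (intro exI[of _ 0] exI[of _ "m + 1"] exI[of _ 0] conjI)
  next
    case 3
    have "corner (above_except m k0) (m + 1) 0 0"
      unfolding corner_def above_except_def 3 by simp
    moreover have "trim_coef m k0 k = (\<lambda>f. coef f (m + 1) 0 0)"
      using 3 True m by (simp add: trim_coef_def)
    ultimately show ?thesis by (intro exI[of _ "m + 1"] exI[of _ 0] exI[of _ 0] conjI)
  qed
next
  case False
  then have "k \<in> {- int m..int m}" using k by (auto simp: trim_index_def split: if_splits)
  have "corner (above_except m k0) (nat (- k)) (nat k) (m - nat \<bar>k\<bar>)"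
    by (rule corner_mono[OF corner_above[OF \<open>k \<in> {- int m..int m}\<close>]]) (simp add: above_except_def)
  moreover have "trim_coef m k0 k = (\<lambda>f. coef f (nat (- k)) (nat k) (m - nat \<bar>k\<bar>))"
    using False by (simp add: trim_coef_def)
  ultimately show ?thesis
    by (intro exI[of _ "nat (- k)"] exI[of _ "nat k"] exI[of _ "m - nat \<bar>k\<bar>"] conjI)
qed

lemma trim_coef_trim_gen:
  assumes m: "2 \<le> m" and k0: "k0 \<in> {- int m..int m}"
    and k: "k \<in> trim_index m k0" and l: "l \<in> trim_index m k0"
  shows "trim_coef m k0 k (trim_gen m k0 l) = (if k = l then 1 else (0 :: 'k :: field))"
proof -
  consider (1) "k = int m + 1" "l = int m + 1" | (2) "k = int m + 1" "l \<in> {- int m..int m}"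
    | (3) "k \<in> {- int m..int m}" "l = int m + 1" | (4) "k \<in> {- int m..int m}" "l \<in> {- int m..int m}"
    using k l unfolding trim_index_def by (auto split: if_splits)
  then show ?thesis
  proof cases
    case 1
    then have "k0 = 0 \<or> k0 = int m \<or> k0 = - int m" using k by (auto simp: trim_index_def split: if_splits)
    then show ?thesis using 1 m by (auto simp: trim_coef_def trim_gen_def extra_gen_def)
  next
    case 2
    then show ?thesis by (auto simp: trim_coef_def trim_gen_def)
  next
    case 3
    define v where "v = (if k0 = 0 then varz else if k0 = int m then vary else varx :: 'k pser3)"
    have "(varx :: 'k pser3) \<in> max_ideal" "(vary :: 'k pser3) \<in> max_ideal" "(varz :: 'k pser3) \<in> max_ideal"
      unfolding max_ideal_def by (rule genideal_mem; simp)+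
    then have v: "v \<in> max_ideal" by (simp add: v_def)
    have "coef (v * gen m k0) (nat (- k)) (nat k) (m - nat \<bar>k\<bar>) = 0"
      by (rule coef_corner_max_ideal[OF stable_above corner_above[OF 3(1)] gen_mem_above v])
    then show ?thesis using 3 by (simp add: trim_coef_def trim_gen_def extra_gen_def v_def)
  next
    case 4
    then show ?thesis by (auto simp: trim_coef_def trim_gen_def dest: nat_eq_both)
  qed
qed

lemma
  assumes m: "2 \<le> m" and k0: "k0 \<in> {- int m..int m}"
  defines "I \<equiv> supp_in (above_except m k0) :: 'k :: field pser3 set"
  shows minimally_generated_by_trim: "minimally_generated_by class_ring I (card (trim_index m k0))"
    and min_num_generators_trim: "min_num_generators class_ring I = card (trim_index m k0)"
proof -
  note g = generators_at_corners[where u = "\<lambda>_. 1" and a = "trim_gen m k0 :: int \<Rightarrow> 'k pser3",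
      OF stable_above_except[OF k0] finite_trim_index trim_coef_corner[OF m k0]
      trim_coef_trim_gen[OF m k0] one_neq_zero genideal_trim_gen[OF m k0], folded I_def]
  show "min_num_generators class_ring I = card (trim_index m k0)" by (rule g(3))
  show "minimally_generated_by class_ring I (card (trim_index m k0))"
    unfolding minimally_generated_by_def
    using g(2) card_image[OF g(1)] by (intro exI[of _ "trim_gen m k0 ` trim_index m k0"]) simp
qed

section \<open>The exterior algebra in three variables over the power series ring\<close>

text \<open>Forms are represented as in \<^const>\<open>koszul_algebra\<close>, with coefficients in \<open>Q\<close>.\<close>

type_synonym 'k form = "nat set \<Rightarrow> 'k pser3"

definition is_form :: "'k :: field form \<Rightarrow> bool" where
  "is_form u \<longleftrightarrow> (\<forall>S. \<not> S \<subseteq> {..<3} \<longrightarrow> u S = 0)"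

definition wedge :: "'k :: field form \<Rightarrow> 'k form \<Rightarrow> 'k form" where
  "wedge u v = (\<lambda>S. if S \<subseteq> {..<3}
     then (\<Sum>T\<in>Pow S. (-1) ^ inversions T (S - T) * (u T * v (S - T))) else 0)"

definition kd :: "'k :: field form \<Rightarrow> 'k form" where
  "kd u = (\<lambda>S. if S \<subseteq> {..<3}
     then (\<Sum>j\<in>{..<3} - S. (-1) ^ card {i \<in> S. i < j} * ([varx, vary, varz] ! j * u (insert j S))) else 0)"

text \<open>The grading automorphism. It makes the Leibniz rule hold for inhomogeneous
  forms.\<close>

definition twist :: "'k :: field form \<Rightarrow> 'k form" where
  "twist u = (\<lambda>S. (-1) ^ card S * u S)"

definition one_form :: "'k :: field form" where
  "one_form = (\<lambda>S. if S = {} then 1 else 0)"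

section \<open>Component formulas and the Leibniz rule\<close>

lemma lessThan_3: "{..<3 :: nat} = {0, 1, 2}"
  by auto

lemma subset_3_cases:
  assumes "S \<subseteq> {..<3 :: nat}"
  shows "S = {} \<or> S = {0} \<or> S = {1} \<or> S = {2} \<or> S = {0, 1} \<or> S = {0, 2} \<or> S = {1, 2} \<or> S = {0, 1, 2}"
proof -
  have "S \<in> Pow {0, 1, 2}" using assms by (simp add: lessThan_3)
  then show ?thesis unfolding Pow_insert Pow_empty by auto
qed

lemma inversions_sum:
  assumes "finite S" "finite T"
  shows "inversions S T = (\<Sum>s\<in>S. \<Sum>t\<in>T. if t < s then 1 else 0)"
proof -
  have "{(s, t). s \<in> S \<and> t \<in> T \<and> t < s} = (SIGMA s:S. {t \<in> T. t < s})" by auto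
  then have "inversions S T = (\<Sum>s\<in>S. card {t \<in> T. t < s})"
    unfolding inversions_def using assms by simp
  moreover have "card {t \<in> T. t < s} = (\<Sum>t\<in>T. if t < s then 1 else 0)" for s
    using assms(2) by (simp add: sum.If_cases Int_def)
  ultimately show ?thesis by simp
qed

lemma inversions_empty [simp]: "inversions {} T = 0" "inversions T {} = 0"
  by (simp_all add: inversions_def)

lemma inversions_insert:
  assumes "finite S" "finite T" "s \<notin> S"
  shows "inversions (insert s S) T = (\<Sum>t\<in>T. if t < s then 1 else 0) + inversions S T"
  using assms by (simp add: inversions_sum)

lemma sum_Pow_insert:
  assumes "a \<notin> A" "finite A"
  shows "sum f (Pow (insert a A)) = sum f (Pow A) + (\<Sum>T\<in>Pow A. f (insert a T))"
proof -
  have "sum f (Pow (insert a A)) = sum f (Pow A) + sum f (insert a ` Pow A)"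
    unfolding Pow_insert using assms by (intro sum.union_disjoint) auto
  also have "sum f (insert a ` Pow A) = (\<Sum>T\<in>Pow A. f (insert a T))"
    using assms by (subst sum.reindex) (auto simp: inj_on_def o_def)
  finally show ?thesis .
qed

text \<open>With all eight components written out, associativity and the Leibniz rule become
  polynomial identities in the entries.\<close>

lemma wedge_components:
  fixes u v :: "'k :: field form"
  shows "wedge u v {} = u {} * v {}"
    "wedge u v {0} = u {} * v {0} + u {0} * v {}"
    "wedge u v {1} = u {} * v {1} + u {1} * v {}"
    "wedge u v {2} = u {} * v {2} + u {2} * v {}"
    "wedge u v {0, 1} = u {} * v {0, 1} + u {0} * v {1} - u {1} * v {0} + u {0, 1} * v {}"
    "wedge u v {0, 2} = u {} * v {0, 2} + u {0} * v {2} - u {2} * v {0} + u {0, 2} * v {}"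
    "wedge u v {1, 2} = u {} * v {1, 2} + u {1} * v {2} - u {2} * v {1} + u {1, 2} * v {}"
    "wedge u v {0, 1, 2} = u {} * v {0, 1, 2} + u {0} * v {1, 2} - u {1} * v {0, 2} + u {2} * v {0, 1} +
       u {0, 1} * v {2} - u {0, 2} * v {1} + u {1, 2} * v {0} + u {0, 1, 2} * v {}"
  by (simp_all add: wedge_def sum_Pow_insert inversions_insert insert_Diff_if lessThan_3 insert_commute)

lemma kd_eq:
  assumes "S \<subseteq> {..<3}"
  shows "kd u S = (\<Sum>j\<in>{..<3} - S. (-1) ^ (\<Sum>i\<in>S. if i < j then 1 else 0) *
    ([varx, vary, varz] ! j * u (insert j S)))"
proof -
  have "finite S" using assms finite_subset by blast
  then have "card {i \<in> S. i < j} = (\<Sum>i\<in>S. if i < j then 1 else 0)" for j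
    by (simp add: sum.If_cases Int_def)
  then show ?thesis using assms by (simp add: kd_def)
qed

lemma kd_components:
  fixes u :: "'k :: field form"
  shows "kd u {} = varx * u {0} + vary * u {1} + varz * u {2}"
    "kd u {0} = - (vary * u {0, 1}) - varz * u {0, 2}"
    "kd u {1} = varx * u {0, 1} - varz * u {1, 2}"
    "kd u {2} = varx * u {0, 2} + vary * u {1, 2}"
    "kd u {0, 1} = varz * u {0, 1, 2}"
    "kd u {0, 2} = - (vary * u {0, 1, 2})"
    "kd u {1, 2} = varx * u {0, 1, 2}"
    "kd u {0, 1, 2} = 0"
  by (simp_all add: kd_eq lessThan_3 insert_Diff_if insert_commute)

lemma is_form_simps [simp]:
  "is_form (wedge u v)" "is_form (kd u)" "is_form (\<lambda>S. 0)" "is_form one_form"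
  "is_form u \<Longrightarrow> is_form (twist u)"
  "is_form u \<Longrightarrow> is_form v \<Longrightarrow> is_form (\<lambda>S. u S + v S)"
  "is_form u \<Longrightarrow> is_form v \<Longrightarrow> is_form (\<lambda>S. u S - v S)"
  "is_form u \<Longrightarrow> is_form (\<lambda>S. - u S)"
  "is_form u \<Longrightarrow> is_form (\<lambda>S. c * u S)"
  by (auto simp: is_form_def wedge_def kd_def one_form_def twist_def)

lemma form_eqI:
  assumes "is_form u" "is_form v" "u {} = v {}" "u {0} = v {0}" "u {1} = v {1}" "u {2} = v {2}"
    "u {0, 1} = v {0, 1}" "u {0, 2} = v {0, 2}" "u {1, 2} = v {1, 2}" "u {0, 1, 2} = v {0, 1, 2}"
  shows "u = v"
proof
  fix S
  show "u S = v S"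
  proof (cases "S \<subseteq> {..<3}")
    case True
    from subset_3_cases[OF this] assms show ?thesis by (elim disjE) simp_all
  next
    case False
    then show ?thesis using assms(1,2) by (simp add: is_form_def)
  qed
qed

lemma wedge_assoc: "wedge (wedge u v) w = wedge u (wedge v w)"
  by (rule form_eqI) (simp_all only: is_form_simps wedge_components, simp_all only: algebra_simps)

lemma wedge_one: "is_form u \<Longrightarrow> wedge one_form u = u" "is_form u \<Longrightarrow> wedge u one_form = u"
  by (rule form_eqI; simp add: wedge_components[unfolded One_nat_def] one_form_def)+

lemma wedge_distrib:
  "wedge (\<lambda>S. u S + v S) w = (\<lambda>S. wedge u w S + wedge v w S)"
  "wedge w (\<lambda>S. u S + v S) = (\<lambda>S. wedge w u S + wedge w v S)"
  by (rule form_eqI; simp only: is_form_simps wedge_components; simp only: algebra_simps)+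

lemma kd_add: "kd (\<lambda>S. u S + v S) = (\<lambda>S. kd u S + kd v S)"
  and kd_uminus: "kd (\<lambda>S. - u S) = (\<lambda>S. - kd u S)"
  and kd_diff: "kd (\<lambda>S. u S - v S) = (\<lambda>S. kd u S - kd v S)"
  and kd_scale: "kd (\<lambda>S. c * u S) = (\<lambda>S. c * kd u S)"
  and kd_zero: "kd (\<lambda>S. 0) = (\<lambda>S. 0)"
  and kd_kd: "kd (kd u) = (\<lambda>S. 0)"
  by (rule form_eqI; simp add: kd_components[unfolded One_nat_def] algebra_simps)+

lemma twist_components:
  "twist u {} = u {}" "twist u {0} = - u {0}" "twist u {1} = - u {1}" "twist u {2} = - u {2}"
  "twist u {0, 1} = u {0, 1}" "twist u {0, 2} = u {0, 2}" "twist u {1, 2} = u {1, 2}"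
  "twist u {0, 1, 2} = - u {0, 1, 2}"
  by (simp_all add: twist_def)

lemma twist_twist: "twist (twist u) = u"
  by (simp add: twist_def fun_eq_iff minus_one_power_iff mult.assoc[symmetric])

lemma kd_wedge: "kd (wedge u v) = (\<lambda>S. wedge (kd u) v S + wedge (twist u) (kd v) S)"
  by (rule form_eqI; simp only: is_form_simps kd_components wedge_components twist_components;
      simp only: algebra_simps mult_zero_right mult_zero_left mult_minus_right mult_minus_left minus_diff_eq; simp)

lemma kd_twist: "kd (twist u) = (\<lambda>S. - twist (kd u) S)"
  by (rule form_eqI; simp add: kd_components[unfolded One_nat_def]
      twist_components[unfolded One_nat_def] algebra_simps)

section \<open>The Koszul homology algebra of a quotient\<close>

lemma const3_simps [simp]: "const3 0 = 0" "const3 1 = 1" "const3 (- c) = - const3 c"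
  by (simp_all add: const3_def flip: fps_const_neg)

lemma carrier_Quot: "carrier (A Quot I) = (\<lambda>x. I +>\<^bsub>A\<^esub> x) ` carrier A"
  by (auto simp: FactRing_simps)

locale quotient_ideal =
  fixes \<aa> :: "'k :: field pser3 set"
  assumes ideal: "ideal \<aa> class_ring"
begin

section \<open>Residue classes and lifts of Koszul chains\<close>

lemmas closed = ideal_closed[OF ideal]

lemma cring_quot: "cring (quot \<aa>)"
  by (rule ideal.quotient_is_cring[OF ideal class_cring.cring_axioms])

interpretation R: cring "quot \<aa>"
  by (rule cring_quot)

lemma cls_eq: "cls \<aa> f = {h + f | h. h \<in> \<aa>}"
  unfolding cls_def a_r_coset_def r_coset_def by auto

lemma cls_eq_iff: "cls \<aa> f = cls \<aa> g \<longleftrightarrow> f - g \<in> \<aa>"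
proof
  assume *: "cls \<aa> f = cls \<aa> g"
  have "f \<in> cls \<aa> f" unfolding cls_eq using closed(1) by force
  then have "f \<in> cls \<aa> g" using * by simp
  then obtain h where "f = h + g" "h \<in> \<aa>" unfolding cls_eq by auto
  then show "f - g \<in> \<aa>" by simp
next
  assume *: "f - g \<in> \<aa>"
  have "h + f \<in> cls \<aa> g" if "h \<in> \<aa>" for h
    unfolding cls_eq using closed(2)[OF that *] by (auto intro!: exI[of _ "h + (f - g)"])
  moreover have "h + g \<in> cls \<aa> f" if "h \<in> \<aa>" for h
    unfolding cls_eq using closed(6)[OF that *] by (auto intro!: exI[of _ "h - (f - g)"])
  ultimately show "cls \<aa> f = cls \<aa> g" unfolding cls_eq[of f] cls_eq[of g] by (auto simp: cls_eq)
qed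

lemma zero_quot: "\<zero>\<^bsub>quot \<aa>\<^esub> = cls \<aa> 0"
  unfolding cls_eq FactRing_def by auto

lemma cls_eq_zero_iff: "cls \<aa> f = \<zero>\<^bsub>quot \<aa>\<^esub> \<longleftrightarrow> f \<in> \<aa>"
  unfolding zero_quot cls_eq_iff by simp

lemma one_quot: "\<one>\<^bsub>quot \<aa>\<^esub> = cls \<aa> 1"
  unfolding cls_def FactRing_def by simp

lemma carrier_quot: "carrier (quot \<aa>) = range (cls \<aa>)"
  unfolding cls_def FactRing_def A_RCOSETS_defs a_r_coset_def r_coset_def by auto

lemma cls_closed [simp]: "cls \<aa> f \<in> carrier (quot \<aa>)"
  by (simp add: carrier_quot)

lemma cls_add: "cls \<aa> f \<oplus>\<^bsub>quot \<aa>\<^esub> cls \<aa> g = cls \<aa> (f + g)"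
  using ring_hom_add[OF ideal.rcos_ring_hom[OF ideal], of f g] by (simp add: cls_def)

lemma cls_mult: "cls \<aa> f \<otimes>\<^bsub>quot \<aa>\<^esub> cls \<aa> g = cls \<aa> (f * g)"
  using ring_hom_mult[OF ideal.rcos_ring_hom[OF ideal], of f g] by (simp add: cls_def)

lemma cls_uminus: "\<ominus>\<^bsub>quot \<aa>\<^esub> cls \<aa> f = cls \<aa> (- f)"
  by (rule R.minus_equality) (simp_all add: cls_add zero_quot)

lemma cls_sum: "finsum (quot \<aa>) (\<lambda>i. cls \<aa> (f i)) A = cls \<aa> (sum f A)"
  by (induction A rule: infinite_finite_induct) (simp_all add: zero_quot cls_add Pi_def)

lemma ring_sign_quot: "ring_sign (quot \<aa>) k = cls \<aa> ((-1) ^ k)"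
  unfolding ring_sign_def
  by (induction k) (simp_all add: one_quot cls_uminus cls_mult mult.commute)

abbreviation "xs \<equiv> max_ideal_gens \<aa>"

lemma length_xs [simp]: "length xs = 3"
  by (simp add: max_ideal_gens_def)

lemma nth_xs: "j < 3 \<Longrightarrow> xs ! j = cls \<aa> ([varx, vary, varz] ! j)"
  by (auto simp: max_ideal_gens_def less_Suc_eq numeral_3_eq_3)

text \<open>Reduction of a form modulo the ideal. Chains over the quotient are always represented by
  lifts over Q, so that sums and products need no choice of representatives.\<close>

definition L :: "'k form \<Rightarrow> nat set \<Rightarrow> 'k pser3 set" where
  "L u = (\<lambda>S. cls \<aa> (u S))"

lemma L_eq_iff: "L u = L v \<longleftrightarrow> (\<forall>S. u S - v S \<in> \<aa>)"
  unfolding L_def fun_eq_iff cls_eq_iff ..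

lemma carrier_koszul: "carrier (koszul_algebra (quot \<aa>) xs) = L ` {u. is_form u}"
proof
  show "L ` {u. is_form u} \<subseteq> carrier (koszul_algebra (quot \<aa>) xs)"
    by (auto simp: koszul_algebra_def L_def is_form_def zero_quot)
  show "carrier (koszul_algebra (quot \<aa>) xs) \<subseteq> L ` {u. is_form u}"
  proof
    fix U assume U: "U \<in> carrier (koszul_algebra (quot \<aa>) xs)"
    define u where "u S = (if S \<subseteq> {..<3} then (SOME f. cls \<aa> f = U S) else 0)" for S
    have "cls \<aa> (u S) = U S" for S
    proof (cases "S \<subseteq> {..<3}")
      case True
      have "\<exists>f. cls \<aa> f = U S" using U by (auto simp: koszul_algebra_def carrier_quot) (metis rangeE)
      then have "cls \<aa> (SOME f. cls \<aa> f = U S) = U S" by (rule someI_ex)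
      then show ?thesis using True by (simp add: u_def)
    next
      case False
      then show ?thesis using U by (auto simp: koszul_algebra_def zero_quot u_def)
    qed
    then have "U = L u" by (auto simp: L_def)
    moreover have "is_form u" by (simp add: is_form_def u_def)
    ultimately show "U \<in> L ` {u. is_form u}" by blast
  qed
qed

lemma mult_koszul: "L u \<otimes>\<^bsub>koszul_algebra (quot \<aa>) xs\<^esub> L v = L (wedge u v)"
  by (auto simp: koszul_algebra_def L_def wedge_def ring_sign_quot cls_mult cls_sum zero_quot fun_eq_iff)

lemma add_koszul: "L u \<oplus>\<^bsub>koszul_algebra (quot \<aa>) xs\<^esub> L v = L (\<lambda>S. u S + v S)"
  by (auto simp: koszul_algebra_def L_def cls_add)

lemma one_koszul: "\<one>\<^bsub>koszul_algebra (quot \<aa>) xs\<^esub> = L one_form"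
  by (auto simp: fun_eq_iff koszul_algebra_def L_def one_form_def one_quot zero_quot)

lemma zero_koszul: "\<zero>\<^bsub>koszul_algebra (quot \<aa>) xs\<^esub> = L (\<lambda>S. 0)"
  by (auto simp: koszul_algebra_def L_def zero_quot)

lemma diff_koszul: "koszul_diff (quot \<aa>) xs (L u) = L (kd u)"
proof
  fix S
  show "koszul_diff (quot \<aa>) xs (L u) S = L (kd u) S"
  proof (cases "S \<subseteq> {..<3}")
    case True
    have "koszul_diff (quot \<aa>) xs (L u) S = (\<Oplus>\<^bsub>quot \<aa>\<^esub>j\<in>{..<3} - S.
        cls \<aa> ((-1) ^ card {i \<in> S. i < j} * ([varx, vary, varz] ! j * u (insert j S))))"
      unfolding koszul_diff_def using True
      by (simp, intro R.finsum_cong') (auto simp: L_def ring_sign_quot cls_mult nth_xs)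
    then show ?thesis using True by (simp add: cls_sum L_def kd_def)
  next
    case False
    then show ?thesis by (simp add: koszul_diff_def L_def kd_def zero_quot)
  qed
qed

text \<open>A lift of a cycle over the quotient; its differential over Q need not vanish.\<close>

definition cycle :: "'k form \<Rightarrow> bool" where
  "cycle u \<longleftrightarrow> is_form u \<and> (\<forall>S. kd u S \<in> \<aa>)"

definition bnd :: "'k form \<Rightarrow> bool" where
  "bnd u \<longleftrightarrow> (\<exists>w. is_form w \<and> (\<forall>S. u S - kd w S \<in> \<aa>))"

lemma koszul_cycles_eq: "koszul_cycles (quot \<aa>) xs = L ` {u. cycle u}"
  unfolding koszul_cycles_def carrier_koszul zero_koszul
  by (auto simp: diff_koszul L_eq_iff cycle_def)

lemma koszul_boundaries_eq: "koszul_boundaries (quot \<aa>) xs = (\<lambda>w. L (kd w)) ` {w. is_form w}"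
  unfolding koszul_boundaries_def carrier_koszul by (auto simp: diff_koszul image_iff)

lemma wedge_closed:
  assumes "(\<forall>S. u S \<in> \<aa>) \<or> (\<forall>S. v S \<in> \<aa>)"
  shows "wedge u v S \<in> \<aa>"
proof -
  have p: "u T * v (S - T) \<in> \<aa>" for T
    using assms closed(3)[of "v (S - T)" "u T"] closed(4)[of "u T" "v (S - T)"] by blast
  have "(\<Sum>T\<in>Pow S. (-1) ^ inversions T (S - T) * (u T * v (S - T))) \<in> \<aa>"
    by (rule closed(7), rule closed(3), rule p)
  then show ?thesis unfolding wedge_def using closed(1) by simp
qed

lemma twist_closed: "(\<forall>S. u S \<in> \<aa>) \<Longrightarrow> twist u S \<in> \<aa>"
  unfolding twist_def by (auto intro: closed(3))

lemma cycle_wedge: "cycle u \<Longrightarrow> cycle v \<Longrightarrow> cycle (wedge u v)"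
  unfolding cycle_def kd_wedge by (auto intro!: closed(2) wedge_closed)

lemma cycle_simps [simp]:
  "cycle (\<lambda>S. 0)" "cycle u \<Longrightarrow> cycle v \<Longrightarrow> cycle (\<lambda>S. u S + v S)"
  "cycle u \<Longrightarrow> cycle (\<lambda>S. - u S)" "cycle u \<Longrightarrow> cycle v \<Longrightarrow> cycle (\<lambda>S. u S - v S)"
  "cycle u \<Longrightarrow> cycle (\<lambda>S. c * u S)"
  "is_form w \<Longrightarrow> cycle (kd w)"
  by (auto simp: cycle_def kd_add kd_uminus kd_zero kd_diff kd_kd kd_scale intro: closed)

lemma cycle_scalar [simp]: "cycle (\<lambda>S. if S = {} then c else 0)"
proof -
  have "kd (\<lambda>S. if S = {} then c else 0) = (\<lambda>S. 0)"
    by (rule form_eqI) (simp_all add: kd_components[unfolded One_nat_def])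
  then show ?thesis by (auto simp: cycle_def is_form_def closed(1))
qed

abbreviation "Z \<equiv> koszul_cycle_algebra (quot \<aa>) xs"

lemma Z_simps:
  "carrier Z = L ` {u. cycle u}" "L u \<otimes>\<^bsub>Z\<^esub> L v = L (wedge u v)" "L u \<oplus>\<^bsub>Z\<^esub> L v = L (\<lambda>S. u S + v S)"
  "\<one>\<^bsub>Z\<^esub> = L one_form" "\<zero>\<^bsub>Z\<^esub> = L (\<lambda>S. 0)"
  using mult_koszul add_koszul one_koszul zero_koszul
  by (simp_all add: koszul_cycle_algebra_def koszul_cycles_eq)

lemma cycle_one [simp]: "cycle one_form"
  using cycle_scalar[of 1] by (simp add: one_form_def)

lemma is_form_cycle: "cycle u \<Longrightarrow> is_form u"
  by (simp add: cycle_def)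

lemma ring_Z: "ring Z"
proof (rule ringI)
  show "abelian_group Z"
  proof (rule abelian_groupI)
    fix U assume "U \<in> carrier Z"
    then obtain u where u: "U = L u" "cycle u" by (auto simp: Z_simps)
    then show "\<exists>V\<in>carrier Z. V \<oplus>\<^bsub>Z\<^esub> U = \<zero>\<^bsub>Z\<^esub>"
      by (intro bexI[of _ "L (\<lambda>S. - u S)"]) (auto simp: Z_simps)
  qed (auto simp: Z_simps add_ac)
  show "Group.monoid Z"
    by (rule monoidI) (auto simp: Z_simps wedge_assoc wedge_one is_form_cycle cycle_wedge)
qed (auto simp: Z_simps wedge_distrib)

interpretation Z: ring Z by (rule ring_Z)

abbreviation "B \<equiv> koszul_boundaries (quot \<aa>) xs"

lemma ideal_B: "ideal B Z"
proof (rule idealI[OF ring_Z])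
  show "subgroup B (add_monoid Z)"
  proof (rule Z.add.subgroupI)
    show "B \<subseteq> carrier Z" by (auto simp: koszul_boundaries_eq Z_simps)
    show "B \<noteq> {}" by (auto simp: koszul_boundaries_eq intro: is_form_simps)
  next
    fix U assume "U \<in> B"
    then obtain w where w: "U = L (kd w)" "is_form w" by (auto simp: koszul_boundaries_eq)
    have "\<ominus>\<^bsub>Z\<^esub> U = L (kd (\<lambda>S. - w S))"
      using w by (intro Z.minus_equality) (auto simp: Z_simps kd_uminus)
    then show "\<ominus>\<^bsub>Z\<^esub> U \<in> B" using w by (auto simp: koszul_boundaries_eq)
  next
    fix U V assume "U \<in> B" "V \<in> B"
    then obtain w v where w: "U = L (kd w)" "is_form w" "V = L (kd v)" "is_form v"
      by (auto simp: koszul_boundaries_eq)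
    then have "U \<oplus>\<^bsub>Z\<^esub> V = L (kd (\<lambda>S. w S + v S))"
      by (simp add: Z_simps kd_add)
    then show "U \<oplus>\<^bsub>Z\<^esub> V \<in> B" using w by (auto simp: koszul_boundaries_eq)
  qed
next
  fix U V assume "U \<in> B" "V \<in> carrier Z"
  then obtain w v where w: "U = L (kd w)" "is_form w" "V = L v" "cycle v"
    by (auto simp: koszul_boundaries_eq Z_simps)
  have c: "\<forall>S. kd v S \<in> \<aa>" using w(4) by (simp add: cycle_def)
  have 1: "L (wedge (kd w) v) = L (kd (wedge w v))"
    unfolding L_eq_iff kd_wedge using c
    by (auto intro!: closed(5) wedge_closed)
  \<comment> \<open>The twist in the Leibniz rule acts on the left factor, so the primitive is built
    from \<open>twist v\<close>. The other term contains \<open>twist (kd v)\<close>, whose entries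
    lie in the ideal.\<close>
  have 2: "L (wedge v (kd w)) = L (kd (wedge (twist v) w))"
    unfolding L_eq_iff kd_wedge kd_twist twist_twist using c twist_closed[OF c]
    by (auto intro!: closed(5) wedge_closed)
  show "V \<otimes>\<^bsub>Z\<^esub> U \<in> B" "U \<otimes>\<^bsub>Z\<^esub> V \<in> B"
    using w by (auto simp: Z_simps 1 2 koszul_boundaries_eq)
qed

definition kc :: "'k form \<Rightarrow> (nat set \<Rightarrow> 'k pser3 set) set" where
  "kc u = koszul_class (quot \<aa>) xs (L u)"

lemma kc_eq: "kc u = {L (\<lambda>S. kd w S + u S) | w. is_form w}"
  unfolding kc_def koszul_class_def a_r_coset_def r_coset_def koszul_boundaries_eq
  by (auto simp: Z_simps(3))

lemma kc_eq_iff: "kc u = kc v \<longleftrightarrow> bnd (\<lambda>S. u S - v S)"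
proof
  assume *: "kc u = kc v"
  have "L u \<in> kc u"
    unfolding kc_eq by (auto intro!: exI[of _ "\<lambda>S. 0"] simp: kd_zero)
  then have "L u \<in> kc v" using * by simp
  then obtain w where "L u = L (\<lambda>S. kd w S + v S)" "is_form w" unfolding kc_eq by auto
  then show "bnd (\<lambda>S. u S - v S)"
    unfolding bnd_def L_eq_iff by (auto intro!: exI[of _ w] simp: algebra_simps)
next
  assume "bnd (\<lambda>S. u S - v S)"
  then obtain w where w: "is_form w" "\<And>S. u S - v S - kd w S \<in> \<aa>" unfolding bnd_def by auto
  have 1: "L (\<lambda>S. kd w' S + u S) = L (\<lambda>S. kd (\<lambda>S. w' S + w S) S + v S)" for w'
    unfolding L_eq_iff kd_add using w(2) by (auto simp: algebra_simps)
  have 2: "L (\<lambda>S. kd w' S + v S) = L (\<lambda>S. kd (\<lambda>S. w' S - w S) S + u S)" for w'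
    unfolding L_eq_iff kd_diff using closed(5)[OF w(2)] by (auto simp: algebra_simps)
  show "kc u = kc v"
  proof
    show "kc u \<subseteq> kc v"
    proof
      fix X assume "X \<in> kc u"
      then obtain w' where "X = L (\<lambda>S. kd w' S + u S)" "is_form w'" unfolding kc_eq by auto
      then show "X \<in> kc v"
        unfolding kc_eq using 1[of w'] w(1) by (intro CollectI exI[of _ "\<lambda>S. w' S + w S"]) simp
    qed
    show "kc v \<subseteq> kc u"
    proof
      fix X assume "X \<in> kc v"
      then obtain w' where "X = L (\<lambda>S. kd w' S + v S)" "is_form w'" unfolding kc_eq by auto
      then show "X \<in> kc u"
        unfolding kc_eq using 2[of w'] w(1) by (intro CollectI exI[of _ "\<lambda>S. w' S - w S"]) simp
    qed
  qed
qed

lemma hom_alg_eq: "hom_alg \<aa> = Z Quot B"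
  by (simp add: hom_alg_def koszul_homology_def)

lemma kc_coset: "kc u = B +>\<^bsub>Z\<^esub> L u"
  by (simp add: kc_def koszul_class_def)

lemma ring_hom_alg: "ring (hom_alg \<aa>)"
  unfolding hom_alg_eq by (rule ideal.quotient_is_ring[OF ideal_B])

lemma carrier_hom_alg: "carrier (hom_alg \<aa>) = kc ` {u. cycle u}"
  unfolding hom_alg_eq carrier_Quot kc_coset Z_simps by auto

lemma kc_mult: "cycle u \<Longrightarrow> cycle v \<Longrightarrow> kc u \<otimes>\<^bsub>hom_alg \<aa>\<^esub> kc v = kc (wedge u v)"
  using ring_hom_mult[OF ideal.rcos_ring_hom[OF ideal_B], of "L u" "L v"]
  unfolding kc_coset hom_alg_eq by (simp add: Z_simps)

lemma kc_add: "cycle u \<Longrightarrow> cycle v \<Longrightarrow> kc u \<oplus>\<^bsub>hom_alg \<aa>\<^esub> kc v = kc (\<lambda>S. u S + v S)"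
  using ring_hom_add[OF ideal.rcos_ring_hom[OF ideal_B], of "L u" "L v"]
  unfolding kc_coset hom_alg_eq by (simp add: Z_simps)

lemma kc_zero: "\<zero>\<^bsub>hom_alg \<aa>\<^esub> = kc (\<lambda>S. 0)"
proof -
  have "\<zero>\<^bsub>hom_alg \<aa>\<^esub> = B" by (simp add: hom_alg_eq FactRing_def)
  also have "\<dots> = kc (\<lambda>S. 0)" by (auto simp: kc_eq koszul_boundaries_eq)
  finally show ?thesis .
qed

definition hom_degree_form :: "nat \<Rightarrow> 'k form \<Rightarrow> bool" where
  "hom_degree_form p u \<longleftrightarrow> (\<forall>S. card S \<noteq> p \<longrightarrow> u S = 0)"

lemma hom_deg_eq: "hom_deg \<aa> p = kc ` {u. cycle u \<and> hom_degree_form p u}"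
proof -
  have "koszul_cycles (quot \<aa>) xs \<inter> koszul_degree (quot \<aa>) xs p = L ` {u. cycle u \<and> hom_degree_form p u}"
  proof
    show "L ` {u. cycle u \<and> hom_degree_form p u} \<subseteq> koszul_cycles (quot \<aa>) xs \<inter> koszul_degree (quot \<aa>) xs p"
      by (auto simp: koszul_cycles_eq koszul_degree_def carrier_koszul is_form_cycle hom_degree_form_def L_def zero_quot)
    show "koszul_cycles (quot \<aa>) xs \<inter> koszul_degree (quot \<aa>) xs p \<subseteq> L ` {u. cycle u \<and> hom_degree_form p u}"
    proof
      fix U assume U: "U \<in> koszul_cycles (quot \<aa>) xs \<inter> koszul_degree (quot \<aa>) xs p"
      then obtain u where u: "U = L u" "cycle u" by (auto simp: koszul_cycles_eq)
      \<comment> \<open>The lift \<open>u\<close> may have entries from the ideal in other degrees;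
        they are cut off.\<close>
      define v where "v S = (if card S = p then u S else 0)" for S
      have "cls \<aa> (u S) = \<zero>\<^bsub>quot \<aa>\<^esub>" if "card S \<noteq> p" for S
        using U that unfolding u koszul_degree_def L_def by auto
      then have uv: "u S - v S \<in> \<aa>" for S
        by (auto simp: v_def cls_eq_zero_iff closed(1))
      have "U = L v" unfolding u L_eq_iff using uv by simp
      moreover have "cycle v"
      proof -
        have f: "is_form v" using u(2) by (auto simp: v_def cycle_def is_form_def)
        have "L (kd u) = L (kd v)"
          using \<open>U = L v\<close> u(1) diff_koszul[of u] diff_koszul[of v] by simp
        then have "kd v S \<in> \<aa>" for S
          using u(2) closed(6)[of "kd u S" "kd u S - kd v S"] by (simp add: L_eq_iff cycle_def)
        then show ?thesis using f by (simp add: cycle_def)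
      qed
      ultimately show "U \<in> L ` {u. cycle u \<and> hom_degree_form p u}"
        by (auto simp: hom_degree_form_def v_def)
    qed
  qed
  then show ?thesis
    unfolding hom_deg_def koszul_homology_degree_def by (auto simp: kc_def)
qed

lemma hom_scalars_eq: "hom_scalars \<aa> = range (\<lambda>c. kc (\<lambda>S. if S = {} then const3 c else 0))"
proof -
  have "(\<lambda>S. if S = {} then cls \<aa> f else \<zero>\<^bsub>quot \<aa>\<^esub>) = L (\<lambda>S. if S = {} then f else 0)" for f
    by (auto simp: fun_eq_iff L_def zero_quot)
  then show ?thesis unfolding hom_scalars_def kc_def by simp
qed

lemma scalar_wedge:
  assumes "is_form u"
  shows "wedge (\<lambda>S. if S = {} then c else 0) u = (\<lambda>S. c * u S)"
  by (rule form_eqI) (use assms in \<open>simp_all add: wedge_components[unfolded One_nat_def]\<close>)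

lemma scalar_mult: "cycle u \<Longrightarrow>
    kc (\<lambda>S. if S = {} then const3 c else 0) \<otimes>\<^bsub>hom_alg \<aa>\<^esub> kc u = kc (\<lambda>S. const3 c * u S)"
  by (simp add: kc_mult scalar_wedge is_form_cycle)

section \<open>Linear combinations and bases of homology\<close>

definition lincomb :: "(nat \<Rightarrow> 'k) \<Rightarrow> 'k form list \<Rightarrow> 'k form" where
  "lincomb c us = (\<lambda>S. \<Sum>i<length us. const3 (c i) * (us ! i) S)"

lemma lincomb_Nil [simp]: "lincomb c [] = (\<lambda>S. 0)"
  by (simp add: lincomb_def)

lemma lincomb_Cons: "lincomb c (u # us) = (\<lambda>S. const3 (c 0) * u S + lincomb (\<lambda>i. c (Suc i)) us S)"
  by (simp add: lincomb_def sum.lessThan_Suc_shift del: sum.lessThan_Suc)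

lemma cycle_lincomb: "(\<And>u. u \<in> set us \<Longrightarrow> cycle u) \<Longrightarrow> cycle (lincomb c us)"
  by (induction us arbitrary: c) (auto simp: lincomb_Cons)

lemma Span_eq:
  assumes "\<And>u. u \<in> set us \<Longrightarrow> cycle u"
  shows "ring.Span (hom_alg \<aa>) (hom_scalars \<aa>) (map kc us) = range (\<lambda>c. kc (lincomb c us))"
  using assms
proof (induction us)
  case Nil
  then show ?case using ring.Span.simps[OF ring_hom_alg] by (auto simp: kc_zero)
next
  case (Cons u us)
  note S = ring.Span.simps[OF ring_hom_alg]
  have "ring.Span (hom_alg \<aa>) (hom_scalars \<aa>) (map kc (u # us)) =
      ring.line_extension (hom_alg \<aa>) (hom_scalars \<aa>) (kc u) (range (\<lambda>c. kc (lincomb c us)))"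
  proof -
    have "ring.Span (hom_alg \<aa>) (hom_scalars \<aa>) (map kc us) = range (\<lambda>c. kc (lincomb c us))"
      by (rule Cons.IH) (simp add: Cons.prems)
    then show ?thesis by (simp only: S list.map foldr_Cons o_apply)
  qed
  also have "\<dots> = range (\<lambda>c. kc (lincomb c (u # us)))"
  proof -
    have e: "kc (\<lambda>S. if S = {} then const3 b else 0) \<otimes>\<^bsub>hom_alg \<aa>\<^esub> kc u \<oplus>\<^bsub>hom_alg \<aa>\<^esub> kc (lincomb c us) =
        kc (lincomb (case_nat b c) (u # us))" for b c
      using Cons.prems by (simp add: scalar_mult kc_add cycle_lincomb lincomb_Cons)
    have "X \<in> ring.line_extension (hom_alg \<aa>) (hom_scalars \<aa>) (kc u) (range (\<lambda>c. kc (lincomb c us))) \<longleftrightarrow>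
        (\<exists>b c. X = kc (lincomb (case_nat b c) (u # us)))" for X
      unfolding ring.line_extension_mem_iff[OF ring_hom_alg] hom_scalars_eq e[symmetric] by blast
    moreover have "(\<exists>b c. X = kc (lincomb (case_nat b c) (u # us))) \<longleftrightarrow> X \<in> range (\<lambda>c. kc (lincomb c (u # us)))" for X
    proof
      assume "X \<in> range (\<lambda>c. kc (lincomb c (u # us)))"
      then obtain c where "X = kc (lincomb c (u # us))" by blast
      moreover have "c = case_nat (c 0) (\<lambda>i. c (Suc i))" by (auto split: nat.split)
      ultimately show "\<exists>b c. X = kc (lincomb (case_nat b c) (u # us))" by metis
    qed blast
    ultimately show ?thesis by (simp only: set_eq_iff) blast
  qed
  finally show ?case .
qed

lemma independentI:
  assumes "\<And>u. u \<in> set us \<Longrightarrow> cycle u"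
    "\<And>c i. bnd (lincomb c us) \<Longrightarrow> i < length us \<Longrightarrow> c i = 0"
  shows "ring.independent (hom_alg \<aa>) (hom_scalars \<aa>) (map kc us)"
  using assms
proof (induction us)
  case Nil
  show ?case by (simp add: ring.li_Nil[OF ring_hom_alg])
next
  case (Cons u us)
  have 1: "kc u \<notin> ring.Span (hom_alg \<aa>) (hom_scalars \<aa>) (map kc us)"
  proof
    assume "kc u \<in> ring.Span (hom_alg \<aa>) (hom_scalars \<aa>) (map kc us)"
    then obtain c where "kc u = kc (lincomb c us)"
      using Span_eq[of us] Cons.prems(1) by auto
    then have "bnd (\<lambda>S. u S - lincomb c us S)" by (simp add: kc_eq_iff)
    moreover have "(\<lambda>S. u S - lincomb c us S) = lincomb (case_nat 1 (\<lambda>i. - c i)) (u # us)"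
      unfolding lincomb_Cons by (simp add: lincomb_def sum_negf)
    ultimately have "bnd (lincomb (case_nat 1 (\<lambda>i. - c i)) (u # us))" by simp
    from Cons.prems(2)[OF this, of 0] show False by simp
  qed
  have 2: "ring.independent (hom_alg \<aa>) (hom_scalars \<aa>) (map kc us)"
  proof (rule Cons.IH)
    fix c i assume "bnd (lincomb c us)" "i < length us"
    moreover have "lincomb c us = lincomb (case_nat 0 c) (u # us)"
      unfolding lincomb_Cons by simp
    ultimately show "c i = 0" using Cons.prems(2)[of "case_nat 0 c" "Suc i"] by simp
  qed (use Cons.prems in auto)
  show ?case
    using ring.li_Cons[OF ring_hom_alg _ 1 2] Cons.prems(1) by (auto simp: carrier_hom_alg)
qed

text \<open>The passage from cosets to lifts: the bases below are established entirely by conditions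
  modulo the ideal on forms over Q.\<close>

lemma hom_basisI:
  assumes "\<And>u. u \<in> set us \<Longrightarrow> cycle u" "\<And>u. u \<in> set us \<Longrightarrow> hom_degree_form p u"
    "\<And>c i. bnd (lincomb c us) \<Longrightarrow> i < length us \<Longrightarrow> c i = 0"
    "\<And>u. cycle u \<Longrightarrow> hom_degree_form p u \<Longrightarrow> \<exists>c. bnd (\<lambda>S. u S - lincomb c us S)"
  shows "hom_basis \<aa> p (map kc us)"
proof -
  have "hom_degree_form p (lincomb c us)" for c
    using assms(2) by (auto simp: hom_degree_form_def lincomb_def intro!: sum.neutral)
  then have "kc (lincomb c us) \<in> hom_deg \<aa> p" for c
    unfolding hom_deg_eq using cycle_lincomb[OF assms(1)] by blast
  moreover have "kc u \<in> range (\<lambda>c. kc (lincomb c us))" if "cycle u" "hom_degree_form p u" for u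
    using assms(4)[OF that] unfolding kc_eq_iff[symmetric] by blast
  ultimately have "range (\<lambda>c. kc (lincomb c us)) = hom_deg \<aa> p"
    unfolding hom_deg_eq by blast
  moreover have "ring.independent (hom_alg \<aa>) (hom_scalars \<aa>) (map kc us)"
    by (rule independentI) (use assms in auto)
  ultimately show ?thesis
    unfolding hom_basis_def using Span_eq[of us] assms(1) by simp
qed

lemma has_type_of_basis: "hom_basis \<aa> 3 us \<Longrightarrow> has_type \<aa> (length us)"
  unfolding hom_basis_def has_type_def
  using ring.dimension_independent[OF ring_hom_alg] by metis

end

section \<open>Koszul relations over the power series ring\<close>

lemma varx_nonzero [simp]: "varx \<noteq> (0 :: 'k :: field pser3)"
  and vary_nonzero [simp]: "vary \<noteq> (0 :: 'k :: field pser3)"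
  and varz_nonzero [simp]: "varz \<noteq> (0 :: 'k :: field pser3)"
  by (simp_all add: varx_def vary_def varz_def)

text \<open>The right-hand side has no coordinate with b = 0, so every exponent of \<open>u\<close>
  contains y.\<close>

lemma vary_dvd:
  assumes "varx * u = vary * (v :: 'k :: field pser3)"
  obtains t where "u = vary * t" "v = varx * t"
proof -
  have "coef u a 0 j = 0" for a j
    using arg_cong[OF assms, of "\<lambda>f. coef f (Suc a) 0 j"] by simp
  then have "u = vary * el (\<lambda>a b j. coef u a (Suc b) j)"
    by (intro coef_eqI) auto
  then obtain t where t: "u = vary * t" by blast
  then have "vary * v = vary * (varx * t)" using assms by (simp add: mult_ac)
  then show thesis using that t by simp
qed

lemma koszul_exact_2:
  assumes "varx * p + vary * q = (0 :: 'k :: field pser3)"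
  obtains t where "p = - (vary * t)" "q = varx * t"
proof -
  have "varx * (- p) = vary * q" using assms by (simp add: add_eq_0_iff)
  then obtain t where "- p = vary * t" "q = varx * t" by (rule vary_dvd)
  then show thesis using that by (metis minus_minus)
qed

text \<open>Setting z = 0 leaves a relation between x and y alone, solved by
  \<open>koszul_exact_2\<close>. What remains of p and q is divisible by z, and cancelling z gives
  r.\<close>

lemma koszul_exact_1:
  assumes "varx * p + vary * q + varz * r = (0 :: 'k :: field pser3)"
  obtains A B C where "p = - (vary * A) - varz * B" "q = varx * A - varz * C" "r = varx * B + vary * C"
proof -
  have split: "f = fps_const (f !! 0) + varz * fps_shift 1 f" for f :: "'k pser3"
    by (simp add: fps_eq_iff varz_def)
  define P where "P = (fps_const (p !! 0) :: 'k pser3)"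
  define Q where "Q = (fps_const (q !! 0) :: 'k pser3)"
  have "varx * P + vary * Q = fps_const ((varx * p + vary * q + varz * r) !! 0)"
    by (simp add: P_def Q_def varx_def vary_def varz_def)
  then have "varx * P + vary * Q = 0" unfolding assms by simp
  then obtain A where A: "P = - (vary * A)" "Q = varx * A" by (rule koszul_exact_2)
  define B where "B = - fps_shift 1 p"
  define C where "C = - fps_shift 1 q"
  have p: "p = - (vary * A) - varz * B" using split[of p] A(1) by (simp add: P_def B_def)
  have q: "q = varx * A - varz * C" using split[of q] A(2) by (simp add: Q_def C_def)
  have "varz * r = varz * (varx * B + vary * C)"
    using assms unfolding p q by (simp add: algebra_simps eq_neg_iff_add_eq_0 add_eq_0_iff2)
  then have "r = varx * B + vary * C" by simp
  with p q show thesis by (rule that)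
qed

lemma koszul_exact_0:
  assumes "varx * b = vary * a" "varx * c = varz * (a :: 'k :: field pser3)"
  obtains t where "a = varx * t" "b = vary * t" "c = varz * t"
proof -
  obtain t where t: "b = vary * t" "a = varx * t" using assms(1) by (rule vary_dvd)
  have "varx * c = varx * (varz * t)" using assms(2) t by (simp add: mult_ac)
  then show thesis using that t by simp
qed

section \<open>Second homology and socle modulo the Pfaffian ideal\<close>

text \<open>
  The columns of the alternating middle matrix of the resolution of the Pfaffian ideal, lifted along
  the Koszul differential: \<open>syz_xy m k\<close>, \<open>syz_xz m k\<close>, \<open>syz_yz m k\<close> are the coefficients of a
  2-form, and \<open>lift_x m k\<close>, \<open>lift_y m k\<close>, \<open>lift_z m k\<close> those of a 1-form with differential \<open>gen m k\<close>.
\<close>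

definition syz_xy :: "nat \<Rightarrow> int \<Rightarrow> 'k :: field pser3" where
  "syz_xy m k = (if k > 0 then varx ^ nat k * ch (m - nat k) else vary ^ nat (- k) * ch (m - nat (- k)))"

definition syz_xz :: "nat \<Rightarrow> int \<Rightarrow> 'k :: field pser3" where
  "syz_xz m k = (if k > 0 then - (varx ^ (nat k - 1) * ch (Suc (m - nat k))) else 0)"

definition syz_yz :: "nat \<Rightarrow> int \<Rightarrow> 'k :: field pser3" where
  "syz_yz m k = (if k < 0 then vary ^ (nat (- k) - 1) * ch (Suc (m - nat (- k))) else 0)"

definition lift_x :: "nat \<Rightarrow> int \<Rightarrow> 'k :: field pser3" where
  "lift_x m k = (if k < 0 then varx ^ (nat (- k) - 1) * ch (Suc (m - nat (- k)))
    else if k = 0 then - (vary * ch (m - 1)) else 0)"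

definition lift_y :: "nat \<Rightarrow> int \<Rightarrow> 'k :: field pser3" where
  "lift_y m k = (if k > 0 then vary ^ (nat k - 1) * ch (Suc (m - nat k)) else 0)"

definition lift_z :: "nat \<Rightarrow> int \<Rightarrow> 'k :: field pser3" where
  "lift_z m k = (if k = 0 then ch m else 0)"

text \<open>Extension by zero, so that the formulas for the syzygies hold uniformly up to the ends
  of the index range.\<close>

definition gen0 :: "nat \<Rightarrow> int \<Rightarrow> 'k :: field pser3" where
  "gen0 m k = (if k \<in> {- int m..int m} then gen m k else 0)"

lemma index_cases [consumes 1, case_names pos neg zero]:
  assumes "k \<in> {- int m..int m}"
  obtains (pos) n t where "k = int (Suc n)" "m = Suc (n + t)"
    | (neg) n t where "k = - int (Suc n)" "m = Suc (n + t)"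
    | (zero) "k = 0"
proof -
  consider "k > 0" | "k < 0" | "k = 0" by linarith
  then show thesis
  proof cases
    case 1
    then have "k = int (Suc (nat k - 1))" "m = Suc (nat k - 1 + (m - nat k))" using assms by auto
    then show thesis by (rule pos)
  next
    case 2
    then have "k = - int (Suc (nat (- k) - 1))" "m = Suc (nat (- k) - 1 + (m - nat (- k)))" using assms by auto
    then show thesis by (rule neg)
  qed (rule zero)
qed

text \<open>For k different from 0 one factor x or y is split off the generator. For k = 0 the
  recursion D_m = z D_{m-1} - x y D_{m-2} is used, with its second term assigned to x.\<close>

lemma lift_diff:
  assumes "1 \<le> m" "k \<in> {- int m..int m}"
  shows "varx * lift_x m k + vary * lift_y m k + varz * lift_z m k = (gen m k :: 'k :: field pser3)"
  using assms(2)
proof (cases rule: index_cases)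
  case (pos n t)
  then have k: "nat k = Suc n" "nat (- k) = 0" "nat \<bar>k\<bar> = Suc n" "k > 0" by auto
  show ?thesis unfolding gen_def lift_x_def lift_y_def lift_z_def k(1-3) pos(2) using k(4) by simp
next
  case (neg n t)
  then have k: "nat (- k) = Suc n" "nat k = 0" "nat \<bar>k\<bar> = Suc n" "k < 0" by auto
  show ?thesis unfolding gen_def lift_x_def lift_y_def lift_z_def k(1-3) neg(2) using k(4) by simp
next
  case zero
  obtain n where "m = Suc n" using assms(1) by (cases m) auto
  then show ?thesis using zero
    by (simp add: lift_x_def lift_y_def lift_z_def gen_def algebra_simps)
qed

text \<open>Again the recursion of \<open>ch\<close>. The entries of the differential are plus or
  minus single generators, with indices 1 - k, -1 - k and, for k different from 0, -k. Hence the
  k-th 2-form is a cycle modulo the Pfaffian ideal, and the trimming destroys it only if k0 is one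
  of these indices.\<close>

lemma syz_diff:
  assumes "1 \<le> m" "k \<in> {- int m..int m}"
  shows "- (vary * syz_xy m k) - varz * syz_xz m k =
      (if k > 0 then gen0 m (1 - k) else - gen0 m (1 - k) :: 'k :: field pser3)" (is ?A)
    and "varx * syz_xy m k - varz * syz_yz m k =
      (if k \<ge> 0 then gen0 m (- 1 - k) else - gen0 m (- 1 - k) :: 'k pser3)" (is ?B)
    and "varx * syz_xz m k + vary * syz_yz m k =
      (if k = 0 then 0 else if k > 0 then - gen0 m (- k) else gen0 m (- k) :: 'k pser3)" (is ?C)
proof -
  have "?A \<and> ?B \<and> ?C"
    using assms(2)
  proof (cases rule: index_cases)
    case (pos n t)
    have 1: "gen0 m (1 - k) = (varx ^ n * ch (Suc (Suc t)) :: 'k pser3)"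
    proof -
      have "1 - k = - int n" using pos by simp
      then show ?thesis using gen_nonpos[of m n, where 'k = 'k] pos by (simp add: gen0_def del: ch.simps)
    qed
    have 2: "gen0 m (- 1 - k) = (varx ^ Suc (Suc n) * ch t :: 'k pser3)"
    proof (cases t)
      case 0
      then show ?thesis using pos by (simp add: gen0_def)
    next
      case (Suc t')
      have "- 1 - k = - int (Suc (Suc n))" using pos by simp
      then show ?thesis using gen_nonpos[of m "Suc (Suc n)", where 'k = 'k] pos Suc
        by (simp add: gen0_def del: ch.simps)
    qed
    have 3: "gen0 m (- k) = (varx ^ Suc n * ch (Suc t) :: 'k pser3)"
      using gen_nonpos[of m "Suc n", where 'k = 'k] pos by (simp add: gen0_def del: ch.simps)
    have s: "syz_xy m k = (varx ^ Suc n * ch t :: 'k pser3)"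
      "syz_xz m k = (- (varx ^ n * ch (Suc t)) :: 'k pser3)" "syz_yz m k = (0 :: 'k pser3)"
    proof -
      have k: "nat k = Suc n" "k > 0" using pos by auto
      show "syz_xy m k = (varx ^ Suc n * ch t :: 'k pser3)"
        "syz_xz m k = (- (varx ^ n * ch (Suc t)) :: 'k pser3)" "syz_yz m k = (0 :: 'k pser3)"
        unfolding syz_xy_def syz_xz_def syz_yz_def k(1) pos(2) using k(2) by simp_all
    qed
    show ?thesis
      unfolding 1 2 3 s using pos(1) by (simp add: algebra_simps)
  next
    case (neg n t)
    have 1: "gen0 m (- 1 - k) = (vary ^ n * ch (Suc (Suc t)) :: 'k pser3)"
    proof -
      have "- 1 - k = int n" using neg by simp
      then show ?thesis using gen_nonneg[of m n, where 'k = 'k] neg by (simp add: gen0_def del: ch.simps)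
    qed
    have 2: "gen0 m (1 - k) = (vary ^ Suc (Suc n) * ch t :: 'k pser3)"
    proof (cases t)
      case 0
      then show ?thesis using neg by (simp add: gen0_def)
    next
      case (Suc t')
      have "1 - k = int (Suc (Suc n))" using neg by simp
      then show ?thesis using gen_nonneg[of m "Suc (Suc n)", where 'k = 'k] neg Suc
        by (simp add: gen0_def del: ch.simps)
    qed
    have 3: "gen0 m (- k) = (vary ^ Suc n * ch (Suc t) :: 'k pser3)"
      using gen_nonneg[of m "Suc n", where 'k = 'k] neg by (simp add: gen0_def add.commute del: ch.simps)
    have s: "syz_xy m k = (vary ^ Suc n * ch t :: 'k pser3)"
      "syz_yz m k = (vary ^ n * ch (Suc t) :: 'k pser3)" "syz_xz m k = (0 :: 'k pser3)"
    proof -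
      have k: "nat (- k) = Suc n" "k < 0" using neg by auto
      show "syz_xy m k = (vary ^ Suc n * ch t :: 'k pser3)"
        "syz_yz m k = (vary ^ n * ch (Suc t) :: 'k pser3)" "syz_xz m k = (0 :: 'k pser3)"
        unfolding syz_xy_def syz_xz_def syz_yz_def k(1) neg(2) using k(2) by simp_all
    qed
    show ?thesis
      unfolding 1 2 3 s using neg(1) by (simp add: algebra_simps)
  next
    case zero
    obtain n where m: "m = Suc n" using assms(1) by (cases m) auto
    have "gen0 m 1 = (vary * ch m :: 'k pser3)" "gen0 m (- 1) = (varx * ch m :: 'k pser3)"
      using gen_nonneg[of m 1, where 'k = 'k] gen_nonpos[of m 1, where 'k = 'k] m
      by (simp_all add: gen0_def del: ch.simps)
    then show ?thesis using zero
      by (simp add: syz_xy_def syz_xz_def syz_yz_def del: ch.simps)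
  qed
  then show ?A ?B ?C by auto
qed

lemma gen0_above: "gen0 m k \<in> supp_in (above m)"
  by (simp add: gen0_def gen_mem_above)

lemma supp_in_iff: "f \<in> supp_in W \<longleftrightarrow> (\<forall>a b j. \<not> W a b j \<longrightarrow> coef f a b j = 0)"
  unfolding supp_in_def by auto

lemma coef_vary_power_one:
  "coef (vary ^ n) a b j = (if a = 0 \<and> b = n \<and> j = 0 then 1 else (0 :: 'k :: field))"
proof -
  have "coef (vary ^ n * 1) a b j = (if a = 0 \<and> b = n \<and> j = 0 then 1 else (0 :: 'k))"
    unfolding coef_vary_power coef_one by auto
  then show ?thesis by simp
qed

text \<open>Outside the Pfaffian ideal, the conditions for x and y leave only coordinates with a = b
  and a + j = m - 1; the condition for z removes those with j > 0.\<close>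

lemma socle_above:
  assumes "varx * w \<in> supp_in (above m)" "vary * w \<in> supp_in (above m)" "varz * w \<in> supp_in (above m)"
  shows "w - const3 (coef w (m - 1) (m - 1) 0) * (varx ^ (m - 1) * vary ^ (m - 1)) \<in> supp_in (above m)"
proof -
  have x: "coef w a b j = 0" if "max (Suc a) b + j < m" for a b j
    using assms(1) that unfolding supp_in_iff above_def by (drule_tac spec[of _ "Suc a"]) (auto simp: not_le)
  have y: "coef w a b j = 0" if "max a (Suc b) + j < m" for a b j
    using assms(2) that unfolding supp_in_iff above_def
    by (drule_tac spec[of _ a], drule_tac spec[of _ "Suc b"]) (auto simp: not_le)
  have z: "coef (varz * w) a b j = 0" if "max a b + j < m" for a b j
    using assms(3) that unfolding supp_in_iff above_def by (auto simp: not_le)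
  have main: "coef w a b j = 0" if "max a b + j < m" "\<not> (a = m - 1 \<and> b = m - 1 \<and> j = 0)" for a b j
  proof (cases "a = b \<and> Suc (a + j) = m")
    case True
    then have "j \<noteq> 0" using that by auto
    then obtain j' where j: "j = Suc j'" by (cases j) auto
    have "coef w (Suc a) (Suc a) (j' - 1) = 0" if "j' \<noteq> 0"
      by (rule x) (use that True j in auto)
    \<comment> \<open>The coordinate of z w at (a + 1, a + 1, j - 1) is the sum of the one of w at
      (a, a, j) and one that already vanishes by the condition for x.\<close>
    then show ?thesis using z[of "Suc a" "Suc a" j'] True j by (auto split: if_splits)
  next
    case False
    then show ?thesis using x[of a b j] y[of a b j] that(1) by (cases "a < b"; cases "b < a") (auto simp: max_def split: if_splits)
  qed
  have e: "a = m - Suc 0" if "\<not> a < m - Suc 0" "a < m" for a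
    using that by linarith
  show ?thesis
    unfolding supp_in_iff above_def by (auto simp: main not_le coef_vary_power_one) (metis e)
qed

text \<open>The class of the 2-form with entries a, b, c in the second Koszul homology modulo the
  Pfaffian ideal is spanned by the syzygy classes; \<open>w\<close> is the coefficient of the 3-form
  that provides the boundary.\<close>

definition h2_spanned :: "nat \<Rightarrow> 'k :: field pser3 \<Rightarrow> 'k pser3 \<Rightarrow> 'k pser3 \<Rightarrow> bool" where
  "h2_spanned m a b c \<longleftrightarrow> (\<exists>\<gamma> w.
     a - (\<Sum>k\<in>{- int m..int m}. const3 (\<gamma> k) * syz_xy m k) - varz * w \<in> supp_in (above m) \<and>
     b - (\<Sum>k\<in>{- int m..int m}. const3 (\<gamma> k) * syz_xz m k) + vary * w \<in> supp_in (above m) \<and>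
     c - (\<Sum>k\<in>{- int m..int m}. const3 (\<gamma> k) * syz_yz m k) - varx * w \<in> supp_in (above m))"

section \<open>The syzygies span the second homology modulo the Pfaffian ideal\<close>

lemma const3_add: "const3 (a + b) = const3 a + const3 b"
  by (simp add: const3_def)

lemma const3_zero: "const3 0 = 0" and const3_one: "const3 1 = 1"
  by (simp_all add: const3_def)

lemma h2_spanned_add:
  assumes "h2_spanned m a b c" "h2_spanned m a' b' c'"
  shows "h2_spanned m (a + a') (b + b') (c + c')"
proof -
  obtain g w where 1: "a - (\<Sum>k\<in>{- int m..int m}. const3 (g k) * syz_xy m k) - varz * w \<in> supp_in (above m)"
     "b - (\<Sum>k\<in>{- int m..int m}. const3 (g k) * syz_xz m k) + vary * w \<in> supp_in (above m)"
     "c - (\<Sum>k\<in>{- int m..int m}. const3 (g k) * syz_yz m k) - varx * w \<in> supp_in (above m)"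
    using assms(1) unfolding h2_spanned_def by blast
  obtain g' w' where 2: "a' - (\<Sum>k\<in>{- int m..int m}. const3 (g' k) * syz_xy m k) - varz * w' \<in> supp_in (above m)"
     "b' - (\<Sum>k\<in>{- int m..int m}. const3 (g' k) * syz_xz m k) + vary * w' \<in> supp_in (above m)"
     "c' - (\<Sum>k\<in>{- int m..int m}. const3 (g' k) * syz_yz m k) - varx * w' \<in> supp_in (above m)"
    using assms(2) unfolding h2_spanned_def by blast
  have s: "(\<Sum>k\<in>{- int m..int m}. const3 (g k + g' k) * f k) =
      (\<Sum>k\<in>{- int m..int m}. const3 (g k) * f k) + (\<Sum>k\<in>{- int m..int m}. const3 (g' k) * f k)" for f
    by (simp add: const3_add distrib_right sum.distrib)
  show ?thesis
    unfolding h2_spanned_def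
  proof (intro exI conjI)
    show "a + a' - (\<Sum>k\<in>{- int m..int m}. const3 (g k + g' k) * syz_xy m k) - varz * (w + w') \<in> supp_in (above m)"
      using supp_in_add[OF 1(1) 2(1)] unfolding s by (simp add: algebra_simps)
    show "b + b' - (\<Sum>k\<in>{- int m..int m}. const3 (g k + g' k) * syz_xz m k) + vary * (w + w') \<in> supp_in (above m)"
      using supp_in_add[OF 1(2) 2(2)] unfolding s by (simp add: algebra_simps)
    show "c + c' - (\<Sum>k\<in>{- int m..int m}. const3 (g k + g' k) * syz_yz m k) - varx * (w + w') \<in> supp_in (above m)"
      using supp_in_add[OF 1(3) 2(3)] unfolding s by (simp add: algebra_simps)
  qed
qed

lemma h2_spanned_above:
  "a \<in> supp_in (above m) \<Longrightarrow> b \<in> supp_in (above m) \<Longrightarrow> c \<in> supp_in (above m) \<Longrightarrow> h2_spanned m a b c"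
  unfolding h2_spanned_def by (rule exI[of _ "\<lambda>_. 0"], rule exI[of _ 0]) (simp add: const3_zero)

lemma h2_spanned_boundary: "h2_spanned m (varz * w) (- (vary * w)) (varx * w)"
  unfolding h2_spanned_def by (rule exI[of _ "\<lambda>_. 0"], rule exI[of _ w]) (simp add: const3_zero)

lemma h2_spanned_syz:
  assumes "k \<in> {- int m..int m}"
  shows "h2_spanned m (const3 g * syz_xy m k) (const3 g * syz_xz m k) (const3 g * syz_yz m k)"
proof -
  have "(\<Sum>l\<in>{- int m..int m}. const3 (if l = k then g else 0) * f l) = const3 g * f k" for f
  proof -
    have "(\<Sum>l\<in>{- int m..int m}. const3 (if l = k then g else 0) * f l) =
        (\<Sum>l\<in>{- int m..int m}. if l = k then const3 g * f k else 0)"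
      by (rule sum.cong) (auto simp: const3_zero)
    then show ?thesis using assms by simp
  qed
  then show ?thesis
    unfolding h2_spanned_def by (intro exI[of _ "\<lambda>l. if l = k then g else 0"] exI[of _ 0]) simp
qed

lemma h2_spanned_sum:
  assumes "finite K" "\<And>k. k \<in> K \<Longrightarrow> h2_spanned m (a k) (b k) (c k)"
  shows "h2_spanned m (\<Sum>k\<in>K. a k) (\<Sum>k\<in>K. b k) (\<Sum>k\<in>K. c k)"
  using assms by (induction K rule: finite_induct) (auto intro: h2_spanned_above h2_spanned_add)

lemma sum_vary_ch:
  "(\<Sum>l\<in>{1..m}. const3 (\<gamma> l) * (vary ^ (l - 1) * ch (Suc (m - l)))) =
    el (\<lambda>a b j. if a = 0 \<and> Suc (b + j) = m then \<gamma> (Suc b) else 0)"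
proof (rule coef_eqI)
  fix a b j
  have "coef (\<Sum>l\<in>{1..m}. const3 (\<gamma> l) * (vary ^ (l - 1) * ch (Suc (m - l)))) a b j =
      (\<Sum>l\<in>{1..m}. if l = Suc b then (if a = 0 \<and> Suc (b + j) = m then \<gamma> (Suc b) else 0) else 0)"
    unfolding coef_sum by (rule sum.cong) auto
  then show "coef (\<Sum>l\<in>{1..m}. const3 (\<gamma> l) * (vary ^ (l - 1) * ch (Suc (m - l)))) a b j =
      coef (el (\<lambda>a b j. if a = 0 \<and> Suc (b + j) = m then \<gamma> (Suc b) else 0)) a b j"
    by (simp add: sum.delta)
qed

lemma sum_varx_ch:
  "(\<Sum>l\<in>{1..m}. const3 (\<gamma> l) * (varx ^ (l - 1) * ch (Suc (m - l)))) =
    el (\<lambda>a b j. if b = 0 \<and> Suc (a + j) = m then \<gamma> (Suc a) else 0)"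
proof (rule coef_eqI)
  fix a b j
  have "coef (\<Sum>l\<in>{1..m}. const3 (\<gamma> l) * (varx ^ (l - 1) * ch (Suc (m - l)))) a b j =
      (\<Sum>l\<in>{1..m}. if l = Suc a then (if b = 0 \<and> Suc (a + j) = m then \<gamma> (Suc a) else 0) else 0)"
    unfolding coef_sum by (rule sum.cong) auto
  then show "coef (\<Sum>l\<in>{1..m}. const3 (\<gamma> l) * (varx ^ (l - 1) * ch (Suc (m - l)))) a b j =
      coef (el (\<lambda>a b j. if b = 0 \<and> Suc (a + j) = m then \<gamma> (Suc a) else 0)) a b j"
    by (simp add: sum.delta)
qed

text \<open>
  Reduction of a 2-cycle \<open>(a, b, c)\<close>: boundaries make \<open>c\<close> independent of \<open>x\<close>, and then \<open>c\<close>, \<open>b\<close> and \<open>a\<close>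
  are in turn reduced to zero by the syzygies with negative, positive and zero index and by boundaries
  of multiples of elements annihilated by \<open>x\<close>, respectively by \<open>x\<close> and \<open>y\<close>.
\<close>

lemma h2_spanned_step3:
  assumes m: "1 \<le> m" and a: "varx * a \<in> supp_in (above m)" "vary * a \<in> supp_in (above m)"
  shows "h2_spanned m a 0 (0 :: 'k :: field pser3)"
proof -
  let ?A = "supp_in (above m) :: 'k pser3 set"
  have x: "coef a i j l = 0" if "max (Suc i) j + l < m" for i j l
    using a(1) that unfolding supp_in_iff above_def by (drule_tac spec[of _ "Suc i"]) (auto simp: not_le)
  have y: "coef a i j l = 0" if "max i (Suc j) + l < m" for i j l
    using a(2) that unfolding supp_in_iff above_def
    by (drule_tac spec[of _ i], drule_tac spec[of _ "Suc j"]) (auto simp: not_le)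
  \<comment> \<open>The relevant coordinates of \<open>a\<close> lie at (i, i, l) with i + l = m -
    1. For i > 0 each is produced by z from (i - 1, i - 1, l + 1), whose other image under z lies in
    the Pfaffian ideal. The one at (0, 0, m - 1) is left to \<open>syz_xy m 0\<close>, which is
    D_{m-1}.\<close>
  define w where "w = el (\<lambda>i j l. if i = j \<and> Suc (i + l) = m \<and> l \<noteq> 0 then coef a (Suc i) (Suc j) (l - 1) else 0)"
  have zero: "coef a i j l = 0" if "max i j + l < m" "\<not> (i = j \<and> Suc (i + l) = m)" for i j l
    using x[of i j l] y[of i j l] that by (cases "i < j"; cases "j < i") (auto simp: max_def split: if_splits)
  have 1: "a - const3 (coef a 0 0 (m - 1)) * syz_xy m 0 - varz * w \<in> ?A"
    unfolding supp_in_iff above_def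
  proof (intro allI impI)
    fix i j l assume *: "\<not> m \<le> max i j + l"
    obtain m' where m': "m = Suc m'" using m by (cases m) auto
    show "coef (a - const3 (coef a 0 0 (m - 1)) * syz_xy m 0 - varz * w) i j l = 0"
      using * zero[of i j l] unfolding m'
      by (cases i; cases j; cases l) (auto simp: w_def syz_xy_def m' not_le)
  qed
  have 2: "varx * w \<in> ?A" "vary * w \<in> ?A"
    unfolding supp_in_iff above_def by (auto simp: w_def not_le)
  have "h2_spanned m (const3 (coef a 0 0 (m - 1)) * syz_xy m 0 + varz * w + (a - const3 (coef a 0 0 (m - 1)) * syz_xy m 0 - varz * w))
      (const3 (coef a 0 0 (m - 1)) * syz_xz m 0 + (- (vary * w)) + vary * w)
      (const3 (coef a 0 0 (m - 1)) * syz_yz m 0 + varx * w + (- (varx * w)))"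
    by (intro h2_spanned_add h2_spanned_syz h2_spanned_boundary h2_spanned_above supp_in_uminus 1 2) simp
  then show ?thesis by (simp add: syz_xz_def syz_yz_def)
qed

lemma h2_spanned_step2:
  assumes m: "1 \<le> m" and ab: "varx * a \<in> supp_in (above m)" "varx * b \<in> supp_in (above m)"
    "vary * a + varz * b \<in> supp_in (above m)"
  shows "h2_spanned m a b (0 :: 'k :: field pser3)"
proof -
  let ?A = "supp_in (above m) :: 'k pser3 set"
  have x: "coef b i j l = 0" if "max (Suc i) j + l < m" for i j l
    using ab(2) that unfolding supp_in_iff above_def by (drule_tac spec[of _ "Suc i"]) (auto simp: not_le)
  \<comment> \<open>Chosen so that \<open>vary * w\<close> cancels the coordinates of
    \<open>b\<close> that contain y, while \<open>varx * w\<close> stays in the Pfaffian ideal. The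
    remaining coordinates belong to x^i D_l with i + l = m - 1, the entries of the syzygies with
    positive index up to sign; hence the minus sign in \<open>\<beta>\<close>.\<close>
  define w where "w = el (\<lambda>i j l. if \<not> above m i (Suc j) l then - coef b i (Suc j) l else 0)"
  define \<beta> where "\<beta> k = - coef b (k - 1) 0 (m - k)" for k
  define S where "S f = (\<Sum>k\<in>{1..m}. const3 (\<beta> k) * f m (int k))" for f :: "nat \<Rightarrow> int \<Rightarrow> 'k pser3"
  have syz: "syz_xz m (int k) = - (varx ^ (k - 1) * (ch (Suc (m - k)) :: 'k pser3))" "syz_yz m (int k) = (0 :: 'k pser3)"
    if "k \<in> {1..m}" for k
    using that by (simp_all add: syz_xz_def syz_yz_def)
  have Sxz: "S syz_xz = - el (\<lambda>i j l. if j = 0 \<and> Suc (i + l) = m then \<beta> (Suc i) else 0)"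
    unfolding S_def sum_varx_ch[symmetric] sum_negf[symmetric] by (rule sum.cong) (simp_all add: syz)
  have Syz: "S syz_yz = 0" unfolding S_def by (rule sum.neutral) (simp add: syz)
  have x_w: "varx * w \<in> ?A"
    unfolding supp_in_iff
  proof (intro allI impI)
    fix i j l assume *: "\<not> above m i j l"
    show "coef (varx * w) i j l = 0"
    proof (cases i)
      case (Suc i')
      have "\<not> above m i' (Suc j) l \<Longrightarrow> coef b i' (Suc j) l = 0"
        by (rule x) (use * Suc in \<open>auto simp: above_def max_def split: if_splits\<close>)
      then show ?thesis using Suc by (simp add: w_def)
    qed simp
  qed
  have 1: "b - S syz_xz + vary * w \<in> ?A"
    unfolding supp_in_iff above_def
  proof (intro allI impI)
    fix i j l assume *: "\<not> m \<le> max i j + l"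
    show "coef (b - S syz_xz + vary * w) i j l = 0"
    proof (cases j)
      case 0
      have "Suc (i + l) \<noteq> m \<Longrightarrow> coef b i 0 l = 0" by (rule x) (use * 0 in auto)
      moreover have "Suc (i + l) = m \<Longrightarrow> \<beta> (Suc i) = - coef b i 0 l"
        unfolding \<beta>_def by (rule arg_cong[of _ _ uminus]) (simp, metis add_diff_cancel_left' add_Suc)
      ultimately show ?thesis using 0 unfolding Sxz by auto
    next
      case (Suc j')
      then show ?thesis using * unfolding Sxz by (simp add: w_def above_def)
    qed
  qed
  define a' where "a' = a - S syz_xy - varz * w"
  have diffS: "varx * S syz_xy \<in> ?A" "vary * S syz_xy + varz * S syz_xz \<in> ?A"
  proof -
    have k: "int k \<in> {- int m..int m}" if "k \<in> {1..m}" for k using that by auto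
    have "varx * S syz_xy = (\<Sum>k\<in>{1..m}. const3 (\<beta> k) * gen0 m (- 1 - int k))"
      unfolding S_def sum_distrib_left
    proof (rule sum.cong)
      fix k assume "k \<in> {1..m}"
      then show "varx * (const3 (\<beta> k) * syz_xy m (int k)) = const3 (\<beta> k) * gen0 m (- 1 - int k)"
        using syz_diff(2)[OF m k[of k], where 'k = 'k] by (simp add: syz mult.left_commute)
    qed simp
    then show "varx * S syz_xy \<in> ?A"
      by (simp add: ideal_sum[OF supp_in_ideal[OF stable_above]] supp_in_mult[OF stable_above] gen0_above)
    have "vary * S syz_xy + varz * S syz_xz = (\<Sum>k\<in>{1..m}. const3 (\<beta> k) * - gen0 m (1 - int k))"
      unfolding S_def sum_distrib_left sum.distrib[symmetric]
    proof (rule sum.cong)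
      fix k assume "k \<in> {1..m}"
      then have "- (vary * syz_xy m (int k)) - varz * syz_xz m (int k) = (gen0 m (1 - int k) :: 'k pser3)"
        using syz_diff(1)[OF m k[of k], where 'k = 'k] by simp
      then have "- gen0 m (1 - int k) = vary * syz_xy m (int k) + varz * (syz_xz m (int k) :: 'k pser3)"
        by (metis add_uminus_conv_diff minus_add_distrib minus_minus)
      then show "vary * (const3 (\<beta> k) * syz_xy m (int k)) + varz * (const3 (\<beta> k) * syz_xz m (int k)) =
          const3 (\<beta> k) * - gen0 m (1 - int k)"
        by (simp only: distrib_left mult.left_commute)
    qed simp
    then show "vary * S syz_xy + varz * S syz_xz \<in> ?A"
      by (simp only: ideal_sum[OF supp_in_ideal[OF stable_above]] supp_in_mult[OF stable_above]
        supp_in_uminus gen0_above)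
  qed
  note i = supp_in_ideal[OF stable_above[of m], where 'a = 'k]
  have xa: "varx * a' \<in> ?A"
  proof -
    have "varx * a' = varx * a - varx * S syz_xy - varz * (varx * w)"
      by (simp add: a'_def algebra_simps)
    then show ?thesis
      by (simp only: ideal_diff[OF i] ideal_mult[OF i] ab(1) diffS(1) x_w)
  qed
  have ya: "vary * a' \<in> ?A"
  proof -
    have "vary * a' = (vary * a + varz * b) - (vary * S syz_xy + varz * S syz_xz) - varz * (b - S syz_xz + vary * w)"
      by (simp add: a'_def algebra_simps)
    then show ?thesis
      by (simp only: ideal_diff[OF i] ideal_mult[OF i] ab(3) diffS(2) 1)
  qed
  have "h2_spanned m (S syz_xy) (S syz_xz) (S syz_yz)"
    unfolding S_def by (rule h2_spanned_sum) (auto intro!: h2_spanned_syz)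
  moreover have "h2_spanned m 0 (b - S syz_xz + vary * w) (- (varx * w))"
    by (intro h2_spanned_above 1 supp_in_uminus x_w) simp
  ultimately have "h2_spanned m (S syz_xy + varz * w + 0 + a') (S syz_xz + (- (vary * w)) + (b - S syz_xz + vary * w) + 0)
      (S syz_yz + varx * w + (- (varx * w)) + 0)"
    by (intro h2_spanned_add[OF h2_spanned_add[OF h2_spanned_add[OF _ h2_spanned_boundary]] h2_spanned_step3[OF m xa ya]])
  then show ?thesis by (simp add: Syz a'_def)
qed

lemma h2_spanned_cycle:
  assumes m: "1 \<le> m" and cyc: "vary * a + varz * b \<in> supp_in (above m)" "varx * a - varz * c \<in> supp_in (above m)"
    "varx * b + vary * c \<in> supp_in (above m)"
  shows "h2_spanned m a b (c :: 'k :: field pser3)"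
proof -
  let ?A = "supp_in (above m) :: 'k pser3 set"
  note i = supp_in_ideal[OF stable_above[of m], where 'a = 'k]
  \<comment> \<open>The quotient of \<open>c\<close> by x, so that \<open>c1\<close> is free of
    x.\<close>
  define w where "w = el (\<lambda>i j l. coef c (Suc i) j l)"
  define c1 where "c1 = c - varx * w"
  define b1 where "b1 = b + vary * w"
  have c1: "coef c1 i j l = (if i = 0 then coef c 0 j l else 0)" for i j l
    by (auto simp: c1_def w_def)
  have "varx * b1 + vary * c1 = varx * b + vary * c" by (simp add: b1_def c1_def algebra_simps)
  then have bc: "varx * b1 + vary * c1 \<in> ?A" using cyc(3) by simp
  \<comment> \<open>The exponents of \<open>varx * b1\<close> contain x and those of
    \<open>vary * c1\<close> do not, so membership of the sum passes to both summands.\<close>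
  have yc1: "vary * c1 \<in> ?A"
    unfolding supp_in_iff
  proof (intro allI impI)
    fix i j l assume "\<not> above m i j l"
    then have "coef (varx * b1 + vary * c1) i j l = 0" using bc unfolding supp_in_iff by blast
    then show "coef (vary * c1) i j l = 0" by (cases i) (auto simp: c1)
  qed
  have xb1: "varx * b1 \<in> ?A" using ideal_diff[OF i bc yc1] by simp
  define \<gamma> where "\<gamma> k = coef c 0 (k - 1) (m - k)" for k
  define S where "S f = (\<Sum>k\<in>{1..m}. const3 (\<gamma> k) * f m (- int k))" for f :: "nat \<Rightarrow> int \<Rightarrow> 'k pser3"
  have syz: "syz_yz m (- int k) = vary ^ (k - 1) * (ch (Suc (m - k)) :: 'k pser3)" "syz_xz m (- int k) = (0 :: 'k pser3)"
    if "k \<in> {1..m}" for k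
    using that by (simp_all add: syz_xz_def syz_yz_def)
  have Syz: "S syz_yz = el (\<lambda>i j l. if i = 0 \<and> Suc (j + l) = m then \<gamma> (Suc j) else 0)"
    unfolding S_def sum_vary_ch[symmetric] by (rule sum.cong) (simp_all add: syz)
  have Sxz: "S syz_xz = 0" unfolding S_def by (rule sum.neutral) (simp add: syz)
  have 1: "c1 - S syz_yz \<in> ?A"
    unfolding supp_in_iff above_def
  proof (intro allI impI)
    fix i j l assume *: "\<not> m \<le> max i j + l"
    have "coef c1 0 j l = 0" if "Suc (j + l) < m"
      using yc1 that unfolding supp_in_iff above_def
      by (drule_tac spec[of _ 0], drule_tac spec[of _ "Suc j"]) (auto simp: not_le)
    moreover have "Suc (j + l) = m \<Longrightarrow> \<gamma> (Suc j) = coef c 0 j l"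
      unfolding \<gamma>_def by (simp, metis add_diff_cancel_left' add_Suc)
    ultimately show "coef (c1 - S syz_yz) i j l = 0"
      using * unfolding Syz by (cases i; cases "Suc (j + l) = m") (auto simp: c1)
  qed
  have k: "- int k \<in> {- int m..int m}" if "k \<in> {1..m}" for k using that by auto
  have diffS: "vary * S syz_xy \<in> ?A" "varx * S syz_xy - varz * S syz_yz \<in> ?A"
  proof -
    have "vary * S syz_xy = (\<Sum>k\<in>{1..m}. const3 (\<gamma> k) * gen0 m (1 + int k))"
      unfolding S_def sum_distrib_left
    proof (rule sum.cong)
      fix k assume "k \<in> {1..m}"
      then show "vary * (const3 (\<gamma> k) * syz_xy m (- int k)) = const3 (\<gamma> k) * gen0 m (1 + int k)"
        using syz_diff(1)[OF m k[of k], where 'k = 'k] by (simp add: syz mult.left_commute)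
    qed simp
    then show "vary * S syz_xy \<in> ?A"
      by (simp add: ideal_sum[OF i] supp_in_mult[OF stable_above] gen0_above)
    have "varx * S syz_xy - varz * S syz_yz = (\<Sum>k\<in>{1..m}. const3 (\<gamma> k) * - gen0 m (int k - 1))"
      unfolding S_def sum_distrib_left sum_subtractf[symmetric]
    proof (rule sum.cong)
      fix k assume "k \<in> {1..m}"
      then have "varx * syz_xy m (- int k) - varz * syz_yz m (- int k) = (- gen0 m (int k - 1) :: 'k pser3)"
        using syz_diff(2)[OF m k[of k], where 'k = 'k] by simp
      then show "varx * (const3 (\<gamma> k) * syz_xy m (- int k)) - varz * (const3 (\<gamma> k) * syz_yz m (- int k)) =
          const3 (\<gamma> k) * - gen0 m (int k - 1)"
        by (simp only: mult.left_commute[of varx] mult.left_commute[of varz] right_diff_distrib[symmetric])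
    qed simp
    then show "varx * S syz_xy - varz * S syz_yz \<in> ?A"
      by (simp only: ideal_sum[OF i] supp_in_mult[OF stable_above] supp_in_uminus gen0_above)
  qed
  define a1 where "a1 = a - S syz_xy - varz * w"
  have xa: "varx * a1 \<in> ?A"
  proof -
    have "varx * a1 = (varx * a - varz * c) - (varx * S syz_xy - varz * S syz_yz) + varz * (c1 - S syz_yz)"
      by (simp add: a1_def c1_def algebra_simps)
    then show ?thesis by (simp only: ideal_diff[OF i] ideal_add[OF i] ideal_mult[OF i] cyc(2) diffS(2) 1)
  qed
  have ya: "vary * a1 + varz * b1 \<in> ?A"
  proof -
    have "vary * a1 + varz * b1 = (vary * a + varz * b) - vary * S syz_xy"
      by (simp add: a1_def b1_def algebra_simps)
    then show ?thesis by (simp only: ideal_diff[OF i] cyc(1) diffS(1))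
  qed
  have "h2_spanned m (S syz_xy) (S syz_xz) (S syz_yz)"
    unfolding S_def by (rule h2_spanned_sum) (auto intro!: h2_spanned_syz)
  moreover have "h2_spanned m 0 0 (c1 - S syz_yz)"
    by (intro h2_spanned_above 1) simp_all
  ultimately have "h2_spanned m (S syz_xy + varz * w + 0 + a1) (S syz_xz + (- (vary * w)) + 0 + b1)
      (S syz_yz + varx * w + (c1 - S syz_yz) + 0)"
    by (intro h2_spanned_add[OF h2_spanned_add[OF h2_spanned_add[OF _ h2_spanned_boundary]] h2_spanned_step2[OF m xa xb1 ya]])
  then show ?thesis by (simp add: Sxz a1_def b1_def c1_def)
qed

section \<open>Homogeneous forms and their classes\<close>

text \<open>The supports are encoded by membership tests, which the simplifier evaluates.\<close>

definition form1 :: "'k :: field pser3 \<Rightarrow> 'k pser3 \<Rightarrow> 'k pser3 \<Rightarrow> 'k form" where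
  "form1 p q r = (\<lambda>S. if S \<subseteq> {..<3} then
     if 0 \<in> S \<and> 1 \<notin> S \<and> 2 \<notin> S then p else if 0 \<notin> S \<and> 1 \<in> S \<and> 2 \<notin> S then q
     else if 0 \<notin> S \<and> 1 \<notin> S \<and> 2 \<in> S then r else 0 else 0)"

definition form2 :: "'k :: field pser3 \<Rightarrow> 'k pser3 \<Rightarrow> 'k pser3 \<Rightarrow> 'k form" where
  "form2 a b c = (\<lambda>S. if S \<subseteq> {..<3} then
     if 0 \<in> S \<and> 1 \<in> S \<and> 2 \<notin> S then a else if 0 \<in> S \<and> 1 \<notin> S \<and> 2 \<in> S then b
     else if 0 \<notin> S \<and> 1 \<in> S \<and> 2 \<in> S then c else 0 else 0)"

definition form3 :: "'k :: field pser3 \<Rightarrow> 'k form" where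
  "form3 t = (\<lambda>S. if S \<subseteq> {..<3} \<and> 0 \<in> S \<and> 1 \<in> S \<and> 2 \<in> S then t else 0)"

lemma form_components [simp]:
  "form1 p q r {} = 0" "form1 p q r {0} = p" "form1 p q r {Suc 0} = q" "form1 p q r {2} = r"
  "form1 p q r {0, Suc 0} = 0" "form1 p q r {0, 2} = 0" "form1 p q r {Suc 0, 2} = 0" "form1 p q r {0, Suc 0, 2} = 0"
  "form2 p q r {} = 0" "form2 p q r {0} = 0" "form2 p q r {Suc 0} = 0" "form2 p q r {2} = 0"
  "form2 p q r {0, Suc 0} = p" "form2 p q r {0, 2} = q" "form2 p q r {Suc 0, 2} = r" "form2 p q r {0, Suc 0, 2} = 0"
  "form3 p {} = 0" "form3 p {0} = 0" "form3 p {Suc 0} = 0" "form3 p {2} = 0"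
  "form3 p {0, Suc 0} = 0" "form3 p {0, 2} = 0" "form3 p {Suc 0, 2} = 0" "form3 p {0, Suc 0, 2} = p"
  by (simp_all add: form1_def form2_def form3_def)

lemma is_form_homogeneous [simp]: "is_form (form1 p q r)" "is_form (form2 p q r)" "is_form (form3 p)"
  by (auto simp: is_form_def form1_def form2_def form3_def)

lemmas component_simps = kd_components[unfolded One_nat_def] wedge_components[unfolded One_nat_def]

lemmas form_eqI' = form_eqI[unfolded One_nat_def]

lemma wedge_homogeneous:
  "wedge (form1 p q r) (form1 p' q' r') = form2 (p * q' - q * p') (p * r' - r * p') (q * r' - r * q')"
  "wedge (form1 p q r) (form2 a b c) = form3 (p * c - q * b + r * a)"
  "wedge (form2 a b c) (form1 p q r) = form3 (p * c - q * b + r * a)"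
  "wedge (form2 a b c) (form2 a' b' c') = (\<lambda>S. 0)"
  "wedge (form3 t) (form1 p q r) = (\<lambda>S. 0)" "wedge (form1 p q r) (form3 t) = (\<lambda>S. 0)"
  "wedge (form3 t) (form2 p q r) = (\<lambda>S. 0)" "wedge (form2 p q r) (form3 t) = (\<lambda>S. 0)"
  "wedge (form3 t) (form3 t') = (\<lambda>S. 0)"
  by (rule form_eqI'; simp add: component_simps algebra_simps)+

lemma kd_homogeneous:
  "kd (form1 p q r) = (\<lambda>S. if S = {} then varx * p + vary * q + varz * r else 0)"
  "kd (form2 a b c) = form1 (- (vary * a) - varz * b) (varx * a - varz * c) (varx * b + vary * c)"
  "kd (form3 t) = form2 (varz * t) (- (vary * t)) (varx * t)"
proof -
  have "is_form (\<lambda>S. if S = {} then f else 0)" for f :: "'a pser3" by (auto simp: is_form_def)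
  then show "kd (form1 p q r) = (\<lambda>S. if S = {} then varx * p + vary * q + varz * r else 0)"
    by (intro form_eqI') (simp_all add: component_simps)
qed (rule form_eqI'; simp add: component_simps)+

lemma homogeneous_diff:
  "(\<lambda>S. form1 p q r S - form1 p' q' r' S) = form1 (p - p') (q - q') (r - r')"
  "(\<lambda>S. form2 p q r S - form2 p' q' r' S) = form2 (p - p') (q - q') (r - r')"
  "(\<lambda>S. form3 t S - form3 t' S) = form3 (t - t')"
  by (auto simp: form1_def form2_def form3_def fun_eq_iff)

lemma homogeneous_zero: "form1 0 0 0 = (\<lambda>S. 0)" "form2 0 0 0 = (\<lambda>S. 0)" "form3 0 = (\<lambda>S. 0)"
  by (auto simp: form1_def form2_def form3_def fun_eq_iff)

context quotient_ideal
begin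

section \<open>Cycles and boundaries among homogeneous forms\<close>

lemma form_closed:
  assumes "is_form u"
  shows "(\<forall>S. u S \<in> \<aa>) \<longleftrightarrow> u {} \<in> \<aa> \<and> u {0} \<in> \<aa> \<and> u {Suc 0} \<in> \<aa> \<and> u {2} \<in> \<aa> \<and>
    u {0, Suc 0} \<in> \<aa> \<and> u {0, 2} \<in> \<aa> \<and> u {Suc 0, 2} \<in> \<aa> \<and> u {0, Suc 0, 2} \<in> \<aa>" (is "_ \<longleftrightarrow> ?r")
proof
  assume ?r
  show "\<forall>S. u S \<in> \<aa>"
  proof
    fix S
    show "u S \<in> \<aa>"
    proof (cases "S \<subseteq> {..<3}")
      case True
      from subset_3_cases[OF this] \<open>?r\<close> show ?thesis by (elim disjE) simp_all
    next
      case False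
      then show ?thesis using assms closed(1) by (simp add: is_form_def)
    qed
  qed
qed auto

lemma cycle_homogeneous:
  "cycle (form1 p q r) \<longleftrightarrow> varx * p + vary * q + varz * r \<in> \<aa>"
  "cycle (form2 a b c) \<longleftrightarrow> - (vary * a) - varz * b \<in> \<aa> \<and> varx * a - varz * c \<in> \<aa> \<and> varx * b + vary * c \<in> \<aa>"
  "cycle (form3 t) \<longleftrightarrow> varx * t \<in> \<aa> \<and> vary * t \<in> \<aa> \<and> varz * t \<in> \<aa>"
proof -
  note c = form_closed[OF is_form_simps(2)]
  show "cycle (form1 p q r) \<longleftrightarrow> varx * p + vary * q + varz * r \<in> \<aa>"
    unfolding cycle_def c by (auto simp: kd_homogeneous closed(1))
  show "cycle (form2 a b c) \<longleftrightarrow> - (vary * a) - varz * b \<in> \<aa> \<and> varx * a - varz * c \<in> \<aa> \<and> varx * b + vary * c \<in> \<aa>"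
    unfolding cycle_def c by (auto simp: kd_homogeneous closed(1))
  have "- (vary * t) \<in> \<aa> \<longleftrightarrow> vary * t \<in> \<aa>" using closed(5)[of "- (vary * t)"] closed(5)[of "vary * t"] by auto
  then show "cycle (form3 t) \<longleftrightarrow> varx * t \<in> \<aa> \<and> vary * t \<in> \<aa> \<and> varz * t \<in> \<aa>"
    unfolding cycle_def c by (auto simp: kd_homogeneous closed(1))
qed

lemma bnd_homogeneous:
  "bnd (form1 p q r) \<longleftrightarrow> (\<exists>A B C. p - (- (vary * A) - varz * B) \<in> \<aa> \<and> q - (varx * A - varz * C) \<in> \<aa> \<and>
     r - (varx * B + vary * C) \<in> \<aa>)"
  "bnd (form2 a b c) \<longleftrightarrow> (\<exists>t. a - varz * t \<in> \<aa> \<and> b + vary * t \<in> \<aa> \<and> c - varx * t \<in> \<aa>)"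
  "bnd (form3 t) \<longleftrightarrow> t \<in> \<aa>"
proof -
  show "bnd (form1 p q r) \<longleftrightarrow> (\<exists>A B C. p - (- (vary * A) - varz * B) \<in> \<aa> \<and> q - (varx * A - varz * C) \<in> \<aa> \<and>
     r - (varx * B + vary * C) \<in> \<aa>)" (is "_ \<longleftrightarrow> ?r")
  proof
    assume "bnd (form1 p q r)"
    then obtain w where "\<And>S. form1 p q r S - kd w S \<in> \<aa>" unfolding bnd_def by blast
    from this[of "{0}"] this[of "{Suc 0}"] this[of "{2}"] show ?r
      by (intro exI[of _ "w {0, Suc 0}"] exI[of _ "w {0, 2}"] exI[of _ "w {Suc 0, 2}"])
        (simp add: component_simps)
  next
    assume ?r
    then obtain A B C where *: "p - (- (vary * A) - varz * B) \<in> \<aa>" "q - (varx * A - varz * C) \<in> \<aa>"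
      "r - (varx * B + vary * C) \<in> \<aa>" by blast
    show "bnd (form1 p q r)"
      unfolding bnd_def
      by (rule exI[of _ "form2 A B C"], subst form_closed)
        (use * in \<open>simp_all add: kd_homogeneous closed(1) del: diff_minus_eq_add\<close>)
  qed
  show "bnd (form2 a b c) \<longleftrightarrow> (\<exists>t. a - varz * t \<in> \<aa> \<and> b + vary * t \<in> \<aa> \<and> c - varx * t \<in> \<aa>)" (is "_ \<longleftrightarrow> ?r")
  proof
    assume "bnd (form2 a b c)"
    then obtain w where "\<And>S. form2 a b c S - kd w S \<in> \<aa>" unfolding bnd_def by blast
    from this[of "{0, Suc 0}"] this[of "{0, 2}"] this[of "{Suc 0, 2}"] show ?r
      by (intro exI[of _ "w {0, Suc 0, 2}"]) (simp add: component_simps)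
  next
    assume ?r
    then obtain t where *: "a - varz * t \<in> \<aa>" "b + vary * t \<in> \<aa>" "c - varx * t \<in> \<aa>" by blast
    show "bnd (form2 a b c)"
      unfolding bnd_def
      by (rule exI[of _ "form3 t"], subst form_closed) (use * in \<open>simp_all add: kd_homogeneous closed(1)\<close>)
  qed
  show "bnd (form3 t) \<longleftrightarrow> t \<in> \<aa>"
  proof
    assume "bnd (form3 t)"
    then obtain w where "\<And>S. form3 t S - kd w S \<in> \<aa>" unfolding bnd_def by blast
    from this[of "{0, Suc 0, 2}"] show "t \<in> \<aa>" by (simp add: component_simps)
  next
    assume "t \<in> \<aa>"
    then show "bnd (form3 t)"
      unfolding bnd_def
      by (intro exI[of _ "\<lambda>S. 0"], subst form_closed) (simp_all add: kd_zero closed(1))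
  qed
qed

lemma hom_degree_homogeneous:
  "hom_degree_form 1 (form1 p q r)" "hom_degree_form 2 (form2 p q r)" "hom_degree_form 3 (form3 t)"
proof -
  have c: "S \<subseteq> {..<3} \<Longrightarrow> card S =
      (if 0 \<in> S then 1 else 0) + (if 1 \<in> S then 1 else 0) + (if 2 \<in> S then 1 else (0 :: nat))" for S :: "nat set"
    by (drule subset_3_cases) (elim disjE; simp)
  show "hom_degree_form 1 (form1 p q r)" "hom_degree_form 2 (form2 p q r)" "hom_degree_form 3 (form3 t)"
    by (auto simp: hom_degree_form_def form1_def form2_def form3_def c)
qed

lemma homogeneous_cases:
  assumes "is_form u"
  shows "hom_degree_form 1 u \<Longrightarrow> u = form1 (u {0}) (u {Suc 0}) (u {2})"
    and "hom_degree_form 2 u \<Longrightarrow> u = form2 (u {0, Suc 0}) (u {0, 2}) (u {Suc 0, 2})"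
    and "hom_degree_form 3 u \<Longrightarrow> u = form3 (u {0, Suc 0, 2})"
  using assms by (intro form_eqI'; simp add: hom_degree_form_def)+

lemma lincomb_map:
  "lincomb c (map (\<lambda>l. form1 (p l) (q l) (r l)) ls) = form1 (\<Sum>i<length ls. const3 (c i) * p (ls ! i))
     (\<Sum>i<length ls. const3 (c i) * q (ls ! i)) (\<Sum>i<length ls. const3 (c i) * r (ls ! i))"
  "lincomb c (map (\<lambda>l. form2 (p l) (q l) (r l)) ls) = form2 (\<Sum>i<length ls. const3 (c i) * p (ls ! i))
     (\<Sum>i<length ls. const3 (c i) * q (ls ! i)) (\<Sum>i<length ls. const3 (c i) * r (ls ! i))"
  "lincomb c (map (\<lambda>l. form3 (p l)) ls) = form3 (\<Sum>i<length ls. const3 (c i) * p (ls ! i))"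
proof -
  have 1: "is_form (lincomb c us)" if "\<And>u. u \<in> set us \<Longrightarrow> is_form u" for us
  proof -
    have "(us ! i) S = 0" if "i < length us" "\<not> S \<subseteq> {..<3}" for i S
      using \<open>\<And>u. u \<in> set us \<Longrightarrow> is_form u\<close>[OF nth_mem[OF that(1)]] that(2) by (simp add: is_form_def)
    then show ?thesis by (simp add: is_form_def lincomb_def)
  qed
  show "lincomb c (map (\<lambda>l. form1 (p l) (q l) (r l)) ls) = form1 (\<Sum>i<length ls. const3 (c i) * p (ls ! i))
     (\<Sum>i<length ls. const3 (c i) * q (ls ! i)) (\<Sum>i<length ls. const3 (c i) * r (ls ! i))"
    by (rule form_eqI'[OF 1]) (auto simp: lincomb_def)
  show "lincomb c (map (\<lambda>l. form2 (p l) (q l) (r l)) ls) = form2 (\<Sum>i<length ls. const3 (c i) * p (ls ! i))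
     (\<Sum>i<length ls. const3 (c i) * q (ls ! i)) (\<Sum>i<length ls. const3 (c i) * r (ls ! i))"
    by (rule form_eqI'[OF 1]) (auto simp: lincomb_def)
  show "lincomb c (map (\<lambda>l. form3 (p l)) ls) = form3 (\<Sum>i<length ls. const3 (c i) * p (ls ! i))"
    by (rule form_eqI'[OF 1]) (auto simp: lincomb_def)
qed

end

section \<open>Homogeneous power series\<close>

text \<open>D_j is homogeneous of degree j in x, y, z, so this is ordinary homogeneity.\<close>

definition homog :: "nat \<Rightarrow> 'k :: field pser3 \<Rightarrow> bool" where
  "homog d f \<longleftrightarrow> (\<forall>a b j. coef f a b j \<noteq> 0 \<longrightarrow> a + b + j = d)"

text \<open>Homogeneous of degree \<open>d\<close>, in a form that is visibly closed under products.\<close>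

definition homog_op :: "nat \<Rightarrow> 'k :: field pser3 \<Rightarrow> bool" where
  "homog_op d u \<longleftrightarrow> (\<forall>e f. homog e f \<longrightarrow> homog (d + e) (u * f))"

lemma homogD: "homog d f \<Longrightarrow> a + b + j \<noteq> d \<Longrightarrow> coef f a b j = 0"
  unfolding homog_def by blast

lemma homogI: "(\<And>a b j. a + b + j \<noteq> d \<Longrightarrow> coef f a b j = 0) \<Longrightarrow> homog d f"
  unfolding homog_def by blast

lemma homog_op_var: "homog_op 1 (varx :: 'k :: field pser3)" "homog_op 1 (vary :: 'k pser3)" "homog_op 1 (varz :: 'k pser3)"
proof -
  have "coef (varx * f) a b j = 0" if "homog e f" "a + b + j \<noteq> 1 + e" for e a b j and f :: "'k pser3"
    using homogD[OF that(1), of "a - 1" b j] that(2) by (cases a) auto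
  then show "homog_op 1 (varx :: 'k pser3)" unfolding homog_op_def by (blast intro: homogI)
  have "coef (vary * f) a b j = 0" if "homog e f" "a + b + j \<noteq> 1 + e" for e a b j and f :: "'k pser3"
    using homogD[OF that(1), of a "b - 1" j] that(2) by (cases b) auto
  then show "homog_op 1 (vary :: 'k pser3)" unfolding homog_op_def by (blast intro: homogI)
  have "coef (varz * f) a b j = 0" if "homog e f" "a + b + j \<noteq> 1 + e" for e a b j and f :: "'k pser3"
    using homogD[OF that(1), of a b "j - 1"] homogD[OF that(1), of "a - 1" "b - 1" "Suc j"] that(2)
    by (cases a; cases b; cases j) auto
  then show "homog_op 1 (varz :: 'k pser3)" unfolding homog_op_def by (blast intro: homogI)
qed

lemma homog_op_one: "homog_op 0 1"
  by (simp add: homog_op_def)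

lemma homog_op_mult: "homog_op d u \<Longrightarrow> homog_op e v \<Longrightarrow> homog_op (d + e) (u * v)"
  by (simp add: homog_op_def mult.assoc add.assoc)

lemma homog_op_power: "homog_op 1 u \<Longrightarrow> homog_op n (u ^ n)"
proof (induction n)
  case (Suc n)
  then show ?case using homog_op_mult[of 1 u n "u ^ n"] by simp
qed (simp add: homog_op_one)

lemma homog_op_diff: "homog_op d u \<Longrightarrow> homog_op d v \<Longrightarrow> homog_op d (u - v)"
  and homog_op_uminus: "homog_op d u \<Longrightarrow> homog_op d (- u)"
  and homog_op_add: "homog_op d u \<Longrightarrow> homog_op d v \<Longrightarrow> homog_op d (u + v)"
proof -
  have d: "coef (u * f) a b j = 0" if "homog_op d u" "homog e f" "a + b + j \<noteq> d + e" for d u e f a b j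
    using that unfolding homog_op_def by (blast intro: homogD)
  show "homog_op d u \<Longrightarrow> homog_op d v \<Longrightarrow> homog_op d (u - v)"
    unfolding homog_op_def[of d "u - v"] by (intro allI impI homogI) (simp add: left_diff_distrib d)
  show "homog_op d u \<Longrightarrow> homog_op d (- u)"
    unfolding homog_op_def[of d "- u"] by (intro allI impI homogI) (simp add: d)
  show "homog_op d u \<Longrightarrow> homog_op d v \<Longrightarrow> homog_op d (u + v)"
    unfolding homog_op_def[of d "u + v"] by (intro allI impI homogI) (simp add: distrib_right d)
qed

lemma homog_op_zero: "homog_op d 0"
  by (simp add: homog_op_def homog_def)

lemma homog_op_ch: "homog_op n (ch (Suc n) :: 'k :: field pser3)"
proof (induction n rule: ch.induct)
  case 1
  then show ?case by (simp add: homog_op_one)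
next
  case 2
  then show ?case using homog_op_var(3) by simp
next
  case (3 n)
  have "homog_op (Suc (Suc n)) (varz * ch (Suc (Suc n)) :: 'k pser3)"
    using homog_op_mult[OF homog_op_var(3) 3(1)] by (simp del: ch.simps)
  moreover have "homog_op (Suc (Suc n)) (varx * vary * ch (Suc n) :: 'k pser3)"
    using homog_op_mult[OF homog_op_mult[OF homog_op_var(1,2)] 3(2)] by (simp del: ch.simps)
  ultimately show ?case by (subst ch.simps(3)) (rule homog_op_diff)
qed

lemma homog_op_monomial:
  "d = a + b + n \<Longrightarrow> homog_op d (varx ^ a * (vary ^ b * ch (Suc n)))"
  using homog_op_mult[OF homog_op_power[OF homog_op_var(1), of a] homog_op_mult[OF homog_op_power[OF homog_op_var(2), of b] homog_op_ch[of n]]]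
  by (simp add: add.assoc)

lemma homog_op_lift:
  assumes "1 \<le> m" "k \<in> {- int m..int m}"
  shows "homog_op (m - 1) (lift_x m k :: 'k :: field pser3)" "homog_op (m - 1) (lift_y m k :: 'k pser3)" "homog_op (m - 1) (lift_z m k :: 'k pser3)"
    "homog_op (m - 1) (syz_xy m k :: 'k pser3)" "homog_op (m - 1) (syz_xz m k :: 'k pser3)" "homog_op (m - 1) (syz_yz m k :: 'k pser3)"
proof -
  obtain n where m: "m = Suc n" using assms(1) by (cases m) auto
  have X: "homog_op (m - 1) (varx ^ a * ch c :: 'k pser3)" if "a + c = m \<or> c = 0" for a c
  proof (cases c)
    case (Suc c')
    then show ?thesis using homog_op_monomial[of "m - 1" a 0 c'] that by (simp add: m)
  qed (simp add: homog_op_zero)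
  have Y: "homog_op (m - 1) (vary ^ a * ch c :: 'k pser3)" if "a + c = m \<or> c = 0" for a c
  proof (cases c)
    case (Suc c')
    then show ?thesis using homog_op_monomial[of "m - 1" 0 a c'] that by (simp add: m)
  qed (simp add: homog_op_zero)
  have Y1: "homog_op (m - 1) (vary * ch (m - 1) :: 'k pser3)" using Y[of 1 "m - 1"] assms(1) by simp
  have C: "homog_op (m - 1) (ch m :: 'k pser3)" using X[of 0 m] by simp
  note X = X[unfolded One_nat_def] and Y = Y[unfolded One_nat_def] and Y1 = Y1[unfolded One_nat_def]
    and C = C[unfolded One_nat_def]
  show "homog_op (m - 1) (lift_x m k :: 'k pser3)"
    unfolding lift_x_def using assms by (auto intro!: X homog_op_uminus Y1 homog_op_zero)
  show "homog_op (m - 1) (lift_y m k :: 'k pser3)"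
    unfolding lift_y_def using assms by (auto intro!: Y homog_op_zero)
  show "homog_op (m - 1) (lift_z m k :: 'k pser3)"
    unfolding lift_z_def using assms by (auto intro!: C homog_op_zero)
  show "homog_op (m - 1) (syz_xy m k :: 'k pser3)"
    unfolding syz_xy_def using assms by (auto intro!: X Y)
  show "homog_op (m - 1) (syz_xz m k :: 'k pser3)"
    unfolding syz_xz_def using assms by (auto intro!: X homog_op_uminus homog_op_zero)
  show "homog_op (m - 1) (syz_yz m k :: 'k pser3)"
    unfolding syz_yz_def using assms by (auto intro!: Y homog_op_zero)
qed

lemma homog_of_op: "homog_op d u \<Longrightarrow> homog d u"
proof -
  assume "homog_op d u"
  moreover have "homog 0 (1 :: 'a pser3)" by (simp add: homog_def coef_one)
  ultimately have "homog (d + 0) (u * 1)" unfolding homog_op_def by blast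
  then show "homog d u" by simp
qed

lemma homog_op_max_ideal: "homog_op d u \<Longrightarrow> 0 < d \<Longrightarrow> u \<in> max_ideal"
  using homog_of_op[of d u] by (auto simp: mem_max_ideal_iff homog_def)

lemma coef_pairing_monomial:
  assumes "a \<le> M" "b \<le> M"
  shows "coef ((varx ^ a * ch (Suc p)) * (vary ^ b * ch (Suc q))) M M 0 =
    (if M - a = p \<and> M - b = p \<and> p = q then 1 else (0 :: 'k :: field))"
proof -
  have e: "(varx ^ a * ch (Suc p)) * (vary ^ b * ch (Suc q)) = varx ^ a * (vary ^ b * (ch (Suc p) * ch (Suc q) :: 'k pser3))"
    by (simp only: mult_ac)
  show ?thesis unfolding e using assms by (simp add: coef_ch_mult_ch del: ch.simps)
qed

text \<open>The coefficient of the wedge product of the k-th lifted 1-form with the l-th syzygy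
  2-form.\<close>

definition pairing :: "nat \<Rightarrow> int \<Rightarrow> int \<Rightarrow> 'k :: field pser3" where
  "pairing m k l = lift_x m k * syz_yz m l - lift_y m k * syz_xz m l + lift_z m k * syz_xy m l"

text \<open>Each product has the shape x^a y^b D_p D_q up to sign. By \<open>coef_ch_mult_ch\<close>
  it reaches the exponent (m - 1, m - 1, 0) only if p = q and a + p = b + p = m - 1, which forces k
  = l.\<close>

lemma coef_pairing:
  assumes m: "1 \<le> m" and k: "k \<in> {- int m..int m}" and l: "l \<in> {- int m..int m}"
  shows "coef (pairing m k l) (m - 1) (m - 1) 0 = (if k = l then 1 else (0 :: 'k :: field))"
proof -
  have P: "coef (pairing m k l :: 'k pser3) (m - 1) (m - 1) 0 = coef (lift_x m k * syz_yz m l :: 'k pser3) (m - 1) (m - 1) 0 -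
      coef (lift_y m k * syz_xz m l :: 'k pser3) (m - 1) (m - 1) 0 + coef (lift_z m k * syz_xy m l :: 'k pser3) (m - 1) (m - 1) 0"
    by (simp add: pairing_def)
  obtain M where M: "m = Suc M" using m by (cases m) auto
  have cXY: "coef ((varx ^ a * ch (Suc p)) * (vary ^ b * ch (Suc q))) M M 0 =
      (if M - a = p \<and> M - b = p \<and> p = q then 1 else (0 :: 'k))" if "a \<le> M" "b \<le> M" for a b p q
    using that by (rule coef_pairing_monomial)
  have cX: "coef (ch (Suc p) * (varx ^ b * ch q)) M M 0 = (if b = 0 \<and> p = M \<and> q = Suc M then 1 else (0 :: 'k))"
    if "b + q = Suc M" for b p q
  proof (cases q)
    case 0
    then show ?thesis by simp
  next
    case (Suc q')
    have e: "ch (Suc p) * (varx ^ b * ch (Suc q')) = varx ^ b * (ch (Suc p) * (ch (Suc q') :: 'k pser3))"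
      by (simp only: mult_ac)
    show ?thesis unfolding Suc e using that Suc by (auto simp: coef_ch_mult_ch simp del: ch.simps)
  qed
  have cY: "coef (ch (Suc p) * (vary ^ b * ch q)) M M 0 = (if b = 0 \<and> p = M \<and> q = Suc M then 1 else (0 :: 'k))"
    if "b + q = Suc M" for b p q
  proof (cases q)
    case 0
    then show ?thesis by simp
  next
    case (Suc q')
    have e: "ch (Suc p) * (vary ^ b * ch (Suc q')) = vary ^ b * (ch (Suc p) * (ch (Suc q') :: 'k pser3))"
      by (simp only: mult_ac)
    show ?thesis unfolding Suc e using that Suc by (auto simp: coef_ch_mult_ch simp del: ch.simps)
  qed
  \<comment> \<open>The D_0 part of a product D_p D_q is a power of x y, so the additional factors y
    prevent equal exponents of x and y.\<close>
  have cYY: "coef ((vary * ch M) * (vary ^ b * ch (Suc q))) M M 0 = (0 :: 'k)" for b q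
  proof (cases M)
    case 0
    then show ?thesis by simp
  next
    case (Suc M')
    have e: "(vary * ch (Suc M')) * (vary ^ b * ch (Suc q)) = vary ^ Suc b * (ch (Suc M') * (ch (Suc q) :: 'k pser3))"
      by (simp only: mult_ac power_Suc)
    show ?thesis unfolding Suc e coef_vary_power by (simp add: coef_ch_mult_ch del: ch.simps)
  qed
  show ?thesis
    using k
  proof (cases rule: index_cases)
    case (pos n t)
    then have nk: "nat k = Suc n" "k > 0" by auto
    have lk: "lift_x m k = (0 :: 'k pser3)" "lift_z m k = (0 :: 'k pser3)" "lift_y m k = (vary ^ n * ch (Suc t) :: 'k pser3)"
      unfolding lift_x_def lift_y_def lift_z_def nk(1) pos(2) using nk(2) by simp_all
    show ?thesis
    proof (cases "l > 0")
      case True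
      define n' where "n' = nat l - 1"
      define t' where "t' = m - nat l"
      have l': "nat l = Suc n'" "m = Suc (n' + t')" using l True by (auto simp: n'_def t'_def)
      have "syz_xz m l = (- (varx ^ n' * ch (Suc t')) :: 'k pser3)"
        unfolding syz_xz_def l'(1) unfolding l'(2) using True by simp
      then have "coef (pairing m k l :: 'k pser3) (m - 1) (m - 1) 0 = coef ((varx ^ n' * ch (Suc t')) * (vary ^ n * ch (Suc t))) M M 0"
        unfolding P lk by (simp add: M mult.commute del: ch.simps)
      also have "\<dots> = (if k = l then 1 else 0)"
        using nk l' pos(2) M True by (subst cXY) auto
      finally show ?thesis .
    next
      case False
      then have "syz_xz m l = (0 :: 'k pser3)" by (simp add: syz_xz_def)
      then show ?thesis unfolding P lk using False nk by auto
    qed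
  next
    case (neg n t)
    then have nk: "nat (- k) = Suc n" "k < 0" by auto
    have lk: "lift_x m k = (varx ^ n * ch (Suc t) :: 'k pser3)" "lift_z m k = (0 :: 'k pser3)" "lift_y m k = (0 :: 'k pser3)"
      unfolding lift_x_def lift_y_def lift_z_def nk(1) neg(2) using nk(2) by simp_all
    show ?thesis
    proof (cases "l < 0")
      case True
      then have l': "nat (- l) = Suc (nat (- l) - 1)" "m = Suc ((nat (- l) - 1) + (m - nat (- l)))" using l by auto
      define n' where "n' = nat (- l) - 1"
      define t' where "t' = m - nat (- l)"
      have l'': "nat (- l) = Suc n'" "m = Suc (n' + t')" using l' by (simp_all add: n'_def t'_def)
      have "syz_yz m l = (vary ^ n' * ch (Suc t') :: 'k pser3)"
        unfolding syz_yz_def l''(1) unfolding l''(2) using True by simp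
      then have "coef (pairing m k l :: 'k pser3) (m - 1) (m - 1) 0 = coef ((varx ^ n * ch (Suc t)) * (vary ^ n' * ch (Suc t'))) M M 0"
        unfolding P lk by (simp add: M del: ch.simps)
      also have "\<dots> = (if k = l then 1 else 0)"
        using nk l'' neg(2) M True by (subst cXY) auto
      finally show ?thesis .
    next
      case False
      then have "syz_yz m l = (0 :: 'k pser3)" by (simp add: syz_yz_def)
      then show ?thesis unfolding P lk using False nk by auto
    qed
  next
    case zero
    have lk: "lift_x m k = (- (vary * ch M) :: 'k pser3)" "lift_z m k = (ch (Suc M) :: 'k pser3)" "lift_y m k = (0 :: 'k pser3)"
      using zero M by (simp_all add: lift_x_def lift_y_def lift_z_def)
    have 1: "coef (lift_x m k * syz_yz m l :: 'k pser3) (m - 1) (m - 1) 0 = 0"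
      unfolding lk syz_yz_def using cYY by (simp add: M del: ch.simps)
    have 2: "coef (lift_z m k * syz_xy m l :: 'k pser3) M M 0 = (if k = l then 1 else 0)"
    proof (cases "l > 0")
      case True
      then have e: "syz_xy m l = (varx ^ nat l * ch (m - nat l) :: 'k pser3)" by (simp add: syz_xy_def)
      have "nat l + (m - nat l) = Suc M" using l M by auto
      then show ?thesis unfolding lk e using True l M zero by (subst cX) auto
    next
      case False
      then have e: "syz_xy m l = (vary ^ nat (- l) * ch (m - nat (- l)) :: 'k pser3)" by (simp add: syz_xy_def)
      have "nat (- l) + (m - nat (- l)) = Suc M" using l M by auto
      then show ?thesis unfolding lk e using False l M zero by (subst cY) auto
    qed
    have M': "m - 1 = M" by (simp add: M)
    show ?thesis unfolding P 1 unfolding M' 2 unfolding lk by simp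
  qed
qed

section \<open>The Koszul homology of a trimmed quotient\<close>

lemma sum_nth_distinct: "distinct xs \<Longrightarrow> (\<Sum>i<length xs. h (xs ! i)) = (\<Sum>x\<in>set xs. h x)"
  by (rule sum.reindex_bij_betw[OF bij_betw_nth]) auto

locale trimmed_quotient =
  fixes m :: nat and k0 :: int and \<aa> :: "'k :: field pser3 set"
  assumes m3: "3 \<le> m" and k0: "k0 \<in> {- int m..int m}"
    and aa: "\<aa> = supp_in (above_except m k0)"

sublocale trimmed_quotient \<subseteq> quotient_ideal \<aa>
  by (rule quotient_ideal.intro) (simp add: aa supp_in_ideal stable_above_except[OF k0])

context trimmed_quotient
begin

abbreviation "I \<equiv> {- int m..int m}"
abbreviation "A \<equiv> supp_in (above m) :: 'k pser3 set"
abbreviation "g \<equiv> gen m k0 :: 'k pser3"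
abbreviation "s \<equiv> varx ^ (m - 1) * vary ^ (m - 1) :: 'k pser3"
abbreviation "cg f \<equiv> coef f (nat (- k0)) (nat k0) (m - nat \<bar>k0\<bar>)"
abbreviation "cs f \<equiv> coef f (m - 1) (m - 1) 0"

section \<open>Coordinates modulo the trimmed ideal\<close>

lemma m1: "1 \<le> m" and m2: "2 \<le> m" using m3 by auto

lemma aa_subset: "f \<in> \<aa> \<Longrightarrow> f \<in> A"
  unfolding aa supp_in_def above_except_def by auto

lemma aa_iff: "f \<in> \<aa> \<longleftrightarrow> f \<in> A \<and> cg f = 0"
  unfolding aa supp_in_def above_except_def by auto

lemma cg_g [simp]: "cg g = 1" by simp

lemma cs_A: "f \<in> A \<Longrightarrow> cs f = 0"
  using m1 unfolding supp_in_iff above_def by auto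

lemma max_A: "h \<in> max_ideal \<Longrightarrow> f \<in> A \<Longrightarrow> h * f \<in> \<aa>"
  unfolding aa by (rule max_ideal_mult_above[OF k0])

lemma var_max [simp]: "varx \<in> max_ideal" "vary \<in> max_ideal" "(varz :: 'k pser3) \<in> max_ideal"
  unfolding max_ideal_def by (rule genideal_mem; simp)+

lemmas var_A = max_A[OF var_max(1)] max_A[OF var_max(2)] max_A[OF var_max(3)]

lemma g_max: "h \<in> max_ideal \<Longrightarrow> h * g \<in> \<aa>" "h \<in> max_ideal \<Longrightarrow> g * h \<in> \<aa>"
  using max_A[OF _ gen_mem_above, of h k0] by (simp_all add: mult.commute)

lemma A_decompose: "f \<in> A \<Longrightarrow> f - const3 (cg f) * g \<in> \<aa>"
  unfolding aa by (rule above_decompose[OF k0])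

lemma gen0_aa: "k \<noteq> k0 \<Longrightarrow> gen0 m k \<in> \<aa>"
  using gen_mem_above_except[OF k0, of k] closed(1) by (auto simp: gen0_def aa)

lemma cg_gen0: "cg (gen0 m k) = (if k = k0 then 1 else 0)"
  using k0 by (auto simp: gen0_def dest: nat_eq_both)

text \<open>The exponents of the generators have a = 0 or b = 0, so the removed one is not
  concerned.\<close>

lemma monomial_aa:
  "m \<le> max a b + j \<Longrightarrow> 0 < a \<Longrightarrow> 0 < b \<Longrightarrow> varx ^ a * (vary ^ b * ch (Suc j)) \<in> \<aa>"
  unfolding aa supp_in_iff above_except_def above_def by (auto simp del: ch.simps)

lemma coef_s: "coef s a b j = (if a = m - 1 \<and> b = m - 1 \<and> j = 0 then 1 else 0)"
  by (auto simp: coef_vary_power_one)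

lemma s_socle: "varx * s \<in> \<aa>" "vary * s \<in> \<aa>" "varz * s \<in> \<aa>"
proof -
  have "varx * s = varx ^ Suc (m - 1) * (vary ^ (m - 1) * ch (Suc 0))"
    by (simp add: mult_ac)
  then show "varx * s \<in> \<aa>" using m3 by (simp only:) (rule monomial_aa; simp)
  have "vary * s = varx ^ (m - 1) * (vary ^ Suc (m - 1) * ch (Suc 0))"
    by (simp add: mult_ac)
  then show "vary * s \<in> \<aa>" using m3 by (simp only:) (rule monomial_aa; simp)
  have "varz * s = varx ^ (m - 1) * (vary ^ (m - 1) * ch (Suc 1))"
    by (simp add: mult_ac)
  then show "varz * s \<in> \<aa>" using m3 by (simp only:) (rule monomial_aa; simp)
qed

text \<open>If max a b + j < m, then a + b + j <= 2 m - 2 - j, so degree 2 m - 2 leaves only (m - 1,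
  m - 1, 0). The removed exponent has degree m, and m < 2 m - 2 because m >= 3.\<close>

lemma homog_top:
  assumes "homog_op (m - 1 + (m - 1)) f"
  shows "f - const3 (cs f) * s \<in> \<aa>"
proof -
  have h: "coef f a b j = 0" if "a + b + j \<noteq> 2 * m - 2" for a b j
    using homogD[OF homog_of_op[OF assms], of a b j] that by simp
  show ?thesis
    unfolding aa supp_in_iff
  proof (intro allI impI)
    fix a b j assume *: "\<not> above_except m k0 a b j"
    show "coef (f - const3 (cs f) * s) a b j = 0"
    proof (cases "a = m - 1 \<and> b = m - 1 \<and> j = 0")
      case True
      then show ?thesis by (simp add: coef_s del: coef_varx_power One_nat_def)
    next
      case False
      have "a + b + j \<noteq> 2 * m - 2"
      proof (cases "m \<le> max a b + j")
        case True
        then have "a = nat (- k0)" "b = nat k0" "j = m - nat \<bar>k0\<bar>"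
          using * by (auto simp: above_except_def above_def)
        then show ?thesis using k0 m3 by (cases "k0 \<ge> 0") auto
      next
        case F: False
        then show ?thesis using False by (auto simp: max_def split: if_splits)
      qed
      then show ?thesis using False h by (simp add: coef_s del: coef_varx_power One_nat_def)
    qed
  qed
qed

text \<open>Each component is hit separately: modulo the ideal, z \<open>t1\<close>, y
  \<open>t2\<close> and x \<open>t3\<close> equal s, while every other product of these elements
  with a variable vanishes. The monomials involved keep positive exponents of x and y because m >=
  3.\<close>

lemma bnd_top: "bnd (form2 (const3 c1 * s) (const3 c2 * s) (const3 c3 * s))"
proof -
  obtain n where n: "m = Suc (Suc n)" "0 < n" using m3 by (cases m; cases "m - 1") auto
  define t1 where "t1 = (varx ^ n * (vary ^ n * ch 2) :: 'k pser3)"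
  define t2 where "t2 = (varx ^ Suc n * vary ^ n :: 'k pser3)"
  define t3 where "t3 = (varx ^ n * vary ^ Suc n :: 'k pser3)"
  have s: "s = varx ^ Suc n * vary ^ Suc n" using n by simp
  have st: "s = vary * t2" "s = varx * t3" unfolding s t2_def t3_def by (simp_all add: mult_ac)
  have 2: "(2 :: nat) = Suc 1" "(3 :: nat) = Suc 2" by simp_all
  have "s - varz * t1 = - (varx ^ n * (vary ^ n * ch (Suc 2)))"
    unfolding s t1_def by (simp add: numeral_2_eq_2 algebra_simps)
  moreover have "varx ^ n * (vary ^ n * ch (Suc 2)) \<in> \<aa>" by (rule monomial_aa) (use n in auto)
  ultimately have a1: "s - varz * t1 \<in> \<aa>" using closed(5) by simp
  have "varx * t1 = varx ^ Suc n * (vary ^ n * ch (Suc 1))" by (simp add: t1_def numeral_2_eq_2 mult_ac)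
  then have a2: "varx * t1 \<in> \<aa>" by (simp only:) (rule monomial_aa; use n in auto)
  have "vary * t1 = varx ^ n * (vary ^ Suc n * ch (Suc 1))" by (simp add: t1_def numeral_2_eq_2 mult_ac)
  then have a3: "vary * t1 \<in> \<aa>" by (simp only:) (rule monomial_aa; use n in auto)
  have "varx * t2 = varx ^ Suc (Suc n) * (vary ^ n * ch (Suc 0))" by (simp add: t2_def mult_ac)
  then have b1: "varx * t2 \<in> \<aa>" by (simp only:) (rule monomial_aa; use n in auto)
  have "varz * t2 = varx ^ Suc n * (vary ^ n * ch (Suc 1))" by (simp add: t2_def mult_ac)
  then have b2: "varz * t2 \<in> \<aa>" by (simp only:) (rule monomial_aa; use n in auto)
  have "vary * t3 = varx ^ n * (vary ^ Suc (Suc n) * ch (Suc 0))" by (simp add: t3_def mult_ac)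
  then have c1: "vary * t3 \<in> \<aa>" by (simp only:) (rule monomial_aa; use n in auto)
  have "varz * t3 = varx ^ n * (vary ^ Suc n * ch (Suc 1))" by (simp add: t3_def mult_ac)
  then have c2: "varz * t3 \<in> \<aa>" by (simp only:) (rule monomial_aa; use n in auto)
  let ?t = "const3 c1 * t1 - const3 c2 * t2 + const3 c3 * t3"
  have "const3 c1 * s - varz * ?t = const3 c1 * (s - varz * t1) + const3 c2 * (varz * t2) - const3 c3 * (varz * t3)"
    by (simp add: algebra_simps)
  also have "\<dots> \<in> \<aa>" by (intro closed(2,3,6) a1 b2 c2)
  finally have 1: "const3 c1 * s - varz * ?t \<in> \<aa>" .
  have "const3 c2 * s + vary * ?t = const3 c1 * (vary * t1) + const3 c3 * (vary * t3)"
    unfolding st(1) by (simp add: algebra_simps)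
  also have "\<dots> \<in> \<aa>" by (intro closed(2,3) a3 c1)
  finally have 2: "const3 c2 * s + vary * ?t \<in> \<aa>" .
  have "const3 c3 * s - varx * ?t = const3 c2 * (varx * t2) - const3 c1 * (varx * t1)"
    unfolding st(2) by (simp add: algebra_simps)
  also have "\<dots> \<in> \<aa>" by (intro closed(3,6) a2 b1)
  finally have 3: "const3 c3 * s - varx * ?t \<in> \<aa>" .
  show ?thesis unfolding bnd_homogeneous using 1 2 3 by blast
qed

text \<open>At the extra index m + 1 the 1-form is g times one basis vector, with differential
  \<open>extra_gen m k0\<close>.\<close>

definition ex :: "int \<Rightarrow> 'k pser3" where
  "ex k = (if k = int m + 1 then (if k0 = - int m then g else 0) else lift_x m k)"
definition ey :: "int \<Rightarrow> 'k pser3" where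
  "ey k = (if k = int m + 1 then (if k0 = int m then g else 0) else lift_y m k)"
definition ez :: "int \<Rightarrow> 'k pser3" where
  "ez k = (if k = int m + 1 then (if k0 = 0 then g else 0) else lift_z m k)"

text \<open>The indices m + 2, m + 3, m + 4 stand for g times the three basis 2-forms, which are
  cycles because n g lies in the trimmed ideal.\<close>

definition fx :: "int \<Rightarrow> 'k pser3" where
  "fx l = (if l = int m + 2 then g else if l = int m + 3 \<or> l = int m + 4 then 0 else syz_xy m l)"
definition fy :: "int \<Rightarrow> 'k pser3" where
  "fy l = (if l = int m + 3 then g else if l = int m + 2 \<or> l = int m + 4 then 0 else syz_xz m l)"
definition fz :: "int \<Rightarrow> 'k pser3" where
  "fz l = (if l = int m + 4 then g else if l = int m + 2 \<or> l = int m + 3 then 0 else syz_yz m l)"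

text \<open>The indices \<open>k\<close> for which \<open>syz m k\<close> remains a cycle modulo the trimmed ideal, without \<open>k0\<close>.\<close>

definition Ks :: "int set" where
  "Ks = {k \<in> I. k \<noteq> k0 \<and> 1 - k \<noteq> k0 \<and> - 1 - k \<noteq> k0 \<and> (k = 0 \<or> - k \<noteq> k0)}"

text \<open>The index k0 belongs here: 1 - k0 and -1 - k0 differ from k0 by parity, and -k0 = k0
  only for k0 = 0, so its syzygy remains a cycle. It has no partner in degree 1, since g has ceased
  to be a generator.\<close>

definition Fs :: "int set" where
  "Fs = Ks \<union> {k0} \<union> {int m + 2, int m + 3, int m + 4}"

abbreviation "T \<equiv> trim_index m k0"

section \<open>The explicit cycles and their products\<close>

lemma T_cases: "k \<in> T \<Longrightarrow> (k \<in> I \<and> k \<noteq> k0) \<or> (k = int m + 1 \<and> k0 \<in> {0, int m, - int m})"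
  by (auto simp: trim_index_def split: if_splits)

lemma Ks_T: "Ks \<subseteq> T" and Ks_I: "Ks \<subseteq> I" and k0_T: "k0 \<notin> T" and k0_Ks: "k0 \<notin> Ks"
  using k0 by (auto simp: Ks_def trim_index_def)

lemma e_diff: "k \<in> T \<Longrightarrow> varx * ex k + vary * ey k + varz * ez k = trim_gen m k0 k"
  using T_cases[of k] lift_diff[OF m1, of k, where 'k = 'k] m3
  by (auto simp: ex_def ey_def ez_def trim_gen_def extra_gen_def)

lemma trim_gen_aa: "k \<in> T \<Longrightarrow> trim_gen m k0 k \<in> \<aa>"
  unfolding aa genideal_trim_gen[OF m2 k0, symmetric] by (rule genideal_mem) simp

lemma lift_max:
  assumes "k \<in> I"
  shows "(lift_x m k :: 'k pser3) \<in> max_ideal" "(lift_y m k :: 'k pser3) \<in> max_ideal" "(lift_z m k :: 'k pser3) \<in> max_ideal"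
    "(syz_xy m k :: 'k pser3) \<in> max_ideal" "(syz_xz m k :: 'k pser3) \<in> max_ideal" "(syz_yz m k :: 'k pser3) \<in> max_ideal"
proof -
  have "0 < m - 1" using m3 by simp
  note h = homog_op_max_ideal[OF _ this]
  show "(lift_x m k :: 'k pser3) \<in> max_ideal" "(lift_y m k :: 'k pser3) \<in> max_ideal" "(lift_z m k :: 'k pser3) \<in> max_ideal"
    "(syz_xy m k :: 'k pser3) \<in> max_ideal" "(syz_xz m k :: 'k pser3) \<in> max_ideal" "(syz_yz m k :: 'k pser3) \<in> max_ideal"
    by (rule h, rule homog_op_lift[OF m1 assms])+
qed

lemma g_in_max: "g \<in> max_ideal"
  using m1 by (auto simp: mem_max_ideal_iff)

lemma zero_max [simp]: "(0 :: 'k pser3) \<in> max_ideal"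
  by (simp add: mem_max_ideal_iff)

lemma f_max: "l \<in> Fs \<Longrightarrow> fx l \<in> max_ideal" "l \<in> Fs \<Longrightarrow> fy l \<in> max_ideal" "l \<in> Fs \<Longrightarrow> fz l \<in> max_ideal"
  using Ks_I k0 g_in_max by (auto simp: Fs_def fx_def fy_def fz_def intro!: lift_max)

lemma e_max: "k \<in> T \<Longrightarrow> ex k \<in> max_ideal" "k \<in> T \<Longrightarrow> ey k \<in> max_ideal" "k \<in> T \<Longrightarrow> ez k \<in> max_ideal"
  using T_cases[of k] g_in_max by (auto simp: ex_def ey_def ez_def intro!: lift_max)

abbreviation "Ef k \<equiv> form1 (ex k) (ey k) (ez k)"
abbreviation "Ff l \<equiv> form2 (fx l) (fy l) (fz l)"

lemma cycle_E: "k \<in> T \<Longrightarrow> cycle (Ef k)"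
  unfolding cycle_homogeneous e_diff by (rule trim_gen_aa)

lemma cycle_F:
  assumes "l \<in> Fs"
  shows "cycle (Ff l)"
proof (cases "l \<in> I")
  case True
  have o: "l \<in> Ks \<or> l = k0" using assms True by (auto simp: Fs_def)
  have "gen0 m (1 - l) \<in> \<aa>" "gen0 m (- 1 - l) \<in> \<aa>" "l \<noteq> 0 \<Longrightarrow> gen0 m (- l) \<in> \<aa>"
    using o by (intro gen0_aa; auto simp: Ks_def; presburger)+
  moreover have "fx l = syz_xy m l" "fy l = syz_xz m l" "fz l = syz_yz m l"
    using True by (auto simp: fx_def fy_def fz_def)
  ultimately show ?thesis
    unfolding cycle_homogeneous using syz_diff[OF m1 True, where 'k = 'k] closed(1) by (auto intro: closed(5))
next
  case False
  then have "l = int m + 2 \<or> l = int m + 3 \<or> l = int m + 4" using assms Ks_I k0 by (auto simp: Fs_def)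
  then show ?thesis
    unfolding cycle_homogeneous fx_def fy_def fz_def
    using g_max(1)[OF var_max(1)] g_max(1)[OF var_max(2)] g_max(1)[OF var_max(3)] closed(1)
    by (auto intro: closed(5))
qed

lemma EF:
  assumes k: "k \<in> T \<union> {k0}" and l: "l \<in> Fs"
  shows "ex k * fz l - ey k * fy l + ez k * fx l - (if k = l then s else 0) \<in> \<aa>"
proof (cases "k \<in> I")
  case True
  then have e: "ex k = lift_x m k" "ey k = lift_y m k" "ez k = lift_z m k"
    by (auto simp: ex_def ey_def ez_def)
  show ?thesis
  proof (cases "l \<in> I")
    case l: True
    then have f: "fx l = syz_xy m l" "fy l = syz_xz m l" "fz l = syz_yz m l"
      by (auto simp: fx_def fy_def fz_def)
    have p: "ex k * fz l - ey k * fy l + ez k * fx l = pairing m k l"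
      unfolding e f pairing_def ..
    have "homog_op (m - 1 + (m - 1)) (pairing m k l :: 'k pser3)"
      unfolding pairing_def
      by (intro homog_op_add homog_op_diff homog_op_mult homog_op_lift[OF m1] True l)
    from homog_top[OF this] show ?thesis
      unfolding p coef_pairing[OF m1 True l] by (simp split: if_splits)
  next
    case False
    then have "l = int m + 2 \<or> l = int m + 3 \<or> l = int m + 4" "k \<noteq> l" using l Ks_I k0 True by (auto simp: Fs_def)
    then show ?thesis
      using g_max(1)[OF lift_max(1)[OF True]] g_max(1)[OF lift_max(2)[OF True]] g_max(1)[OF lift_max(3)[OF True]]
      unfolding e fx_def fy_def fz_def by (auto intro: closed(5))
  qed
next
  case False
  then have km: "k = int m + 1" "k \<in> T" using k k0 T_cases[of k] by auto
  then have "k \<noteq> l" using l Ks_I k0 by (auto simp: Fs_def)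
  moreover have "ex k * fz l \<in> \<aa>" "ey k * fy l \<in> \<aa>" "ez k * fx l \<in> \<aa>"
    using f_max[OF l] g_max(2) km closed(1) by (auto simp: ex_def ey_def ez_def)
  ultimately show ?thesis by (auto intro!: closed(2,6) simp: closed(1))
qed

text \<open>The entries of a product of two lifts have degree 2 m - 2, so they are multiples of s
  modulo the ideal, and \<open>bnd_top\<close> makes them a boundary. With the extra index involved,
  all entries lie in n g.\<close>

lemma EE:
  assumes k: "k \<in> T" and l: "l \<in> T"
  shows "bnd (wedge (Ef k) (Ef l))"
proof -
  let ?a = "ex k * ey l - ey k * ex l" and ?b = "ex k * ez l - ez k * ex l" and ?c = "ey k * ez l - ez k * ey l"
  have w: "wedge (Ef k) (Ef l) = form2 ?a ?b ?c" by (rule wedge_homogeneous)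
  show ?thesis
  proof (cases "k \<in> I \<and> l \<in> I")
    case True
    then have e: "ex k = lift_x m k" "ey k = lift_y m k" "ez k = lift_z m k"
      "ex l = lift_x m l" "ey l = lift_y m l" "ez l = lift_z m l"
      by (auto simp: ex_def ey_def ez_def)
    have "homog_op (m - 1 + (m - 1)) ?a" "homog_op (m - 1 + (m - 1)) ?b" "homog_op (m - 1 + (m - 1)) ?c"
      unfolding e using True by (intro homog_op_diff homog_op_mult homog_op_lift[OF m1]; simp)+
    note h = this[THEN homog_top]
    obtain t where t: "const3 (cs ?a) * s - varz * t \<in> \<aa>" "const3 (cs ?b) * s + vary * t \<in> \<aa>"
      "const3 (cs ?c) * s - varx * t \<in> \<aa>"
      using bnd_top[of "cs ?a" "cs ?b" "cs ?c"] unfolding bnd_homogeneous by blast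
    have "?a - varz * t \<in> \<aa>" using closed(2)[OF h(1) t(1)] by (simp only: diff_add_cancel add_diff_eq diff_add_eq)
    moreover have "?b + vary * t \<in> \<aa>" using closed(2)[OF h(2) t(2)] by (simp only: diff_add_cancel add.assoc[symmetric])
    moreover have "?c - varx * t \<in> \<aa>" using closed(2)[OF h(3) t(3)] by (simp only: diff_add_cancel add_diff_eq diff_add_eq)
    ultimately show ?thesis unfolding w bnd_homogeneous by blast
  next
    case False
    then have "k = int m + 1 \<or> l = int m + 1" using k l T_cases by blast
    then have "ex k \<in> {0, g} \<and> ey k \<in> {0, g} \<and> ez k \<in> {0, g} \<or> ex l \<in> {0, g} \<and> ey l \<in> {0, g} \<and> ez l \<in> {0, g}"
      by (auto simp: ex_def ey_def ez_def)
    then have "?a \<in> \<aa> \<and> ?b \<in> \<aa> \<and> ?c \<in> \<aa>"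
    proof
      assume *: "ex k \<in> {0, g} \<and> ey k \<in> {0, g} \<and> ez k \<in> {0, g}"
      have "u * v \<in> \<aa>" if "u \<in> {0, g}" "v \<in> max_ideal" for u v
        using that g_max(2) closed(1) by auto
      then show ?thesis using * e_max[OF l] by (intro conjI closed(6)) auto
    next
      assume *: "ex l \<in> {0, g} \<and> ey l \<in> {0, g} \<and> ez l \<in> {0, g}"
      have "v * u \<in> \<aa>" if "u \<in> {0, g}" "v \<in> max_ideal" for u v
        using that g_max(1) closed(1) by auto
      then show ?thesis using * e_max[OF k] by (intro conjI closed(6)) auto
    qed
    then show ?thesis unfolding w bnd_homogeneous by (intro exI[of _ 0]) simp
  qed
qed

section \<open>Bases of the homology in degrees 1, 2 and 3\<close>

lemma trim_coef_max:
  assumes "k \<in> T" "h \<in> max_ideal" "f \<in> \<aa>"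
  shows "trim_coef m k0 k (h * f) = 0"
proof -
  obtain p q r where "corner (above_except m k0) p q r" "trim_coef m k0 k = (\<lambda>f. coef f p q r :: 'k)"
    using trim_coef_corner[OF m2 k0 assms(1), where 'a = 'k] by blast
  then show ?thesis
    using coef_corner_max_ideal[OF stable_above_except[OF k0], of p q r f h] assms(2,3) by (simp add: aa)
qed

lemma trim_coef_linear:
  assumes "k \<in> T"
  shows "trim_coef m k0 k (f + h) = trim_coef m k0 k f + (trim_coef m k0 k h :: 'k)"
    and "trim_coef m k0 k (\<Sum>i\<in>J. const3 (c i) * F i) = (\<Sum>i\<in>J. c i * trim_coef m k0 k (F i) :: 'k)"
proof -
  obtain p q r where "trim_coef m k0 k = (\<lambda>f. coef f p q r :: 'k)"
    using trim_coef_corner[OF m2 k0 assms(1), where 'a = 'k] by blast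
  then show "trim_coef m k0 k (f + h) = trim_coef m k0 k f + (trim_coef m k0 k h :: 'k)"
    "trim_coef m k0 k (\<Sum>i\<in>J. const3 (c i) * F i) = (\<Sum>i\<in>J. c i * trim_coef m k0 k (F i) :: 'k)"
    by simp_all
qed

lemma delta_nth:
  assumes "distinct ys" "i < length ys"
  shows "(\<Sum>j<length ys. c j * (if ys ! i = ys ! j then 1 else 0)) = (c i :: 'k)"
proof -
  have "(\<Sum>j<length ys. c j * (if ys ! i = ys ! j then 1 else 0)) = (\<Sum>j<length ys. if j = i then c i else 0)"
    using assms by (intro sum.cong) (auto simp: nth_eq_iff_index_eq)
  then show ?thesis using assms(2) by simp
qed

text \<open>The Koszul differential over Q identifies degree 1 of the homology with the ideal modulo
  n times the ideal, where the generators form a basis. Independence uses the dual functionals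
  \<open>trim_coef\<close>, spanning the exactness of the Koszul complex over Q.\<close>

lemma hom_basis_1:
  assumes ks: "distinct ks" "set ks = T"
  shows "hom_basis \<aa> 1 (map kc (map Ef ks))"
proof (rule hom_basisI)
  fix u assume "u \<in> set (map Ef ks)"
  then show "cycle u" "hom_degree_form 1 u" using cycle_E ks hom_degree_homogeneous by auto
next
  fix c i assume "bnd (lincomb c (map Ef ks))" "i < length (map Ef ks)"
  then have i: "i < length ks" by simp
  let ?p = "\<Sum>i<length ks. const3 (c i) * ex (ks ! i)" and ?q = "\<Sum>i<length ks. const3 (c i) * ey (ks ! i)"
    and ?r = "\<Sum>i<length ks. const3 (c i) * ez (ks ! i)"
  obtain X Y Z where *: "?p - (- (vary * X) - varz * Y) \<in> \<aa>" "?q - (varx * X - varz * Z) \<in> \<aa>"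
     "?r - (varx * Y + vary * Z) \<in> \<aa>"
    using \<open>bnd (lincomb c (map Ef ks))\<close> unfolding lincomb_map bnd_homogeneous by blast
  have "varx * ?p + vary * ?q + varz * ?r = (\<Sum>i<length ks. const3 (c i) * trim_gen m k0 (ks ! i))"
    unfolding sum_distrib_left sum.distrib[symmetric]
  proof (rule sum.cong)
    fix i assume "i \<in> {..<length ks}"
    then have "ks ! i \<in> T" using ks by (metis lessThan_iff nth_mem)
    from e_diff[OF this] show "varx * (const3 (c i) * ex (ks ! i)) + vary * (const3 (c i) * ey (ks ! i)) +
        varz * (const3 (c i) * ez (ks ! i)) = const3 (c i) * trim_gen m k0 (ks ! i)"
      by (simp only: mult.left_commute[of varx] mult.left_commute[of vary] mult.left_commute[of varz] distrib_left[symmetric])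
  qed simp
  \<comment> \<open>The terms with X, Y, Z are the differential of a boundary and cancel; what
    remains lies in n times the ideal, where \<open>trim_coef\<close> vanishes.\<close>
  also have "varx * ?p + vary * ?q + varz * ?r = varx * (?p - (- (vary * X) - varz * Y)) +
      vary * (?q - (varx * X - varz * Z)) + varz * (?r - (varx * Y + vary * Z))"
    by (simp add: algebra_simps)
  finally have e: "(\<Sum>i<length ks. const3 (c i) * trim_gen m k0 (ks ! i)) = varx * (?p - (- (vary * X) - varz * Y)) +
      vary * (?q - (varx * X - varz * Z)) + varz * (?r - (varx * Y + vary * Z))" by simp
  have kT: "ks ! j \<in> T" if "j < length ks" for j using ks that by (metis nth_mem)
  have "(\<Sum>j<length ks. c j * trim_coef m k0 (ks ! i) (trim_gen m k0 (ks ! j))) =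
      trim_coef m k0 (ks ! i) (\<Sum>i<length ks. const3 (c i) * trim_gen m k0 (ks ! i))"
    by (rule trim_coef_linear(2)[OF kT[OF i], symmetric])
  also have "\<dots> = 0"
    unfolding e trim_coef_linear(1)[OF kT[OF i]]
    using trim_coef_max[OF kT[OF i]] * by simp
  also have "(\<Sum>j<length ks. c j * trim_coef m k0 (ks ! i) (trim_gen m k0 (ks ! j))) =
      (\<Sum>j<length ks. c j * (if ks ! i = ks ! j then 1 else 0))"
    using kT i by (intro sum.cong) (simp_all add: trim_coef_trim_gen[OF m2 k0])
  also have "\<dots> = c i" by (rule delta_nth[OF ks(1) i])
  finally show "c i = 0" .
next
  fix u assume u: "cycle u" "hom_degree_form 1 u"
  obtain p q r where upqr: "u = form1 p q r"
    using homogeneous_cases(1)[OF is_form_cycle[OF u(1)] u(2)] by blast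
  let ?f = "varx * p + vary * q + varz * r"
  have "?f \<in> \<aa>" using u(1) unfolding upqr cycle_homogeneous .
  then obtain h where h: "?f = (\<Sum>k\<in>T. h k * trim_gen m k0 k)"
    unfolding aa genideal_trim_gen[OF m2 k0, symmetric] by (auto simp: genideal_image)
  define c where "c k = coef (h k) 0 0 0" for k
  have "h k - const3 (c k) \<in> max_ideal" for k
  proof -
    have "coef (const3 (c k) * 1) 0 0 0 = c k" by (simp only: coef_const3 coef_one) simp
    then show ?thesis by (simp add: mem_max_ideal_iff c_def)
  qed
  \<comment> \<open>The non-constant parts of the coefficients contribute elements of n times the
    ideal. They are absorbed by \<open>P\<close>, \<open>Q\<close>, \<open>R\<close>, which change
    the 1-form only modulo the ideal.\<close>
  then have "\<forall>k. \<exists>h1 h2 h3. h k - const3 (c k) = varx * h1 + vary * h2 + varz * h3"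
    by (meson max_ideal_decompose)
  then obtain h1 h2 h3 where h': "\<And>k. h k - const3 (c k) = varx * h1 k + vary * h2 k + varz * h3 k" by metis
  define P where "P = (\<Sum>k\<in>T. h1 k * trim_gen m k0 k)"
  define Q where "Q = (\<Sum>k\<in>T. h2 k * trim_gen m k0 k)"
  define R where "R = (\<Sum>k\<in>T. h3 k * trim_gen m k0 k)"
  have PQR: "P \<in> \<aa>" "Q \<in> \<aa>" "R \<in> \<aa>"
    unfolding P_def Q_def R_def using trim_gen_aa by (auto intro!: closed(7) closed(3))
  have "h k = const3 (c k) + (varx * h1 k + vary * h2 k + varz * h3 k)" for k
    using h'[of k] by (simp add: algebra_simps)
  then have "?f = (\<Sum>k\<in>T. const3 (c k) * trim_gen m k0 k) + (varx * P + vary * Q + varz * R)"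
    unfolding h P_def Q_def R_def sum_distrib_left sum.distrib[symmetric]
    by (intro sum.cong) (simp_all only: algebra_simps)
  moreover have "(\<Sum>k\<in>T. const3 (c k) * trim_gen m k0 k) = varx * (\<Sum>k\<in>T. const3 (c k) * ex k) +
      vary * (\<Sum>k\<in>T. const3 (c k) * ey k) + varz * (\<Sum>k\<in>T. const3 (c k) * ez k)"
    unfolding sum_distrib_left sum.distrib[symmetric]
    by (intro sum.cong refl, subst e_diff[symmetric]) (simp_all only: algebra_simps)
  ultimately have "varx * (p - (\<Sum>k\<in>T. const3 (c k) * ex k) - P) + vary * (q - (\<Sum>k\<in>T. const3 (c k) * ey k) - Q) +
      varz * (r - (\<Sum>k\<in>T. const3 (c k) * ez k) - R) = 0"
    by (simp add: algebra_simps)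
  then obtain X Y Z where XYZ: "p - (\<Sum>k\<in>T. const3 (c k) * ex k) - P = - (vary * X) - varz * Y"
    "q - (\<Sum>k\<in>T. const3 (c k) * ey k) - Q = varx * X - varz * Z"
    "r - (\<Sum>k\<in>T. const3 (c k) * ez k) - R = varx * Y + vary * Z"
    by (rule koszul_exact_1)
  have l: "lincomb (\<lambda>i. c (ks ! i)) (map Ef ks) = form1 (\<Sum>k\<in>T. const3 (c k) * ex k)
      (\<Sum>k\<in>T. const3 (c k) * ey k) (\<Sum>k\<in>T. const3 (c k) * ez k)"
    unfolding lincomb_map ks(2)[symmetric]
    using sum_nth_distinct[OF ks(1), of "\<lambda>k. const3 (c k) * ex k"] sum_nth_distinct[OF ks(1), of "\<lambda>k. const3 (c k) * ey k"]
      sum_nth_distinct[OF ks(1), of "\<lambda>k. const3 (c k) * ez k"] by simp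
  have "bnd (\<lambda>S. u S - lincomb (\<lambda>i. c (ks ! i)) (map Ef ks) S)"
    unfolding l upqr homogeneous_diff bnd_homogeneous
    by (intro exI[of _ X] exI[of _ Y] exI[of _ Z], fold XYZ) (simp add: PQR)
  then show "\<exists>c. bnd (\<lambda>S. u S - lincomb c (map Ef ks) S)" by blast
qed

text \<open>Modulo the Pfaffian ideal such a t is a multiple of s. The variables move s into the
  trimmed ideal, and also the difference, as n times the Pfaffian ideal lies there.\<close>

lemma socle_A:
  assumes "varx * t \<in> A" "vary * t \<in> A" "varz * t \<in> A"
  shows "varx * t \<in> \<aa>" "vary * t \<in> \<aa>" "varz * t \<in> \<aa>"
proof -
  have *: "t - const3 (cs t) * s \<in> A" by (rule socle_above[OF assms])
  have "v * t \<in> \<aa>" if "v \<in> max_ideal" "v * s \<in> \<aa>" for v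
  proof -
    have "v * t = v * (t - const3 (cs t) * s) + const3 (cs t) * (v * s)" by (simp add: algebra_simps)
    then show ?thesis using closed(2)[OF max_A[OF that(1) *] closed(3)[OF that(2)]] by simp
  qed
  then show "varx * t \<in> \<aa>" "vary * t \<in> \<aa>" "varz * t \<in> \<aa>" using s_socle by simp_all
qed

lemma socle_quotient:
  assumes "varx * t \<in> \<aa>" "vary * t \<in> \<aa>" "varz * t \<in> \<aa>"
  obtains c d where "t - (const3 c * s + const3 d * g) \<in> \<aa>"
proof -
  have "t - const3 (cs t) * s \<in> A" using assms by (intro socle_above aa_subset)
  from A_decompose[OF this] show thesis by (intro that[of "cs t" "cg (t - const3 (cs t) * s)"]) (simp add: algebra_simps)
qed

lemma cg_s: "cg s = 0"
  using m3 k0 unfolding coef_s by auto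

lemma hom_basis_3: "hom_basis \<aa> 3 (map kc (map form3 [s, g]))"
proof (rule hom_basisI)
  fix u assume "u \<in> set (map form3 [s, g])"
  then show "cycle u" "hom_degree_form 3 u"
    using hom_degree_homogeneous(3) s_socle g_max(1)[OF var_max(1)] g_max(1)[OF var_max(2)] g_max(1)[OF var_max(3)]
    by (auto simp: cycle_homogeneous)
next
  fix c i assume b: "bnd (lincomb c (map form3 [s, g]))" "i < length (map form3 [s, g])"
  have "lincomb c (map form3 [s, g]) = form3 (const3 (c 0) * s + const3 (c 1) * g)"
    using lincomb_map(3)[of c "\<lambda>t. t" "[s, g]"] by (simp add: numeral_2_eq_2)
  then have *: "const3 (c 0) * s + const3 (c 1) * g \<in> \<aa>" using b(1) by (simp only: bnd_homogeneous)
  have "cg (const3 (c 0) * s + const3 (c 1) * g) = c 1"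
    using cg_s cg_g by (simp only: coef_add coef_const3 mult_zero_right mult_1_right add_0)
  moreover have "cg (const3 (c 0) * s + const3 (c 1) * g) = 0" using * aa_iff by blast
  ultimately have c1: "c 1 = 0" by (simp only:)
  have "cs (const3 (c 0) * s + const3 (c 1) * g) = c 0"
    unfolding coef_add coef_const3 coef_s c1 by simp
  moreover have "cs (const3 (c 0) * s + const3 (c 1) * g) = 0" by (rule cs_A[OF aa_subset[OF *]])
  ultimately have "c 0 = 0" by (simp only:)
  then show "c i = 0" using c1 b(2) by (cases i) auto
next
  fix u assume u: "cycle u" "hom_degree_form 3 u"
  obtain t where t: "u = form3 t"
    using homogeneous_cases(3)[OF is_form_cycle[OF u(1)] u(2)] by blast
  have "varx * t \<in> \<aa>" "vary * t \<in> \<aa>" "varz * t \<in> \<aa>" using u(1) unfolding t cycle_homogeneous by auto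
  then obtain c d where cd: "t - (const3 c * s + const3 d * g) \<in> \<aa>" by (rule socle_quotient)
  have "lincomb (case_nat c (\<lambda>_. d)) (map form3 [s, g]) = form3 (const3 c * s + const3 d * g)"
    using lincomb_map(3)[of "case_nat c (\<lambda>_. d)" "\<lambda>t. t" "[s, g]"] by (simp add: numeral_2_eq_2)
  then have "bnd (\<lambda>S. u S - lincomb (case_nat c (\<lambda>_. d)) (map form3 [s, g]) S)"
    unfolding t using cd by (simp only: homogeneous_diff bnd_homogeneous)
  then show "\<exists>c. bnd (\<lambda>S. u S - lincomb c (map form3 [s, g]) S)" by blast
qed

lemma type_2: "has_type \<aa> 2"
  using has_type_of_basis[OF hom_basis_3] by (simp add: numeral_2_eq_2)

text \<open>The multiplier t of such a boundary is a socle element modulo the Pfaffian ideal. By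
  \<open>socle_A\<close> its products with the variables lie in the trimmed ideal and cannot produce
  a non-zero multiple of g.\<close>

lemma bnd_g_forms:
  assumes "bnd (form2 (const3 a * g) (const3 b * g) (const3 c * g))"
  shows "a = 0" "b = 0" "c = 0"
proof -
  obtain t where t: "const3 a * g - varz * t \<in> \<aa>" "const3 b * g + vary * t \<in> \<aa>" "const3 c * g - varx * t \<in> \<aa>"
    using assms unfolding bnd_homogeneous by blast
  have gA: "const3 d * g \<in> A" for d
    by (rule supp_in_mult[OF stable_above gen_mem_above])
  note i = supp_in_ideal[OF stable_above[of m], where 'a = 'k]
  have A: "varz * t \<in> A" "vary * t \<in> A" "varx * t \<in> A"
    using ideal_diff[OF i gA[of a] aa_subset[OF t(1)]] ideal_diff[OF i aa_subset[OF t(2)] gA[of b]]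
      ideal_diff[OF i gA[of c] aa_subset[OF t(3)]] by simp_all
  note z = socle_A[OF A(3,2,1)]
  have "const3 a * g \<in> \<aa>" "const3 b * g \<in> \<aa>" "const3 c * g \<in> \<aa>"
    using closed(2)[OF t(1) z(3)] closed(6)[OF t(2) z(2)] closed(2)[OF t(3) z(1)] by simp_all
  then have "cg (const3 a * g) = 0" "cg (const3 b * g) = 0" "cg (const3 c * g) = 0"
    using aa_iff by blast+
  then show "a = 0" "b = 0" "c = 0" unfolding coef_const3 cg_g by simp_all
qed

lemma Fs_Ks: "l \<in> Fs \<Longrightarrow> l \<in> Ks \<or> l = k0 \<or> l = int m + 2 \<or> l = int m + 3 \<or> l = int m + 4"
  by (auto simp: Fs_def)

text \<open>The pairing with the 1-forms detects the coefficients of the syzygies, and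
  \<open>bnd_g_forms\<close> those of the multiples of g. For spanning, the cycle is first written
  over all syzygies modulo the Pfaffian ideal; its being a cycle modulo the smaller ideal then
  excludes the syzygies that are not.\<close>

lemma hom_basis_2:
  assumes ls: "distinct ls" "set ls = Fs"
  shows "hom_basis \<aa> 2 (map kc (map Ff ls))"
proof (rule hom_basisI)
  fix u assume "u \<in> set (map Ff ls)"
  then show "cycle u" "hom_degree_form 2 u" using cycle_F ls hom_degree_homogeneous by auto
next
  fix c i assume b: "bnd (lincomb c (map Ff ls))" and "i < length (map Ff ls)"
  then have i: "i < length ls" by simp
  have lF: "ls ! j \<in> Fs" if "j < length ls" for j using ls that by (metis nth_mem)
  let ?a = "\<Sum>i<length ls. const3 (c i) * fx (ls ! i)" and ?b = "\<Sum>i<length ls. const3 (c i) * fy (ls ! i)"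
    and ?c = "\<Sum>i<length ls. const3 (c i) * fz (ls ! i)"
  obtain t where t: "?a - varz * t \<in> \<aa>" "?b + vary * t \<in> \<aa>" "?c - varx * t \<in> \<aa>"
    using b unfolding lincomb_map bnd_homogeneous by blast
  have zero: "c i = 0" if i: "i < length ls" and l: "ls ! i \<in> Ks \<union> {k0}" for i
  proof -
    let ?k = "ls ! i"
    have kI: "?k \<in> I" and kT: "?k \<in> T \<union> {k0}" using l Ks_I Ks_T k0 by auto
    have d: "varx * ex ?k + vary * ey ?k + varz * ez ?k = gen m ?k"
      using lift_diff[OF m1 kI, where 'k = 'k] kI by (auto simp: ex_def ey_def ez_def)
    \<comment> \<open>The relation is wedged with \<open>Ef ?k\<close>. The boundary contributes
      \<open>gen m ?k * t\<close>, which lies in the Pfaffian ideal and has no coordinate at the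
      exponent of s.\<close>
    have "ex ?k * (?c - varx * t) - ey ?k * (?b + vary * t) + ez ?k * (?a - varz * t) \<in> \<aa>"
      by (intro closed(2,3,6) t)
    also have "ex ?k * (?c - varx * t) - ey ?k * (?b + vary * t) + ez ?k * (?a - varz * t) =
        (ex ?k * ?c - ey ?k * ?b + ez ?k * ?a) - (varx * ex ?k + vary * ey ?k + varz * ez ?k) * t"
      by (simp add: algebra_simps)
    finally have "(ex ?k * ?c - ey ?k * ?b + ez ?k * ?a) - gen m ?k * t \<in> \<aa>" unfolding d .
    then have "cs ((ex ?k * ?c - ey ?k * ?b + ez ?k * ?a) - gen m ?k * t) = 0" by (rule cs_A[OF aa_subset])
    then have 1: "cs (ex ?k * ?c - ey ?k * ?b + ez ?k * ?a) - cs (gen m ?k * t) = 0"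
      by (simp only: coef_diff[of _ "gen m ?k * t"])
    have 2: "cs (gen m ?k * t) = 0"
      using ideal_mult_right[OF supp_in_ideal[OF stable_above] gen_mem_above, of m ?k t] by (rule cs_A)
    have "ex ?k * ?c - ey ?k * ?b + ez ?k * ?a =
        (\<Sum>j<length ls. const3 (c j) * (ex ?k * fz (ls ! j) - ey ?k * fy (ls ! j) + ez ?k * fx (ls ! j)))"
      unfolding sum_distrib_left sum_subtractf[symmetric] sum.distrib[symmetric]
      by (rule sum.cong) (simp_all add: algebra_simps)
    then have "cs (ex ?k * ?c - ey ?k * ?b + ez ?k * ?a) =
        (\<Sum>j<length ls. c j * cs (ex ?k * fz (ls ! j) - ey ?k * fy (ls ! j) + ez ?k * fx (ls ! j)))"
      by (simp only: coef_sum coef_const3)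
    also have "\<dots> = (\<Sum>j<length ls. c j * (if ?k = ls ! j then 1 else 0))"
    proof (rule sum.cong)
      fix j assume "j \<in> {..<length ls}"
      then have "cs (ex ?k * fz (ls ! j) - ey ?k * fy (ls ! j) + ez ?k * fx (ls ! j) - (if ?k = ls ! j then s else 0)) = 0"
        using cs_A[OF aa_subset[OF EF[OF kT lF]]] by simp
      then have "cs (ex ?k * fz (ls ! j) - ey ?k * fy (ls ! j) + ez ?k * fx (ls ! j)) = (if ?k = ls ! j then 1 else 0)"
        unfolding coef_diff[of _ "if ?k = ls ! j then s else 0"] by (simp add: coef_s del: coef_varx_power One_nat_def split: if_splits)
      then show "c j * cs (ex ?k * fz (ls ! j) - ey ?k * fy (ls ! j) + ez ?k * fx (ls ! j)) =
          c j * (if ?k = ls ! j then 1 else 0)" by simp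
    qed simp
    also have "\<dots> = c i" by (rule delta_nth[OF ls(1) i])
    finally show ?thesis using 1 2 by simp
  qed
  \<comment> \<open>The coefficients indexed by labels instead of list positions.\<close>
  define d where "d l = c (inv_into {..<length ls} (nth ls) l)" for l
  have dn: "d (ls ! j) = c j" if "j < length ls" for j
    unfolding d_def using that ls(1) by (simp add: inj_on_nth inv_into_f_f)
  have d0: "d l = 0" if "l \<in> Ks \<union> {k0}" for l
  proof -
    have "l \<in> set ls" using that ls by (auto simp: Fs_def)
    then obtain j where "j < length ls" "l = ls ! j" by (metis in_set_conv_nth)
    then show ?thesis using zero[of j] that dn by simp
  qed
  have fin: "finite Fs" using ls(2) by (metis List.finite_set)
  have sums: "(\<Sum>i<length ls. const3 (c i) * f (ls ! i)) = const3 (d (int m + 2)) * f (int m + 2) +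
      const3 (d (int m + 3)) * f (int m + 3) + const3 (d (int m + 4)) * f (int m + 4)" for f :: "int \<Rightarrow> 'k pser3"
  proof -
    have "(\<Sum>i<length ls. const3 (c i) * f (ls ! i)) = (\<Sum>i<length ls. const3 (d (ls ! i)) * f (ls ! i))"
      by (rule sum.cong) (auto simp: dn)
    also have "\<dots> = (\<Sum>l\<in>Fs. const3 (d l) * f l)"
      using sum_nth_distinct[OF ls(1), of "\<lambda>l. const3 (d l) * f l"] ls(2) by simp
    also have "\<dots> = (\<Sum>l\<in>{int m + 2, int m + 3, int m + 4}. const3 (d l) * f l)"
      using d0 fin by (intro sum.mono_neutral_right) (auto simp: Fs_def)
    finally show ?thesis by (simp add: add.assoc)
  qed
  have "lincomb c (map Ff ls) = form2 (const3 (d (int m + 2)) * g) (const3 (d (int m + 3)) * g) (const3 (d (int m + 4)) * g)"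
    unfolding lincomb_map sums by (simp add: fx_def fy_def fz_def)
  then have "d (int m + 2) = 0" "d (int m + 3) = 0" "d (int m + 4) = 0"
    using bnd_g_forms b by auto
  then show "c i = 0" using Fs_Ks[OF lF[OF i]] zero[OF i] dn[OF i] by auto
next
  fix u assume u: "cycle u" "hom_degree_form 2 u"
  obtain a b c where uabc: "u = form2 a b c"
    using homogeneous_cases(2)[OF is_form_cycle[OF u(1)] u(2)] by blast
  have cyc: "- (vary * a) - varz * b \<in> \<aa>" "varx * a - varz * c \<in> \<aa>" "varx * b + vary * c \<in> \<aa>"
    using u(1) unfolding uabc cycle_homogeneous by auto
  have "vary * a + varz * b \<in> \<aa>" using closed(5)[OF cyc(1)] by (simp add: algebra_simps)
  then have "h2_spanned m a b c" using cyc by (intro h2_spanned_cycle m1 aa_subset)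
  then obtain \<gamma> w where
     1: "a - (\<Sum>k\<in>I. const3 (\<gamma> k) * syz_xy m k) - varz * w \<in> A"
     "b - (\<Sum>k\<in>I. const3 (\<gamma> k) * syz_xz m k) + vary * w \<in> A"
     "c - (\<Sum>k\<in>I. const3 (\<gamma> k) * syz_yz m k) - varx * w \<in> A"
    unfolding h2_spanned_def by blast
  let ?a = "a - (\<Sum>k\<in>I. const3 (\<gamma> k) * syz_xy m k) - varz * w"
    and ?b = "b - (\<Sum>k\<in>I. const3 (\<gamma> k) * syz_xz m k) + vary * w"
    and ?c = "c - (\<Sum>k\<in>I. const3 (\<gamma> k) * syz_yz m k) - varx * w"
  \<comment> \<open>These sums are the differential of the syzygy part. It differs from the
    differential of the given cycle by that of the error terms, which lie in n times the Pfaffian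
    ideal; the differential of the boundary is zero.\<close>
  have D: "(\<Sum>k\<in>I. const3 (\<gamma> k) * (- (vary * syz_xy m k) - varz * syz_xz m k)) \<in> \<aa>"
    "(\<Sum>k\<in>I. const3 (\<gamma> k) * (varx * syz_xy m k - varz * syz_yz m k)) \<in> \<aa>"
    "(\<Sum>k\<in>I. const3 (\<gamma> k) * (varx * syz_xz m k + vary * syz_yz m k)) \<in> \<aa>"
  proof -
    have l: "(\<Sum>k\<in>I. const3 (\<gamma> k) * (v * f k)) = v * (\<Sum>k\<in>I. const3 (\<gamma> k) * f k)" for v f
      by (simp add: sum_distrib_left mult.left_commute)
    have "(\<Sum>k\<in>I. const3 (\<gamma> k) * (- (vary * syz_xy m k) - varz * syz_xz m k)) =
        - (vary * (\<Sum>k\<in>I. const3 (\<gamma> k) * syz_xy m k)) - varz * (\<Sum>k\<in>I. const3 (\<gamma> k) * syz_xz m k)"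
      by (simp only: right_diff_distrib mult_minus_right sum_subtractf sum_negf l)
    also have "\<dots> = (- (vary * a) - varz * b) + vary * ?a + varz * ?b"
      by (simp add: algebra_simps)
    finally have "(\<Sum>k\<in>I. const3 (\<gamma> k) * (- (vary * syz_xy m k) - varz * syz_xz m k)) = (- (vary * a) - varz * b) + vary * ?a + varz * ?b" .
    then show "(\<Sum>k\<in>I. const3 (\<gamma> k) * (- (vary * syz_xy m k) - varz * syz_xz m k)) \<in> \<aa>"
      by (simp only:) (intro closed(2) cyc var_A 1)
    have "(\<Sum>k\<in>I. const3 (\<gamma> k) * (varx * syz_xy m k - varz * syz_yz m k)) =
        varx * (\<Sum>k\<in>I. const3 (\<gamma> k) * syz_xy m k) - varz * (\<Sum>k\<in>I. const3 (\<gamma> k) * syz_yz m k)"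
      by (simp only: right_diff_distrib sum_subtractf l)
    also have "\<dots> = (varx * a - varz * c) - varx * ?a + varz * ?c"
      by (simp add: algebra_simps)
    finally have "(\<Sum>k\<in>I. const3 (\<gamma> k) * (varx * syz_xy m k - varz * syz_yz m k)) = (varx * a - varz * c) - varx * ?a + varz * ?c" .
    then show "(\<Sum>k\<in>I. const3 (\<gamma> k) * (varx * syz_xy m k - varz * syz_yz m k)) \<in> \<aa>"
      by (simp only:) (intro closed(2,6) cyc var_A 1)
    have "(\<Sum>k\<in>I. const3 (\<gamma> k) * (varx * syz_xz m k + vary * syz_yz m k)) =
        varx * (\<Sum>k\<in>I. const3 (\<gamma> k) * syz_xz m k) + vary * (\<Sum>k\<in>I. const3 (\<gamma> k) * syz_yz m k)"
      by (simp only: distrib_left sum.distrib l)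
    also have "\<dots> = (varx * b + vary * c) - varx * ?b - vary * ?c"
      by (simp add: algebra_simps)
    finally have "(\<Sum>k\<in>I. const3 (\<gamma> k) * (varx * syz_xz m k + vary * syz_yz m k)) = (varx * b + vary * c) - varx * ?b - vary * ?c" .
    then show "(\<Sum>k\<in>I. const3 (\<gamma> k) * (varx * syz_xz m k + vary * syz_yz m k)) \<in> \<aa>"
      by (simp only:) (intro closed(2,6) cyc var_A 1)
  qed
  \<comment> \<open>In one component the differential of the k-th syzygy is plus or minus g, and no
    other index yields g there. So \<open>cg\<close> of that component of the sum is plus or minus
    \<open>\<gamma> k\<close>.\<close>
  have zero: "\<gamma> k = 0" if k: "k \<in> I" "k \<notin> Ks" "k \<noteq> k0" for k
  proof -
    have e: "(\<Sum>l\<in>I. \<gamma> l * cg (f l)) = 0" if "(\<Sum>l\<in>I. const3 (\<gamma> l) * f l) \<in> \<aa>" for f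
    proof -
      have "cg (\<Sum>l\<in>I. const3 (\<gamma> l) * f l) = 0" using that aa_iff by blast
      then show ?thesis by (simp only: coef_sum coef_const3)
    qed
    have sel: "(\<Sum>l\<in>I. \<gamma> l * h l) = \<gamma> k * h k" if "\<And>l. l \<in> I \<Longrightarrow> l \<noteq> k \<Longrightarrow> h l = 0" for h
    proof -
      have "(\<Sum>l\<in>I. \<gamma> l * h l) = (\<Sum>l\<in>{k}. \<gamma> l * h l)"
        using k(1) that by (intro sum.mono_neutral_right) auto
      then show ?thesis by simp
    qed
    consider "1 - k = k0" | "- 1 - k = k0" | "k \<noteq> 0" "- k = k0"
      using k by (auto simp: Ks_def)
    then show ?thesis
    proof cases
      case 1
      have h: "cg (- (vary * syz_xy m l) - varz * syz_xz m l) = (if l = k then if k > 0 then 1 else - 1 else 0)"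
        if "l \<in> I" for l
        unfolding syz_diff(1)[OF m1 that] using 1 cg_gen0[of "1 - l"] by auto
      have "\<gamma> k * cg (- (vary * syz_xy m k) - varz * syz_xz m k) = (\<Sum>l\<in>I. \<gamma> l * cg (- (vary * syz_xy m l) - varz * syz_xz m l))"
        by (rule sel[symmetric]) (simp only: h if_False)
      also have "\<dots> = 0" by (rule e[OF D(1)])
      finally show ?thesis unfolding h[OF k(1)] by (simp split: if_splits)
    next
      case 2
      have h: "cg (varx * syz_xy m l - varz * syz_yz m l) = (if l = k then if k \<ge> 0 then 1 else - 1 else 0)"
        if "l \<in> I" for l
        unfolding syz_diff(2)[OF m1 that] using 2 cg_gen0[of "- 1 - l"] by auto
      have "\<gamma> k * cg (varx * syz_xy m k - varz * syz_yz m k) = (\<Sum>l\<in>I. \<gamma> l * cg (varx * syz_xy m l - varz * syz_yz m l))"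
        by (rule sel[symmetric]) (simp only: h if_False)
      also have "\<dots> = 0" by (rule e[OF D(2)])
      finally show ?thesis unfolding h[OF k(1)] by (simp split: if_splits)
    next
      case 3
      have h: "cg (varx * syz_xz m l + vary * syz_yz m l) = (if l = k then if k > 0 then - 1 else 1 else 0)"
        if "l \<in> I" for l
        unfolding syz_diff(3)[OF m1 that] using 3 cg_gen0[of "- l"] by auto
      have "\<gamma> k * cg (varx * syz_xz m k + vary * syz_yz m k) = (\<Sum>l\<in>I. \<gamma> l * cg (varx * syz_xz m l + vary * syz_yz m l))"
        by (rule sel[symmetric]) (simp only: h if_False)
      also have "\<dots> = 0" by (rule e[OF D(3)])
      finally show ?thesis unfolding h[OF k(1)] by (simp split: if_splits)
    qed
  qed
  \<comment> \<open>Modulo the trimmed ideal the three error terms are multiples of g; these are the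
    coefficients of the last three 2-cycles.\<close>
  define ca where "ca = cg ?a"
  define cb where "cb = cg ?b"
  define cc where "cc = cg ?c"
  define d where "d l = (if l = int m + 2 then ca else if l = int m + 3 then cb else if l = int m + 4 then cc else \<gamma> l)" for l
  have fin: "finite Fs" using ls(2) by (metis List.finite_set)
  have sums: "(\<Sum>i<length ls. const3 (d (ls ! i)) * f (ls ! i)) = (\<Sum>k\<in>I. const3 (\<gamma> k) * f k) +
      (const3 (ca) * f (int m + 2) + const3 (cb) * f (int m + 3) + const3 (cc) * f (int m + 4))" for f
  proof -
    have "(\<Sum>i<length ls. const3 (d (ls ! i)) * f (ls ! i)) = (\<Sum>l\<in>Fs. const3 (d l) * f l)"
      using sum_nth_distinct[OF ls(1), of "\<lambda>l. const3 (d l) * f l"] ls(2) by simp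
    also have "\<dots> = (\<Sum>l\<in>Ks \<union> {k0}. const3 (d l) * f l) + (\<Sum>l\<in>{int m + 2, int m + 3, int m + 4}. const3 (d l) * f l)"
      unfolding Fs_def using fin Ks_I k0 by (intro sum.union_disjoint) (auto simp: Fs_def)
    also have "(\<Sum>l\<in>Ks \<union> {k0}. const3 (d l) * f l) = (\<Sum>l\<in>Ks \<union> {k0}. const3 (\<gamma> l) * f l)"
      using Ks_I k0 by (intro sum.cong) (auto simp: d_def)
    also have "\<dots> = (\<Sum>l\<in>I. const3 (\<gamma> l) * f l)"
      using Ks_I k0 zero by (intro sum.mono_neutral_left) auto
    finally show ?thesis by (simp add: d_def add.assoc)
  qed
  have l: "lincomb (\<lambda>i. d (ls ! i)) (map Ff ls) = form2 ((\<Sum>k\<in>I. const3 (\<gamma> k) * syz_xy m k) + const3 (ca) * g)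
      ((\<Sum>k\<in>I. const3 (\<gamma> k) * syz_xz m k) + const3 (cb) * g) ((\<Sum>k\<in>I. const3 (\<gamma> k) * syz_yz m k) + const3 (cc) * g)"
  proof -
    have "(\<Sum>k\<in>I. const3 (\<gamma> k) * fx k) = (\<Sum>k\<in>I. const3 (\<gamma> k) * syz_xy m k)"
      "(\<Sum>k\<in>I. const3 (\<gamma> k) * fy k) = (\<Sum>k\<in>I. const3 (\<gamma> k) * syz_xz m k)"
      "(\<Sum>k\<in>I. const3 (\<gamma> k) * fz k) = (\<Sum>k\<in>I. const3 (\<gamma> k) * syz_yz m k)"
      by (intro sum.cong; auto simp: fx_def fy_def fz_def)+
    moreover have "fx (int m + 2) = g" "fx (int m + 3) = 0" "fx (int m + 4) = 0"
      "fy (int m + 2) = 0" "fy (int m + 3) = g" "fy (int m + 4) = 0"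
      "fz (int m + 2) = 0" "fz (int m + 3) = 0" "fz (int m + 4) = g"
      by (simp_all add: fx_def fy_def fz_def)
    ultimately show ?thesis unfolding lincomb_map sums by (simp only: mult_zero_right add_0 add_0_right)
  qed
  have r: "x - (S + h) - v = (x - S - v) - h" "x - (S + h) + v = (x - S + v) - h" for x S h v :: "'k pser3"
    by (simp_all add: algebra_simps)
  have "bnd (\<lambda>S. u S - lincomb (\<lambda>i. d (ls ! i)) (map Ff ls) S)"
    unfolding l uabc homogeneous_diff bnd_homogeneous
    by (intro exI[of _ w], unfold r) (intro conjI A_decompose[OF 1(1), folded ca_def] A_decompose[OF 1(2), folded cb_def] A_decompose[OF 1(3), folded cc_def])
  then show "\<exists>c. bnd (\<lambda>S. u S - lincomb c (map Ff ls) S)" by blast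
qed

end

text \<open>Four of the 2 m + 1 indices drop out in general: k0, 1 - k0, -1 - k0 and -k0. For k0 = m
  or -m one of them is out of range, and for k0 = 0 the last coincides with the first, so only three
  drop out.\<close>

lemma (in trimmed_quotient) card_Ks: "card Ks = (if k0 \<in> {0, int m, - int m} then 2 * m - 2 else 2 * m - 3)"
proof -
  define X where "X = {k0} \<union> ({1 - k0, - 1 - k0} \<inter> I) \<union> (if k0 = 0 then {} else {- k0})"
  have K: "Ks = I - X" and XI: "X \<subseteq> I" using k0 by (auto simp: Ks_def X_def)
  have cX: "card X = (if k0 \<in> {0, int m, - int m} then 3 else 4)"
  proof -
    consider "k0 = 0" | "k0 = int m" | "k0 = - int m" | "k0 \<notin> {0, int m, - int m}" by blast
    then show ?thesis
    proof cases
      case 1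
      then have "X = {0, 1, - 1}" using m3 by (auto simp: X_def)
      then show ?thesis using 1 by simp
    next
      case 2
      then have "X = {int m, 1 - int m, - int m}" using m3 by (auto simp: X_def)
      then show ?thesis using 2 m3 by simp
    next
      case 3
      then have "X = {- int m, int m - 1, int m}" using m3 by (auto simp: X_def)
      then show ?thesis using 3 m3 by simp
    next
      case 4
      then have "X = {k0, 1 - k0, - 1 - k0, - k0}" using k0 by (auto simp: X_def)
      moreover have "1 - k0 \<noteq> k0" "- 1 - k0 \<noteq> k0" by presburger+
      ultimately show ?thesis using 4 by simp
    qed
  qed
  have "finite X" using XI finite_subset by blast
  then have "card Ks = card I - card X" unfolding K using XI by (intro card_Diff_subset)
  moreover have "card I = 2 * m + 1" by simp
  ultimately show ?thesis unfolding cX using m3 by auto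
qed

lemma (in trimmed_quotient) card_T: "card T = card Ks + 3"
  using card_trim_index[OF m1 k0] m3 unfolding card_Ks by simp

lemma (in trimmed_quotient) subset_max_square: "\<aa> \<subseteq> ideal_prod class_ring max_ideal max_ideal"
proof -
  let ?P = "ideal_prod class_ring max_ideal max_ideal :: 'k pser3 set"
  have M: "ideal (max_ideal :: 'k pser3 set) class_ring"
    unfolding max_ideal_def by (rule genideal_is_ideal)
  have P: "ideal ?P class_ring"
    by (rule ring.ideal_prod_is_ideal[OF class_ring.ring_axioms M M])
  have prod: "u * v \<in> ?P" if "u \<in> max_ideal" "v \<in> max_ideal" for u v
    using ideal_prod.prod[OF that, of class_ring] by simp
  have "gen m k \<in> ?P" if "k \<in> I" for k
    unfolding lift_diff[OF m1 that, symmetric]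
    by (intro ideal_add[OF P] prod lift_max that var_max)
  then have "genideal class_ring (gen m ` I) \<subseteq> ?P"
    by (intro genideal_least[OF P]) auto
  then show ?thesis unfolding genideal_gen using aa_subset by blast
qed

text \<open>Both lists of cycles begin with the indices of \<open>Ks\<close> in the same order and
  have no other labels in common, so equality of labels is equality of positions below
  \<open>card Ks\<close>.\<close>

lemma (in trimmed_quotient) class_G_card_Ks:
  assumes "proj_dim_quotient \<aa> 3"
  shows "class_G \<aa> (card Ks)"
proof -
  define ks where "ks = sorted_list_of_set Ks"
  have fK: "finite Ks" using Ks_I finite_subset by blast
  have ks: "distinct ks" "set ks = Ks" "length ks = card Ks"
    using fK by (simp_all add: ks_def)
  define ts where "ts = ks @ sorted_list_of_set (T - Ks)"
  have ts: "distinct ts" "set ts = T" "length ts = card T"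
    using ks Ks_T fK by (auto simp: ts_def card_Diff_subset card_mono)
  define ls where "ls = ks @ [k0, int m + 2, int m + 3, int m + 4]"
  have ls: "distinct ls" "set ls = Fs" "length ls = card T + 1"
    using ks k0_Ks Ks_I k0 by (auto simp: ls_def Fs_def card_T)
  have iff: "ts ! i = ls ! j \<longleftrightarrow> i = j \<and> i < card Ks" if "i < length ts" "j < length ls" for i j
  proof -
    have ni: "ts ! i \<in> T - Ks" if "\<not> i < card Ks"
      using that \<open>i < length ts\<close> ks nth_mem[of "i - length ks" "sorted_list_of_set (T - Ks)"] fK
      by (auto simp: ts_def nth_append)
    have nj: "ls ! j \<in> {k0, int m + 2, int m + 3, int m + 4}" if "\<not> j < card Ks"
      using that \<open>j < length ls\<close> ks nth_mem[of "j - length ks" "[k0, int m + 2, int m + 3, int m + 4]"]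
      by (auto simp: ls_def nth_append simp del: nth_mem)
    have d: "x \<notin> {k0, int m + 2, int m + 3, int m + 4}" if "x \<in> T" for x
      using that k0_T T_cases[of x] by auto
    have i': "i < card Ks \<Longrightarrow> ts ! i = ks ! i" "i < card Ks \<Longrightarrow> ts ! i \<in> Ks"
      using ks nth_mem[of i ks] by (auto simp: ts_def nth_append)
    have j': "j < card Ks \<Longrightarrow> ls ! j = ks ! j" "j < card Ks \<Longrightarrow> ls ! j \<in> Ks"
      using ks nth_mem[of j ks] by (auto simp: ls_def nth_append)
    have tT: "ts ! i \<in> T" using that(1) ts nth_mem by blast
    show ?thesis
    proof (cases "j < card Ks")
      case True
      then show ?thesis
        using ni i' j' ks by (cases "i < card Ks") (auto simp: nth_eq_iff_index_eq)
    next
      case False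
      then have "ts ! i \<noteq> ls ! j" using nj d[OF tT] by metis
      then show ?thesis using False by auto
    qed
  qed
  let ?es = "map kc (map Ef ts)" and ?fs = "map kc (map Ff ls)" and ?gs = "map kc (map form3 [s, g])"
  have cF: "cycle (Ff (ls ! j))" if "j < length ls" for j
    using that ls(2) cycle_F nth_mem by blast
  have cE: "cycle (Ef (ts ! i))" if "i < length ts" for i
    using that ts(2) cycle_E nth_mem by blast
  have cG: "cycle (form3 s)" "cycle (form3 g)"
    using s_socle g_max(1)[OF var_max(1)] g_max(1)[OF var_max(2)] g_max(1)[OF var_max(3)]
    by (simp_all only: cycle_homogeneous simp_thms)
  have EF': "kc (form3 (ex (ts ! i) * fz (ls ! j) - ey (ts ! i) * fy (ls ! j) + ez (ts ! i) * fx (ls ! j))) =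
      (if i = j \<and> i < card Ks then ?gs ! 0 else \<zero>\<^bsub>hom_alg \<aa>\<^esub>)" if i: "i < length ts" and j: "j < length ls" for i j
  proof -
    have "ts ! i \<in> T \<union> {k0}" "ls ! j \<in> Fs" using i j ts ls nth_mem by blast+
    from EF[OF this] have "kc (form3 (ex (ts ! i) * fz (ls ! j) - ey (ts ! i) * fy (ls ! j) + ez (ts ! i) * fx (ls ! j))) =
        kc (form3 (if ts ! i = ls ! j then s else 0))"
      unfolding kc_eq_iff homogeneous_diff bnd_homogeneous .
    then show ?thesis
      unfolding iff[OF i j] by (simp add: kc_zero homogeneous_zero del: One_nat_def)
  qed
  have EF2: "?es ! i \<otimes>\<^bsub>hom_alg \<aa>\<^esub> ?fs ! j = (if i = j \<and> i < card Ks then ?gs ! 0 else \<zero>\<^bsub>hom_alg \<aa>\<^esub>)"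
    "?fs ! j \<otimes>\<^bsub>hom_alg \<aa>\<^esub> ?es ! i = (if i = j \<and> i < card Ks then ?gs ! 0 else \<zero>\<^bsub>hom_alg \<aa>\<^esub>)"
    if i: "i < length ts" and j: "j < length ls" for i j
    unfolding EF'[OF i j, symmetric] using i j cE[OF i] cF[OF j]
    by (simp_all add: kc_mult wedge_homogeneous)
  have EE2: "u \<otimes>\<^bsub>hom_alg \<aa>\<^esub> v = \<zero>\<^bsub>hom_alg \<aa>\<^esub>" if uv: "u \<in> set ?es" "v \<in> set ?es" for u v
  proof -
    obtain k l where kl: "k \<in> T" "l \<in> T" "u = kc (Ef k)" "v = kc (Ef l)" using uv ts(2) by auto
    have "kc (wedge (Ef k) (Ef l)) = kc (\<lambda>S. 0)"
      unfolding kc_eq_iff using EE[OF kl(1,2)] by simp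
    then show ?thesis unfolding kl kc_zero by (simp add: kc_mult cycle_E kl(1,2))
  qed
  have FF2: "u \<otimes>\<^bsub>hom_alg \<aa>\<^esub> v = \<zero>\<^bsub>hom_alg \<aa>\<^esub>" if uv: "u \<in> set ?fs" "v \<in> set ?fs" for u v
  proof -
    obtain k l where kl: "k \<in> Fs" "l \<in> Fs" "u = kc (Ff k)" "v = kc (Ff l)" using uv ls(2) by auto
    show ?thesis unfolding kl kc_zero by (simp add: kc_mult cycle_F kl(1,2) wedge_homogeneous)
  qed
  have GG: "u \<otimes>\<^bsub>hom_alg \<aa>\<^esub> v = \<zero>\<^bsub>hom_alg \<aa>\<^esub> \<and> v \<otimes>\<^bsub>hom_alg \<aa>\<^esub> u = \<zero>\<^bsub>hom_alg \<aa>\<^esub>"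
    if u: "u \<in> set ?gs" and v: "v \<in> set (?es @ ?fs @ ?gs)" for u v
  proof -
    obtain t where t: "u = kc (form3 t)" "cycle (form3 t)" using u cG by auto
    consider k where "k \<in> T" "v = kc (Ef k)" | l where "l \<in> Fs" "v = kc (Ff l)"
      | t' where "v = kc (form3 t')" "cycle (form3 t')"
      using v ts(2) ls(2) cG by auto
    then show ?thesis
      by cases (simp_all add: t kc_mult cycle_E cycle_F wedge_homogeneous kc_zero)
  qed
  have n: "card T = min_num_generators class_ring \<aa>"
    unfolding aa by (rule min_num_generators_trim[OF m2 k0, symmetric])
  have bE: "hom_basis \<aa> 1 ?es" by (rule hom_basis_1[OF ts(1,2)])
  have bF: "hom_basis \<aa> 2 ?fs" by (rule hom_basis_2[OF ls(1,2)])
  have bG: "hom_basis \<aa> 3 ?gs" by (rule hom_basis_3)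
  have r: "2 \<le> card Ks" using card_Ks m3 by auto
  show ?thesis
    unfolding class_G_def
  proof (intro conjI, goal_cases)
    case 1 show ?case by (rule ideal)
    case 2 show ?case by (rule subset_max_square)
    case 3 show ?case by (rule assms)
    case 4 show ?case by (rule r)
    case 5
    show ?case
    proof (rule exI[of _ "card T"], rule exI[of _ 2], rule exI[of _ ?es], rule exI[of _ ?fs], rule exI[of _ ?gs],
        intro conjI)
    show "\<forall>i<card T. \<forall>j<card T + 2 - 1.
       ?es ! i \<otimes>\<^bsub>hom_alg \<aa>\<^esub> ?fs ! j = (if i = j \<and> i < card Ks then ?gs ! 0 else \<zero>\<^bsub>hom_alg \<aa>\<^esub>) \<and>
       ?fs ! j \<otimes>\<^bsub>hom_alg \<aa>\<^esub> ?es ! i = (if i = j \<and> i < card Ks then ?gs ! 0 else \<zero>\<^bsub>hom_alg \<aa>\<^esub>)"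
      using EF2 ts(3) ls(3) by (intro allI impI conjI) auto
    show "\<forall>u\<in>set ?es. \<forall>v\<in>set ?es. u \<otimes>\<^bsub>hom_alg \<aa>\<^esub> v = \<zero>\<^bsub>hom_alg \<aa>\<^esub>" using EE2 by blast
    show "\<forall>u\<in>set ?fs. \<forall>v\<in>set ?fs. u \<otimes>\<^bsub>hom_alg \<aa>\<^esub> v = \<zero>\<^bsub>hom_alg \<aa>\<^esub>" using FF2 by blast
    show "\<forall>u\<in>set ?gs. \<forall>v\<in>set (?es @ ?fs @ ?gs).
       u \<otimes>\<^bsub>hom_alg \<aa>\<^esub> v = \<zero>\<^bsub>hom_alg \<aa>\<^esub> \<and> v \<otimes>\<^bsub>hom_alg \<aa>\<^esub> u = \<zero>\<^bsub>hom_alg \<aa>\<^esub>" using GG by blast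
    show "has_type \<aa> 2" by (rule type_2)
    qed (use n bE bF bG r ts ls card_T in auto)
  qed
qed

section \<open>Projective dimension: lower bound\<close>

lemma koszul_exact_1_vec:
  fixes u1 u2 u3 :: "'k :: field pser3 vec"
  assumes u: "u1 \<in> carrier_vec n" "u2 \<in> carrier_vec n" "u3 \<in> carrier_vec n"
    and eq: "\<And>i. i < n \<Longrightarrow> varz * u1 $ i - vary * u2 $ i + varx * u3 $ i = 0"
  obtains A B C where "A \<in> carrier_vec n" "B \<in> carrier_vec n" "C \<in> carrier_vec n"
    "u1 = varx \<cdot>\<^sub>v B + vary \<cdot>\<^sub>v C" "u2 = varz \<cdot>\<^sub>v C - varx \<cdot>\<^sub>v A" "u3 = - (vary \<cdot>\<^sub>v A) - varz \<cdot>\<^sub>v B"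
proof -
  have "\<exists>A B C. u3 $ i = - (vary * A) - varz * B \<and> - u2 $ i = varx * A - varz * C \<and>
      u1 $ i = varx * B + vary * C" if "i < n" for i
  proof -
    have "varx * u3 $ i + vary * (- u2 $ i) + varz * u1 $ i = 0"
      using eq[OF that] by (simp add: algebra_simps)
    then show ?thesis using koszul_exact_1 by metis
  qed
  then obtain A B C where *: "\<And>i. i < n \<Longrightarrow> u3 $ i = - (vary * A i) - varz * B i \<and>
      - u2 $ i = varx * A i - varz * C i \<and> u1 $ i = varx * B i + vary * C i"
    by metis
  show thesis
  proof (rule that[of "vec n A" "vec n B" "vec n C"])
    show "u2 = varz \<cdot>\<^sub>v vec n C - varx \<cdot>\<^sub>v vec n A"
    proof (rule eq_vecI)
      fix i assume "i < dim_vec (varz \<cdot>\<^sub>v vec n C - varx \<cdot>\<^sub>v vec n A)"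
      then have i: "i < n" by simp
      then have "- (- u2 $ i) = - (varx * A i - varz * C i)" using * by simp
      then show "u2 $ i = (varz \<cdot>\<^sub>v vec n C - varx \<cdot>\<^sub>v vec n A) $ i" using i by simp
    qed (use u in auto)
  qed (use u * in \<open>auto intro!: eq_vecI\<close>)
qed

lemma koszul_exact_0_vec:
  fixes a b c :: "'k :: field pser3 vec"
  assumes u: "a \<in> carrier_vec n" "b \<in> carrier_vec n" "c \<in> carrier_vec n"
    and eq: "varx \<cdot>\<^sub>v b = vary \<cdot>\<^sub>v a" "varx \<cdot>\<^sub>v c = varz \<cdot>\<^sub>v a"
  obtains t where "t \<in> carrier_vec n" "a = varx \<cdot>\<^sub>v t"
proof -
  have "\<exists>t. a $ i = varx * t" if "i < n" for i
  proof -
    have "varx * b $ i = vary * a $ i" "varx * c $ i = varz * a $ i"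
      using arg_cong[OF eq(1), of "\<lambda>v. v $ i"] arg_cong[OF eq(2), of "\<lambda>v. v $ i"] u that by simp_all
    then obtain t where "a $ i = varx * t" by (rule koszul_exact_0)
    then show ?thesis by blast
  qed
  then have "\<forall>i. \<exists>t. i < n \<longrightarrow> a $ i = varx * t" by blast
  then obtain t where t: "\<forall>i. i < n \<longrightarrow> a $ i = varx * t i" by (rule choice[THEN exE])
  show thesis
  proof (rule that[of "vec n t"])
    show "a = varx \<cdot>\<^sub>v vec n t" by (rule eq_vecI) (use u t in simp_all)
  qed simp
qed

lemma mult_mat_vec_lincomb:
  fixes M :: "'a :: comm_ring_1 mat"
  assumes "M \<in> carrier_mat p n" "u \<in> carrier_vec n" "v \<in> carrier_vec n"
  shows "M *\<^sub>v (c \<cdot>\<^sub>v u + d \<cdot>\<^sub>v v) = c \<cdot>\<^sub>v (M *\<^sub>v u) + d \<cdot>\<^sub>v (M *\<^sub>v v)"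
    and "M *\<^sub>v (c \<cdot>\<^sub>v u - d \<cdot>\<^sub>v v) = c \<cdot>\<^sub>v (M *\<^sub>v u) - d \<cdot>\<^sub>v (M *\<^sub>v v)"
    and "M *\<^sub>v (u - v) = M *\<^sub>v u - M *\<^sub>v v" "M *\<^sub>v (u + v) = M *\<^sub>v u + M *\<^sub>v v"
    and "M *\<^sub>v (c \<cdot>\<^sub>v u) = c \<cdot>\<^sub>v (M *\<^sub>v u)"
proof -
  have cd: "e \<cdot>\<^sub>v w \<in> carrier_vec n" if "w \<in> carrier_vec n" for e w using that by simp
  have smult: "M *\<^sub>v (e \<cdot>\<^sub>v w) = e \<cdot>\<^sub>v (M *\<^sub>v w)" if "w \<in> carrier_vec n" for e w
    by (rule eq_vecI) (use assms(1) that in simp_all)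
  show "M *\<^sub>v (c \<cdot>\<^sub>v u + d \<cdot>\<^sub>v v) = c \<cdot>\<^sub>v (M *\<^sub>v u) + d \<cdot>\<^sub>v (M *\<^sub>v v)"
    unfolding mult_add_distrib_mat_vec[OF assms(1) cd[OF assms(2)] cd[OF assms(3)]] smult[OF assms(2)] smult[OF assms(3)] ..
  show "M *\<^sub>v (c \<cdot>\<^sub>v u - d \<cdot>\<^sub>v v) = c \<cdot>\<^sub>v (M *\<^sub>v u) - d \<cdot>\<^sub>v (M *\<^sub>v v)"
    unfolding mult_minus_distrib_mat_vec[OF assms(1) cd[OF assms(2)] cd[OF assms(3)]] smult[OF assms(2)] smult[OF assms(3)] ..
  show "M *\<^sub>v (c \<cdot>\<^sub>v u) = c \<cdot>\<^sub>v (M *\<^sub>v u)" by (rule smult[OF assms(2)])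
qed (rule mult_minus_distrib_mat_vec[OF assms] mult_add_distrib_mat_vec[OF assms])+

text \<open>
  A socle element \<open>s\<close> of \<open>Q/\<aa>\<close> is chased through a resolution of length 2: exactness of the Koszul
  complexes on the modules of the resolution lifts it to an element of the image of the augmentation's
  kernel.
\<close>

lemma has_free_resolution_socle:
  fixes \<aa> :: "'k :: field pser3 set"
  assumes ideal: "ideal \<aa> class_ring" and s: "s \<notin> \<aa>" "varx * s \<in> \<aa>" "vary * s \<in> \<aa>" "varz * s \<in> \<aa>"
    and res: "has_free_resolution \<aa> l"
  shows "3 \<le> l"
proof (rule ccontr)
  assume "\<not> 3 \<le> l"
  then have l: "l < 3" by simp
  note closed = ideal_closed[OF ideal]
  obtain b M q where *: "\<forall>i. M i \<in> carrier_mat (b i) (b (Suc i))" "\<forall>i>l. b i = 0"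
      "q \<in> carrier_vec (b 0)" "\<forall>f. \<exists>v\<in>carrier_vec (b 0). f - q \<bullet> v \<in> \<aa>"
      "\<forall>v\<in>carrier_vec (b 0). q \<bullet> v \<in> \<aa> \<longleftrightarrow> (\<exists>w\<in>carrier_vec (b 1). v = M 0 *\<^sub>v w)"
      "\<forall>i. \<forall>v\<in>carrier_vec (b (Suc i)).
        M i *\<^sub>v v = 0\<^sub>v (b i) \<longleftrightarrow> (\<exists>w\<in>carrier_vec (b (Suc (Suc i))). v = M (Suc i) *\<^sub>v w)"
    using res unfolding has_free_resolution_def by (elim exE conjE) (rule that)
  note M = *(1)[rule_format] and b = *(2)[rule_format] and q = *(3) and surj = *(4)[rule_format]
    and ex0 = *(5)[rule_format] and ex = *(6)[rule_format]
  have b3: "b 3 = 0" using b l by simp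
  note M0 = M[of 0, unfolded One_nat_def[symmetric]]
  note M1 = M[of 1, unfolded Suc_1]
  obtain v where v: "v \<in> carrier_vec (b 0)" "s - q \<bullet> v \<in> \<aa>" using surj by blast
  have "\<exists>w\<in>carrier_vec (b 1). c \<cdot>\<^sub>v v = M 0 *\<^sub>v w" if "c * s \<in> \<aa>" for c
  proof -
    have "q \<bullet> (c \<cdot>\<^sub>v v) = c * s - c * (s - q \<bullet> v)" using q v by (simp add: algebra_simps)
    then have "q \<bullet> (c \<cdot>\<^sub>v v) \<in> \<aa>" using closed(6)[OF that closed(3)[OF v(2)]] by simp
    then show ?thesis using ex0 v by simp
  qed
  from this[OF s(2)] this[OF s(3)] this[OF s(4)] obtain wx wy wz where
    w: "wx \<in> carrier_vec (b 1)" "wy \<in> carrier_vec (b 1)" "wz \<in> carrier_vec (b 1)"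
    "varx \<cdot>\<^sub>v v = M 0 *\<^sub>v wx" "vary \<cdot>\<^sub>v v = M 0 *\<^sub>v wy" "varz \<cdot>\<^sub>v v = M 0 *\<^sub>v wz"
    by blast
  have lift: "\<exists>u\<in>carrier_vec (b 2). c \<cdot>\<^sub>v w1 - d \<cdot>\<^sub>v w2 = M 1 *\<^sub>v u"
    if w12: "w1 \<in> carrier_vec (b 1)" "w2 \<in> carrier_vec (b 1)" "M 0 *\<^sub>v w1 = d \<cdot>\<^sub>v v" "M 0 *\<^sub>v w2 = c \<cdot>\<^sub>v v"
    for c d w1 w2
  proof -
    have "M 0 *\<^sub>v (c \<cdot>\<^sub>v w1 - d \<cdot>\<^sub>v w2) = 0\<^sub>v (b 0)"
      unfolding mult_mat_vec_lincomb(2)[OF M0 w12(1,2)] w12(3,4) 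
      by (rule eq_vecI) (use v(1) in \<open>simp_all add: mult.left_commute\<close>)
    then show ?thesis using ex[of "c \<cdot>\<^sub>v w1 - d \<cdot>\<^sub>v w2" 0] w12(1,2) unfolding numeral_2_eq_2 One_nat_def by simp
  qed
  obtain u1 where u1: "u1 \<in> carrier_vec (b 2)" "vary \<cdot>\<^sub>v wx - varx \<cdot>\<^sub>v wy = M 1 *\<^sub>v u1"
    using lift[OF w(1,2) w(4,5)[symmetric]] by blast
  obtain u2 where u2: "u2 \<in> carrier_vec (b 2)" "varz \<cdot>\<^sub>v wx - varx \<cdot>\<^sub>v wz = M 1 *\<^sub>v u2"
    using lift[OF w(1,3) w(4,6)[symmetric]] by blast
  obtain u3 where u3: "u3 \<in> carrier_vec (b 2)" "varz \<cdot>\<^sub>v wy - vary \<cdot>\<^sub>v wz = M 1 *\<^sub>v u3"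
    using lift[OF w(2,3) w(5,6)[symmetric]] by blast
  \<comment> \<open>The differential of z u1 - y u2 + x u3 cancels identically. Since
    \<open>b 3 = 0\<close>, exactness makes this element itself zero, and the Koszul relation over Q
    solves for u1, u2, u3.\<close>
  define u where "u = varz \<cdot>\<^sub>v u1 - vary \<cdot>\<^sub>v u2"
  have uc: "u \<in> carrier_vec (b 2)" "u + varx \<cdot>\<^sub>v u3 \<in> carrier_vec (b 2)" "varx \<cdot>\<^sub>v u3 \<in> carrier_vec (b 2)"
    using u1(1) u2(1) u3(1) by (simp_all add: u_def)
  have "M 1 *\<^sub>v (u + varx \<cdot>\<^sub>v u3) = (varz \<cdot>\<^sub>v (M 1 *\<^sub>v u1) - vary \<cdot>\<^sub>v (M 1 *\<^sub>v u2)) + varx \<cdot>\<^sub>v (M 1 *\<^sub>v u3)"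
    unfolding mult_mat_vec_lincomb(4)[OF M1 uc(1,3)] mult_mat_vec_lincomb(5)[OF M1 u3(1) u3(1)]
    unfolding u_def mult_mat_vec_lincomb(2)[OF M1 u1(1) u2(1)] ..
  also have "\<dots> = 0\<^sub>v (b 1)"
    unfolding u1(2)[symmetric] u2(2)[symmetric] u3(2)[symmetric]
    by (rule eq_vecI) (use w(1-3) in \<open>simp_all add: algebra_simps\<close>)
  finally obtain w' where w': "w' \<in> carrier_vec (b 3)" "u + varx \<cdot>\<^sub>v u3 = M 2 *\<^sub>v w'"
    using ex[of "u + varx \<cdot>\<^sub>v u3" 1] uc(2) unfolding numeral_3_eq_3 numeral_2_eq_2 One_nat_def by blast
  have "(u + varx \<cdot>\<^sub>v u3) $ i = 0" if "i < b 2" for i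
    unfolding w'(2) using M[of 2] w'(1) b3 that by (simp add: scalar_prod_def)
  then have "varz * u1 $ i - vary * u2 $ i + varx * u3 $ i = 0" if "i < b 2" for i
    using u1(1) u2(1) u3(1) that unfolding u_def by simp
  then obtain A B C where ABC: "A \<in> carrier_vec (b 2)" "B \<in> carrier_vec (b 2)" "C \<in> carrier_vec (b 2)"
    "u1 = varx \<cdot>\<^sub>v B + vary \<cdot>\<^sub>v C" "u2 = varz \<cdot>\<^sub>v C - varx \<cdot>\<^sub>v A" "u3 = - (vary \<cdot>\<^sub>v A) - varz \<cdot>\<^sub>v B"
    by (rule koszul_exact_1_vec[OF u1(1) u2(1) u3(1)])
  \<comment> \<open>Adding images of \<open>M 1\<close> leaves the images under \<open>M 0\<close>
    unchanged and achieves x c = y a and x d = z a. Hence a = x t, and cancelling x gives v = M 0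
    t.\<close>
  define a where "a = wx - M 1 *\<^sub>v C"
  define c where "c = wy + M 1 *\<^sub>v B"
  define d where "d = wz - M 1 *\<^sub>v A"
  have c1: "M 1 *\<^sub>v A \<in> carrier_vec (b 1)" "M 1 *\<^sub>v B \<in> carrier_vec (b 1)" "M 1 *\<^sub>v C \<in> carrier_vec (b 1)"
    by (rule mult_mat_vec_carrier[OF M1 ABC(1)] mult_mat_vec_carrier[OF M1 ABC(2)] mult_mat_vec_carrier[OF M1 ABC(3)])+
  have carr: "a \<in> carrier_vec (b 1)" "c \<in> carrier_vec (b 1)" "d \<in> carrier_vec (b 1)"
    using w c1 by (simp_all add: a_def c_def d_def)
  have e1: "vary \<cdot>\<^sub>v wx - varx \<cdot>\<^sub>v wy = varx \<cdot>\<^sub>v (M 1 *\<^sub>v B) + vary \<cdot>\<^sub>v (M 1 *\<^sub>v C)"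
    unfolding u1(2) ABC(4) by (rule mult_mat_vec_lincomb(1)[OF M1 ABC(2,3)])
  have e2: "varz \<cdot>\<^sub>v wx - varx \<cdot>\<^sub>v wz = varz \<cdot>\<^sub>v (M 1 *\<^sub>v C) - varx \<cdot>\<^sub>v (M 1 *\<^sub>v A)"
    unfolding u2(2) ABC(5) by (rule mult_mat_vec_lincomb(2)[OF M1 ABC(3,1)])
  have "varx \<cdot>\<^sub>v c = vary \<cdot>\<^sub>v a"
  proof (rule eq_vecI)
    fix i assume "i < dim_vec (vary \<cdot>\<^sub>v a)"
    then have i: "i < b 1" using carr by simp
    show "(varx \<cdot>\<^sub>v c) $ i = (vary \<cdot>\<^sub>v a) $ i"
      using arg_cong[OF e1, of "\<lambda>v. v $ i"] i w(1-3) c1[unfolded carrier_vec_def] unfolding a_def c_def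
      by (simp add: algebra_simps carrier_vecD[OF w(1)] carrier_vecD[OF w(2)] del: index_mult_mat_vec)
  qed (use carr in simp)
  moreover have "varx \<cdot>\<^sub>v d = varz \<cdot>\<^sub>v a"
  proof (rule eq_vecI)
    fix i assume "i < dim_vec (varz \<cdot>\<^sub>v a)"
    then have i: "i < b 1" using carr by simp
    show "(varx \<cdot>\<^sub>v d) $ i = (varz \<cdot>\<^sub>v a) $ i"
      using arg_cong[OF e2, of "\<lambda>v. v $ i"] i w(1-3) c1[unfolded carrier_vec_def] unfolding a_def d_def
      by (simp add: algebra_simps carrier_vecD[OF w(1)] carrier_vecD[OF w(3)] del: index_mult_mat_vec)
  qed (use carr in simp)
  ultimately obtain t where t: "t \<in> carrier_vec (b 1)" "a = varx \<cdot>\<^sub>v t"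
    by (rule koszul_exact_0_vec[OF carr])
  have "M 0 *\<^sub>v (M 1 *\<^sub>v C) = 0\<^sub>v (b 0)"
    using ex[of "M 1 *\<^sub>v C" 0] c1(3) ABC(3) by (auto simp: numeral_2_eq_2)
  then have "M 0 *\<^sub>v a = varx \<cdot>\<^sub>v v"
    unfolding a_def mult_mat_vec_lincomb(3)[OF M0 w(1) c1(3)] w(4)[symmetric] using v(1) by auto
  then have eq: "varx \<cdot>\<^sub>v (M 0 *\<^sub>v t) = varx \<cdot>\<^sub>v v"
    unfolding t(2) mult_mat_vec_lincomb(5)[OF M0 t(1) t(1)] .
  have "v = M 0 *\<^sub>v t"
  proof (rule eq_vecI)
    fix i assume "i < dim_vec (M 0 *\<^sub>v t)"
    then have i: "i < b 0" using M0 by simp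
    have "varx * (M 0 *\<^sub>v t) $ i = varx * v $ i"
      using arg_cong[OF eq, of "\<lambda>v. v $ i"] i v(1) M0 by simp
    then show "v $ i = (M 0 *\<^sub>v t) $ i" by simp
  qed (use M0 v in auto)
  then have "q \<bullet> v \<in> \<aa>" using ex0[OF v(1)] t(1) by auto
  then have "s \<in> \<aa>" using closed(2)[OF v(2), of "q \<bullet> v"] by simp
  then show False using s(1) by simp
qed

section \<open>Projective dimension: upper bound\<close>

text \<open>
  Let \<open>W\<close> be stable with finite complement \<open>bs\<close>. Multiplication by \<open>x\<close>, \<open>y\<close>, \<open>z\<close> on \<open>Q / supp_in W\<close> is given,
  in the basis indexed by \<open>bs\<close>, by commuting matrices \<open>X\<close>, \<open>Y\<close>, \<open>Z\<close> over the field that are strictly triangular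
  for the degree, and the Koszul complex of \<open>x - X\<close>, \<open>y - Y\<close>, \<open>z - Z\<close> on the free module with this basis
  is a free resolution. Exactness follows from division with remainder by each of these operators.
\<close>

definition shift_op :: "nat \<Rightarrow> 'a \<Rightarrow> (nat \<Rightarrow> nat \<Rightarrow> 'a) \<Rightarrow> (nat \<Rightarrow> 'a) \<Rightarrow> nat \<Rightarrow> 'a :: comm_ring_1" where
  "shift_op N x A v = (\<lambda>i. if i < N then x * v i - (\<Sum>j<N. A i j * v j) else 0)"

definition vecs :: "nat \<Rightarrow> (nat \<Rightarrow> 'a :: zero) set" where
  "vecs N = {v. \<forall>i\<ge>N. v i = 0}"

lemma shift_op_vecs [simp]: "shift_op N x A v \<in> vecs N"
  by (simp add: shift_op_def vecs_def)

lemma vecs_closed [simp]: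
  "0 \<in> vecs N"
  "u \<in> vecs N \<Longrightarrow> v \<in> vecs N \<Longrightarrow> u + v \<in> vecs N"
  "u \<in> vecs N \<Longrightarrow> v \<in> vecs N \<Longrightarrow> u - v \<in> vecs N"
  "u \<in> vecs N \<Longrightarrow> - u \<in> vecs N"
  for u v :: "nat \<Rightarrow> 'a :: ab_group_add"
  by (simp_all add: vecs_def)

lemma shift_op_linear:
  "shift_op N x A (u + v) = shift_op N x A u + shift_op N x A v"
  "shift_op N x A (u - v) = shift_op N x A u - shift_op N x A v"
  "shift_op N x A (- u) = - shift_op N x A u"
  "shift_op N x A 0 = 0"
  unfolding shift_op_def fun_eq_iff by (simp_all add: ring_distribs sum.distrib sum_subtractf sum_negf)

lemma shift_op_commute:
  assumes "\<And>i l. i < N \<Longrightarrow> l < N \<Longrightarrow> (\<Sum>j<N. A i j * B j l) = (\<Sum>j<N. B i j * A j l)"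
  shows "shift_op N x A (shift_op N y B v) = shift_op N y B (shift_op N x A v)"
proof
  fix i
  show "shift_op N x A (shift_op N y B v) i = shift_op N y B (shift_op N x A v) i"
  proof (cases "i < N")
    case True
    have e: "(\<Sum>j<N. C i j * shift_op N z D v j) = z * (\<Sum>j<N. C i j * v j) - (\<Sum>l<N. (\<Sum>j<N. C i j * D j l) * v l)"
      for C D z
    proof -
      have "(\<Sum>j<N. C i j * shift_op N z D v j) = (\<Sum>j<N. z * (C i j * v j) - (\<Sum>l<N. C i j * D j l * v l))"
        by (rule sum.cong) (auto simp: shift_op_def algebra_simps sum_distrib_left)
      also have "\<dots> = z * (\<Sum>j<N. C i j * v j) - (\<Sum>j<N. \<Sum>l<N. C i j * D j l * v l)"
        by (simp add: sum_subtractf sum_distrib_left)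
      also have "(\<Sum>j<N. \<Sum>l<N. C i j * D j l * v l) = (\<Sum>l<N. (\<Sum>j<N. C i j * D j l) * v l)"
        by (subst sum.swap) (simp add: sum_distrib_right)
      finally show ?thesis .
    qed
    have s: "(\<Sum>l<N. (\<Sum>j<N. A i j * B j l) * v l) = (\<Sum>l<N. (\<Sum>j<N. B i j * A j l) * v l)"
      using assms True by (intro sum.cong) auto
    have u: "shift_op N z C w i = z * w i - (\<Sum>j<N. C i j * w j)" for z C w
      using True by (simp add: shift_op_def)
    show ?thesis
      unfolding u[of x A "shift_op N y B v"] u[of y B "shift_op N x A v"] e s u[of y B v] u[of x A v]
      by (simp add: algebra_simps)
  qed (simp add: shift_op_def)
qed

context
  fixes N :: nat and A :: "nat \<Rightarrow> nat \<Rightarrow> 'g :: comm_ring_1" and wt :: "nat \<Rightarrow> nat"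
  assumes wt: "\<And>i j. i < N \<Longrightarrow> j < N \<Longrightarrow> A i j \<noteq> 0 \<Longrightarrow> wt j < wt i"
begin

abbreviation "op \<equiv> shift_op N fps_X (\<lambda>i j. fps_const (A i j))"

text \<open>Comparing coefficients, the n-th coefficient of v_i is a combination of the (n+1)-st
  coefficients of those v_j with smaller weight, so induction on the weight applies for all n
  simultaneously.\<close>

lemma shift_op_const_remainder:
  assumes v: "v \<in> vecs N" and eq: "\<And>i. i < N \<Longrightarrow> op v i = fps_const (c i)"
  shows "v = 0"
proof -
  have "\<forall>n. v i !! n = 0" if "i < N" for i
    using that
  proof (induction "wt i" arbitrary: i rule: less_induct)
    case less
    show ?case
    proof
      fix n
      have "op v i !! Suc n = 0" using eq[OF less.prems] by simp
      then have "v i !! n = (\<Sum>j<N. A i j * v j !! Suc n)"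
        using less.prems by (simp add: shift_op_def fps_sum_nth)
      also have "\<dots> = 0"
      proof (intro sum.neutral ballI)
        fix j assume j: "j \<in> {..<N}"
        show "A i j * v j !! Suc n = 0"
        proof (cases "A i j = 0")
          case False
          then have "v j !! Suc n = 0" using less.hyps[OF wt[OF less.prems _ False]] j by blast
          then show ?thesis by simp
        qed simp
      qed
      finally show "v i !! n = 0" .
    qed
  qed
  then have "v i = 0" for i
    using v by (cases "i < N") (auto simp: vecs_def fps_eq_iff)
  then show ?thesis by (simp add: fun_eq_iff)
qed

text \<open>Comparison of coefficients expresses the n-th coefficient of the quotient through
  (n+1)-st coefficients at indices of smaller weight. The coefficient index grows, but the weight
  makes the recursion well-founded.\<close>

lemma shift_op_division:
  assumes v: "v \<in> vecs N"
  obtains u c where "u \<in> vecs N" "c \<in> vecs N" "v = (\<lambda>i. op u i + fps_const (c i))"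
proof -
  have "\<exists>U. \<forall>i<N. \<forall>n. U i n = v i !! Suc n + (\<Sum>j | j < N \<and> wt j < wt i. A i j * U j (Suc n))"
  proof -
    define R where "R = {(x :: nat \<times> nat, y :: nat \<times> nat). wt (fst x) < wt (fst y)}"
    have wf: "wf R" unfolding R_def by (rule wf_subset[OF wf_measure[of "\<lambda>x. wt (fst x)"]]) auto
    define F where "F U x = v (fst x) !! Suc (snd x) +
        (\<Sum>j | j < N \<and> wt j < wt (fst x). A (fst x) j * U (j, Suc (snd x)))" for U x
    have "wfrec R F x = F (wfrec R F) x" for x
    proof -
      have "wfrec R F x = F (cut (wfrec R F) R x) x" by (rule wfrec[OF wf])
      also have "\<dots> = F (wfrec R F) x"
        unfolding F_def by (intro arg_cong2[of _ _ _ _ "(+)"] sum.cong) (auto simp: cut_def R_def)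
      finally show ?thesis .
    qed
    note rec = this
    have e: "wfrec R F (i, n) = v i !! Suc n + (\<Sum>j | j < N \<and> wt j < wt i. A i j * wfrec R F (j, Suc n))" for i n
      by (rule trans[OF rec]) (simp only: F_def fst_conv snd_conv)
    show ?thesis
      by (rule exI[of _ "\<lambda>i n. wfrec R F (i, n)"]) (use e in blast)
  qed
  then obtain U where U: "\<And>i n. i < N \<Longrightarrow> U i n = v i !! Suc n + (\<Sum>j | j < N \<and> wt j < wt i. A i j * U j (Suc n))"
    by blast
  have U': "U i n = v i !! Suc n + (\<Sum>j<N. A i j * U j (Suc n))" if "i < N" for i n
  proof -
    have "(\<Sum>j | j < N \<and> wt j < wt i. A i j * U j (Suc n)) = (\<Sum>j<N. A i j * U j (Suc n))"
    proof (rule sum.mono_neutral_left)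
      show "\<forall>j\<in>{..<N} - {j. j < N \<and> wt j < wt i}. A i j * U j (Suc n) = 0"
      proof
        fix j assume "j \<in> {..<N} - {j. j < N \<and> wt j < wt i}"
        then have "A i j = 0" using wt[OF that, of j] by blast
        then show "A i j * U j (Suc n) = 0" by simp
      qed
    qed auto
    then show ?thesis using U[OF that] by simp
  qed
  define u where "u i = (if i < N then Abs_fps (U i) else 0)" for i
  define c where "c i = (if i < N then v i !! 0 + (\<Sum>j<N. A i j * U j 0) else 0)" for i
  show thesis
  proof (rule that)
    show "u \<in> vecs N" "c \<in> vecs N" by (simp_all add: u_def c_def vecs_def)
    show "v = (\<lambda>i. op u i + fps_const (c i))"
    proof
      fix i
      show "v i = op u i + fps_const (c i)"
      proof (cases "i < N")
        case True
        have s: "(\<Sum>j<N. fps_const (A i j) * u j) !! n = (\<Sum>j<N. A i j * U j n)" for n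
          by (simp add: fps_sum_nth u_def)
        show ?thesis
        proof (rule fps_ext)
          fix n
          show "v i !! n = (op u i + fps_const (c i)) !! n"
          proof (cases n)
            case 0
            show ?thesis using True s[of 0] unfolding 0 shift_op_def c_def by simp
          next
            case (Suc n')
            show ?thesis using True s[of n] U'[OF True, of n'] unfolding Suc shift_op_def by (simp add: u_def)
          qed
        qed
      next
        case False
        then show ?thesis using v by (simp add: vecs_def shift_op_def c_def)
      qed
    qed
  qed
qed

end

section \<open>The Koszul complex of three commuting triangular operators\<close>

locale triangular_triple =
  fixes N :: nat and X Y Z :: "nat \<Rightarrow> nat \<Rightarrow> 'k :: field" and wt :: "nat \<Rightarrow> nat"
  assumes wt: "\<And>i j. i < N \<Longrightarrow> j < N \<Longrightarrow> X i j \<noteq> 0 \<or> Y i j \<noteq> 0 \<or> Z i j \<noteq> 0 \<Longrightarrow> wt j < wt i"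
    and comm: "\<And>i l. i < N \<Longrightarrow> l < N \<Longrightarrow> (\<Sum>j<N. X i j * Y j l) = (\<Sum>j<N. Y i j * X j l)"
      "\<And>i l. i < N \<Longrightarrow> l < N \<Longrightarrow> (\<Sum>j<N. X i j * Z j l) = (\<Sum>j<N. Z i j * X j l)"
      "\<And>i l. i < N \<Longrightarrow> l < N \<Longrightarrow> (\<Sum>j<N. Y i j * Z j l) = (\<Sum>j<N. Z i j * Y j l)"
begin

abbreviation "V \<equiv> vecs N"

definition opx :: "(nat \<Rightarrow> 'k pser3) \<Rightarrow> nat \<Rightarrow> 'k pser3" where
  "opx = shift_op N varx (\<lambda>i j. const3 (X i j))"
definition opy :: "(nat \<Rightarrow> 'k pser3) \<Rightarrow> nat \<Rightarrow> 'k pser3" where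
  "opy = shift_op N vary (\<lambda>i j. const3 (Y i j))"
definition opz :: "(nat \<Rightarrow> 'k pser3) \<Rightarrow> nat \<Rightarrow> 'k pser3" where
  "opz = shift_op N varz (\<lambda>i j. const3 (Z i j))"
text \<open>\<open>op2\<close> and \<open>op3\<close> are the operators induced by
  \<open>opy\<close> on vectors free of z, and by \<open>opx\<close> on vectors free of y and z,
  where the remainders of division live.\<close>

definition op2 :: "(nat \<Rightarrow> 'k fps fps) \<Rightarrow> nat \<Rightarrow> 'k fps fps" where
  "op2 = shift_op N fps_X (\<lambda>i j. fps_const (fps_const (Y i j)))"
definition op3 :: "(nat \<Rightarrow> 'k fps) \<Rightarrow> nat \<Rightarrow> 'k fps" where
  "op3 = shift_op N fps_X (\<lambda>i j. fps_const (X i j))"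

lemma op_vecs [simp]: "opx v \<in> V" "opy v \<in> V" "opz v \<in> V"
  by (simp_all add: opx_def opy_def opz_def)

lemma op_linear:
  "opx (u + v) = opx u + opx v" "opx (u - v) = opx u - opx v" "opx (- u) = - opx u" "opx 0 = 0"
  "opy (u + v) = opy u + opy v" "opy (u - v) = opy u - opy v" "opy (- u) = - opy u" "opy 0 = 0"
  "opz (u + v) = opz u + opz v" "opz (u - v) = opz u - opz v" "opz (- u) = - opz u" "opz 0 = 0"
  unfolding opx_def opy_def opz_def by (rule shift_op_linear)+

lemma const3_sum: "const3 (\<Sum>i\<in>S. f i) = (\<Sum>i\<in>S. const3 (f i))"
  by (induction S rule: infinite_finite_induct) (simp_all add: const3_def flip: fps_const_add)

lemma const3_mult: "const3 a * const3 b = const3 (a * b)"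
  by (simp add: const3_def)

lemma op_commute: "opx (opy v) = opy (opx v)" "opx (opz v) = opz (opx v)" "opy (opz v) = opz (opy v)"
  unfolding opx_def opy_def opz_def
  by (rule shift_op_commute; simp add: const3_mult comm flip: const3_sum)+

lemma fps_const_vecs [simp]: "v \<in> V \<Longrightarrow> (\<lambda>i. fps_const (v i)) \<in> V"
  by (simp add: vecs_def)

lemma sum_fps_const: "(\<Sum>i\<in>S. fps_const (f i)) = fps_const (\<Sum>i\<in>S. f i)"
  by (induction S rule: infinite_finite_induct) simp_all

lemma shift_op_fps_const:
  "shift_op N (fps_const x) (\<lambda>i j. fps_const (A i j)) (\<lambda>i. fps_const (v i)) = (\<lambda>i. fps_const (shift_op N x A v i))"
  by (auto simp: shift_op_def sum_fps_const)

lemma opy_const: "opy (\<lambda>i. fps_const (v i)) = (\<lambda>i. fps_const (op2 v i))"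
  unfolding opy_def op2_def vary_def const3_def by (rule shift_op_fps_const)

lemma opx_const: "opx (\<lambda>i. fps_const (fps_const (v i))) = (\<lambda>i. fps_const (fps_const (op3 v i)))"
  unfolding opx_def op3_def varx_def const3_def shift_op_fps_const ..

lemma division:
  fixes v :: "nat \<Rightarrow> 'k pser3" and v2 :: "nat \<Rightarrow> 'k fps fps" and v3 :: "nat \<Rightarrow> 'k fps"
  shows "v \<in> V \<Longrightarrow> \<exists>u\<in>V. \<exists>c\<in>V. v = opz u + (\<lambda>i. fps_const (c i))"
    and "v2 \<in> V \<Longrightarrow> \<exists>u\<in>V. \<exists>c\<in>V. v2 = op2 u + (\<lambda>i. fps_const (c i))"
    and "v3 \<in> V \<Longrightarrow> \<exists>u\<in>V. \<exists>c\<in>V. v3 = op3 u + (\<lambda>i. fps_const (c i))"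
proof -
  assume v: "v \<in> V"
  have "wt j < wt i" if "i < N" "j < N" "fps_const (fps_const (Z i j)) \<noteq> 0" for i j
    using wt that by simp
  from shift_op_division[of N "\<lambda>i j. fps_const (fps_const (Z i j))" wt, OF this v] obtain u c
    where "u \<in> V" "c \<in> V" "v = (\<lambda>i. opz u i + fps_const (c i))"
    unfolding opz_def varz_def const3_def by blast
  then show "\<exists>u\<in>V. \<exists>c\<in>V. v = opz u + (\<lambda>i. fps_const (c i))" by (auto simp: plus_fun_def)
next
  assume v: "v2 \<in> V"
  have "wt j < wt i" if "i < N" "j < N" "fps_const (Y i j) \<noteq> 0" for i j
    using wt that by simp
  from shift_op_division[of N "\<lambda>i j. fps_const (Y i j)" wt, OF this v] obtain u c
    where "u \<in> V" "c \<in> V" "v2 = (\<lambda>i. op2 u i + fps_const (c i))"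
    unfolding op2_def by blast
  then show "\<exists>u\<in>V. \<exists>c\<in>V. v2 = op2 u + (\<lambda>i. fps_const (c i))" by (auto simp: plus_fun_def)
next
  assume v: "v3 \<in> V"
  have "wt j < wt i" if "i < N" "j < N" "X i j \<noteq> 0" for i j
    using wt that by simp
  from shift_op_division[of N X wt, OF this v] obtain u c
    where "u \<in> V" "c \<in> V" "v3 = (\<lambda>i. op3 u i + fps_const (c i))"
    unfolding op3_def by blast
  then show "\<exists>u\<in>V. \<exists>c\<in>V. v3 = op3 u + (\<lambda>i. fps_const (c i))" by (auto simp: plus_fun_def)
qed

lemma const_remainder:
  "v \<in> V \<Longrightarrow> opz v = (\<lambda>i. fps_const (c i)) \<Longrightarrow> v = 0"
  "v2 \<in> V \<Longrightarrow> op2 v2 = (\<lambda>i. fps_const (c2 i)) \<Longrightarrow> v2 = 0"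
  "v3 \<in> V \<Longrightarrow> op3 v3 = (\<lambda>i. fps_const (c3 i)) \<Longrightarrow> v3 = 0"
proof -
  assume v: "v \<in> V" "opz v = (\<lambda>i. fps_const (c i))"
  have "wt j < wt i" if "i < N" "j < N" "fps_const (fps_const (Z i j)) \<noteq> 0" for i j
    using wt that by simp
  from shift_op_const_remainder[of N "\<lambda>i j. fps_const (fps_const (Z i j))" wt, OF this v(1)] v(2)
  show "v = 0" unfolding opz_def varz_def const3_def by simp
next
  assume v: "v2 \<in> V" "op2 v2 = (\<lambda>i. fps_const (c2 i))"
  have "wt j < wt i" if "i < N" "j < N" "fps_const (Y i j) \<noteq> 0" for i j
    using wt that by simp
  from shift_op_const_remainder[of N "\<lambda>i j. fps_const (Y i j)" wt, OF this v(1)] v(2)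
  show "v2 = 0" unfolding op2_def by simp
next
  assume v: "v3 \<in> V" "op3 v3 = (\<lambda>i. fps_const (c3 i))"
  have "wt j < wt i" if "i < N" "j < N" "X i j \<noteq> 0" for i j
    using wt that by simp
  from shift_op_const_remainder[of N X wt, OF this v(1)] v(2)
  show "v3 = 0" unfolding op3_def by simp
qed

lemma opz_zero: "v \<in> V \<Longrightarrow> opz v = 0 \<Longrightarrow> v = 0"
  using const_remainder(1)[of v "\<lambda>i. 0"] by (simp add: zero_fun_def)

lemma opz_const:
  assumes v: "v \<in> V" and eq: "opz v = (\<lambda>i. fps_const (c i))"
  shows "v = 0" "c = 0"
proof -
  show "v = 0" by (rule const_remainder(1)[OF v eq])
  have "(0 :: nat \<Rightarrow> 'k pser3) = (\<lambda>i. fps_const (c i))" using eq unfolding \<open>v = 0\<close> op_linear .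
  then show "c = 0" by (auto simp: fun_eq_iff)
qed

text \<open>Together with \<open>opz_zero\<close> and \<open>opx_regular\<close>: the operators form
  a regular sequence in the order \<open>opz\<close>, \<open>opy\<close>, \<open>opx\<close>. The
  remainder of v modulo \<open>opz\<close> is killed by \<open>op2\<close> because remainders are
  unique, so it is zero.\<close>

lemma opy_regular:
  assumes v: "v \<in> V" "w \<in> V" and eq: "opy v = opz w"
  shows "\<exists>u\<in>V. v = opz u"
proof -
  obtain u c where u: "u \<in> V" "c \<in> V" "v = opz u + (\<lambda>i. fps_const (c i))" using division(1)[OF v(1)] by blast
  have "opz (w - opy u) = (\<lambda>i. fps_const (op2 c i))"
    using eq unfolding u(3) op_linear opy_const op_commute(3) by (simp add: algebra_simps)
  from opz_const(2)[OF _ this] v have "op2 c = (\<lambda>i. fps_const 0)" by (simp add: zero_fun_def)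
  from const_remainder(2)[OF u(2) this] show ?thesis
    using u(1) unfolding u(3) by (auto simp: plus_fun_def)
qed

text \<open>Dividing by \<open>opz\<close> and then by \<open>op2\<close> leaves a remainder d in x
  alone. Uniqueness of the remainders modulo \<open>opz\<close> gives \<open>op2 q\<close> =
  \<open>op3 d\<close>; this is constant in y, so q = 0, then \<open>op3 d\<close> = 0, and finally
  d = 0.\<close>

lemma opx_regular:
  assumes v: "v \<in> V" "w1 \<in> V" "w2 \<in> V" and eq: "opx v = opy w1 + opz w2"
  shows "\<exists>a\<in>V. \<exists>b\<in>V. v = opy a + opz b"
proof -
  obtain u c where u: "u \<in> V" "c \<in> V" "v = opz u + (\<lambda>i. fps_const (c i))" using division(1)[OF v(1)] by blast
  obtain e d where e: "e \<in> V" "d \<in> V" "c = op2 e + (\<lambda>i. fps_const (d i))" using division(2)[OF u(2)] by blast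
  let ?e = "\<lambda>i. fps_const (e i)" and ?d = "\<lambda>i. fps_const (fps_const (d i))"
  have v_eq: "v = opz u + opy ?e + ?d"
    unfolding u(3) e(3) opy_const by (simp add: fun_eq_iff)
  obtain p q where p: "p \<in> V" "q \<in> V" "w1 - opx ?e = opz p + (\<lambda>i. fps_const (q i))"
    using division(1)[of "w1 - opx ?e"] v by auto
  have "opx ?d = opx v - opx (opz u) - opx (opy ?e)" unfolding v_eq op_linear by simp
  also have "\<dots> = opy (w1 - opx ?e) + opz (w2 - opx u)"
    unfolding eq op_linear op_commute by simp
  also have "\<dots> = opz (opy p + w2 - opx u) + (\<lambda>i. fps_const (op2 q i))"
    unfolding p(3) op_linear op_commute opy_const by simp
  finally have "opz (opy p + w2 - opx u) = (\<lambda>i. fps_const (fps_const (op3 d i) - op2 q i))"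
    unfolding opx_const by (simp add: fun_eq_iff algebra_simps flip: fps_const_sub)
  from opz_const(2)[OF _ this] v have q: "op2 q = (\<lambda>i. fps_const (op3 d i))" by (simp add: fun_eq_iff)
  from const_remainder(2)[OF p(2) this] have "q = 0" .
  have "(0 :: nat \<Rightarrow> 'k fps fps) = (\<lambda>i. fps_const (op3 d i))"
    using q unfolding \<open>q = 0\<close> op2_def shift_op_linear .
  then have "op3 d = (\<lambda>i. fps_const 0)" by (auto simp: fun_eq_iff)
  from const_remainder(3)[OF e(2) this] have "?d = 0" by (simp add: fun_eq_iff)
  then have "v = opy ?e + opz u" unfolding v_eq by simp
  then show ?thesis using u(1) e(1) fps_const_vecs by blast
qed

text \<open>Three divisions in succession: modulo the images of the three operators every vector is
  constant. This identifies the cokernel of the complex with a quotient of the coefficient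
  space.\<close>

lemma division_const:
  assumes "v \<in> V"
  shows "\<exists>a\<in>V. \<exists>b\<in>V. \<exists>c\<in>V. \<exists>d\<in>V. v = opx a + opy b + opz c + (\<lambda>i. const3 (d i))"
proof -
  obtain u c where u: "u \<in> V" "c \<in> V" "v = opz u + (\<lambda>i. fps_const (c i))" using division(1)[OF assms] by blast
  obtain e d where e: "e \<in> V" "d \<in> V" "c = op2 e + (\<lambda>i. fps_const (d i))" using division(2)[OF u(2)] by blast
  obtain r t where r: "r \<in> V" "t \<in> V" "d = op3 r + (\<lambda>i. fps_const (t i))" using division(3)[OF e(2)] by blast
  have "v = opx (\<lambda>i. fps_const (fps_const (r i))) + opy (\<lambda>i. fps_const (e i)) + opz u + (\<lambda>i. const3 (t i))"
    unfolding u(3) e(3) r(3) opx_const opy_const const3_def by (simp add: fun_eq_iff add_ac flip: fps_const_add)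
  moreover have "(\<lambda>i. fps_const (fps_const (r i))) \<in> V" "(\<lambda>i. fps_const (e i)) \<in> V" using e r by simp_all
  ultimately show ?thesis using u(1) r(2) by blast
qed

lemma koszul_op_exact_2:
  assumes V: "a \<in> V" "b \<in> V" "c \<in> V"
    and eq: "- opy a - opz b = 0" "opx a - opz c = 0"
  shows "\<exists>t\<in>V. a = opz t \<and> b = - opy t \<and> c = opx t"
proof -
  have "opy a = opz (- b) - (- opy a - opz b)" by (simp add: op_linear)
  then have "opy a = opz (- b)" unfolding eq(1) by simp
  then obtain t where t: "t \<in> V" "a = opz t" using opy_regular[OF V(1), of "- b"] V by auto
  have "opz (opy t + b) = 0" using eq(1) unfolding t(2) op_linear op_commute by (simp add: neg_eq_iff_add_eq_0 add.commute)
  then have "opy t + b = 0" using opz_zero[of "opy t + b"] V by simp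
  moreover have "opz (opx t - c) = 0" using eq(2) unfolding t(2) op_linear op_commute .
  then have "opx t - c = 0" using opz_zero[of "opx t - c"] V by simp
  ultimately show ?thesis using t by (intro bexI[of _ t]) (auto simp: eq_neg_iff_add_eq_0 add.commute)
qed

text \<open>Acyclicity of the Koszul complex of a regular sequence: \<open>opx_regular\<close>
  solves for p, \<open>opy_regular\<close> for what is left of q, and injectivity of
  \<open>opz\<close> for r.\<close>

lemma koszul_op_exact_1:
  assumes V: "p \<in> V" "q \<in> V" "r \<in> V"
    and eq: "opx p + opy q + opz r = 0"
  shows "\<exists>a\<in>V. \<exists>b\<in>V. \<exists>c\<in>V. p = - opy a - opz b \<and> q = opx a - opz c \<and> r = opx b + opy c"
proof -
  have "opx p = opy (- q) + opz (- r) + (opx p + opy q + opz r)" by (simp add: op_linear)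
  then have "opx p = opy (- q) + opz (- r)" unfolding eq by simp
  then obtain a b where ab: "a \<in> V" "b \<in> V" "p = opy a + opz b" using opx_regular[OF V(1), of "- q" "- r"] V by auto
  have "opy (q + opx a) = opz (- r - opx b) + (opx p + opy q + opz r)"
    unfolding ab(3) op_linear op_commute by simp
  then have *: "opy (q + opx a) = opz (- r - opx b)" unfolding eq by simp
  then obtain c where c: "c \<in> V" "q + opx a = opz c" using opy_regular[OF _ _ *] V by auto
  have "opz (opy c + r + opx b) = 0"
    using * unfolding c(2) op_linear op_commute by simp
  then have "opy c + r + opx b = 0" using opz_zero[of "opy c + r + opx b"] V by simp
  moreover have "r = opx (- b) + opy (- c) + (opy c + r + opx b)" unfolding op_linear by simp
  ultimately have "r = opx (- b) + opy (- c)" by simp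
  moreover have "q = opx (- a) - opz (- c)" using c(2) unfolding op_linear by (simp add: algebra_simps)
  moreover have "p = - opy (- a) - opz (- b)" unfolding op_linear ab(3) by simp
  ultimately show ?thesis using ab(1,2)[THEN vecs_closed(4)] c(1)[THEN vecs_closed(4)] by blast
qed

end

section \<open>Operators as block matrices\<close>

definition act :: "nat \<Rightarrow> (nat \<Rightarrow> nat \<Rightarrow> 'a) \<Rightarrow> (nat \<Rightarrow> 'a) \<Rightarrow> nat \<Rightarrow> 'a :: comm_ring_1" where
  "act N P v = (\<lambda>i. if i < N then (\<Sum>j<N. P i j * v j) else 0)"

lemma act_uminus: "act N (- P) v = - act N P v"
  and act_zero: "act N 0 v = 0"
  by (auto simp: act_def fun_eq_iff sum_negf)

lemma act_shift_op: "act N (\<lambda>i j. (if i = j then x else 0) - A i j) = shift_op N x A"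
proof (intro ext)
  fix v i
  have "(\<Sum>j<N. (if i = j then x else 0) * v j) = (\<Sum>j<N. if i = j then x * v j else 0)"
    by (intro sum.cong) auto
  then show "act N (\<lambda>i j. (if i = j then x else 0) - A i j) v i = shift_op N x A v i"
    by (simp add: act_def shift_op_def ring_distribs sum_subtractf)
qed

text \<open>A free module of rank r N is cut into r consecutive blocks of length N, so that
  complexes of operators become complexes of matrices.\<close>

definition blk :: "nat \<Rightarrow> 'a vec \<Rightarrow> nat \<Rightarrow> nat \<Rightarrow> 'a :: comm_ring_1" where
  "blk N v s = (\<lambda>i. if i < N then v $ (s * N + i) else 0)"

definition unblk :: "nat \<Rightarrow> nat \<Rightarrow> (nat \<Rightarrow> nat \<Rightarrow> 'a) \<Rightarrow> 'a :: comm_ring_1 vec" where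
  "unblk N r u = vec (r * N) (\<lambda>i. u (i div N) (i mod N))"

definition block_mat :: "nat \<Rightarrow> nat \<Rightarrow> nat \<Rightarrow> (nat \<Rightarrow> nat \<Rightarrow> nat \<Rightarrow> nat \<Rightarrow> 'a) \<Rightarrow> 'a :: comm_ring_1 mat" where
  "block_mat N r c P = mat (r * N) (c * N) (\<lambda>(i, j). P (i div N) (j div N) (i mod N) (j mod N))"

lemma block_carrier [simp]:
  "unblk N r u \<in> carrier_vec (r * N)" "block_mat N r c P \<in> carrier_mat (r * N) (c * N)"
  by (simp_all add: unblk_def block_mat_def)

lemma blk_vecs [simp]: "blk N v s \<in> vecs N"
  by (simp add: blk_def vecs_def)

lemma block_index: "s < r \<Longrightarrow> i < N \<Longrightarrow> s * N + i < r * (N :: nat)"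
proof -
  assume "s < r" "i < N"
  then have "s * N + i < Suc s * N" "Suc s * N \<le> r * N" by (simp, intro mult_le_mono1, simp)
  then show ?thesis by linarith
qed

lemma blk_unblk: "s < r \<Longrightarrow> u s \<in> vecs N \<Longrightarrow> blk N (unblk N r u) s = u s"
  by (auto simp: blk_def unblk_def vecs_def fun_eq_iff block_index)

lemma blk_eqI:
  assumes "v \<in> carrier_vec (r * N)" "w \<in> carrier_vec (r * N)" "\<And>s. s < r \<Longrightarrow> blk N v s = blk N w s"
  shows "v = w"
proof (rule eq_vecI)
  fix i assume "i < dim_vec w"
  then have i: "i < r * N" using assms(2) by simp
  then have N: "N > 0" by (cases N) auto
  have "i div N < r" "i mod N < N" using i N by (simp_all add: less_mult_imp_div_less)
  then show "v $ i = w $ i"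
    using fun_cong[OF assms(3), of "i div N" "i mod N"] by (simp add: blk_def)
qed (use assms in simp)

lemma blk_zero: "s < r \<Longrightarrow> blk N (0\<^sub>v (r * N)) s = 0"
  by (auto simp: blk_def fun_eq_iff block_index)

lemma blk_mult:
  assumes s: "s < r" and w: "w \<in> carrier_vec (c * N)"
  shows "blk N (block_mat N r c P *\<^sub>v w) s = (\<lambda>i. \<Sum>t<c. act N (P s t) (blk N w t) i)"
proof
  fix i
  show "blk N (block_mat N r c P *\<^sub>v w) s i = (\<Sum>t<c. act N (P s t) (blk N w t) i)"
  proof (cases "i < N")
    case True
    define f where "f j = P s (j div N) i (j mod N) * w $ j" for j
    have "blk N (block_mat N r c P *\<^sub>v w) s i = (\<Sum>j<c * N. f j)"
      using True s w by (simp add: blk_def block_mat_def block_index scalar_prod_def f_def atLeast0LessThan)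
    also have "\<dots> = (\<Sum>t<c. \<Sum>j = t * N..<t * N + N. f j)" by (rule sum.nat_group[symmetric])
    also have "\<dots> = (\<Sum>t<c. act N (P s t) (blk N w t) i)"
    proof (rule sum.cong)
      fix t
      have "(\<Sum>j = t * N..<t * N + N. f j) = (\<Sum>j<N. f (j + t * N))"
        using sum.shift_bounds_nat_ivl[of f 0 "t * N" N] by (simp add: atLeast0LessThan add.commute)
      also have "\<dots> = act N (P s t) (blk N w t) i"
        using True by (auto simp: act_def blk_def f_def add.commute intro!: sum.cong)
      finally show "(\<Sum>j = t * N..<t * N + N. f j) = act N (P s t) (blk N w t) i" .
    qed simp
    finally show ?thesis .
  qed (simp add: blk_def act_def)
qed

lemma block_mult_eq_iff:
  assumes "v \<in> carrier_vec (r * N)" "w \<in> carrier_vec (c * N)"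
  shows "v = block_mat N r c P *\<^sub>v w \<longleftrightarrow> (\<forall>s<r. blk N v s = (\<lambda>i. \<Sum>t<c. act N (P s t) (blk N w t) i))"
proof -
  have "block_mat N r c P *\<^sub>v w \<in> carrier_vec (r * N)"
    by (rule mult_mat_vec_carrier[OF block_carrier(2) assms(2)])
  note carr = this
  have m: "blk N (block_mat N r c P *\<^sub>v w) s = (\<lambda>i. \<Sum>t<c. act N (P s t) (blk N w t) i)" if "s < r" for s
    by (rule blk_mult[OF that assms(2)])
  show ?thesis
  proof
    assume "v = block_mat N r c P *\<^sub>v w"
    then show "\<forall>s<r. blk N v s = (\<lambda>i. \<Sum>t<c. act N (P s t) (blk N w t) i)" using m by blast
  next
    assume *: "\<forall>s<r. blk N v s = (\<lambda>i. \<Sum>t<c. act N (P s t) (blk N w t) i)"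
    show "v = block_mat N r c P *\<^sub>v w"
      by (rule blk_eqI[OF assms(1) carr]) (use * in \<open>simp only: m\<close>)
  qed
qed

lemma block_image_iff:
  assumes v: "v \<in> carrier_vec (r * N)"
  shows "(\<exists>w\<in>carrier_vec (c * N). v = block_mat N r c P *\<^sub>v w) \<longleftrightarrow>
    (\<exists>u. (\<forall>t<c. u t \<in> vecs N) \<and> (\<forall>s<r. blk N v s = (\<lambda>i. \<Sum>t<c. act N (P s t) (u t) i)))"
  (is "?L \<longleftrightarrow> ?R")
proof
  assume ?L
  then obtain w where w: "w \<in> carrier_vec (c * N)" "v = block_mat N r c P *\<^sub>v w" by blast
  show ?R
    by (intro exI[of _ "blk N w"] conjI) (simp, rule iffD1[OF block_mult_eq_iff[OF v w(1)] w(2)])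
next
  assume ?R
  then obtain u where u: "\<forall>t<c. u t \<in> vecs N" "\<forall>s<r. blk N v s = (\<lambda>i. \<Sum>t<c. act N (P s t) (u t) i)" by blast
  have "blk N v s = (\<lambda>i. \<Sum>t<c. act N (P s t) (blk N (unblk N c u) t) i)" if "s < r" for s
    using u that by (simp add: blk_unblk)
  then have "v = block_mat N r c P *\<^sub>v unblk N c u"
    using block_mult_eq_iff[OF v block_carrier(1)] by blast
  then show ?L using block_carrier(1) by blast
qed

lemma block_kernel_iff:
  assumes "w \<in> carrier_vec (c * N)"
  shows "block_mat N r c P *\<^sub>v w = 0\<^sub>v (r * N) \<longleftrightarrow> (\<forall>s<r. (\<lambda>i. \<Sum>t<c. act N (P s t) (blk N w t) i) = 0)"
  using block_mult_eq_iff[OF _ assms, of "0\<^sub>v (r * N)" r P] blk_zero[of _ r N] by (metis (no_types, lifting) zero_carrier_vec)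

lemma less_three: "(\<forall>s<3. Q s) \<longleftrightarrow> Q 0 \<and> Q (Suc 0) \<and> Q 2"
  by (auto simp: numeral_3_eq_3 numeral_2_eq_2 less_Suc_eq)

lemma sum_three: "(\<Sum>t<3. f t :: 'a :: comm_ring_1) = f 0 + f (Suc 0) + f 2"
  by (simp add: numeral_3_eq_3 numeral_2_eq_2)

lemma exists_three:
  "(\<exists>u :: nat \<Rightarrow> 'a. (\<forall>t<3. u t \<in> S) \<and> Q (u 0) (u (Suc 0)) (u 2)) \<longleftrightarrow> (\<exists>a\<in>S. \<exists>b\<in>S. \<exists>c\<in>S. Q a b c)"
proof
  assume "\<exists>a\<in>S. \<exists>b\<in>S. \<exists>c\<in>S. Q a b c"
  then obtain a b c where abc: "a \<in> S" "b \<in> S" "c \<in> S" "Q a b c" by blast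
  show "\<exists>u :: nat \<Rightarrow> 'a. (\<forall>t<3. u t \<in> S) \<and> Q (u 0) (u (Suc 0)) (u 2)"
    using abc by (intro exI[of _ "\<lambda>t. if t = 0 then a else if t = Suc 0 then b else c"]) auto
qed (auto simp: less_three)

lemma exists_one: "(\<exists>u :: nat \<Rightarrow> 'a. (\<forall>t<Suc 0. u t \<in> S) \<and> Q (u 0)) \<longleftrightarrow> (\<exists>a\<in>S. Q a)"
  by (auto intro: exI[of _ "\<lambda>_. _"])

context triangular_triple
begin

definition mx :: "nat \<Rightarrow> nat \<Rightarrow> 'k pser3" where "mx = (\<lambda>i j. (if i = j then varx else 0) - const3 (X i j))"
definition my :: "nat \<Rightarrow> nat \<Rightarrow> 'k pser3" where "my = (\<lambda>i j. (if i = j then vary else 0) - const3 (Y i j))"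
definition mz :: "nat \<Rightarrow> nat \<Rightarrow> 'k pser3" where "mz = (\<lambda>i j. (if i = j then varz else 0) - const3 (Z i j))"

lemma act_mx: "act N mx = opx" "act N my = opy" "act N mz = opz"
  unfolding mx_def my_def mz_def opx_def opy_def opz_def by (rule act_shift_op)+

text \<open>The signs and the order xy, xz, yz of the 2-forms are those of
  \<open>kd_components\<close>.\<close>

definition koszul_block :: "nat \<Rightarrow> nat \<Rightarrow> nat \<Rightarrow> nat \<Rightarrow> nat \<Rightarrow> 'k pser3" where
  "koszul_block i s t =
    (if i = 0 then [mx, my, mz] ! t
     else if i = 1 then [[- my, - mz, 0], [mx, 0, - mz], [0, mx, my]] ! s ! t
     else [mz, - my, mx] ! s)"

definition rk :: "nat \<Rightarrow> nat" where
  "rk i = (if i = 0 \<or> i = 3 then 1 else if i = 1 \<or> i = 2 then 3 else 0)"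

lemma rk_simps: "rk 0 = 1" "rk 1 = 3" "rk (Suc 0) = 3" "rk 2 = 3" "rk 3 = 1" "rk (Suc 1) = 3" "rk (Suc (Suc 0)) = 3"
  "rk (Suc 2) = 1" "rk (Suc (Suc 1)) = 1" "rk (Suc (Suc 2)) = 0"
  by (simp_all add: rk_def)

definition koszul_mat :: "nat \<Rightarrow> 'k pser3 mat" where
  "koszul_mat i = block_mat N (rk i) (rk (Suc i)) (koszul_block i)"

lemma act_koszul_block:
  "(\<lambda>i. \<Sum>t<3. act N (koszul_block 0 s t) (u t) i) = opx (u 0) + opy (u (Suc 0)) + opz (u 2)"
  "(\<lambda>i. \<Sum>t<3. act N (koszul_block 1 0 t) (u t) i) = - opy (u 0) - opz (u (Suc 0))"
  "(\<lambda>i. \<Sum>t<3. act N (koszul_block 1 (Suc 0) t) (u t) i) = opx (u 0) - opz (u 2)"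
  "(\<lambda>i. \<Sum>t<3. act N (koszul_block 1 2 t) (u t) i) = opx (u (Suc 0)) + opy (u 2)"
  "act N (koszul_block 2 0 0) v = opz v" "act N (koszul_block 2 (Suc 0) 0) v = - opy v" "act N (koszul_block 2 2 0) v = opx v"
  unfolding sum_three
  by (simp_all add: koszul_block_def act_mx act_uminus act_zero fun_eq_iff)

lemma koszul_mat_exact:
  assumes v: "v \<in> carrier_vec (rk (Suc i) * N)"
  shows "koszul_mat i *\<^sub>v v = 0\<^sub>v (rk i * N) \<longleftrightarrow>
    (\<exists>w\<in>carrier_vec (rk (Suc (Suc i)) * N). v = koszul_mat (Suc i) *\<^sub>v w)"
proof -
  consider "i = 0" | "i = 1" | "i = 2" | "i \<ge> 3" by linarith
  then show ?thesis
  proof cases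
    case 1
    have "koszul_mat i *\<^sub>v v = 0\<^sub>v (rk i * N) \<longleftrightarrow> opx (blk N v 0) + opy (blk N v (Suc 0)) + opz (blk N v 2) = 0"
      using v unfolding 1 koszul_mat_def rk_simps by (subst block_kernel_iff) (simp_all add: act_koszul_block)
    also have "\<dots> \<longleftrightarrow> (\<exists>a\<in>V. \<exists>b\<in>V. \<exists>c\<in>V. blk N v 0 = - opy a - opz b \<and> blk N v (Suc 0) = opx a - opz c \<and>
        blk N v 2 = opx b + opy c)"
      (is "_ \<longleftrightarrow> ?R")
    proof
      assume ?R
      then obtain a b c where eq: "blk N v 0 = - opy a - opz b" "blk N v (Suc 0) = opx a - opz c" "blk N v 2 = opx b + opy c"
        by blast
      show "opx (blk N v 0) + opy (blk N v (Suc 0)) + opz (blk N v 2) = 0"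
        unfolding eq op_linear op_commute by simp
    qed (intro koszul_op_exact_1 blk_vecs)
    also have "\<dots> \<longleftrightarrow> (\<exists>u. (\<forall>t<3. u t \<in> V) \<and> blk N v 0 = - opy (u 0) - opz (u (Suc 0)) \<and>
        blk N v (Suc 0) = opx (u 0) - opz (u 2) \<and> blk N v 2 = opx (u (Suc 0)) + opy (u 2))"
      by (rule exists_three[symmetric, of V "\<lambda>a b c. blk N v 0 = - opy a - opz b \<and> blk N v (Suc 0) = opx a - opz c \<and>
        blk N v 2 = opx b + opy c"])
    also have "\<dots> \<longleftrightarrow> (\<exists>w\<in>carrier_vec (rk (Suc (Suc i)) * N). v = koszul_mat (Suc i) *\<^sub>v w)"
      using v unfolding 1 koszul_mat_def rk_simps One_nat_def[symmetric]
      by (subst block_image_iff) (simp_all add: less_three act_koszul_block[unfolded One_nat_def])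
    finally show ?thesis .
  next
    case 2
    have "koszul_mat i *\<^sub>v v = 0\<^sub>v (rk i * N) \<longleftrightarrow> - opy (blk N v 0) - opz (blk N v (Suc 0)) = 0 \<and>
        opx (blk N v 0) - opz (blk N v 2) = 0 \<and> opx (blk N v (Suc 0)) + opy (blk N v 2) = 0"
      using v unfolding 2 koszul_mat_def rk_simps
      by (subst block_kernel_iff) (simp_all add: less_three act_koszul_block[unfolded One_nat_def])
    also have "\<dots> \<longleftrightarrow> (\<exists>t\<in>V. blk N v 0 = opz t \<and> blk N v (Suc 0) = - opy t \<and> blk N v 2 = opx t)"
      (is "_ \<longleftrightarrow> ?R")
    proof
      assume ?R
      then obtain t where eq: "blk N v 0 = opz t" "blk N v (Suc 0) = - opy t" "blk N v 2 = opx t" by blast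
      show "- opy (blk N v 0) - opz (blk N v (Suc 0)) = 0 \<and>
          opx (blk N v 0) - opz (blk N v 2) = 0 \<and> opx (blk N v (Suc 0)) + opy (blk N v 2) = 0"
        unfolding eq op_linear op_commute by simp
    qed (intro koszul_op_exact_2 blk_vecs; blast)
    also have "\<dots> \<longleftrightarrow> (\<exists>u. (\<forall>t<Suc 0. u t \<in> V) \<and> blk N v 0 = opz (u 0) \<and> blk N v (Suc 0) = - opy (u 0) \<and>
        blk N v 2 = opx (u 0))"
      by (rule exists_one[symmetric, of V "\<lambda>t. blk N v 0 = opz t \<and> blk N v (Suc 0) = - opy t \<and> blk N v 2 = opx t"])
    also have "\<dots> \<longleftrightarrow> (\<exists>w\<in>carrier_vec (rk (Suc (Suc i)) * N). v = koszul_mat (Suc i) *\<^sub>v w)"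
      using v unfolding 2 koszul_mat_def rk_simps Suc_1
      by (subst block_image_iff) (simp_all add: less_three act_koszul_block exists_one)
    finally show ?thesis .
  next
    case 3
    have "koszul_mat i *\<^sub>v v = 0\<^sub>v (rk i * N) \<longleftrightarrow> opz (blk N v 0) = 0 \<and> - opy (blk N v 0) = 0 \<and> opx (blk N v 0) = 0"
      using v unfolding 3 koszul_mat_def rk_simps by (subst block_kernel_iff) (simp_all add: less_three act_koszul_block)
    also have "\<dots> \<longleftrightarrow> blk N v 0 = 0" using opz_zero[OF blk_vecs] by (auto simp: op_linear)
    also have "\<dots> \<longleftrightarrow> (\<exists>w\<in>carrier_vec (rk (Suc (Suc i)) * N). v = koszul_mat (Suc i) *\<^sub>v w)"
      using v unfolding 3 koszul_mat_def rk_simps by (subst block_image_iff) (simp_all add: zero_fun_def)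
    finally show ?thesis .
  next
    case 4
    then have "rk (Suc i) = 0" by (simp add: rk_def)
    moreover have "\<exists>u. \<forall>t<rk (Suc (Suc i)). u t \<in> V" by (rule exI[of _ "\<lambda>_. 0"]) simp
    ultimately have "koszul_mat i *\<^sub>v v = 0\<^sub>v (rk i * N)" "\<exists>w\<in>carrier_vec (rk (Suc (Suc i)) * N). v = koszul_mat (Suc i) *\<^sub>v w"
      using v block_kernel_iff[of v 0 N "rk i" "koszul_block i"]
        block_image_iff[of v 0 N "rk (Suc (Suc i))" "koszul_block (Suc i)"]
      unfolding koszul_mat_def by (simp_all add: zero_fun_def)
    then show ?thesis by blast
  qed
qed

lemma has_free_resolution_koszul:
  fixes \<aa> :: "'k pser3 set"
  assumes q: "q \<in> carrier_vec N" and surj: "\<And>f. \<exists>v\<in>carrier_vec N. f - q \<bullet> v \<in> \<aa>"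
    and ker: "\<And>v. v \<in> carrier_vec N \<Longrightarrow> q \<bullet> v \<in> \<aa> \<longleftrightarrow> (\<exists>a\<in>V. \<exists>b\<in>V. \<exists>c\<in>V. blk N v 0 = opx a + opy b + opz c)"
  shows "has_free_resolution \<aa> 3"
  unfolding has_free_resolution_def
proof (rule exI[of _ "\<lambda>i. rk i * N"], rule exI[of _ koszul_mat], rule exI[of _ q], intro conjI)
  show "\<forall>i. koszul_mat i \<in> carrier_mat (rk i * N) (rk (Suc i) * N)" by (simp add: koszul_mat_def)
  show "\<forall>i>3. rk i * N = 0" by (simp add: rk_def)
  show "q \<in> carrier_vec (rk 0 * N)" using q by (simp add: rk_def)
  show "\<forall>f. \<exists>v\<in>carrier_vec (rk 0 * N). f - q \<bullet> v \<in> \<aa>" using surj by (simp add: rk_def)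
  show "\<forall>i. \<forall>v\<in>carrier_vec (rk (Suc i) * N). koszul_mat i *\<^sub>v v = 0\<^sub>v (rk i * N) \<longleftrightarrow>
      (\<exists>w\<in>carrier_vec (rk (Suc (Suc i)) * N). v = koszul_mat (Suc i) *\<^sub>v w)"
    using koszul_mat_exact by blast
  show "\<forall>v\<in>carrier_vec (rk 0 * N). (q \<bullet> v \<in> \<aa>) = (\<exists>w\<in>carrier_vec (rk 1 * N). v = koszul_mat 0 *\<^sub>v w)"
  proof
    fix v :: "'k pser3 vec" assume v: "v \<in> carrier_vec (rk 0 * N)"
    then have "(\<exists>w\<in>carrier_vec (rk 1 * N). v = koszul_mat 0 *\<^sub>v w) \<longleftrightarrow>
        (\<exists>a\<in>V. \<exists>b\<in>V. \<exists>c\<in>V. blk N v 0 = opx a + opy b + opz c)"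
      unfolding koszul_mat_def rk_simps
      by (subst block_image_iff) (simp_all add: act_koszul_block exists_three[symmetric])
    then show "(q \<bullet> v \<in> \<aa>) = (\<exists>w\<in>carrier_vec (rk 1 * N). v = koszul_mat 0 *\<^sub>v w)"
      using ker v by (simp add: rk_def)
  qed
qed

end

section \<open>Multiplication on a finite-dimensional quotient\<close>

context
  fixes W :: "nat \<Rightarrow> nat \<Rightarrow> nat \<Rightarrow> bool" and bs :: "(nat \<times> nat \<times> nat) list"
  assumes W: "stable W" and bs: "distinct bs" "\<And>a b j. (a, b, j) \<in> set bs \<longleftrightarrow> \<not> W a b j"
begin

definition coord :: "'k :: field pser3 \<Rightarrow> nat \<Rightarrow> 'k" where
  "coord f i = (case bs ! i of (a, b, j) \<Rightarrow> coef f a b j)"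

definition basis_el :: "nat \<Rightarrow> 'k :: field pser3" where
  "basis_el l = el (\<lambda>a b j. if (a, b, j) = bs ! l then 1 else 0)"

abbreviation "deg_at i \<equiv> (case bs ! i of (a, b, j) \<Rightarrow> a + b + j)"

abbreviation "mult_coord h i l \<equiv> coord (h * basis_el l) i"

lemma coord_linear:
  "coord (f + g) i = coord f i + coord g i" "coord (f - g) i = coord f i - coord g i"
  "coord (const3 c * f) i = c * coord f i" "coord (sum F S) i = (\<Sum>s\<in>S. coord (F s) i)"
  by (simp_all add: coord_def split: prod.split)

lemma coord_basis_el: "i < length bs \<Longrightarrow> l < length bs \<Longrightarrow> coord (basis_el l) i = (if i = l then 1 else 0)"
  using bs(1) by (auto simp: coord_def basis_el_def nth_eq_iff_index_eq split: prod.split)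

lemma supp_in_coord: "f \<in> supp_in W \<longleftrightarrow> (\<forall>i<length bs. coord f i = 0)"
proof
  assume f: "f \<in> supp_in W"
  show "\<forall>i<length bs. coord f i = 0"
  proof (intro allI impI)
    fix i assume i: "i < length bs"
    obtain a b j where e: "bs ! i = (a, b, j)" by (cases "bs ! i")
    then have "\<not> W a b j" using i bs(2) nth_mem by metis
    then show "coord f i = 0" using f unfolding supp_in_iff by (simp add: coord_def e)
  qed
next
  assume f: "\<forall>i<length bs. coord f i = 0"
  show "f \<in> supp_in W"
    unfolding supp_in_iff
  proof (intro allI impI)
    fix a b j assume "\<not> W a b j"
    then obtain i where "i < length bs" "bs ! i = (a, b, j)" using bs(2) in_set_conv_nth by metis
    then show "coef f a b j = 0" using f by (force simp: coord_def)
  qed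
qed

lemma coord_expand: "f - (\<Sum>l<length bs. const3 (coord f l) * basis_el l) \<in> supp_in W"
  unfolding supp_in_coord by (auto simp: coord_linear coord_basis_el if_distrib cong: if_cong)

text \<open>Multiplication by h on the quotient has the matrix \<open>mult_coord h\<close>, since f
  and its expansion differ by an element of the ideal.\<close>

lemma mult_coord_apply:
  assumes "i < length bs"
  shows "coord (h * f) i = (\<Sum>l<length bs. mult_coord h i l * coord f l)"
proof -
  let ?g = "\<Sum>l<length bs. const3 (coord f l) * basis_el l"
  have "h * (f - ?g) \<in> supp_in W" by (rule supp_in_mult[OF W coord_expand])
  then have "coord (h * (f - ?g)) i = 0" using assms unfolding supp_in_coord by blast
  moreover have "h * (f - ?g) = h * f - (\<Sum>l<length bs. const3 (coord f l) * (h * basis_el l))"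
    by (simp add: right_diff_distrib sum_distrib_left mult_ac)
  ultimately show ?thesis by (simp add: coord_linear mult.commute)
qed

text \<open>Both sums are the coordinate of g h times a basis element.\<close>

lemma mult_coord_commute:
  assumes "i < length bs"
  shows "(\<Sum>j<length bs. mult_coord g i j * mult_coord h j l) = (\<Sum>j<length bs. mult_coord h i j * mult_coord g j l)"
  unfolding mult_coord_apply[OF assms, symmetric] by (simp add: mult_ac)

lemma mult_coord_degree:
  assumes "(h :: 'k :: field pser3) \<in> {varx, vary, varz}" "mult_coord h i l \<noteq> 0"
  shows "deg_at l < deg_at i"
proof -
  obtain a b j where i: "bs ! i = (a, b, j)" by (cases "bs ! i")
  obtain a' b' j' where l: "bs ! l = (a', b', j')" by (cases "bs ! l")
  show ?thesis
    using assms unfolding coord_def basis_el_def i l by (auto split: if_splits)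
qed

text \<open>The element h b_j and its expansion in the basis agree modulo the ideal, so the
  augmentation kills the image of h minus its matrix.\<close>

lemma basis_el_shift_op:
  "(\<Sum>i<length bs. basis_el i * shift_op (length bs) h (\<lambda>i j. const3 (mult_coord h i j)) a i) \<in> supp_in W"
proof -
  let ?N = "length bs"
  have "(\<Sum>i<?N. basis_el i * shift_op ?N h (\<lambda>i j. const3 (mult_coord h i j)) a i) =
      (\<Sum>i<?N. basis_el i * h * a i) - (\<Sum>i<?N. \<Sum>j<?N. const3 (mult_coord h i j) * basis_el i * a j)"
    by (simp add: shift_op_def right_diff_distrib sum_subtractf sum_distrib_left mult_ac)
  also have "(\<Sum>i<?N. \<Sum>j<?N. const3 (mult_coord h i j) * basis_el i * a j) =
      (\<Sum>j<?N. \<Sum>i<?N. const3 (mult_coord h i j) * basis_el i * a j)" by (rule sum.swap)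
  also have "(\<Sum>i<?N. basis_el i * h * a i) - \<dots> =
      (\<Sum>j<?N. a j * (h * basis_el j - (\<Sum>i<?N. const3 (mult_coord h i j) * basis_el i)))"
    by (simp add: right_diff_distrib sum_subtractf sum_distrib_left mult_ac)
  also have "\<dots> \<in> supp_in W"
    by (intro ideal_sum[OF supp_in_ideal[OF W]] supp_in_mult[OF W] coord_expand)
  finally show ?thesis .
qed

lemma has_free_resolution_3: "has_free_resolution (supp_in W :: 'k :: field pser3 set) 3"
proof -
  let ?N = "length bs"
  interpret triangular_triple ?N "mult_coord (varx :: 'k pser3)" "mult_coord (vary :: 'k pser3)" "mult_coord (varz :: 'k pser3)"
    "\<lambda>i. deg_at i"
    by unfold_locales (use mult_coord_degree in blast, (rule mult_coord_commute, assumption)+)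
  let ?q = "vec ?N basis_el :: 'k pser3 vec"
  have dot: "?q \<bullet> v = (\<Sum>i<?N. basis_el i * v $ i)" if "v \<in> carrier_vec ?N" for v
    using that by (simp add: scalar_prod_def atLeast0LessThan)
  show ?thesis
  proof (rule has_free_resolution_koszul)
    show "?q \<in> carrier_vec ?N" by simp
    show "\<exists>v\<in>carrier_vec ?N. f - ?q \<bullet> v \<in> supp_in W" for f
      by (rule bexI[of _ "vec ?N (\<lambda>i. const3 (coord f i))"])
        (use coord_expand[of f] in \<open>simp_all add: dot mult.commute\<close>)
    show "?q \<bullet> v \<in> supp_in W \<longleftrightarrow> (\<exists>a\<in>V. \<exists>b\<in>V. \<exists>c\<in>V. blk ?N v 0 = opx a + opy b + opz c)"
      if v: "v \<in> carrier_vec ?N" for v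
    proof -
      have d: "?q \<bullet> v = (\<Sum>i<?N. basis_el i * blk ?N v 0 i)" unfolding dot[OF v] by (simp add: blk_def)
      have im: "(\<Sum>i<?N. basis_el i * opx a i) \<in> supp_in W" "(\<Sum>i<?N. basis_el i * opy a i) \<in> supp_in W"
        "(\<Sum>i<?N. basis_el i * opz a i) \<in> supp_in W" for a
        unfolding opx_def opy_def opz_def by (rule basis_el_shift_op)+
      have im3: "(\<Sum>i<?N. basis_el i * (opx a + opy b + opz c) i) \<in> supp_in W" for a b c
        using supp_in_add[OF supp_in_add[OF im(1)[of a] im(2)[of b]] im(3)[of c]]
        by (simp add: distrib_left sum.distrib)
      show ?thesis
      proof
        assume q: "?q \<bullet> v \<in> supp_in W"
        \<comment> \<open>After division only a constant vector d remains. The augmentation sends it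
          to a combination of basis elements, which lies in the ideal only for d = 0.\<close>
        obtain a b c d where abc: "a \<in> V" "b \<in> V" "c \<in> V" "d \<in> V"
            "blk ?N v 0 = opx a + opy b + opz c + (\<lambda>i. const3 (d i))"
          using division_const[OF blk_vecs] by blast
        have "(\<Sum>i<?N. basis_el i * const3 (d i)) = ?q \<bullet> v - (\<Sum>i<?N. basis_el i * (opx a + opy b + opz c) i)"
          unfolding d abc(5) by (simp add: distrib_left sum.distrib)
        then have "(\<Sum>i<?N. const3 (d i) * basis_el i) \<in> supp_in W"
          using ideal_diff[OF supp_in_ideal[OF W] q im3] by (simp add: mult.commute)
        then have "d i = 0" if "i < ?N" for i
          using that unfolding supp_in_coord by (force simp: coord_linear coord_basis_el if_distrib cong: if_cong)
        then have "d i = 0" for i using abc(4) by (cases "i < ?N") (auto simp: vecs_def)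
        then have "blk ?N v 0 = opx a + opy b + opz c" unfolding abc(5) by (simp add: fun_eq_iff const3_def)
        then show "\<exists>a\<in>V. \<exists>b\<in>V. \<exists>c\<in>V. blk ?N v 0 = opx a + opy b + opz c" using abc by blast
      next
        assume "\<exists>a\<in>V. \<exists>b\<in>V. \<exists>c\<in>V. blk ?N v 0 = opx a + opy b + opz c"
        then show "?q \<bullet> v \<in> supp_in W" unfolding d using im3 by auto
      qed
    qed
  qed
qed

end

lemma has_free_resolution_supp_in:
  assumes "stable W" "finite {(a, b, j). \<not> W a b j}"
  shows "has_free_resolution (supp_in W :: 'k :: field pser3 set) 3"
proof -
  obtain bs where bs: "set bs = {(a, b, j). \<not> W a b j}" "distinct bs"
    using finite_distinct_list[OF assms(2)] by blast
  show ?thesis by (rule has_free_resolution_3[OF assms(1) bs(2)]) (simp add: bs(1))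
qed

section \<open>The quotient ring\<close>

text \<open>Row reduction with respect to the functionals: \<open>piv n\<close> is the set of
  positions of leading entries in \<open>J n\<close>. Nested ideals with equal pivots coincide,
  because an element of the larger one can be reduced step by step by elements of the smaller one
  until it lies in \<open>\<aa>\<close>.\<close>

lemma (in quotient_ideal) quot_chain_stabilizes:
  fixes \<phi> :: "nat \<Rightarrow> 'k pser3 \<Rightarrow> 'k" and J :: "nat \<Rightarrow> 'k pser3 set"
  assumes lin: "\<And>i f g. \<phi> i (f + g) = \<phi> i f + \<phi> i g" "\<And>i c f. \<phi> i (const3 c * f) = c * \<phi> i f"
    and ker: "\<And>f. (\<And>i. i < N \<Longrightarrow> \<phi> i f = 0) \<Longrightarrow> f \<in> \<aa>"
    and J: "\<And>n. ideal (J n) class_ring" "\<And>n. \<aa> \<subseteq> J n" "\<And>n. J (Suc n) \<subseteq> J n"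
  shows "\<exists>M. \<forall>n\<ge>M. J n = J M"
proof -
  define piv where "piv n = {i. i < N \<and> (\<exists>f\<in>J n. \<phi> i f \<noteq> 0 \<and> (\<forall>j<i. \<phi> j f = 0))}" for n
  have anti: "J n \<subseteq> J M" if "M \<le> n" for M n by (rule lift_Suc_antimono_le[of J, OF J(3) that])
  have piv: "piv n \<subseteq> piv M" if "M \<le> n" for M n using anti[OF that] by (auto simp: piv_def)
  have fin: "finite (piv n)" for n by (simp add: piv_def)
  have lower: "J M \<subseteq> J n" if sub: "piv M \<subseteq> piv n" "J n \<subseteq> J M" for M n
  proof -
    have "f \<in> J n" if "f \<in> J M" "\<forall>j<i. \<phi> j f = 0" "i \<le> N" for f i
      using that(3,1,2)
    proof (induction i arbitrary: f rule: inc_induct)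
      case base
      then show ?case using ker[of f] J(2)[of n] by blast
    next
      case (step i)
      show ?case
      proof (cases "\<phi> i f = 0")
        case True
        then have "\<forall>j<Suc i. \<phi> j f = 0" using step.prems by (simp add: less_Suc_eq)
        then show ?thesis using step by blast
      next
        case False
        then have "i \<in> piv M" using step by (auto simp: piv_def)
        then obtain g where g: "g \<in> J n" "\<phi> i g \<noteq> 0" "\<forall>j<i. \<phi> j g = 0" using sub(1) by (auto simp: piv_def)
        define h where "h = const3 (- (\<phi> i f / \<phi> i g)) * g"
        have h: "h \<in> J n" unfolding h_def by (rule ideal_mult[OF J(1) g(1)])
        have "\<forall>j<Suc i. \<phi> j (f + h) = 0"
          unfolding h_def lin using step.prems g by (simp add: less_Suc_eq)
        moreover have "f + h \<in> J M" using ideal_add[OF J(1) step.prems(1)] h sub(2) by blast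
        ultimately have "f + h \<in> J n" using step.IH by blast
        from ideal_diff[OF J(1) this h] show ?thesis by simp
      qed
    qed
    then show ?thesis by (meson less_nat_zero_code subsetI zero_le)
  qed
  \<comment> \<open>From an index with the least number of pivots on, the decreasing sets of pivots
    are constant.\<close>
  obtain M where M: "\<And>n. card (piv M) \<le> card (piv n)"
    using ex_has_least_nat[of "\<lambda>_. True" 0 "\<lambda>n. card (piv n)"] by blast
  have "J n = J M" if "M \<le> n" for n
  proof -
    have "piv n = piv M" by (rule card_seteq[OF fin piv[OF that] M])
    then show ?thesis using lower[of M n] anti[OF that] by blast
  qed
  then show ?thesis by blast
qed

context quotient_ideal
begin

lemma cls_image_eq: "a_r_coset class_ring \<aa> = cls \<aa>"
  by (simp add: fun_eq_iff cls_def)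

lemma ideal_cls_image: "ideal J class_ring \<Longrightarrow> ideal (cls \<aa> ` J) (quot \<aa>)"
  using ring.ring_ideal_imp_quot_ideal[OF class_ring.ring_axioms ideal] by (simp add: cls_image_eq)

lemma ideal_cls_vimage:
  assumes J: "ideal J (quot \<aa>)"
  shows "ideal {f. cls \<aa> f \<in> J} class_ring" "\<aa> \<subseteq> {f. cls \<aa> f \<in> J}" "J = cls \<aa> ` {f. cls \<aa> f \<in> J}"
proof -
  have z: "cls \<aa> 0 \<in> J" using additive_subgroup.zero_closed[OF ideal.axioms(1)[OF J]] by (simp add: zero_quot)
  have add: "cls \<aa> (f + g) \<in> J" if "cls \<aa> f \<in> J" "cls \<aa> g \<in> J" for f g
    using additive_subgroup.a_closed[OF ideal.axioms(1)[OF J] that] by (simp add: cls_add)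
  have mult: "cls \<aa> (h * f) \<in> J" if "cls \<aa> f \<in> J" for f h
    using ideal.I_l_closed[OF J that, of "cls \<aa> h"] by (simp add: cls_mult)
  show "ideal {f. cls \<aa> f \<in> J} class_ring"
    by (rule class_ring_idealI) (use z add mult in auto)
  have "cls \<aa> f = cls \<aa> 0" if "f \<in> \<aa>" for f using that by (simp add: cls_eq_iff)
  then show "\<aa> \<subseteq> {f. cls \<aa> f \<in> J}" using z by auto
  have "J \<subseteq> carrier (quot \<aa>)" using additive_subgroup.a_subset[OF ideal.axioms(1)[OF J]] .
  then show "J = cls \<aa> ` {f. cls \<aa> f \<in> J}" unfolding carrier_quot by auto
qed

lemma artinian_quot:
  fixes \<phi> :: "nat \<Rightarrow> 'k pser3 \<Rightarrow> 'k"
  assumes "\<And>i f g. \<phi> i (f + g) = \<phi> i f + \<phi> i g" "\<And>i c f. \<phi> i (const3 c * f) = c * \<phi> i f"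
    and "\<And>f. (\<And>i. i < N \<Longrightarrow> \<phi> i f = 0) \<Longrightarrow> f \<in> \<aa>"
  shows "artinian_cring (quot \<aa>)"
  unfolding artinian_cring_def
proof (intro conjI allI impI)
  show "cring (quot \<aa>)" by (rule cring_quot)
  fix J :: "nat \<Rightarrow> 'k pser3 set set"
  assume J: "\<forall>n. ideal (J n) (quot \<aa>) \<and> J (Suc n) \<subseteq> J n"
  then have i: "ideal (J n) (quot \<aa>)" for n by blast
  have "\<exists>M. \<forall>n\<ge>M. {f. cls \<aa> f \<in> J n} = {f. cls \<aa> f \<in> J M}"
    by (rule quot_chain_stabilizes[OF assms]) (use ideal_cls_vimage[OF i] J in auto)
  then obtain M where M: "\<And>n. M \<le> n \<Longrightarrow> {f. cls \<aa> f \<in> J n} = {f. cls \<aa> f \<in> J M}" by blast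
  have "J n = J M" if "M \<le> n" for n
    using ideal_cls_vimage(3)[OF i, of n] ideal_cls_vimage(3)[OF i, of M] M[OF that] by simp
  then show "\<exists>M. \<forall>n\<ge>M. J n = J M" by blast
qed

end

section \<open>The local ring structure and the socle\<close>

lemma fps_unit:
  fixes f :: "'a :: comm_ring_1 fps"
  assumes "f !! 0 * y = 1"
  shows "\<exists>g. f * g = 1"
  using fps_right_inverse[OF assms] by blast

lemma unit_of_coef:
  fixes f :: "'k :: field pser3"
  assumes "coef f 0 0 0 \<noteq> 0"
  shows "\<exists>g. f * g = 1"
proof -
  have "f !! 0 !! 0 !! 0 \<noteq> 0" using assms by (simp add: coef.simps[of f 0 0 0])
  then have "f !! 0 !! 0 !! 0 * inverse (f !! 0 !! 0 !! 0) = 1" by simp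
  then obtain g1 where "f !! 0 !! 0 * g1 = 1" using fps_unit by blast
  then obtain g2 where "f !! 0 * g2 = 1" using fps_unit by blast
  then show ?thesis by (rule fps_unit)
qed

text \<open>An ideal with an element outside the image of n contains the class of a series with
  non-zero constant term, which is a unit.\<close>

lemma (in quotient_ideal) local_quot:
  assumes sub: "\<aa> \<subseteq> max_ideal"
  shows "local_cring (quot \<aa>)"
proof -
  let ?M = "cls \<aa> ` max_ideal"
  interpret R: cring "quot \<aa>" by (rule cring_quot)
  have iM: "ideal ?M (quot \<aa>)"
    by (rule ideal_cls_image) (simp add: max_ideal_def genideal_is_ideal)
  have one: "cls \<aa> 1 \<notin> ?M"
  proof
    assume "cls \<aa> 1 \<in> ?M"
    then obtain f where "f \<in> max_ideal" "1 - f \<in> \<aa>" by (auto simp: cls_eq_iff)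
    then have "coef f 0 0 0 = 0" "coef (1 - f) 0 0 0 = 0" using sub by (auto simp: mem_max_ideal_iff)
    then show False by (simp add: coef_one)
  qed
  have below: "J \<subseteq> ?M \<or> J = carrier (quot \<aa>)" if J: "ideal J (quot \<aa>)" for J
  proof (rule disjCI)
    assume "J \<noteq> carrier (quot \<aa>)"
    show "J \<subseteq> ?M"
    proof
      fix r assume r: "r \<in> J"
      then obtain f where f: "r = cls \<aa> f" using ideal_cls_vimage(3)[OF J] by blast
      have "coef f 0 0 0 = 0"
      proof (rule ccontr)
        assume "coef f 0 0 0 \<noteq> 0"
        then obtain h where "f * h = 1" using unit_of_coef by blast
        then have "\<one>\<^bsub>quot \<aa>\<^esub> \<in> J"
          using ideal.I_r_closed[OF J r, of "cls \<aa> h"] by (simp add: f cls_mult one_quot)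
        then show False using ideal.one_imp_carrier[OF J] \<open>J \<noteq> _\<close> by blast
      qed
      then show "r \<in> ?M" unfolding f by (simp add: mem_max_ideal_iff)
    qed
  qed
  have sc: "J \<subseteq> carrier (quot \<aa>)" if "ideal J (quot \<aa>)" for J
    using additive_subgroup.a_subset[OF ideal.axioms(1)[OF that]] .
  have ne: "?M \<noteq> carrier (quot \<aa>)" using one cls_closed[of 1] by metis
  have "maximalideal ?M (quot \<aa>)"
  proof (rule maximalidealI[OF iM])
    show "carrier (quot \<aa>) \<noteq> ?M" using ne by simp
    show "J = ?M \<or> J = carrier (quot \<aa>)" if "ideal J (quot \<aa>)" "?M \<subseteq> J" for J
      using below[OF that(1)] that(2) by blast
  qed
  moreover have "M' = ?M" if "maximalideal M' (quot \<aa>)" for M'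
  proof -
    interpret M': maximalideal M' "quot \<aa>" by (rule that)
    have "M' \<subseteq> ?M" using below[OF M'.is_ideal] M'.I_notcarr by blast
    then show ?thesis using M'.I_maximal[OF iM _ sc[OF iM]] ne by blast
  qed
  ultimately show ?thesis
    unfolding local_cring_def using cring_quot by blast
qed

lemma (in quotient_ideal) annihilator_max_ideal:
  "annihilator (quot \<aa>) (cls \<aa> ` max_ideal) = cls \<aa> ` {f. \<forall>h\<in>max_ideal. f * h \<in> \<aa>}"
  proof -
  have "(\<forall>r\<in>cls \<aa> ` max_ideal. cls \<aa> f \<otimes>\<^bsub>quot \<aa>\<^esub> r = \<zero>\<^bsub>quot \<aa>\<^esub>) \<longleftrightarrow> (\<forall>h\<in>max_ideal. f * h \<in> \<aa>)" for f
    by (simp only: ball_simps cls_mult cls_eq_zero_iff)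
  then show ?thesis unfolding annihilator_def carrier_quot by blast
qed

text \<open>The choice of sign allows for the generator as named in the theorem, which is
  \<open>gen m k0\<close> up to sign. The annihilator consists of the socle elements described by
  \<open>socle_quotient\<close>.\<close>

lemma (in trimmed_quotient) annihilator_eq:
  assumes "g' = g \<or> g' = - g"
  shows "annihilator (quot \<aa>) (cls \<aa> ` max_ideal) = genideal (quot \<aa>) {cls \<aa> g', cls \<aa> s}"
proof -
  interpret R: cring "quot \<aa>" by (rule cring_quot)
  let ?S = "{f. \<forall>h\<in>max_ideal. f * h \<in> \<aa>}" and ?G = "genideal (quot \<aa>) {cls \<aa> g', cls \<aa> s}"
  have iG: "ideal ?G (quot \<aa>)" by (rule R.genideal_ideal) simp
  have gG: "cls \<aa> g' \<in> ?G" "cls \<aa> s \<in> ?G" using R.genideal_self[of "{cls \<aa> g', cls \<aa> s}"] by simp_all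
  have iS: "ideal ?S class_ring"
    by (rule class_ring_idealI) (use closed in \<open>auto simp: distrib_right mult.assoc\<close>)
  have sS: "s \<in> ?S"
  proof (intro CollectI ballI)
    fix h :: "'k pser3" assume "h \<in> max_ideal"
    then obtain h1 h2 h3 where "h = varx * h1 + vary * h2 + varz * h3" by (rule max_ideal_decompose)
    then have "s * h = h1 * (varx * s) + h2 * (vary * s) + h3 * (varz * s)" by (simp add: algebra_simps)
    then show "s * h \<in> \<aa>" using closed(2,3) s_socle by (simp only:)
  qed
  have gS: "g' \<in> ?S" using assms g_max(2) closed(5) by auto
  note vG = ideal_cls_vimage[OF iG]
  show ?thesis
    unfolding annihilator_max_ideal
  proof
    show "?G \<subseteq> cls \<aa> ` ?S"
      by (rule R.genideal_minimal[OF ideal_cls_image[OF iS]]) (use gS sS in blast)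
    show "cls \<aa> ` ?S \<subseteq> ?G"
    proof safe
      fix f assume f: "\<forall>h\<in>max_ideal. f * h \<in> \<aa>"
      then have "varx * f \<in> \<aa>" "vary * f \<in> \<aa>" "varz * f \<in> \<aa>" using var_max by (metis mult.commute)+
      then obtain c d where cd: "f - (const3 c * s + const3 d * g) \<in> \<aa>" by (rule socle_quotient)
      have g: "g \<in> {f. cls \<aa> f \<in> ?G}"
        using assms ideal_uminus[OF vG(1), of g'] gG(1) by auto
      have s: "s \<in> {f. cls \<aa> f \<in> ?G}" using gG(2) by blast
      have "const3 c * s + const3 d * g \<in> {f. cls \<aa> f \<in> ?G}"
        by (rule ideal_add[OF vG(1) ideal_mult[OF vG(1) s] ideal_mult[OF vG(1) g]])
      then have "cls \<aa> (const3 c * s + const3 d * g) \<in> ?G" by blast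
      moreover have "cls \<aa> f = cls \<aa> (const3 c * s + const3 d * g)" using cd by (simp add: cls_eq_iff)
      ultimately show "cls \<aa> f \<in> ?G" by simp
    qed
  qed
qed

lemma (in trimmed_quotient) finite_complement: "finite {(a, b, j). \<not> above_except m k0 a b j}"
  by (rule finite_subset[of _ "{..m} \<times> {..m} \<times> {..m}"])
    (use k0 in \<open>auto simp: above_except_def above_def not_le\<close>)

lemma (in trimmed_quotient) s_nin: "s \<notin> \<aa>"
proof
  assume "s \<in> \<aa>"
  from cs_A[OF aa_subset[OF this]] show False unfolding coef_s by simp
qed

lemma (in trimmed_quotient) proj_dim_3: "proj_dim_quotient \<aa> 3"
  unfolding proj_dim_quotient_def
proof (intro conjI allI impI)
  show "has_free_resolution \<aa> 3"
    unfolding aa by (rule has_free_resolution_supp_in[OF stable_above_except[OF k0] finite_complement])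
  show "\<not> has_free_resolution \<aa> k" if "k < 3" for k
    using has_free_resolution_socle[OF ideal s_nin s_socle, of k] that by auto
qed

lemma (in trimmed_quotient) artinian: "artinian_cring (quot \<aa>)"
proof -
  obtain bs where bs: "set bs = {(a, b, j). \<not> above_except m k0 a b j}" "distinct bs"
    using finite_distinct_list[OF finite_complement] by blast
  show ?thesis
  proof (rule artinian_quot[where \<phi> = "\<lambda>i f. case bs ! i of (a, b, j) \<Rightarrow> coef f a b j" and N = "length bs"])
    fix f :: "'k pser3"
    assume *: "(case bs ! i of (a, b, j) \<Rightarrow> coef f a b j) = 0" if "i < length bs" for i
    have "coef f a b j = 0" if "\<not> above_except m k0 a b j" for a b j
    proof -
      have "(a, b, j) \<in> set bs" using that bs(1) by simp
      then obtain i where "i < length bs" "bs ! i = (a, b, j)" by (auto simp: in_set_conv_nth)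
      then show ?thesis using *[of i] by simp
    qed
    then show "f \<in> \<aa>" unfolding aa supp_in_iff by blast
  qed (simp_all split: prod.split)
qed

lemma (in trimmed_quotient) local_ring: "local_cring (quot \<aa>)"
proof (rule local_quot)
  show "\<aa> \<subseteq> max_ideal"
  proof
    fix f assume "f \<in> \<aa>"
    from aa_subset[OF this] have "coef f 0 0 0 = 0" using m3 unfolding supp_in_iff above_def by simp
    then show "f \<in> max_ideal" by (simp add: mem_max_ideal_iff)
  qed
qed

section \<open>Matching the generators named in the theorem with their indices\<close>

lemma pgen_index_varx:
  assumes "k \<in> {- int m..int m}" "i \<le> m" "pgen m k = varx ^ (m - i) * (dU i :: 'k :: field pser3)"
  shows "k = - int (m - i)"
proof -
  have "(pgen m k :: 'k pser3) = pgen m (- int (m - i))" by (simp only: assms(3) pgen_varx[OF assms(2)])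
  then show ?thesis using inj_on_pgen[of m, where 'k = 'k] assms(1) by (auto simp: inj_on_def del: of_nat_diff)
qed

lemma pgen_index_vary:
  assumes "k \<in> {- int m..int m}" "i \<le> m" "pgen m k = vary ^ (m - i) * (dU i :: 'k :: field pser3)"
  shows "k = int (m - i)"
proof -
  have "(pgen m k :: 'k pser3) = pgen m (int (m - i))" by (simp only: assms(3) pgen_vary[OF assms(2)])
  then show ?thesis using inj_on_pgen[of m, where 'k = 'k] assms(1) by (auto simp: inj_on_def del: of_nat_diff)
qed

lemma trimmed_ideal_properties:
  fixes m :: nat and k0 :: int
  defines "g \<equiv> pgen m k0 :: 'k :: field pser3"
  defines "\<aa> \<equiv> trimmed_ideal m g"
  assumes m: "3 \<le> m" and k0: "k0 \<in> {- int m..int m}"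
  shows "artinian_cring (quot \<aa>)" "local_cring (quot \<aa>)" "has_type \<aa> 2"
    and "annihilator (quot \<aa>) (cls \<aa> ` max_ideal) = genideal (quot \<aa>) {cls \<aa> g, cls \<aa> (varx ^ (m - 1) * vary ^ (m - 1))}"
    and "minimally_generated_by class_ring \<aa> (if k0 \<in> {0, int m, - int m} then 2 * m + 1 else 2 * m)"
    and "class_G \<aa> (if k0 \<in> {0, int m, - int m} then 2 * m - 2 else 2 * m - 3)"
proof -
  have aa: "\<aa> = supp_in (above_except m k0)" unfolding \<aa>_def g_def by (rule trimmed_ideal_eq[OF k0])
  interpret trimmed_quotient m k0 \<aa> by unfold_locales (use m k0 aa in auto)
  show "artinian_cring (quot \<aa>)" "local_cring (quot \<aa>)" "has_type \<aa> 2"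
    by (rule artinian local_ring type_2)+
  have "g = gen m k0 \<or> g = - gen m k0"
    using sg_cases[of "m - nat \<bar>k0\<bar>", where 'a = "'k pser3"] unfolding g_def pgen_def by auto
  then show "annihilator (quot \<aa>) (cls \<aa> ` max_ideal) = genideal (quot \<aa>) {cls \<aa> g, cls \<aa> (varx ^ (m - 1) * vary ^ (m - 1))}"
    by (rule annihilator_eq)
  show "minimally_generated_by class_ring \<aa> (if k0 \<in> {0, int m, - int m} then 2 * m + 1 else 2 * m)"
    using minimally_generated_by_trim[OF m2 k0, where 'k = 'k]
    unfolding aa card_trim_index[OF m1 k0] .
  show "class_G \<aa> (if k0 \<in> {0, int m, - int m} then 2 * m - 2 else 2 * m - 3)"
    using class_G_card_Ks[OF proj_dim_3] unfolding card_Ks .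
qed

theorem proposition3p5:
  fixes m :: nat
  assumes "m \<ge> 3"
  shows "minimal_generating_set class_ring (pf_ideal m) (pf_gens m :: 'k :: field pser3 set) \<and>
    card (pf_gens m :: 'k pser3 set) = 2 * m + 1 \<and>
    (\<forall>g \<in> (pf_gens m :: 'k pser3 set).
      let \<aa> = trimmed_ideal m g; R = class_ring Quot \<aa> in
        (artinian_cring R \<and> local_cring R \<and> has_type \<aa> 2 \<and>
          annihilator R (cls \<aa> ` max_ideal) =
            genideal R {cls \<aa> g, cls \<aa> (varx ^ (m - 1) * vary ^ (m - 1))}) \<and>
        ((\<exists>i\<in>{1..m - 1}. g = varx ^ (m - i) * dU i \<or> g = vary ^ (m - i) * dU i) \<longrightarrow>
          minimally_generated_by class_ring \<aa> (2 * m) \<and> class_G \<aa> (2 * m - 3)) \<and>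
        (g \<in> {varx ^ m, vary ^ m, dU m} \<longrightarrow>
          minimally_generated_by class_ring \<aa> (2 * m + 1) \<and> class_G \<aa> (2 * m - 2)))"
  proof (intro conjI ballI)
  show "minimal_generating_set class_ring (pf_ideal m) (pf_gens m :: 'k pser3 set)"
    by (rule minimal_generating_set_pf_gens)
  show "card (pf_gens m :: 'k pser3 set) = 2 * m + 1" by (rule card_pf_gens)
  fix g :: "'k pser3" assume "g \<in> pf_gens m"
  then obtain k0 where k0: "k0 \<in> {- int m..int m}" "g = pgen m k0" unfolding pf_gens_eq by blast
  note props = trimmed_ideal_properties[OF assms k0(1), where 'k = 'k, folded k0(2)]
  \<comment> \<open>By injectivity of \<open>pgen\<close> the shape of g determines k0, here as plus
    or minus m - i with 0 < m - i < m.\<close>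
  have b: "k0 \<notin> {0, int m, - int m}" if "i \<in> {1..m - 1}" "g = varx ^ (m - i) * dU i \<or> g = vary ^ (m - i) * dU i" for i
  proof -
    have i: "i \<le> m" "0 < m - i" "m - i < m" using that(1) assms by auto
    have "k0 = - int (m - i) \<or> k0 = int (m - i)"
      using that(2) pgen_index_varx[OF k0(1) i(1), where 'k = 'k] pgen_index_vary[OF k0(1) i(1), where 'k = 'k]
      unfolding k0(2) by blast
    then show ?thesis using i by auto
  qed
  have c: "k0 \<in> {0, int m, - int m}" if "g \<in> {varx ^ m, vary ^ m, dU m}"
  proof -
    have "dU 0 = (1 :: 'k pser3)" by (simp add: dU_def Umat_def)
    \<comment> \<open>x^m and y^m are the case i = 0, since d_0 = 1, and d_m is the case i =
      m.\<close>
    then have "k0 = - int (m - 0) \<or> k0 = int (m - 0) \<or> k0 = - int (m - m)"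
      using that pgen_index_varx[OF k0(1), of 0, where 'k = 'k] pgen_index_vary[OF k0(1), of 0, where 'k = 'k]
        pgen_index_varx[OF k0(1), of m, where 'k = 'k] unfolding k0(2) by auto
    then show ?thesis by auto
  qed
  show "let \<aa> = trimmed_ideal m g; R = class_ring Quot \<aa> in
      (artinian_cring R \<and> local_cring R \<and> has_type \<aa> 2 \<and>
        annihilator R (cls \<aa> ` max_ideal) =
          genideal R {cls \<aa> g, cls \<aa> (varx ^ (m - 1) * vary ^ (m - 1))}) \<and>
      ((\<exists>i\<in>{1..m - 1}. g = varx ^ (m - i) * dU i \<or> g = vary ^ (m - i) * dU i) \<longrightarrow>
        minimally_generated_by class_ring \<aa> (2 * m) \<and> class_G \<aa> (2 * m - 3)) \<and>
      (g \<in> {varx ^ m, vary ^ m, dU m} \<longrightarrow>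
        minimally_generated_by class_ring \<aa> (2 * m + 1) \<and> class_G \<aa> (2 * m - 2))"
    unfolding Let_def
  proof (intro conjI impI)
    assume "\<exists>i\<in>{1..m - 1}. g = varx ^ (m - i) * dU i \<or> g = vary ^ (m - i) * dU i"
    then have k: "k0 \<notin> {0, int m, - int m}" using b by blast
    show "minimally_generated_by class_ring (trimmed_ideal m g) (2 * m)" "class_G (trimmed_ideal m g) (2 * m - 3)"
      using props(5,6) unfolding if_not_P[OF k] .
  next
    assume "g \<in> {varx ^ m, vary ^ m, dU m}"
    then have k: "k0 \<in> {0, int m, - int m}" by (rule c)
    show "minimally_generated_by class_ring (trimmed_ideal m g) (2 * m + 1)" "class_G (trimmed_ideal m g) (2 * m - 2)"
      using props(5,6) unfolding if_P[OF k] .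
  qed (rule props)+
qed

end
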